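(* Under the standing assumptions given in the context, let $h$ be a continuous function defined on an open set containing $[h_1,h_2]$. Then: 1. If $Z_n\sim GOE(n)$, the oracle quantities $d_i^{(h)}=\hat w_i^\intercal h(A_n)\hat w_i$, $1\le i\le n$, almost surely satisfy $$\lim_{n\to\infty}\lim_{\sigma\to\infty}\max_{1\le i\le n}\left|d_i^{(h)}-\int h(t)\,dH(t)\right|=0.$$ 2. The optimal shrinkage function $f_h^*$ (which depends on $\sigma$) satisfies $$\lim_{\sigma\to\infty}f_h^*(\sigma x)=\int h(t)\,dH(t)\qquad\text{for } |x|<2.$$
   Context: Standing assumptions. For each $n$, $A_n\in\mathbb{R}^{n\times n}$ is a real symmetric matrix (deterministic or random), and for $\sigma>0$, $\hat{A}_n=A_n+\sigma n^{-1/2}Z_n$. (i) As $n\to\infty$, the empirical spectral distribution of the eigenvalues of $A_n$ converges weakly almost surely to a deterministic probability measure $H$. (ii) $H$ is supported on a compact interval of $\mathbb{R}$, and eventually (for all large $n$) all eigenvalues of $A_n$ lie in a compact interval $[h_1,h_2]\subset\mathbb{R}$. (iii) $Z_n$ is a real symmetric random matrix independent of $A_n$ (in part 1, $Z_n\sim GOE(n)$, the Gaussian Orthogonal Ensemble on real symmetric $n\times n$ matrices: independent centered Gaussian entries on and above the diagonal, off-diagonal variance $1$, diagonal variance $2$). Notation. $\hat\lambda_1\ge\dots\ge\hat\lambda_n$ are the eigenvalues of $\hat A_n$ and $\hat w_1,\dots,\hat w_n$ corresponding orthonormal eigenvectors (depending on $\sigma$). $\rho_{sc;\sigma^2}$ is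 the centered semicircular distribution of variance $\sigma^2$, $\boxplus$ is free additive convolution, and $\hat\mu=H\boxplus\rho_{sc;\sigma^2}$. Its Stieltjes transform $m_{\hat\mu}(z)=\int (x-z)^{-1}\hat\mu(dx)$, $z\in\mathbb{C}^+$, satisfies $m_{\hat\mu}(z)=\int \frac{dH(t)}{t-z-\sigma^2m_{\hat\mu}(z)}$. Real functions $u,v$ are defined by $u(x)+iv(x)=\lim_{\eta\downarrow0}m_{\hat\mu}(x+i\eta)$, and $u_h,v_h$ by $$u_h(x)+iv_h(x)=\lim_{\eta\downarrow 0}\int\frac{h(t)\,dH(t)}{t-x-i\eta-\sigma^2m_{\hat\mu}(x+i\eta)}.$$ The optimal shrinkage function is $f_h^*(x)=v_h(x)/v(x)$ for $x\in\operatorname{supp}(\hat\mu)$ (where $v(x)>0$). *)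

theory Defs
  imports
    "HOL-Probability.Probability"
    "HOL-Library.Poly_Mapping"
    "Jordan_Normal_Form.Char_Poly"
begin

section \<open>Symmetric matrices\<close>

text \<open>Real \<open>n\<close>-by-\<open>n\<close> matrices are those of \<^theory>\<open>Jordan_Normal_Form.Matrix\<close>; indices run over
  \<open>{..<n}\<close>.\<close>

definition sym_mat :: "nat \<Rightarrow> real mat \<Rightarrow> bool" where
  "sym_mat n A \<longleftrightarrow> A \<in> carrier_mat n n \<and> transpose_mat A = A"

text \<open>Functional calculus \<open>h(A) = Q diag(h(\<lambda>\<^sub>1), ..., h(\<lambda>\<^sub>n)) Q\<^sup>T\<close> for \<open>A = Q diag(\<lambda>\<^sub>1, ..., \<lambda>\<^sub>n) Q\<^sup>T\<close> with \<open>Q\<close>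
  orthogonal. For symmetric \<open>A\<close> such a decomposition exists and the result does not depend on it.\<close>

definition mat_fun :: "(real \<Rightarrow> real) \<Rightarrow> real mat \<Rightarrow> real mat" where
  "mat_fun h A = (THE B. \<exists>Q lam.
      Q \<in> carrier_mat (dim_row A) (dim_row A) \<and>
      Q * transpose_mat Q = 1\<^sub>m (dim_row A) \<and>
      A = Q * mat_diag (dim_row A) lam * transpose_mat Q \<and>
      B = Q * mat_diag (dim_row A) (\<lambda>i. h (lam i)) * transpose_mat Q)"

definition ordered_eigenbasis :: "real mat \<Rightarrow> (nat \<Rightarrow> real) \<Rightarrow> (nat \<Rightarrow> real vec) \<Rightarrow> bool" where
  "ordered_eigenbasis A lam w \<longleftrightarrow>
     (\<forall>i<dim_row A. w i \<in> carrier_vec (dim_row A) \<and> A *\<^sub>v w i = lam i \<cdot>\<^sub>v w i) \<and>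
     (\<forall>i<dim_row A. \<forall>j<dim_row A. scalar_prod (w i) (w j) = (if i = j then 1 else 0)) \<and>
     (\<forall>i j. i \<le> j \<longrightarrow> j < dim_row A \<longrightarrow> lam j \<le> lam i)"

text \<open>\<^term>\<open>proots (char_poly A)\<close> lists the eigenvalues with multiplicity; only used for symmetric
  matrices of positive dimension, for which it is a multiset of \<open>n > 0\<close> reals.\<close>

definition esd :: "real mat \<Rightarrow> real measure" where
  "esd A = distr (measure_pmf (pmf_of_multiset (proots (char_poly A)))) borel (\<lambda>x. x)"


section \<open>Random symmetric matrices\<close>

definition random_sym_mat :: "'w measure \<Rightarrow> nat \<Rightarrow> ('w \<Rightarrow> real mat) \<Rightarrow> bool" where
  "random_sym_mat M n X \<longleftrightarrow>
     (\<forall>\<omega>\<in>space M. sym_mat n (X \<omega>)) \<and>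
     (\<forall>i<n. \<forall>j<n. (\<lambda>\<omega>. X \<omega> $$ (i, j)) \<in> borel_measurable M)"

definition entries :: "nat \<Rightarrow> ('w \<Rightarrow> real mat) \<Rightarrow> 'w \<Rightarrow> (nat \<times> nat \<Rightarrow> real)" where
  "entries n X \<omega> = (\<lambda>ij\<in>{..<n} \<times> {..<n}. X \<omega> $$ ij)"

definition indep_mat :: "'w measure \<Rightarrow> nat \<Rightarrow> ('w \<Rightarrow> real mat) \<Rightarrow> ('w \<Rightarrow> real mat) \<Rightarrow> bool" where
  "indep_mat M n X Y \<longleftrightarrow>
     prob_space.indep_var M
       (Pi\<^sub>M ({..<n} \<times> {..<n}) (\<lambda>_. borel)) (entries n X)
       (Pi\<^sub>M ({..<n} \<times> {..<n}) (\<lambda>_. borel)) (entries n Y)"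

text \<open>The second parameter of \<^const>\<open>normal_density\<close> is the standard deviation.\<close>

definition is_GOE :: "'w measure \<Rightarrow> nat \<Rightarrow> ('w \<Rightarrow> real mat) \<Rightarrow> bool" where
  "is_GOE M n Z \<longleftrightarrow>
     random_sym_mat M n Z \<and>
     prob_space.indep_vars M (\<lambda>_. borel) (\<lambda>ij \<omega>. Z \<omega> $$ ij) {(i, j). i \<le> j \<and> j < n} \<and>
     (\<forall>i j. i \<le> j \<longrightarrow> j < n \<longrightarrow>
        distributed M lborel (\<lambda>\<omega>. Z \<omega> $$ (i, j))
          (\<lambda>x. ennreal (normal_density 0 (if i = j then sqrt 2 else 1) x)))"

definition perturbed :: "real \<Rightarrow> nat \<Rightarrow> real mat \<Rightarrow> real mat \<Rightarrow> real mat" where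
  "perturbed \<sigma> n A Z = A + (\<sigma> / sqrt (real n)) \<cdot>\<^sub>m Z"


section \<open>Free additive convolution\<close>

definition compactly_supported_law :: "real measure \<Rightarrow> bool" where
  "compactly_supported_law \<mu> \<longleftrightarrow> real_distribution \<mu> \<and> (\<exists>a b. measure \<mu> {a..b} = 1)"

text \<open>The semicircular distribution, parametrised by its variance \<open>s > 0\<close>.\<close>

definition semicircle :: "real \<Rightarrow> real measure" where
  "semicircle s = density lborel (\<lambda>x. ennreal (sqrt (max 0 (4 * s - x\<^sup>2)) / (2 * pi * s)))"

text \<open>Words in two letters, with concatenation written additively so that
  \<^typ>\<open>'a \<Rightarrow>\<^sub>0 real\<close> over them is the free unital algebra \<open>\<real>\<langle>X, Y\<rangle>\<close>.\<close>

datatype ncword = NCWord (letters: "bool list")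

instantiation ncword :: monoid_add
begin

definition zero_ncword :: ncword where "0 = NCWord []"

definition plus_ncword :: "ncword \<Rightarrow> ncword \<Rightarrow> ncword" where
  "u + v = NCWord (letters u @ letters v)"

instance
  by standard (simp_all add: zero_ncword_def plus_ncword_def)

end

type_synonym ncpoly = "ncword \<Rightarrow>\<^sub>0 real"

definition ncconst :: "real \<Rightarrow> ncpoly" where
  "ncconst c = Poly_Mapping.single 0 c"

definition ncvar :: "bool \<Rightarrow> ncpoly" where
  "ncvar b = Poly_Mapping.single (NCWord [b]) 1"

definition nc_eval :: "real poly \<Rightarrow> ncpoly \<Rightarrow> ncpoly" where
  "nc_eval p X = (\<Sum>i\<le>degree p. ncconst (coeff p i) * X ^ i)"

definition unital_functional :: "(ncpoly \<Rightarrow> real) \<Rightarrow> bool" where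
  "unital_functional \<phi> \<longleftrightarrow>
     (\<forall>p q. \<phi> (p + q) = \<phi> p + \<phi> q) \<and> (\<forall>c p. \<phi> (ncconst c * p) = c * \<phi> p) \<and> \<phi> 1 = 1"

text \<open>Freeness of the unital algebras generated by the two variables: alternating products of
  centred elements are centred. A list entry \<open>(b, p)\<close> stands for the element \<open>p(X\<^sub>b)\<close>.\<close>

definition free_vars :: "(ncpoly \<Rightarrow> real) \<Rightarrow> bool" where
  "free_vars \<phi> \<longleftrightarrow>
     (\<forall>ps :: (bool \<times> real poly) list.
        ps \<noteq> [] \<longrightarrow>
        (\<forall>k. Suc k < length ps \<longrightarrow> fst (ps ! k) \<noteq> fst (ps ! Suc k)) \<longrightarrow>
        (\<forall>(b, p)\<in>set ps. \<phi> (nc_eval p (ncvar b)) = 0) \<longrightarrow>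
        \<phi> (prod_list (map (\<lambda>(b, p). nc_eval p (ncvar b)) ps)) = 0)"

definition has_law :: "(ncpoly \<Rightarrow> real) \<Rightarrow> ncpoly \<Rightarrow> real measure \<Rightarrow> bool" where
  "has_law \<phi> X \<mu> \<longleftrightarrow> (\<forall>k. \<phi> (X ^ k) = (LINT x|\<mu>. x ^ k))"

text \<open>\<open>\<kappa> = \<mu> \<boxplus> \<nu>\<close> for compactly supported laws: \<open>\<kappa>\<close> is the law of the sum of two free variables with
  laws \<open>\<mu>\<close> and \<open>\<nu>\<close>. Taking the free algebra as the noncommutative probability space loses no
  generality, as any pair of variables pulls its joint distribution back to it. Compactly supported
  laws are determined by their moments, and the joint moments of free variables by the marginals,
  so \<open>\<kappa>\<close> is unique.\<close>

definition is_free_add_conv :: "real measure \<Rightarrow> real measure \<Rightarrow> real measure \<Rightarrow> bool" where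
  "is_free_add_conv \<mu> \<nu> \<kappa> \<longleftrightarrow>
     compactly_supported_law \<mu> \<and> compactly_supported_law \<nu> \<and> compactly_supported_law \<kappa> \<and>
     (\<exists>\<phi>. unital_functional \<phi> \<and> free_vars \<phi> \<and>
          has_law \<phi> (ncvar False) \<mu> \<and> has_law \<phi> (ncvar True) \<nu> \<and>
          has_law \<phi> (ncvar False + ncvar True) \<kappa>)"


section \<open>Stieltjes transforms and the optimal shrinkage function\<close>

definition measure_support :: "real measure \<Rightarrow> real set" where
  "measure_support \<mu> = {x. \<forall>V. open V \<longrightarrow> x \<in> V \<longrightarrow> emeasure \<mu> V > 0}"

definition stieltjes :: "real measure \<Rightarrow> complex \<Rightarrow> complex" where
  "stieltjes \<mu> z = (LINT x|\<mu>. 1 / (complex_of_real x - z))"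

text \<open>The function \<open>h\<close> is only given on its domain \<open>U\<close>, which carries all of \<open>H\<close>; hence integrals
  against \<open>H\<close> that involve \<open>h\<close> are taken over \<open>U\<close>.\<close>

definition weighted_stieltjes ::
  "(real \<Rightarrow> real) \<Rightarrow> real set \<Rightarrow> real measure \<Rightarrow> real \<Rightarrow> real measure \<Rightarrow> complex \<Rightarrow> complex" where
  "weighted_stieltjes h U H \<sigma> \<mu> z =
     (LINT t:U|H. complex_of_real (h t)
        / (complex_of_real t - z - complex_of_real (\<sigma>\<^sup>2) * stieltjes \<mu> z))"

definition has_boundary_value :: "(complex \<Rightarrow> complex) \<Rightarrow> real \<Rightarrow> bool" where
  "has_boundary_value f x \<longleftrightarrow> (\<exists>l. ((\<lambda>\<eta>. f (Complex x \<eta>)) \<longlongrightarrow> l) (at_right 0))"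

definition boundary_value :: "(complex \<Rightarrow> complex) \<Rightarrow> real \<Rightarrow> complex" where
  "boundary_value f x = Lim (at_right 0) (\<lambda>\<eta>. f (Complex x \<eta>))"

definition v_fun :: "real measure \<Rightarrow> real \<Rightarrow> real" where
  "v_fun \<mu> x = Im (boundary_value (stieltjes \<mu>) x)"

definition vh_fun ::
  "(real \<Rightarrow> real) \<Rightarrow> real set \<Rightarrow> real measure \<Rightarrow> real \<Rightarrow> real measure \<Rightarrow> real \<Rightarrow> real" where
  "vh_fun h U H \<sigma> \<mu> x = Im (boundary_value (weighted_stieltjes h U H \<sigma> \<mu>) x)"

definition opt_shrinkage ::
  "(real \<Rightarrow> real) \<Rightarrow> real set \<Rightarrow> real measure \<Rightarrow> real \<Rightarrow> real measure \<Rightarrow> real \<Rightarrow> real" where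
  "opt_shrinkage h U H \<sigma> \<mu> x = vh_fun h U H \<sigma> \<mu> x / v_fun \<mu> x"

text \<open>Where \<^const>\<open>opt_shrinkage\<close> is meaningful: the boundary limits exist (\<^const>\<open>Lim\<close> is
  arbitrary otherwise), the point lies in the support, and the denominator is positive.\<close>

definition opt_shrinkage_dom ::
  "(real \<Rightarrow> real) \<Rightarrow> real set \<Rightarrow> real measure \<Rightarrow> real \<Rightarrow> real measure \<Rightarrow> real set" where
  "opt_shrinkage_dom h U H \<sigma> \<mu> =
     {x \<in> measure_support \<mu>.
        has_boundary_value (stieltjes \<mu>) x \<and>
        has_boundary_value (weighted_stieltjes h U H \<sigma> \<mu>) x \<and>
        v_fun \<mu> x > 0}"

end

theory Submission
  imports Defs "HOL-Complex_Analysis.Complex_Analysis" "HOL-Real_Asymp.Real_Asymp"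
begin

text \<open>
  For large \<open>\<sigma>\<close> the noise dominates, in both parts.

  Part 1. The matrix \<open>sqrt n / \<sigma>\<close> times the perturbed one equals \<open>sqrt n / \<sigma> * A + Z\<close>, which tends to
  \<open>Z\<close>. A GOE matrix almost surely has simple spectrum (\<open>goe_simple\<close>), so its eigenvectors are unique
  up to sign and the eigenvectors of the perturbed matrix converge to them (\<open>strong_noise_overlap\<close>).
  The inner limit is therefore the largest distance of \<open>\<Sum>j. h (\<mu> j) * <z i, v j>\<^sup>2\<close> from \<open>\<integral> h dH\<close>,
  where the \<open>z i\<close> are eigenvectors of \<open>Z\<close> and \<open>(\<mu>, v)\<close> is an eigenbasis of \<open>A\<close>. By independence \<open>v\<close> may
  be treated as fixed, and by rotation invariance \<open>z i\<close> should spread evenly over \<open>v\<close>. Uniformity of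
  \<open>z i\<close> on the sphere is used only through one consequence: the mean of \<open>cosh <t, z i>\<close> depends on
  the length of \<open>t\<close> alone, and comparing with a Gaussian vector \<open>t\<close> bounds it by
  \<open>exp (|t|\<^sup>2 / (2 * n))\<close> (\<open>goe_cosh_bound\<close>). An auxiliary Gaussian vector linearises the exponential
  of a quadratic form, which turns this bound into an exponential tail estimate (\<open>goe_upper_tail\<close>).
  It survives the sum over the \<open>n\<close> indices \<open>i\<close>, so the Borel-Cantelli lemma leaves the average of
  \<open>h (\<mu> j)\<close>, which converges to \<open>\<integral> h dH\<close> because the spectral distributions converge weakly.

  Part 2. From freeness one first obtains the subordination equation
  \<open>m z = \<integral> dH t / (t - z - \<sigma>\<^sup>2 * m z)\<close>: a semicircular variable free from the other one satisfies a
  Schwinger-Dyson equation (\<open>schwinger_dyson\<close>), hence a recursion for the mixed moments, which gives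
  the equation near infinity and by analytic continuation in the upper half-plane
  (\<open>subordination\<close>). With \<open>y = z / \<sigma>\<close>, \<open>q = y + \<sigma> * m (\<sigma> * y)\<close> and \<open>\<tau> = 1 / \<sigma>\<close> it reads
  \<open>q - y = \<integral> dH t / (\<tau> * t - q)\<close>, a small perturbation of \<open>q - y = - 1 / q\<close>. At a real point \<open>x\<close> of
  \<open>(-2, 2)\<close> the latter has the root \<open>q\<^sub>0 = (x + \<i> * sqrt (4 - x\<^sup>2)) / 2\<close>, of modulus one. The two roots
  of the quadratic equation are distinct, so the perturbed equation is stable: its solution extends
  continuously to \<open>x\<close>, with a value \<open>Q\<close> close to \<open>q\<^sub>0\<close> (\<open>boundary_solution\<close>). The functions \<open>v\<close>
  and \<open>v\<^sub>h\<close> at \<open>\<sigma> * x\<close> are \<open>Im Q / \<sigma>\<close> and \<open>Im (\<integral> h t / (\<tau> * t - Q) dH t) / \<sigma>\<close>, whose quotient tends to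
  \<open>\<integral> h dH * Im (- 1 / q\<^sub>0) / Im q\<^sub>0 = \<integral> h dH\<close>.
\<close>

section \<open>Orthonormal eigenbases\<close>

text \<open>Vectors are functions on \<open>nat\<close> and matrices functions on index pairs, of which only the entries
  below \<open>n\<close> matter. Random matrices are then random elements of a function space, whose topology
  and Borel sets are those of the coordinates.\<close>

definition orthonormal :: "nat \<Rightarrow> (nat \<Rightarrow> nat \<Rightarrow> real) \<Rightarrow> bool" where
  "orthonormal n w \<longleftrightarrow> (\<forall>i<n. \<forall>j<n. (\<Sum>k<n. w i k * w j k) = (if i = j then 1 else 0))"

definition eigenbasis :: "nat \<Rightarrow> (nat \<times> nat \<Rightarrow> real) \<Rightarrow> (nat \<Rightarrow> real) \<Rightarrow> (nat \<Rightarrow> nat \<Rightarrow> real) \<Rightarrow> bool" where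
  "eigenbasis n X lam w \<longleftrightarrow>
     (\<forall>i<n. \<forall>k<n. (\<Sum>l<n. X (k, l) * w i l) = lam i * w i k) \<and> orthonormal n w \<and>
     (\<forall>i j. i \<le> j \<longrightarrow> j < n \<longrightarrow> lam j \<le> lam i)"

lemma finite_family_convergent_subseq:
  fixes f :: "'s \<Rightarrow> nat \<Rightarrow> real"
  assumes "finite S" "\<And>s. s \<in> S \<Longrightarrow> bounded (range (f s))"
  shows "\<exists>r. strict_mono r \<and> (\<forall>s\<in>S. convergent (f s \<circ> r))"
  using assms
proof (induction S)
  case empty
  then show ?case using strict_mono_id by blast
next
  case (insert a S)
  have "\<exists>r. strict_mono r \<and> (\<forall>s\<in>S. convergent (f s \<circ> r))"
    by (rule insert.IH) (use insert.prems in auto)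
  then obtain r where r: "strict_mono r" "\<forall>s\<in>S. convergent (f s \<circ> r)" by blast
  have "bounded (range (f a \<circ> r))"
    using insert.prems(1)[of a] by (rule_tac bounded_subset) auto
  then obtain l q where q: "strict_mono q" "((f a \<circ> r) \<circ> q) \<longlonglongrightarrow> l"
    using bounded_imp_convergent_subsequence by metis
  have "convergent (f s \<circ> (r \<circ> q))" if "s \<in> S" for s
    using convergent_subseq_convergent[OF bspec[OF r(2) that] q(1)] by (simp add: o_assoc)
  moreover have "convergent (f a \<circ> (r \<circ> q))"
    using q(2) by (auto simp: convergent_def o_assoc)
  ultimately have "strict_mono (r \<circ> q) \<and> (\<forall>s\<in>insert a S. convergent (f s \<circ> (r \<circ> q)))"
    using strict_mono_o[OF r(1) q(1)] by blast
  then show ?case by blast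
qed

lemma orthonormal_norm: "orthonormal n w \<Longrightarrow> i < n \<Longrightarrow> (\<Sum>k<n. (w i k)\<^sup>2) = 1"
  by (auto simp: orthonormal_def power2_eq_square)

lemma orthonormal_le_1:
  assumes "orthonormal n w" "i < n" "k < n"
  shows "\<bar>w i k\<bar> \<le> 1"
proof -
  have "(w i k)\<^sup>2 \<le> (\<Sum>k<n. (w i k)\<^sup>2)"
    using assms by (intro member_le_sum) auto
  then show ?thesis using orthonormal_norm[OF assms(1,2)] by (simp add: abs_square_le_1)
qed

lemma orthonormal_complete:
  assumes "orthonormal n w" "k < n" "l < n"
  shows "(\<Sum>i<n. w i k * w i l) = (if k = l then 1 else 0)"
proof -
  let ?W = "mat n n (\<lambda>(i, k). w i k)"
  have 1: "?W * transpose_mat ?W = 1\<^sub>m n"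
    using assms(1) by (intro eq_matI) (auto simp: orthonormal_def scalar_prod_def lessThan_atLeast0)
  have "transpose_mat ?W * ?W = 1\<^sub>m n"
    by (rule mat_mult_left_right_inverse[OF _ _ 1]) auto
  then have "(transpose_mat ?W * ?W) $$ (k, l) = 1\<^sub>m n $$ (k, l)" by simp
  then show ?thesis using assms(2,3) by (auto simp: scalar_prod_def lessThan_atLeast0)
qed

lemma orthonormal_expand:
  assumes "orthonormal n w" "k < n"
  shows "t k = (\<Sum>j<n. (\<Sum>l<n. t l * w j l) * w j k)"
proof -
  have "(\<Sum>j<n. (\<Sum>l<n. t l * w j l) * w j k) = (\<Sum>j<n. \<Sum>l<n. t l * (w j l * w j k))"
    by (simp add: sum_distrib_right mult.assoc)
  also have "\<dots> = (\<Sum>l<n. t l * (\<Sum>j<n. w j l * w j k))"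
    by (subst sum.swap) (simp add: sum_distrib_left)
  also have "\<dots> = (\<Sum>l<n. t l * (if l = k then 1 else 0))"
    using orthonormal_complete[OF assms(1)] assms(2) by (intro sum.cong) auto
  also have "\<dots> = (\<Sum>l<n. if l = k then t l else 0)"
    by (intro sum.cong) auto
  also have "\<dots> = t k" using assms(2) by (subst sum.delta) auto
  finally show ?thesis by simp
qed

lemma orthonormal_parseval:
  assumes "orthonormal n w"
  shows "(\<Sum>j<n. (\<Sum>k<n. t k * w j k)\<^sup>2) = (\<Sum>k<n. (t k)\<^sup>2)"
proof -
  have "(\<Sum>k<n. (t k)\<^sup>2) = (\<Sum>k<n. t k * (\<Sum>j<n. (\<Sum>l<n. t l * w j l) * w j k))"
    using orthonormal_expand[OF assms, of _ t] by (intro sum.cong) (auto simp: power2_eq_square)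
  also have "\<dots> = (\<Sum>k<n. \<Sum>j<n. (\<Sum>l<n. t l * w j l) * (t k * w j k))"
    by (simp add: sum_distrib_left mult_ac)
  also have "\<dots> = (\<Sum>j<n. (\<Sum>l<n. t l * w j l) * (\<Sum>k<n. t k * w j k))"
    by (subst sum.swap) (simp add: sum_distrib_left)
  finally show ?thesis by (simp add: power2_eq_square)
qed

lemma eigenbasis_repr:
  assumes "eigenbasis n X lam w" "k < n" "l < n"
  shows "X (k, l) = (\<Sum>i<n. lam i * w i k * w i l)"
proof -
  have o: "orthonormal n w" using assms(1) by (simp add: eigenbasis_def)
  have "X (k, l) = (\<Sum>j<n. (\<Sum>m<n. X (k, m) * w j m) * w j l)"
    using orthonormal_expand[OF o assms(3), of "\<lambda>l. X (k, l)"] by simp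
  also have "\<dots> = (\<Sum>i<n. lam i * w i k * w i l)"
    using assms(1,2) by (intro sum.cong) (auto simp: eigenbasis_def)
  finally show ?thesis .
qed

lemma eigenbasis_sym: "eigenbasis n X lam w \<Longrightarrow> k < n \<Longrightarrow> l < n \<Longrightarrow> X (k, l) = X (l, k)"
  unfolding eigenbasis_repr[of n X lam w k l] eigenbasis_repr[of n X lam w l k] by (simp add: mult.assoc mult.commute[of "w _ k"])

lemma eigenbasis_eigval:
  assumes "eigenbasis n X lam w" "i < n"
  shows "lam i = (\<Sum>k<n. \<Sum>l<n. X (k, l) * w i k * w i l)"
proof -
  have "(\<Sum>k<n. \<Sum>l<n. X (k, l) * w i k * w i l) = (\<Sum>k<n. w i k * (\<Sum>l<n. X (k, l) * w i l))"
    by (auto simp: sum_distrib_left mult_ac intro!: sum.cong)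
  also have "\<dots> = (\<Sum>k<n. w i k * (lam i * w i k))"
    using assms by (intro sum.cong) (auto simp: eigenbasis_def)
  also have "\<dots> = lam i * (\<Sum>k<n. w i k * w i k)" by (simp add: sum_distrib_left mult_ac)
  also have "\<dots> = lam i" using assms by (auto simp: eigenbasis_def orthonormal_def)
  finally show ?thesis by simp
qed

text \<open>Orthonormal vectors have bounded entries, so eigenbases of a convergent sequence of matrices
  have convergent subsequences. This takes the place of perturbation theory: wherever the limit
  matrix determines a quantity uniquely, that quantity converges along the whole sequence.\<close>

lemma eigenbasis_limit:
  assumes E: "\<And>p. eigenbasis n (X p) (lam p) (w p)"
    and X: "\<And>k l. k < n \<Longrightarrow> l < n \<Longrightarrow> (\<lambda>p. X p (k, l)) \<longlonglongrightarrow> Y (k, l)"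
  obtains r lam' w' where "strict_mono r" "eigenbasis n Y lam' w'"
    "\<And>i. i < n \<Longrightarrow> (\<lambda>p. lam (r p) i) \<longlonglongrightarrow> lam' i"
    "\<And>i k. i < n \<Longrightarrow> k < n \<Longrightarrow> (\<lambda>p. w (r p) i k) \<longlonglongrightarrow> w' i k"
proof -
  have o: "orthonormal n (w p)" for p using E[of p] by (simp add: eigenbasis_def)
  obtain r where r: "strict_mono r"
    "\<forall>s\<in>{..<n} \<times> {..<n}. convergent ((\<lambda>p. w p (fst s) (snd s)) \<circ> r)"
  proof (atomize_elim, rule finite_family_convergent_subseq)
    fix s assume "s \<in> {..<n} \<times> {..<n}"
    then show "bounded (range (\<lambda>p. w p (fst s) (snd s)))"
      by (intro boundedI[of _ 1]) (auto intro: orthonormal_le_1[OF o])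
  qed auto
  define w' where "w' i k = lim (\<lambda>p. w (r p) i k)" for i k
  have w': "(\<lambda>p. w (r p) i k) \<longlonglongrightarrow> w' i k" if "i < n" "k < n" for i k
    using bspec[OF r(2), of "(i, k)"] that unfolding w'_def by (simp add: o_def convergent_LIMSEQ_iff)
  have X': "(\<lambda>p. X (r p) (k, l)) \<longlonglongrightarrow> Y (k, l)" if "k < n" "l < n" for k l
    using LIMSEQ_subseq_LIMSEQ[OF X[OF that] r(1)] by (simp add: o_def)
  define lam' where "lam' i = (\<Sum>k<n. \<Sum>l<n. Y (k, l) * w' i k * w' i l)" for i
  have lam': "(\<lambda>p. lam (r p) i) \<longlonglongrightarrow> lam' i" if "i < n" for i
    unfolding lam'_def eigenbasis_eigval[OF E that]
    by (intro tendsto_sum tendsto_mult X' w') (use that in auto)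
  have "eigenbasis n Y lam' w'"
    unfolding eigenbasis_def orthonormal_def
  proof (intro conjI allI impI)
    fix i k assume ik: "i < n" "k < n"
    have "(\<lambda>p. \<Sum>l<n. X (r p) (k, l) * w (r p) i l) \<longlonglongrightarrow> (\<Sum>l<n. Y (k, l) * w' i l)"
      by (intro tendsto_sum tendsto_mult X' w') (use ik in auto)
    moreover have "(\<Sum>l<n. X (r p) (k, l) * w (r p) i l) = lam (r p) i * w (r p) i k" for p
      using E[of "r p"] ik by (simp add: eigenbasis_def)
    moreover have "(\<lambda>p. lam (r p) i * w (r p) i k) \<longlonglongrightarrow> lam' i * w' i k"
      by (intro tendsto_mult lam' w') (use ik in auto)
    ultimately show "(\<Sum>l<n. Y (k, l) * w' i l) = lam' i * w' i k"
      using LIMSEQ_unique by auto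
  next
    fix i j assume ij: "i < n" "j < n"
    have "(\<lambda>p. \<Sum>k<n. w (r p) i k * w (r p) j k) \<longlonglongrightarrow> (\<Sum>k<n. w' i k * w' j k)"
      by (intro tendsto_sum tendsto_mult w') (use ij in auto)
    moreover have "(\<Sum>k<n. w (r p) i k * w (r p) j k) = (if i = j then 1 else 0)" for p
      using o[of "r p"] ij by (auto simp: orthonormal_def)
    ultimately show "(\<Sum>k<n. w' i k * w' j k) = (if i = j then 1 else 0)"
      by (simp add: LIMSEQ_const_iff)
  next
    fix i j :: nat assume ij: "i \<le> j" "j < n"
    show "lam' j \<le> lam' i"
      by (rule LIMSEQ_le[OF lam' lam']) (use ij E in \<open>auto simp: eigenbasis_def\<close>)
  qed
  then show ?thesis using that r(1) lam' w' by blast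
qed

text \<open>The eigenvectors \<open>w i\<close> and \<open>w' j\<close> are thus orthogonal unless \<open>lam i = lam' j\<close>.\<close>

lemma eigenbasis_overlap:
  assumes "eigenbasis n X lam w" "eigenbasis n X lam' w'" "i < n" "j < n"
  shows "lam i * (\<Sum>k<n. w i k * w' j k) = lam' j * (\<Sum>k<n. w i k * w' j k)"
proof -
  have "lam i * (\<Sum>k<n. w i k * w' j k) = (\<Sum>k<n. (\<Sum>l<n. X (k, l) * w i l) * w' j k)"
    unfolding sum_distrib_left
    using assms by (intro sum.cong) (auto simp: eigenbasis_def mult_ac)
  also have "\<dots> = (\<Sum>l<n. \<Sum>k<n. X (k, l) * w i l * w' j k)"
    unfolding sum_distrib_right by (rule sum.swap)
  also have "\<dots> = (\<Sum>l<n. w i l * (\<Sum>k<n. X (l, k) * w' j k))"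
    unfolding sum_distrib_left
    using eigenbasis_sym[OF assms(1)] by (intro sum.cong) (auto simp: mult_ac)
  also have "\<dots> = (\<Sum>l<n. w i l * (lam' j * w' j l))"
    using assms by (intro sum.cong) (auto simp: eigenbasis_def)
  also have "\<dots> = lam' j * (\<Sum>k<n. w i k * w' j k)"
    by (simp add: sum_distrib_left mult_ac)
  finally show ?thesis .
qed

text \<open>Both sides are entries of \<open>f (X)\<close>. Expanding one basis in the other, the coefficients vanish
  unless the eigenvalues agree, so \<open>f (lam i)\<close> can be exchanged for \<open>f (lam' j)\<close>.\<close>

lemma eigenbasis_fun_unique:
  assumes E: "eigenbasis n X lam w" "eigenbasis n X lam' w'" and kl: "k < n" "l < n"
  shows "(\<Sum>i<n. f (lam i) * w i k * w i l) = (\<Sum>i<n. f (lam' i) * w' i k * w' i l)"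
proof -
  have o: "orthonormal n w" "orthonormal n w'" using E by (auto simp: eigenbasis_def)
  define R where "R i j = (\<Sum>k<n. w i k * w' j k)" for i j
  have R: "f (lam i) * R i j = f (lam' j) * R i j" if "i < n" "j < n" for i j
    using eigenbasis_overlap[OF E that] unfolding R_def[symmetric] by auto
  have w: "w i k = (\<Sum>j<n. R i j * w' j k)" for i
    unfolding R_def by (rule orthonormal_expand[OF o(2) kl(1)])
  have "f (lam i) * w i k * w i l = (\<Sum>j<n. f (lam i) * R i j * (w' j k * w i l))" for i
    by (subst w) (simp add: sum_distrib_left sum_distrib_right mult.assoc)
  then have "(\<Sum>i<n. f (lam i) * w i k * w i l) = (\<Sum>i<n. \<Sum>j<n. f (lam i) * R i j * (w' j k * w i l))"
    by simp
  also have "\<dots> = (\<Sum>i<n. \<Sum>j<n. f (lam' j) * R i j * (w' j k * w i l))"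
    using R by (intro sum.cong refl) auto
  also have "\<dots> = (\<Sum>j<n. f (lam' j) * w' j k * (\<Sum>i<n. R i j * w i l))"
    by (subst sum.swap) (simp add: sum_distrib_left mult_ac)
  also have "\<dots> = (\<Sum>i<n. f (lam' i) * w' i k * w' i l)"
  proof -
    have "(\<Sum>i<n. R i j * w i l) = w' j l" for j
      using orthonormal_expand[OF o(1) kl(2), of "w' j"] by (simp add: R_def mult.commute)
    then show ?thesis by simp
  qed
  finally show ?thesis .
qed

lemma eigenbasis_eigval_mem:
  assumes E: "eigenbasis n X lam w" "eigenbasis n X lam' w'" and i: "i < n"
  shows "lam i \<in> lam' ` {..<n}"
proof (rule ccontr)
  assume c: "\<not> ?thesis"
  have o: "orthonormal n w" "orthonormal n w'" using E by (auto simp: eigenbasis_def)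
  have "(\<Sum>k<n. w i k * w' j k) = 0" if "j < n" for j
    using eigenbasis_overlap[OF E i that] c that by auto
  then have "(\<Sum>k<n. (w i k)\<^sup>2) = 0"
    using orthonormal_parseval[OF o(2), of "w i"] by simp
  then show False using orthonormal_norm[OF o(1) i] by simp
qed

lemma simple_eigvals_unique:
  assumes E: "eigenbasis n X lam w" "eigenbasis n X lam' w'" and inj: "inj_on lam {..<n}" and i: "i < n"
  shows "lam' i = lam i"
proof -
  have img: "lam' ` {..<n} = lam ` {..<n}"
    using eigenbasis_eigval_mem[OF E] eigenbasis_eigval_mem[OF E(2,1)] by blast
  then have inj': "inj_on lam' {..<n}"
    using inj by (metis card_image eq_card_imp_inj_on finite_lessThan)
  have s: "sorted (map (\<lambda>i. - lam i) [0..<n])" if "eigenbasis n X lam w" for lam w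
    using that by (auto simp: sorted_iff_nth_mono eigenbasis_def)
  have d: "distinct (map (\<lambda>i. - lam i) [0..<n])" if "inj_on lam {..<n}" for lam :: "nat \<Rightarrow> real"
    using that by (auto simp: distinct_map inj_on_def)
  have "map (\<lambda>i. - lam i) [0..<n] = map (\<lambda>i. - lam' i) [0..<n]"
  proof (rule sorted_distinct_set_unique)
    have "uminus ` (lam' ` {..<n}) = uminus ` (lam ` {..<n})" using img by simp
    then show "set (map (\<lambda>i. - lam i) [0..<n]) = set (map (\<lambda>i. - lam' i) [0..<n])"
      by (simp add: image_image lessThan_atLeast0)
  qed (use s[OF E(1)] s[OF E(2)] d[OF inj] d[OF inj'] in auto)
  then show ?thesis using i by (auto simp: map_eq_conv)
qed

lemma simple_eigvec_unique:
  assumes E: "eigenbasis n X lam w" "eigenbasis n X lam' w'" and inj: "inj_on lam {..<n}" and i: "i < n"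
  obtains c where "c = 1 \<or> c = -1" "\<And>k. k < n \<Longrightarrow> w' i k = c * w i k"
proof -
  have o: "orthonormal n w" "orthonormal n w'" using E by (auto simp: eigenbasis_def)
  define R where "R j = (\<Sum>k<n. w' i k * w j k)" for j
  have R0: "R j = 0" if "j < n" "j \<noteq> i" for j
  proof -
    have "lam j * R j = lam i * R j"
      using eigenbasis_overlap[OF E(2,1) i that(1)] simple_eigvals_unique[OF E inj i] unfolding R_def by metis
    moreover have "lam j \<noteq> lam i" using inj_onD[OF inj, of j i] that i by auto
    ultimately show ?thesis by auto
  qed
  have 1: "w' i k = R i * w i k" if "k < n" for k
  proof -
    have "w' i k = (\<Sum>j<n. R j * w j k)" using orthonormal_expand[OF o(1) that, of "w' i"] by (simp add: R_def)
    also have "\<dots> = (\<Sum>j<n. if j = i then R i * w i k else 0)"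
      by (intro sum.cong) (auto simp: R0)
    finally show ?thesis using i by simp
  qed
  have "1 = (\<Sum>k<n. (w' i k)\<^sup>2)" using orthonormal_norm[OF o(2) i] by simp
  also have "\<dots> = (R i)\<^sup>2 * (\<Sum>k<n. (w i k)\<^sup>2)"
    by (simp add: 1 power_mult_distrib sum_distrib_left)
  also have "\<dots> = (R i)\<^sup>2" using orthonormal_norm[OF o(1) i] by simp
  finally have "R i = 1 \<or> R i = -1" using power2_eq_1_iff by metis
  then show ?thesis using that 1 by blast
qed

section \<open>Rotation invariance of Gaussian matrices\<close>

definition gauss1 :: "real measure" where
  "gauss1 = density lborel (\<lambda>x. ennreal (std_normal_density x))"

definition gauss :: "'i set \<Rightarrow> ('i \<Rightarrow> real) measure" where
  "gauss I = Pi\<^sub>M I (\<lambda>_. gauss1)"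

lemma sets_gauss1 [measurable_cong, simp]: "sets gauss1 = sets borel"
  by (simp add: gauss1_def)

lemma space_gauss1 [simp]: "space gauss1 = UNIV"
  by (simp add: gauss1_def)

lemma prob_space_gauss1: "prob_space gauss1"
  unfolding gauss1_def by (rule prob_space_normal_density) simp

interpretation gauss1: prob_space gauss1 by (rule prob_space_gauss1)

interpretation gauss: product_sigma_finite "\<lambda>_. gauss1"
  by unfold_locales

lemma sets_gauss [measurable_cong]: "sets (gauss I) = sets (Pi\<^sub>M I (\<lambda>_. borel))"
  unfolding gauss_def by (intro sets_PiM_cong) auto

lemma space_gauss: "space (gauss I) = (\<Pi>\<^sub>E i\<in>I. UNIV)"
  by (simp add: gauss_def space_PiM)

lemma prob_space_gauss: "prob_space (gauss I)"
  unfolding gauss_def by (intro prob_space_PiM prob_space_gauss1)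

lemma nn_integral_gauss1:
  "f \<in> borel_measurable borel \<Longrightarrow>
    (\<integral>\<^sup>+x. f x \<partial>gauss1) = (\<integral>\<^sup>+x. ennreal (std_normal_density x) * f x \<partial>lborel)"
  unfolding gauss1_def by (subst nn_integral_density) auto

text \<open>Unless it is a quarter turn, a rotation is a composition of substitutions each of which changes
  one variable affinely while the other is held fixed; Tonelli's theorem allows switching
  between the two variables.\<close>

lemma lborel_rotation:
  fixes f :: "real \<times> real \<Rightarrow> ennreal"
  assumes [measurable]: "f \<in> borel_measurable borel" and cs: "c\<^sup>2 + s\<^sup>2 = 1"
  shows "(\<integral>\<^sup>+u. \<integral>\<^sup>+v. f (c * u - s * v, s * u + c * v) \<partial>lborel \<partial>lborel) =
         (\<integral>\<^sup>+u. \<integral>\<^sup>+v. f (u, v) \<partial>lborel \<partial>lborel)"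
proof (cases "c = 0")
  case False
  have [measurable]: "f \<in> borel_measurable (borel \<Otimes>\<^sub>M borel)" by (simp add: borel_prod)
  have "(\<integral>\<^sup>+u. \<integral>\<^sup>+v. f (c * u - s * v, s * u + c * v) \<partial>lborel \<partial>lborel) =
        (\<integral>\<^sup>+v. \<integral>\<^sup>+u. f (c * u - s * v, s * u + c * v) \<partial>lborel \<partial>lborel)"
    by (rule lborel_pair.Fubini') simp
  also have "\<dots> = (\<integral>\<^sup>+v. \<bar>1 / c\<bar> * (\<integral>\<^sup>+u. f (u, s / c * u + 1 / c * v) \<partial>lborel) \<partial>lborel)"
  proof (rule nn_integral_cong)
    fix v :: real
    have e1: "c * (s * v / c + 1 / c * u) - s * v = u" for u using False by (simp add: field_simps)
    have "c * c * v + s * s * v = (c\<^sup>2 + s\<^sup>2) * v" by (simp add: algebra_simps power2_eq_square)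
    then have e2: "s * (s * v / c + 1 / c * u) + c * v = s / c * u + 1 / c * v" for u
      using False cs by (simp add: field_simps)
    show "(\<integral>\<^sup>+u. f (c * u - s * v, s * u + c * v) \<partial>lborel) =
        \<bar>1 / c\<bar> * (\<integral>\<^sup>+u. f (u, s / c * u + 1 / c * v) \<partial>lborel)"
      using False
      by (subst nn_integral_real_affine[where c = "1 / c" and t = "s * v / c"]) (auto simp only: e1 e2, measurable)
  qed
  also have "\<dots> = (\<integral>\<^sup>+v. \<integral>\<^sup>+u. \<bar>1 / c\<bar> * f (u, s / c * u + 1 / c * v) \<partial>lborel \<partial>lborel)"
    by (intro nn_integral_cong nn_integral_cmult[symmetric]) measurable
  also have "\<dots> = (\<integral>\<^sup>+u. \<integral>\<^sup>+v. \<bar>1 / c\<bar> * f (u, s / c * u + 1 / c * v) \<partial>lborel \<partial>lborel)"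
    by (rule lborel_pair.Fubini') simp
  also have "\<dots> = (\<integral>\<^sup>+u. \<bar>1 / c\<bar> * (\<integral>\<^sup>+v. f (u, s / c * u + 1 / c * v) \<partial>lborel) \<partial>lborel)"
    by (intro nn_integral_cong nn_integral_cmult) measurable
  also have "\<dots> = (\<integral>\<^sup>+u. \<integral>\<^sup>+v. f (u, v) \<partial>lborel \<partial>lborel)"
    using False
    by (intro nn_integral_cong nn_integral_real_affine[symmetric, where c = "1 / c"]) auto
  finally show ?thesis .
next
  case True
  then have s: "s = 1 \<or> s = -1" using cs power2_eq_1_iff by auto
  have [measurable]: "f \<in> borel_measurable (borel \<Otimes>\<^sub>M borel)" by (simp add: borel_prod)
  have r: "(\<integral>\<^sup>+u. g (s * u) \<partial>lborel) = (\<integral>\<^sup>+u. g u \<partial>lborel)"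
    if [measurable]: "g \<in> borel_measurable borel" for g :: "real \<Rightarrow> ennreal"
    using s nn_integral_real_affine[OF that, of s 0] by auto
  have r': "(\<integral>\<^sup>+u. g (- (s * u)) \<partial>lborel) = (\<integral>\<^sup>+u. g u \<partial>lborel)"
    if [measurable]: "g \<in> borel_measurable borel" for g :: "real \<Rightarrow> ennreal"
    using s nn_integral_real_affine[OF that, of "-s" 0] by auto
  have "(\<integral>\<^sup>+u. \<integral>\<^sup>+v. f (c * u - s * v, s * u + c * v) \<partial>lborel \<partial>lborel) =
        (\<integral>\<^sup>+u. \<integral>\<^sup>+v. f (v, s * u) \<partial>lborel \<partial>lborel)"
  proof (rule nn_integral_cong)
    fix u :: real
    have "(\<lambda>v. f (v, s * u)) \<in> borel_measurable borel" by measurable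
    from r'[OF this] show "(\<integral>\<^sup>+v. f (c * u - s * v, s * u + c * v) \<partial>lborel) = (\<integral>\<^sup>+v. f (v, s * u) \<partial>lborel)"
      by (simp add: True)
  qed
  also have "\<dots> = (\<integral>\<^sup>+v. \<integral>\<^sup>+u. f (v, s * u) \<partial>lborel \<partial>lborel)"
    by (rule lborel_pair.Fubini') simp
  also have "\<dots> = (\<integral>\<^sup>+v. \<integral>\<^sup>+u. f (v, u) \<partial>lborel \<partial>lborel)"
    by (intro nn_integral_cong r) measurable
  finally show ?thesis .
qed

lemma gauss1_rotation:
  fixes f :: "real \<times> real \<Rightarrow> ennreal"
  assumes [measurable]: "f \<in> borel_measurable borel" and cs: "c\<^sup>2 + s\<^sup>2 = 1"
  shows "(\<integral>\<^sup>+u. \<integral>\<^sup>+v. f (c * u - s * v, s * u + c * v) \<partial>gauss1 \<partial>gauss1) =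
         (\<integral>\<^sup>+u. \<integral>\<^sup>+v. f (u, v) \<partial>gauss1 \<partial>gauss1)"
proof -
  have [measurable]: "f \<in> borel_measurable (borel \<Otimes>\<^sub>M borel)" by (simp add: borel_prod)
  define g where "g p = ennreal (std_normal_density (fst p)) * (ennreal (std_normal_density (snd p)) * f p)" for p
  have g [measurable]: "g \<in> borel_measurable borel"
    unfolding g_def borel_prod[symmetric] by measurable
  have [measurable]: "g \<in> borel_measurable (borel \<Otimes>\<^sub>M borel)" by (simp add: borel_prod)
  have *: "(\<integral>\<^sup>+u. \<integral>\<^sup>+v. h (u, v) \<partial>gauss1 \<partial>gauss1) =
     (\<integral>\<^sup>+u. \<integral>\<^sup>+v. ennreal (std_normal_density u) * (ennreal (std_normal_density v) * h (u, v)) \<partial>lborel \<partial>lborel)"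
    if [measurable]: "h \<in> borel_measurable (borel \<Otimes>\<^sub>M borel)" for h :: "real \<times> real \<Rightarrow> ennreal"
    apply (subst nn_integral_gauss1)
     apply measurable
    apply (intro nn_integral_cong)
    apply (subst nn_integral_gauss1)
     apply measurable
    apply (subst nn_integral_cmult[symmetric])
     apply measurable
    done
  have e: "std_normal_density u * std_normal_density v =
      std_normal_density (c * u - s * v) * std_normal_density (s * u + c * v)" for u v
  proof -
    have "(c * u - s * v)\<^sup>2 + (s * u + c * v)\<^sup>2 = (c\<^sup>2 + s\<^sup>2) * (u\<^sup>2 + v\<^sup>2)"
      by (simp add: power2_eq_square algebra_simps)
    then have "- u\<^sup>2 / 2 + - v\<^sup>2 / 2 = - (c * u - s * v)\<^sup>2 / 2 + - (s * u + c * v)\<^sup>2 / 2"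
      using cs by (simp add: field_simps)
    then show ?thesis
      unfolding std_normal_density_def by (simp add: exp_add[symmetric])
  qed
  have "(\<integral>\<^sup>+u. \<integral>\<^sup>+v. f (c * u - s * v, s * u + c * v) \<partial>gauss1 \<partial>gauss1) =
     (\<integral>\<^sup>+u. \<integral>\<^sup>+v. g (c * u - s * v, s * u + c * v) \<partial>lborel \<partial>lborel)"
  proof (subst *[of "\<lambda>(u, v). f (c * u - s * v, s * u + c * v)", simplified prod.case])
    show "(\<integral>\<^sup>+u. \<integral>\<^sup>+v. ennreal (std_normal_density u) *
        (ennreal (std_normal_density v) * f (c * u - s * v, s * u + c * v)) \<partial>lborel \<partial>lborel) =
       (\<integral>\<^sup>+u. \<integral>\<^sup>+v. g (c * u - s * v, s * u + c * v) \<partial>lborel \<partial>lborel)"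
    proof (intro nn_integral_cong)
      fix u v :: real
      let ?F = "f (c * u - s * v, s * u + c * v)"
      have "ennreal (std_normal_density u) * (ennreal (std_normal_density v) * ?F) =
          ennreal (std_normal_density u * std_normal_density v) * ?F"
        by (simp add: mult.assoc ennreal_mult')
      also have "std_normal_density u * std_normal_density v =
          std_normal_density (c * u - s * v) * std_normal_density (s * u + c * v)" by (rule e)
      also have "ennreal \<dots> * ?F = ennreal (std_normal_density (c * u - s * v)) *
          (ennreal (std_normal_density (s * u + c * v)) * ?F)"
        by (simp add: mult.assoc ennreal_mult')
      finally show "ennreal (std_normal_density u) *
        (ennreal (std_normal_density v) * f (c * u - s * v, s * u + c * v)) =
        g (c * u - s * v, s * u + c * v)"
        by (simp only: g_def fst_conv snd_conv)
    qed
  qed measurable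
  also have "\<dots> = (\<integral>\<^sup>+u. \<integral>\<^sup>+v. g (u, v) \<partial>lborel \<partial>lborel)"
    by (rule lborel_rotation) fact+
  also have "\<dots> = (\<integral>\<^sup>+u. \<integral>\<^sup>+v. f (u, v) \<partial>gauss1 \<partial>gauss1)"
    by (subst *) (simp_all add: g_def)
  finally show ?thesis .
qed

definition rot :: "'i \<Rightarrow> 'i \<Rightarrow> real \<Rightarrow> real \<Rightarrow> ('i \<Rightarrow> real) \<Rightarrow> 'i \<Rightarrow> real" where
  "rot a b c s x = x(a := c * x a - s * x b, b := s * x a + c * x b)"

lemma measurable_rot [measurable]:
  assumes [simp]: "a \<in> I" "b \<in> I"
  shows "rot a b c s \<in> measurable (gauss I) (gauss I)"
proof -
  have "(\<lambda>x i. rot a b c s x i) \<in> measurable (gauss I) (Pi\<^sub>M I (\<lambda>_. borel))"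
  proof (rule measurable_PiM_single')
    fix i assume [simp]: "i \<in> I"
    show "(\<lambda>x. rot a b c s x i) \<in> borel_measurable (gauss I)"
      unfolding rot_def fun_upd_def by measurable
  qed (auto simp: space_gauss rot_def PiE_iff extensional_def)
  then show ?thesis by (simp cong: measurable_cong_sets add: sets_gauss)
qed

lemma gauss_rot:
  assumes I: "finite I" "a \<in> I" "b \<in> I" "a \<noteq> b" and cs: "c\<^sup>2 + s\<^sup>2 = 1"
    and f: "f \<in> borel_measurable (gauss I)"
  shows "(\<integral>\<^sup>+x. f (rot a b c s x) \<partial>gauss I) = (\<integral>\<^sup>+x. f x \<partial>gauss I)"
proof -
  define J where "J = I - {a, b}"
  have J: "finite J" "a \<notin> J" "b \<notin> insert a J" "I = insert b (insert a J)"
    using I by (auto simp: J_def)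
  have *: "(\<integral>\<^sup>+x. g x \<partial>gauss I) = (\<integral>\<^sup>+x. \<integral>\<^sup>+u. \<integral>\<^sup>+v. g (x(a := u, b := v)) \<partial>gauss1 \<partial>gauss1 \<partial>gauss J)"
    if g: "g \<in> borel_measurable (gauss I)" for g :: "('a \<Rightarrow> real) \<Rightarrow> ennreal"
  proof -
    have g': "g \<in> borel_measurable (Pi\<^sub>M (insert b (insert a J)) (\<lambda>_. gauss1))"
      using g by (simp add: gauss_def J(4))
    note [measurable] = g'
    show ?thesis
      unfolding J(4) gauss_def
      apply (subst gauss.product_nn_integral_insert[OF _ J(3) g'])
      using J(1) apply simp
      apply (subst gauss.product_nn_integral_insert[OF J(1,2)])
       apply measurable
      done
  qed
  have fr: "(\<lambda>x. f (rot a b c s x)) \<in> borel_measurable (gauss I)"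
    using I f by measurable
  show ?thesis
    unfolding *[OF fr] *[OF f]
  proof (rule nn_integral_cong)
    fix x assume x: "x \<in> space (gauss J)"
    have "(\<lambda>p i. (x(a := fst p, b := snd p)) i) \<in> measurable borel (Pi\<^sub>M I (\<lambda>_. borel))"
    proof (rule measurable_PiM_single')
      fix i assume "i \<in> I"
      show "(\<lambda>p. (x(a := fst p, b := snd p)) i) \<in> borel_measurable borel"
        unfolding fun_upd_def borel_prod[symmetric] by measurable
    qed (use x J in \<open>auto simp: space_gauss PiE_iff extensional_def\<close>)
    then have m: "(\<lambda>p. x(a := fst p, b := snd p)) \<in> measurable borel (gauss I)"
      using measurable_cong_sets[OF refl sets_gauss] by blast
    have mf: "(\<lambda>p. f (x(a := fst p, b := snd p))) \<in> borel_measurable borel"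
      using measurable_compose[OF m f] .
    have "rot a b c s (x(a := u, b := v)) = x(a := c * u - s * v, b := s * u + c * v)" for u v
      using I(4) by (auto simp: rot_def fun_eq_iff)
    then show "(\<integral>\<^sup>+u. \<integral>\<^sup>+v. f (rot a b c s (x(a := u, b := v))) \<partial>gauss1 \<partial>gauss1) =
        (\<integral>\<^sup>+u. \<integral>\<^sup>+v. f (x(a := u, b := v)) \<partial>gauss1 \<partial>gauss1)"
      using gauss1_rotation[OF mf cs] by simp
  qed
qed

text \<open>Invariance of a measure under \<open>T\<close>, in the form in which it is used: for integrals.\<close>

definition preserves :: "'a measure \<Rightarrow> ('a \<Rightarrow> 'a) \<Rightarrow> bool" where
  "preserves M T \<longleftrightarrow> T \<in> measurable M M \<and>
     (\<forall>f\<in>borel_measurable M. (\<integral>\<^sup>+x. f (T x) \<partial>M) = (\<integral>\<^sup>+x. f x \<partial>M))"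

lemma preserves_comp:
  assumes S: "preserves M S" and T: "preserves M T"
  shows "preserves M (\<lambda>x. S (T x))"
  unfolding preserves_def
proof (intro conjI ballI)
  have m: "S \<in> measurable M M" "T \<in> measurable M M" using S T by (simp_all add: preserves_def)
  show "(\<lambda>x. S (T x)) \<in> measurable M M" by (rule measurable_compose[OF m(2,1)])
  fix f :: "'a \<Rightarrow> ennreal" assume f: "f \<in> borel_measurable M"
  have "(\<integral>\<^sup>+x. f (S (T x)) \<partial>M) = (\<integral>\<^sup>+x. f (S x) \<partial>M)"
    using T measurable_compose[OF m(1) f] unfolding preserves_def by (elim conjE bspec)
  also have "\<dots> = (\<integral>\<^sup>+x. f x \<partial>M)"
    using S f unfolding preserves_def by (elim conjE bspec)
  finally show "(\<integral>\<^sup>+x. f (S (T x)) \<partial>M) = (\<integral>\<^sup>+x. f x \<partial>M)" .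
qed

lemma preserves_rot:
  assumes "finite I" "a \<in> I" "b \<in> I" "a \<noteq> b" "c\<^sup>2 + s\<^sup>2 = 1"
  shows "preserves (gauss I) (rot a b c s)"
  unfolding preserves_def
  by (intro conjI ballI measurable_rot gauss_rot assms)

text \<open>A rotation of the rows (or columns) \<open>a\<close> and \<open>b\<close>, restricted to their first \<open>m\<close> entries. The
  parameter \<open>m\<close> makes it a composition of plane rotations of two coordinates, by induction.\<close>

definition rowrot :: "nat \<Rightarrow> nat \<Rightarrow> nat \<Rightarrow> real \<Rightarrow> real \<Rightarrow> (nat \<times> nat \<Rightarrow> real) \<Rightarrow> nat \<times> nat \<Rightarrow> real" where
  "rowrot m a b c s X = (\<lambda>(i, k). if k < m \<and> i = a then c * X (a, k) - s * X (b, k)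
     else if k < m \<and> i = b then s * X (a, k) + c * X (b, k) else X (i, k))"

definition colrot :: "nat \<Rightarrow> nat \<Rightarrow> nat \<Rightarrow> real \<Rightarrow> real \<Rightarrow> (nat \<times> nat \<Rightarrow> real) \<Rightarrow> nat \<times> nat \<Rightarrow> real" where
  "colrot m a b c s X = (\<lambda>(k, i). if k < m \<and> i = a then c * X (k, a) - s * X (k, b)
     else if k < m \<and> i = b then s * X (k, a) + c * X (k, b) else X (k, i))"

lemma preserves_rowrot:
  assumes "a < n" "b < n" "a \<noteq> b" "c\<^sup>2 + s\<^sup>2 = 1" "m \<le> n"
  shows "preserves (gauss ({..<n} \<times> {..<n})) (rowrot m a b c s)"
  using assms(5)
proof (induction m)
  case 0
  have "rowrot 0 a b c s = (\<lambda>x. x)" by (auto simp: rowrot_def fun_eq_iff)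
  then show ?case by (simp add: preserves_def)
next
  case (Suc m)
  have "rowrot (Suc m) a b c s = (\<lambda>x. rot (a, m) (b, m) c s (rowrot m a b c s x))"
  proof (rule ext, rule ext, clarify)
    fix x :: "nat \<times> nat \<Rightarrow> real" and i k
    show "rowrot (Suc m) a b c s x (i, k) = rot (a, m) (b, m) c s (rowrot m a b c s x) (i, k)"
      using assms(3) by (cases "i = a"; cases "i = b"; cases k m rule: linorder_cases)
        (simp_all add: rowrot_def rot_def)
  qed
  then show ?case
    using preserves_comp[OF preserves_rot Suc.IH, of "(a, m)" "(b, m)" c s] Suc.prems assms by auto
qed

lemma preserves_colrot:
  assumes "a < n" "b < n" "a \<noteq> b" "c\<^sup>2 + s\<^sup>2 = 1" "m \<le> n"
  shows "preserves (gauss ({..<n} \<times> {..<n})) (colrot m a b c s)"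
  using assms(5)
proof (induction m)
  case 0
  have "colrot 0 a b c s = (\<lambda>x. x)" by (auto simp: colrot_def fun_eq_iff)
  then show ?case by (simp add: preserves_def)
next
  case (Suc m)
  have "colrot (Suc m) a b c s = (\<lambda>x. rot (m, a) (m, b) c s (colrot m a b c s x))"
  proof (rule ext, rule ext, clarify)
    fix x :: "nat \<times> nat \<Rightarrow> real" and i k
    show "colrot (Suc m) a b c s x (k, i) = rot (m, a) (m, b) c s (colrot m a b c s x) (k, i)"
      using assms(3) by (cases "i = a"; cases "i = b"; cases k m rule: linorder_cases)
        (simp_all add: colrot_def rot_def)
  qed
  then show ?case
    using preserves_comp[OF preserves_rot Suc.IH, of "(m, a)" "(m, b)" c s] Suc.prems assms by auto
qed

definition conj_rot :: "nat \<Rightarrow> nat \<Rightarrow> nat \<Rightarrow> real \<Rightarrow> real \<Rightarrow> (nat \<times> nat \<Rightarrow> real) \<Rightarrow> nat \<times> nat \<Rightarrow> real" where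
  "conj_rot n a b c s X = colrot n a b c s (rowrot n a b c s X)"

definition symmetrize :: "nat \<Rightarrow> (nat \<times> nat \<Rightarrow> real) \<Rightarrow> nat \<times> nat \<Rightarrow> real" where
  "symmetrize n G = (\<lambda>(k, l). if k < n \<and> l < n then (G (k, l) + G (l, k)) / sqrt 2 else 0)"

lemma symmetrize_conj_rot:
  assumes "a < n" "b < n" "a \<noteq> b"
  shows "symmetrize n (conj_rot n a b c s G) = conj_rot n a b c s (symmetrize n G)"
proof (rule ext, clarify)
  fix k l
  show "symmetrize n (conj_rot n a b c s G) (k, l) = conj_rot n a b c s (symmetrize n G) (k, l)"
  proof (cases "k < n \<and> l < n")
    case True
    then show ?thesis
      using assms
      by (cases "k = a"; cases "k = b"; cases "l = a"; cases "l = b")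
         (simp_all add: symmetrize_def conj_rot_def rowrot_def colrot_def field_simps)
  next
    case False
    then consider "k \<noteq> a" "k \<noteq> b" "\<not> k < n" | "l \<noteq> a" "l \<noteq> b" "\<not> l < n"
      using assms by auto
    then show ?thesis
      by cases (simp_all add: symmetrize_def conj_rot_def rowrot_def colrot_def)
  qed
qed

lemma measurable_symmetrize [measurable]:
  "symmetrize n \<in> borel_measurable (gauss ({..<n} \<times> {..<n}))"
proof (rule measurable_coordinatewise_then_product)
  fix p :: "nat \<times> nat"
  show "(\<lambda>x. symmetrize n x p) \<in> borel_measurable (gauss ({..<n} \<times> {..<n}))"
  proof (cases p)
    case (Pair k l)
    have "(\<lambda>x. x q) \<in> borel_measurable (gauss ({..<n} \<times> {..<n}))" if "q \<in> {..<n} \<times> {..<n}" for q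
      using that by measurable
    then have "(\<lambda>x. x (k, l) + x (l, k)) \<in> borel_measurable (gauss ({..<n} \<times> {..<n}))" if "k < n" "l < n"
      using that by (intro borel_measurable_add) auto
    then show ?thesis by (cases "k < n \<and> l < n") (auto simp: Pair symmetrize_def)
  qed
qed

text \<open>The Gaussian orthogonal ensemble as the law of \<open>(G + G\<^sup>T) / sqrt 2\<close> for a matrix \<open>G\<close> with
  independent standard Gaussian entries. In this form conjugation by a rotation acts on \<open>G\<close> as a
  rotation of rows followed by one of columns.\<close>

definition goe_law :: "nat \<Rightarrow> (nat \<times> nat \<Rightarrow> real) measure" where
  "goe_law n = distr (gauss ({..<n} \<times> {..<n})) borel (symmetrize n)"

lemma prob_space_goe_law: "prob_space (goe_law n)"
  unfolding goe_law_def by (intro prob_space.prob_space_distr prob_space_gauss measurable_symmetrize)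

lemma sets_goe_law [measurable_cong, simp]: "sets (goe_law n) = sets borel"
  by (simp add: goe_law_def)

lemma continuous_on_rowrot: "continuous_on UNIV (rowrot m a b c s)"
proof (rule continuous_on_coordinatewise_then_product)
  fix p :: "nat \<times> nat"
  obtain i k where p: "p = (i, k)" by (cases p)
  show "continuous_on UNIV (\<lambda>x. rowrot m a b c s x p)"
    by (cases "k < m"; cases "i = a"; cases "i = b")
       (simp_all add: p rowrot_def continuous_on_add continuous_on_diff continuous_on_mult_left)
qed

lemma continuous_on_colrot: "continuous_on UNIV (colrot m a b c s)"
proof (rule continuous_on_coordinatewise_then_product)
  fix p :: "nat \<times> nat"
  obtain i k where p: "p = (k, i)" by (cases p)
  show "continuous_on UNIV (\<lambda>x. colrot m a b c s x p)"
    by (cases "k < m"; cases "i = a"; cases "i = b")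
       (simp_all add: p colrot_def continuous_on_add continuous_on_diff continuous_on_mult_left)
qed

lemma measurable_conj_rot [measurable]: "conj_rot n a b c s \<in> borel_measurable borel"
proof -
  have "continuous_on UNIV (\<lambda>X. colrot n a b c s (rowrot n a b c s X))"
    by (rule continuous_on_compose2[OF continuous_on_colrot continuous_on_rowrot]) auto
  then show ?thesis
    unfolding conj_rot_def[abs_def] by (rule borel_measurable_continuous_onI)
qed

lemma goe_law_conj_rot:
  assumes n: "a < n" "b < n" "a \<noteq> b" "c\<^sup>2 + s\<^sup>2 = 1"
    and [measurable]: "f \<in> borel_measurable borel"
  shows "(\<integral>\<^sup>+X. f (conj_rot n a b c s X) \<partial>goe_law n) = (\<integral>\<^sup>+X. f X \<partial>goe_law n)"
proof -
  have p: "preserves (gauss ({..<n} \<times> {..<n})) (conj_rot n a b c s)"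
    unfolding conj_rot_def[abs_def]
    by (rule preserves_comp[OF preserves_colrot[OF n order.refl] preserves_rowrot[OF n order.refl]])
  have "(\<integral>\<^sup>+X. f (conj_rot n a b c s X) \<partial>goe_law n) =
      (\<integral>\<^sup>+G. f (conj_rot n a b c s (symmetrize n G)) \<partial>gauss ({..<n} \<times> {..<n}))"
    unfolding goe_law_def by (subst nn_integral_distr) auto
  also have "\<dots> = (\<integral>\<^sup>+G. f (symmetrize n (conj_rot n a b c s G)) \<partial>gauss ({..<n} \<times> {..<n}))"
    using n by (simp add: symmetrize_conj_rot)
  also have "\<dots> = (\<integral>\<^sup>+G. f (symmetrize n G) \<partial>gauss ({..<n} \<times> {..<n}))"
  proof -
    have "(\<lambda>G. f (symmetrize n G)) \<in> borel_measurable (gauss ({..<n} \<times> {..<n}))" by measurable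
    with p show ?thesis unfolding preserves_def by (elim conjE bspec)
  qed
  also have "\<dots> = (\<integral>\<^sup>+X. f X \<partial>goe_law n)"
    unfolding goe_law_def by (subst nn_integral_distr) auto
  finally show ?thesis .
qed

section \<open>The Gaussian orthogonal ensemble\<close>

definition zext :: "nat \<Rightarrow> real mat \<Rightarrow> nat \<times> nat \<Rightarrow> real" where
  "zext n B = (\<lambda>(k, l). if k < n \<and> l < n then B $$ (k, l) else 0)"

definition upper :: "nat \<Rightarrow> (nat \<times> nat) set" where
  "upper n = {(i, j). i \<le> j \<and> j < n}"

definition symfull :: "nat \<Rightarrow> (nat \<times> nat \<Rightarrow> real) \<Rightarrow> nat \<times> nat \<Rightarrow> real" where
  "symfull n y = (\<lambda>(k, l). if k < n \<and> l < n then y (min k l, max k l) else 0)"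

lemma measurable_symfull [measurable]: "symfull n \<in> borel_measurable (Pi\<^sub>M (upper n) (\<lambda>_. borel))"
proof (rule measurable_coordinatewise_then_product)
  fix p :: "nat \<times> nat"
  obtain k l where p: "p = (k, l)" by (cases p)
  show "(\<lambda>x. symfull n x p) \<in> borel_measurable (Pi\<^sub>M (upper n) (\<lambda>_. borel))"
  proof (cases "k < n \<and> l < n")
    case True
    then have "(min k l, max k l) \<in> upper n" by (auto simp: upper_def)
    then have "(\<lambda>x. x (min k l, max k l)) \<in> borel_measurable (Pi\<^sub>M (upper n) (\<lambda>_. borel))"
      by (rule measurable_component_singleton)
    then show ?thesis using True by (simp add: symfull_def p)
  qed (auto simp: symfull_def p)
qed

definition goe_sd :: "nat \<times> nat \<Rightarrow> real" where
  "goe_sd = (\<lambda>(i, j). if i = j then sqrt 2 else 1)"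

lemma indep_normal_upper_law:
  assumes "prob_space P" and n: "n \<ge> 1"
    and ind: "prob_space.indep_vars P (\<lambda>_. borel) (\<lambda>p \<omega>. W \<omega> p) (upper n)"
    and d: "\<And>p. p \<in> upper n \<Longrightarrow> distributed P lborel (\<lambda>\<omega>. W \<omega> p) (\<lambda>x. ennreal (normal_density 0 (goe_sd p) x))"
  shows "distr P (Pi\<^sub>M (upper n) (\<lambda>_. borel)) (\<lambda>\<omega>. restrict (W \<omega>) (upper n)) =
    Pi\<^sub>M (upper n) (\<lambda>p. density lborel (\<lambda>x. ennreal (normal_density 0 (goe_sd p) x)))"
proof -
  interpret prob_space P by fact
  have "(0, 0) \<in> upper n" using n by (auto simp: upper_def)
  then have ne: "upper n \<noteq> {}" by blast
  have m: "(\<lambda>\<omega>. W \<omega> p) \<in> borel_measurable P" if "p \<in> upper n" for p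
    using distributed_measurable[OF d[OF that]] by simp
  have "distr P (Pi\<^sub>M (upper n) (\<lambda>_. borel)) (\<lambda>\<omega>. restrict (W \<omega>) (upper n)) =
      Pi\<^sub>M (upper n) (\<lambda>p. distr P borel (\<lambda>\<omega>. W \<omega> p))"
    using iffD1[OF indep_vars_iff_distr_eq_PiM'[OF ne m] ind] by simp
  also have "\<dots> = Pi\<^sub>M (upper n) (\<lambda>p. density lborel (\<lambda>x. ennreal (normal_density 0 (goe_sd p) x)))"
  proof (intro PiM_cong refl)
    fix p assume p: "p \<in> upper n"
    have "distr P borel (\<lambda>\<omega>. W \<omega> p) = distr P lborel (\<lambda>\<omega>. W \<omega> p)" by (intro distr_cong) auto
    then show "distr P borel (\<lambda>\<omega>. W \<omega> p) = density lborel (\<lambda>x. ennreal (normal_density 0 (goe_sd p) x))"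
      using distributed_distr_eq_density[OF d[OF p]] by simp
  qed
  finally show ?thesis .
qed

lemma gauss_coordinate_distributed:
  assumes "i \<in> I"
  shows "distributed (gauss I) lborel (\<lambda>x. x i) (\<lambda>x. ennreal (std_normal_density x))"
  unfolding distributed_def
proof (intro conjI)
  show "(\<lambda>x. x i) \<in> gauss I \<rightarrow>\<^sub>M lborel" using assms by measurable
  have "distr (gauss I) gauss1 (\<lambda>x. x i) = gauss1"
    unfolding gauss_def by (rule distr_PiM_component) (auto intro: prob_space_gauss1 assms)
  then show "distr (gauss I) lborel (\<lambda>x. x i) = density lborel (\<lambda>x. ennreal (std_normal_density x))"
    unfolding gauss1_def by (subst distr_cong[OF refl, of _ gauss1]) (auto simp: gauss1_def)
qed simp

lemma gauss_indep_vars: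
  assumes "I \<noteq> {}"
  shows "prob_space.indep_vars (gauss I) (\<lambda>_. borel) (\<lambda>i x. x i) I"
proof -
  interpret P: prob_space "gauss I" by (rule prob_space_gauss)
  have r: "restrict x I = x" if "x \<in> space (gauss I)" for x
    using that by (auto simp: space_gauss PiE_iff extensional_restrict)
  have m: "(\<lambda>x. x i) \<in> borel_measurable (gauss I)" if "i \<in> I" for i using that by measurable
  have "distr (gauss I) (Pi\<^sub>M I (\<lambda>_. borel)) (\<lambda>x. restrict x I) = distr (gauss I) (gauss I) (\<lambda>x. x)"
    by (intro distr_cong sets_gauss[symmetric] refl r)
  also have "\<dots> = gauss I" by (rule distr_id)
  also have "\<dots> = Pi\<^sub>M I (\<lambda>i. distr (gauss I) borel (\<lambda>x. x i))"
    unfolding gauss_def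
  proof (intro PiM_cong refl)
    fix i assume i: "i \<in> I"
    have "distr (Pi\<^sub>M I (\<lambda>_. gauss1)) borel (\<lambda>x. x i) = distr (Pi\<^sub>M I (\<lambda>_. gauss1)) gauss1 (\<lambda>x. x i)"
      by (intro distr_cong) auto
    also have "\<dots> = gauss1" by (rule distr_PiM_component) (auto intro: prob_space_gauss1 i)
    finally show "gauss1 = distr (Pi\<^sub>M I (\<lambda>_. gauss1)) borel (\<lambda>x. x i)" by simp
  qed
  finally show ?thesis
    by (intro iffD2[OF P.indep_vars_iff_distr_eq_PiM'[OF assms m]]) simp_all
qed

text \<open>Distinct entries on or above the diagonal involve disjoint sets of entries of \<open>G\<close>.\<close>

lemma symmetrize_upper:
  assumes n: "n \<ge> 1"
  defines "P \<equiv> gauss ({..<n} \<times> {..<n})"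
  shows "prob_space.indep_vars P (\<lambda>_. borel) (\<lambda>p G. symmetrize n G p) (upper n)" (is ?A)
    and "p \<in> upper n \<Longrightarrow> distributed P lborel (\<lambda>G. symmetrize n G p) (\<lambda>x. ennreal (normal_density 0 (goe_sd p) x))"
proof -
  interpret P: prob_space P unfolding P_def by (rule prob_space_gauss)
  let ?I = "{..<n} \<times> {..<n}"
  have ne: "?I \<noteq> {}" using n by (auto simp: lessThan_empty_iff)
  define K where "K p = {p, prod.swap p}" for p :: "nat \<times> nat"
  have K: "K p \<subseteq> ?I" if "p \<in> upper n" for p using that by (auto simp: K_def upper_def)
  have dj: "disjoint_family_on K (upper n)"
    by (auto simp: disjoint_family_on_def K_def upper_def)
  have ind: "P.indep_vars (\<lambda>_. borel) (\<lambda>i x. x i) ?I"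
    unfolding P_def by (rule gauss_indep_vars[OF ne])
  have "P.indep_vars (\<lambda>p. Pi\<^sub>M (K p) (\<lambda>_. borel)) (\<lambda>p x. restrict (\<lambda>i. x i) (K p)) (upper n)"
    by (rule P.indep_vars_restrict[OF ind K dj])
  then have "P.indep_vars (\<lambda>_. borel) (\<lambda>p x. (\<lambda>y. (y p + y (prod.swap p)) / sqrt 2) (restrict (\<lambda>i. x i) (K p))) (upper n)"
  proof (rule P.indep_vars_compose2)
    fix p :: "nat \<times> nat"
    have "p \<in> K p" "prod.swap p \<in> K p" by (auto simp: K_def)
    then have "(\<lambda>y. y p) \<in> borel_measurable (Pi\<^sub>M (K p) (\<lambda>_. borel))"
      "(\<lambda>y. y (prod.swap p)) \<in> borel_measurable (Pi\<^sub>M (K p) (\<lambda>_. borel))"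
      by (auto intro: measurable_component_singleton)
    then show "(\<lambda>y. (y p + y (prod.swap p)) / sqrt 2) \<in> borel_measurable (Pi\<^sub>M (K p) (\<lambda>_. borel))"
      by (intro borel_measurable_divide borel_measurable_add) auto
  qed
  then show ?A
    by (rule iffD1[OF P.indep_vars_cong, rotated -1]) (auto simp: K_def symmetrize_def upper_def fun_eq_iff)
  assume p: "p \<in> upper n"
  obtain i j where ij: "p = (i, j)" "i \<le> j" "j < n" using p by (auto simp: upper_def)
  have dq: "distributed P lborel (\<lambda>x. x q) (\<lambda>x. ennreal (normal_density 0 1 x))" if "q \<in> ?I" for q
    unfolding P_def by (rule gauss_coordinate_distributed[OF that])
  show "distributed P lborel (\<lambda>G. symmetrize n G p) (\<lambda>x. ennreal (normal_density 0 (goe_sd p) x))"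
  proof (cases "i = j")
    case True
    have "distributed P lborel (\<lambda>x. 0 + sqrt 2 * x (i, i)) (normal_density (0 + sqrt 2 * 0) (\<bar>sqrt 2\<bar> * 1))"
      by (rule P.normal_density_affine[OF dq]) (use ij in auto)
    moreover have "symmetrize n G p = 0 + sqrt 2 * G (i, i)" for G
      using ij True by (simp add: symmetrize_def field_simps)
    ultimately show ?thesis using ij True by (simp add: goe_sd_def)
  next
    case False
    have "distributed P lborel (\<lambda>x. \<Sum>q\<in>{(i, j), (j, i)}. x q)
       (normal_density (\<Sum>q\<in>{(i, j), (j, i)}. 0) (sqrt (\<Sum>q\<in>{(i, j), (j, i)}. 1\<^sup>2)))"
      by (rule P.sum_indep_normal[OF _ _ P.indep_vars_subset[OF ind] _ dq]) (use ij in auto)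
    then have s: "distributed P lborel (\<lambda>x. x (i, j) + x (j, i)) (normal_density 0 (sqrt 2))"
      using False by simp
    have "distributed P lborel (\<lambda>x. 0 + (1 / sqrt 2) * (x (i, j) + x (j, i)))
        (normal_density (0 + (1 / sqrt 2) * 0) (\<bar>1 / sqrt 2\<bar> * sqrt 2))"
      by (rule P.normal_density_affine[OF s]) auto
    moreover have "symmetrize n G p = 0 + (1 / sqrt 2) * (G (i, j) + G (j, i))" for G
      using ij by (simp add: symmetrize_def)
    ultimately show ?thesis using ij False by (simp add: goe_sd_def)
  qed
qed

text \<open>Independence and the marginal laws determine the joint law of the entries on or above the
  diagonal, and symmetry determines the other entries.\<close>

lemma is_GOE_law:
  assumes "prob_space M" and n: "n \<ge> 1" and goe: "is_GOE M n Z"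
  shows "(\<lambda>\<omega>. zext n (Z \<omega>)) \<in> borel_measurable M"
    and "distr M borel (\<lambda>\<omega>. zext n (Z \<omega>)) = goe_law n"
proof -
  interpret prob_space M by fact
  let ?U = "Pi\<^sub>M (upper n) (\<lambda>_. borel :: real measure)"
  let ?W = "\<lambda>\<omega> p. Z \<omega> $$ p"
  have r: "random_sym_mat M n Z" using goe by (simp add: is_GOE_def)
  have me: "(\<lambda>\<omega>. Z \<omega> $$ (i, j)) \<in> borel_measurable M" if "i < n" "j < n" for i j
    using r that by (auto simp: random_sym_mat_def)
  have eq: "zext n (Z \<omega>) = symfull n (restrict (?W \<omega>) (upper n))" if "\<omega> \<in> space M" for \<omega>
  proof -
    have s: "sym_mat n (Z \<omega>)" using r that by (auto simp: random_sym_mat_def)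
    have zz: "Z \<omega> $$ (k, l) = Z \<omega> $$ (min k l, max k l)" if "k < n" "l < n" for k l
    proof -
      have "Z \<omega> $$ (k, l) = transpose_mat (Z \<omega>) $$ (k, l)" using s by (simp add: sym_mat_def)
      also have "\<dots> = Z \<omega> $$ (l, k)"
        using s that by (intro index_transpose_mat) (auto simp: sym_mat_def)
      finally show ?thesis by (auto simp: min_def max_def)
    qed
    show ?thesis
    proof (rule ext, clarify)
      fix k l
      show "zext n (Z \<omega>) (k, l) = symfull n (restrict (?W \<omega>) (upper n)) (k, l)"
      proof (cases "k < n \<and> l < n")
        case True
        then have "(min k l, max k l) \<in> upper n" by (auto simp: upper_def)
        then show ?thesis using True zz[of k l] by (simp only: zext_def symfull_def prod.case restrict_apply' if_True)
      qed (auto simp: zext_def symfull_def)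
    qed
  qed
  have mr: "(\<lambda>\<omega>. restrict (?W \<omega>) (upper n)) \<in> measurable M ?U"
    by (rule measurable_restrict) (auto simp: upper_def intro!: me)
  show "(\<lambda>\<omega>. zext n (Z \<omega>)) \<in> borel_measurable M"
    by (rule iffD2[OF measurable_cong[OF eq] measurable_compose[OF mr measurable_symfull]])
  have "distr M borel (\<lambda>\<omega>. zext n (Z \<omega>)) = distr M borel (\<lambda>\<omega>. symfull n (restrict (?W \<omega>) (upper n)))"
    by (intro distr_cong refl eq)
  also have "\<dots> = distr (distr M ?U (\<lambda>\<omega>. restrict (?W \<omega>) (upper n))) borel (symfull n)"
    by (subst distr_distr[OF measurable_symfull mr]) (simp add: comp_def)
  also have "distr M ?U (\<lambda>\<omega>. restrict (?W \<omega>) (upper n)) =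
    Pi\<^sub>M (upper n) (\<lambda>p. density lborel (\<lambda>x. ennreal (normal_density 0 (goe_sd p) x)))"
  proof (rule indep_normal_upper_law[OF assms(1) n])
    show "indep_vars (\<lambda>_. borel) (\<lambda>p \<omega>. Z \<omega> $$ p) (upper n)"
      using goe by (simp add: is_GOE_def upper_def)
    show "distributed M lborel (\<lambda>\<omega>. Z \<omega> $$ p) (\<lambda>x. ennreal (normal_density 0 (goe_sd p) x))" if "p \<in> upper n" for p
      using goe that by (auto simp: is_GOE_def upper_def goe_sd_def)
  qed
  also have "\<dots> = distr (gauss ({..<n} \<times> {..<n})) ?U (\<lambda>G. restrict (symmetrize n G) (upper n))"
    by (rule indep_normal_upper_law[symmetric, OF prob_space_gauss n symmetrize_upper[OF n]])
  also have "distr \<dots> borel (symfull n) =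
      distr (gauss ({..<n} \<times> {..<n})) borel (\<lambda>G. symfull n (restrict (symmetrize n G) (upper n)))"
  proof (subst distr_distr[OF measurable_symfull])
    have "(\<lambda>G. symmetrize n G p) \<in> borel_measurable (gauss ({..<n} \<times> {..<n}))" if "p \<in> upper n" for p
      using distributed_measurable[OF symmetrize_upper(2)[OF n that]] by simp
    then show "(\<lambda>G. restrict (symmetrize n G) (upper n)) \<in> measurable (gauss ({..<n} \<times> {..<n})) ?U"
      by (intro measurable_restrict) auto
  qed (simp add: comp_def)
  also have "\<dots> = goe_law n"
    unfolding goe_law_def
    by (intro distr_cong refl) (auto simp: symfull_def symmetrize_def upper_def fun_eq_iff min_def max_def add.commute)
  finally show "distr M borel (\<lambda>\<omega>. zext n (Z \<omega>)) = goe_law n" .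
qed

section \<open>Simplicity of the spectrum\<close>

definition polyfun :: "(real \<Rightarrow> real) \<Rightarrow> bool" where
  "polyfun f \<longleftrightarrow> (\<exists>p. \<forall>s. f s = poly p s)"

lemma polyfun_const [simp, intro]: "polyfun (\<lambda>_. c)"
  unfolding polyfun_def by (rule exI[of _ "[:c:]"]) simp

lemma polyfun_id [simp, intro]: "polyfun (\<lambda>s. s)"
  unfolding polyfun_def by (rule exI[of _ "[:0, 1:]"]) simp

lemma polyfun_add [intro]: "polyfun f \<Longrightarrow> polyfun g \<Longrightarrow> polyfun (\<lambda>s. f s + g s)"
  unfolding polyfun_def by (metis poly_add)

lemma polyfun_mult [intro]: "polyfun f \<Longrightarrow> polyfun g \<Longrightarrow> polyfun (\<lambda>s. f s * g s)"
  unfolding polyfun_def by (metis poly_mult)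

lemma polyfun_sum [intro]: "(\<And>i. i \<in> I \<Longrightarrow> polyfun (f i)) \<Longrightarrow> polyfun (\<lambda>s. \<Sum>i\<in>I. f i s)"
  by (induction I rule: infinite_finite_induct) auto

lemma polyfun_prod [intro]: "(\<And>i. i \<in> I \<Longrightarrow> polyfun (f i)) \<Longrightarrow> polyfun (\<lambda>s. \<Prod>i\<in>I. f i s)"
  by (induction I rule: infinite_finite_induct) auto

lemma AE_gauss1_finite: "finite F \<Longrightarrow> AE s in gauss1. s \<notin> F"
  unfolding gauss1_def
  by (subst AE_density) (auto intro!: AE_I'[of F] simp: null_sets_def emeasure_lborel_countable countable_finite borel_closed finite_imp_closed)

text \<open>By Fubini and induction on the number of variables: for all but finitely many values of the last
  coordinate, the function of the remaining ones is still nonzero at the restriction of \<open>y\<close>.\<close>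

lemma coordinate_polynomial_null:
  assumes "finite J" "f \<in> borel_measurable (gauss J)"
    and "\<And>x i. i \<in> J \<Longrightarrow> polyfun (\<lambda>s. f (x(i := s)))"
    and "y \<in> space (gauss J)" "f y \<noteq> (0 :: real)"
  shows "AE x in gauss J. f x \<noteq> 0"
  using assms
proof (induction J arbitrary: f y)
  case empty
  have "x = y" if "x \<in> space (gauss ({} :: 'a set))" for x
    using that empty.prems(3) by (simp add: space_gauss)
  then show ?case using empty.prems(4) by (intro AE_I2) metis
next
  case (insert i J)
  have f [measurable]: "f \<in> borel_measurable (Pi\<^sub>M (insert i J) (\<lambda>_. gauss1))"
    using insert.prems(1) by (simp add: gauss_def)
  obtain p where p: "\<And>s. f (y(i := s)) = poly p s"
    using insert.prems(2)[of i y] unfolding polyfun_def by blast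
  have "poly p (y i) \<noteq> 0" using p[of "y i"] insert.prems(4) by simp
  then have "p \<noteq> 0" by auto
  then have fin: "finite {s. poly p s = 0}" by (rule poly_roots_finite)
  let ?g = "\<lambda>x. indicator {0} (f x) :: ennreal"
  have *: "(\<integral>\<^sup>+x. ?g (x(i := s)) \<partial>Pi\<^sub>M J (\<lambda>_. gauss1)) = 0" if s: "poly p s \<noteq> 0" for s
  proof -
    define y0 where "y0 = y(i := undefined)"
    have y0: "y0 \<in> space (gauss J)"
      using insert.prems(3) insert.hyps by (auto simp: y0_def space_gauss PiE_iff extensional_def)
    have "(\<lambda>x. f (x(i := s))) \<in> borel_measurable (gauss J)"
      unfolding gauss_def by measurable
    then have "AE x in gauss J. f (x(i := s)) \<noteq> 0"
    proof (rule insert.IH[OF _ _ y0])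
      fix x k assume "k \<in> J"
      then have "(\<lambda>t. f (x(k := t, i := s))) = (\<lambda>t. f ((x(i := s))(k := t)))"
        using insert.hyps by (metis fun_upd_twist)
      then show "polyfun (\<lambda>t. f (x(k := t, i := s)))"
        using insert.prems(2)[of k "x(i := s)"] \<open>k \<in> J\<close> by (simp del: fun_upd_apply)
    next
      show "f (y0(i := s)) \<noteq> 0" using s p[of s] by (simp add: y0_def)
    qed
    then have "AE x in Pi\<^sub>M J (\<lambda>_. gauss1). ?g (x(i := s)) = 0"
      unfolding gauss_def by (rule AE_mp) (auto simp: indicator_def)
    then show ?thesis by (subst nn_integral_0_iff_AE) auto
  qed
  have "(\<integral>\<^sup>+x. ?g x \<partial>gauss (insert i J)) =
      (\<integral>\<^sup>+s. (\<integral>\<^sup>+x. ?g (x(i := s)) \<partial>Pi\<^sub>M J (\<lambda>_. gauss1)) \<partial>gauss1)"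
    unfolding gauss_def
    by (rule gauss.product_nn_integral_insert_rev) (use insert.hyps in auto)
  also have "\<dots> = (\<integral>\<^sup>+s. 0 \<partial>gauss1)"
    by (rule nn_integral_cong_AE) (use AE_gauss1_finite[OF fin] * in \<open>auto elim!: AE_mp\<close>)
  finally have "(\<integral>\<^sup>+x. ?g x \<partial>gauss (insert i J)) = 0" by simp
  then have "AE x in gauss (insert i J). ?g x = 0"
    by (subst (asm) nn_integral_0_iff_AE) (auto simp: gauss_def)
  then show ?case by (rule AE_mp) (auto simp: indicator_def)
qed

text \<open>The vector \<open>X ^ m * (1, ..., 1)\<close>.\<close>

fun krylov :: "nat \<Rightarrow> (nat \<times> nat \<Rightarrow> real) \<Rightarrow> nat \<Rightarrow> nat \<Rightarrow> real" where
  "krylov n X 0 k = 1"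
| "krylov n X (Suc m) k = (\<Sum>l<n. X (k, l) * krylov n X m l)"

definition krylov_det :: "nat \<Rightarrow> (nat \<times> nat \<Rightarrow> real) \<Rightarrow> real" where
  "krylov_det n X = det (mat n n (\<lambda>(i, k). krylov n X i k))"

lemma krylov_eig:
  assumes sym: "\<And>k l. k < n \<Longrightarrow> l < n \<Longrightarrow> X (k, l) = X (l, k)"
    and y: "\<And>k. k < n \<Longrightarrow> (\<Sum>l<n. X (k, l) * y l) = a * y k"
  shows "(\<Sum>k<n. krylov n X m k * y k) = a ^ m * (\<Sum>k<n. y k)"
proof (induction m)
  case (Suc m)
  have "(\<Sum>k<n. krylov n X (Suc m) k * y k) = (\<Sum>k<n. \<Sum>l<n. X (k, l) * krylov n X m l * y k)"
    by (simp add: sum_distrib_right)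
  also have "\<dots> = (\<Sum>l<n. \<Sum>k<n. X (k, l) * krylov n X m l * y k)" by (rule sum.swap)
  also have "\<dots> = (\<Sum>l<n. krylov n X m l * (\<Sum>k<n. X (l, k) * y k))"
    unfolding sum_distrib_left by (intro sum.cong refl) (simp add: sym)
  also have "\<dots> = (\<Sum>l<n. a * (krylov n X m l * y l))"
    by (intro sum.cong refl) (simp add: y)
  also have "\<dots> = a ^ Suc m * (\<Sum>k<n. y k)" by (simp add: sum_distrib_left[symmetric] Suc)
  finally show ?case .
qed simp

text \<open>A two-dimensional eigenspace contains a nonzero vector orthogonal to \<open>(1, ..., 1)\<close>, and this
  vector is then orthogonal to all Krylov vectors.\<close>

lemma krylov_det_not_simple:
  assumes E: "eigenbasis n X lam w" and "\<not> inj_on lam {..<n}"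
  shows "krylov_det n X = 0"
proof -
  obtain a b where ab: "a < n" "b < n" "a \<noteq> b" "lam a = lam b"
    using assms(2) by (auto simp: inj_on_def)
  have o: "orthonormal n w" using E by (simp add: eigenbasis_def)
  define S where "S i = (\<Sum>k<n. w i k)" for i
  obtain al be where ne: "al \<noteq> 0 \<or> be \<noteq> 0" and z: "al * S a + be * S b = 0"
  proof (cases "S a = 0 \<and> S b = 0")
    case True
    then show ?thesis using that[of 1 0] by auto
  next
    case False
    then show ?thesis using that[of "S b" "- S a"] by auto
  qed
  define y where "y k = al * w a k + be * w b k" for k
  have ey: "(\<Sum>l<n. X (k, l) * y l) = lam a * y k" if "k < n" for k
  proof -
    have "(\<Sum>l<n. X (k, l) * y l) = al * (\<Sum>l<n. X (k, l) * w a l) + be * (\<Sum>l<n. X (k, l) * w b l)"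
      unfolding y_def sum_distrib_left sum.distrib[symmetric]
      by (intro sum.cong refl) (simp add: algebra_simps)
    then show ?thesis using E that ab by (simp add: eigenbasis_def y_def algebra_simps)
  qed
  have sy: "(\<Sum>k<n. y k) = 0"
    using z by (simp add: y_def S_def sum.distrib sum_distrib_left)
  have "(\<Sum>k<n. y k * w a k) = al * (\<Sum>k<n. w a k * w a k) + be * (\<Sum>k<n. w b k * w a k)"
    "(\<Sum>k<n. y k * w b k) = al * (\<Sum>k<n. w a k * w b k) + be * (\<Sum>k<n. w b k * w b k)"
    unfolding y_def sum_distrib_left sum.distrib[symmetric]
    by (auto intro!: sum.cong simp: algebra_simps)
  then have "(\<Sum>k<n. y k * w a k) = al" "(\<Sum>k<n. y k * w b k) = be"
    using o ab by (auto simp: orthonormal_def)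
  then have nz: "\<exists>k<n. y k \<noteq> 0" using ne by (metis (no_types, lifting) lessThan_iff mult_zero_left sum.neutral)
  let ?K = "mat n n (\<lambda>(i, k). krylov n X i k)"
  have "?K *\<^sub>v vec n y = 0\<^sub>v n"
    using krylov_eig[OF eigenbasis_sym[OF E] ey] sy
    by (intro eq_vecI) (auto simp: scalar_prod_def lessThan_atLeast0)
  moreover have "vec n y \<noteq> 0\<^sub>v n"
    using nz by (metis index_vec index_zero_vec(1))
  ultimately show ?thesis
    unfolding krylov_det_def
    using det_0_iff_vec_prod_zero_field[of ?K n] vec_carrier[of n y] by (metis mat_carrier)
qed

text \<open>For a diagonal matrix the Krylov vectors form a Vandermonde matrix: a vector in its kernel would
  be the coefficients of a polynomial of degree less than \<open>n\<close> with \<open>n\<close> roots.\<close>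

lemma krylov_det_diag:
  fixes d :: "nat \<Rightarrow> real"
  assumes X: "\<And>k l. k < n \<Longrightarrow> l < n \<Longrightarrow> X (k, l) = (if k = l then d k else 0)" and d: "inj_on d {..<n}"
  shows "krylov_det n X \<noteq> 0"
proof
  assume "krylov_det n X = 0"
  let ?K = "mat n n (\<lambda>(i, k). krylov n X i k)"
  have k: "krylov n X m k = d k ^ m" if "k < n" for m k
    using that
  proof (induction m arbitrary: k)
    case (Suc m)
    have "krylov n X (Suc m) k = (\<Sum>l<n. if l = k then d k * d k ^ m else 0)"
      unfolding krylov.simps using Suc by (intro sum.cong) (auto simp: X)
    then show ?case using Suc.prems by simp
  qed simp
  have "det (transpose_mat ?K) = 0"
    using \<open>krylov_det n X = 0\<close> det_transpose[of ?K n] by (simp add: krylov_det_def)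
  then obtain v where v: "v \<in> carrier_vec n" "v \<noteq> 0\<^sub>v n" "transpose_mat ?K *\<^sub>v v = 0\<^sub>v n"
    using det_0_iff_vec_prod_zero_field[of "transpose_mat ?K" n] by auto
  define p where "p = (\<Sum>i<n. monom (v $ i) i)"
  have pk: "poly p (d k) = 0" if "k < n" for k
  proof -
    have "(transpose_mat ?K *\<^sub>v v) $ k = 0" using v(3) that by simp
    then show ?thesis
      using that v(1) k by (simp add: scalar_prod_def p_def poly_sum poly_monom lessThan_atLeast0 mult.commute)
  qed
  have cf: "coeff p i = (if i < n then v $ i else 0)" for i
    by (simp add: p_def coeff_sum coeff_monom)
  obtain i where i: "i < n" "v $ i \<noteq> 0"
    using v(1,2) by (metis carrier_vecD eq_vecI index_zero_vec)
  then have "p \<noteq> 0" using cf[of i] by auto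
  have "degree p < n"
    using i(1) \<open>p \<noteq> 0\<close> cf by (metis leading_coeff_0_iff)
  moreover have "card (d ` {..<n}) \<le> card {x. poly p x = 0}"
    using pk by (intro card_mono poly_roots_finite \<open>p \<noteq> 0\<close>) auto
  moreover have "card {x. poly p x = 0} \<le> degree p"
    by (rule card_poly_roots_bound[OF \<open>p \<noteq> 0\<close>])
  ultimately show False using card_image[OF d] by simp
qed

text \<open>The Krylov determinant is a polynomial in each entry of \<open>G\<close> and does not vanish at the diagonal
  matrix with entries \<open>0, 1, ..., n - 1\<close>.\<close>

lemma goe_simple:
  assumes n: "n \<ge> 1"
  shows "AE X in goe_law n. \<forall>lam w. eigenbasis n X lam w \<longrightarrow> inj_on lam {..<n}"
proof -
  let ?I = "{..<n} \<times> {..<n}"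
  let ?f = "\<lambda>G. krylov_det n (symmetrize n G)"
  have expand: "krylov_det n X = (\<Sum>p\<in>{p. p permutes {0..<n}}. signof p * (\<Prod>i = 0..<n. krylov n X i (p i)))" for X
    unfolding krylov_det_def det_def by (auto intro!: sum.cong prod.cong simp: permutes_in_image)
  have ck: "continuous_on UNIV (\<lambda>X. krylov n X m k)" for m k
  proof (induction m arbitrary: k)
    case (Suc m)
    then show ?case
      by (auto intro!: continuous_on_sum continuous_on_mult)
  qed simp
  have "continuous_on UNIV (krylov_det n)"
    unfolding expand[abs_def] by (intro continuous_on_sum continuous_on_mult continuous_on_prod ck continuous_on_const)
  then have mk: "krylov_det n \<in> borel_measurable borel" by (rule borel_measurable_continuous_onI)
  have mf: "?f \<in> borel_measurable (gauss ?I)"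
    using measurable_compose[OF measurable_symmetrize mk] .
  have pk: "polyfun (\<lambda>s. krylov n (symmetrize n (x(q := s))) m k)" for x q m k
  proof (induction m arbitrary: k)
    case (Suc m)
    have "polyfun (\<lambda>s. symmetrize n (x(q := s)) (k, l))" for l
    proof -
      have up: "polyfun (\<lambda>s. (x(q := s)) r)" for r by (cases "r = q") auto
      have "polyfun (\<lambda>s. if k < n \<and> l < n then ((x(q := s)) (k, l) + (x(q := s)) (l, k)) * inverse (sqrt 2) else 0)"
        by (cases "k < n \<and> l < n") (simp_all only: if_True if_False simp_thms polyfun_mult polyfun_add up polyfun_const)
      then show ?thesis unfolding symmetrize_def prod.case divide_inverse .
    qed
    with Suc show ?case unfolding krylov.simps by (intro polyfun_sum polyfun_mult) blast+
  qed simp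
  have pf: "polyfun (\<lambda>s. ?f (x(q := s)))" for x q
    unfolding expand by (intro polyfun_sum polyfun_mult polyfun_prod pk polyfun_const)
  define y :: "nat \<times> nat \<Rightarrow> real" where
    "y = restrict (\<lambda>(k, l). if k = l then real k / sqrt 2 else 0) ?I"
  have y: "y \<in> space (gauss ?I)" by (simp add: y_def space_gauss)
  have "?f y \<noteq> 0"
    by (rule krylov_det_diag[of _ _ real]) (auto simp: symmetrize_def y_def field_simps)
  then have "AE G in gauss ?I. ?f G \<noteq> 0"
    by (intro coordinate_polynomial_null[OF _ mf pf y]) auto
  moreover have "{X \<in> space borel. krylov_det n X \<noteq> 0} \<in> sets borel"
    using mk by measurable
  ultimately have "AE X in goe_law n. krylov_det n X \<noteq> 0"
    unfolding goe_law_def by (subst AE_distr_iff) auto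
  then show ?thesis
    by (rule AE_mp) (use krylov_det_not_simple in blast)
qed

section \<open>Gaussian integrals\<close>

lemma nn_integral_normal_density:
  "\<sigma> > 0 \<Longrightarrow> (\<integral>\<^sup>+x. ennreal (normal_density \<mu> \<sigma> x) \<partial>lborel) = 1"
  by (subst nn_integral_eq_integral) auto

lemma gauss1_exp: "(\<integral>\<^sup>+x. ennreal (exp (a * x)) \<partial>gauss1) = ennreal (exp (a\<^sup>2 / 2))"
proof -
  have e: "std_normal_density x * exp (a * x) = exp (a\<^sup>2 / 2) * normal_density a 1 x" for x
  proof -
    have "- x\<^sup>2 / 2 + a * x = a\<^sup>2 / 2 + (-(x - a)\<^sup>2 / 2)" by (simp add: power2_eq_square field_simps)
    then show ?thesis
      by (simp add: normal_density_def exp_add[symmetric] del: exp_add)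
  qed
  have "(\<integral>\<^sup>+x. ennreal (exp (a * x)) \<partial>gauss1) =
      (\<integral>\<^sup>+x. ennreal (exp (a\<^sup>2 / 2)) * ennreal (normal_density a 1 x) \<partial>lborel)"
    by (subst nn_integral_gauss1) (auto simp: ennreal_mult'[symmetric] e)
  also have "\<dots> = ennreal (exp (a\<^sup>2 / 2))"
    by (subst nn_integral_cmult) (auto simp: nn_integral_normal_density)
  finally show ?thesis .
qed

lemma gauss1_exp_square:
  assumes "\<alpha> < 1 / 2"
  shows "(\<integral>\<^sup>+x. ennreal (exp (\<alpha> * x\<^sup>2)) \<partial>gauss1) = ennreal (1 / sqrt (1 - 2 * \<alpha>))"
proof -
  define r where "r = sqrt (1 - 2 * \<alpha>)"
  have r: "r > 0" "r\<^sup>2 = 1 - 2 * \<alpha>" using assms by (auto simp: r_def)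
  have e: "std_normal_density x * exp (\<alpha> * x\<^sup>2) = (1 / r) * normal_density 0 (1 / r) x" for x
  proof -
    have "- x\<^sup>2 / 2 + \<alpha> * x\<^sup>2 = - (x\<^sup>2 * r\<^sup>2) / 2" unfolding r(2) by (simp add: algebra_simps)
    then have "exp (- x\<^sup>2 / 2) * exp (\<alpha> * x\<^sup>2) = exp (- (x\<^sup>2 * r\<^sup>2) / 2)"
      by (metis exp_add)
    moreover have "sqrt (2 * pi * (1 / r)\<^sup>2) = sqrt (2 * pi) * (1 / r)"
      using r(1) by (simp add: real_sqrt_mult)
    ultimately show ?thesis
      using r(1) by (simp add: normal_density_def field_simps)
  qed
  have "(\<integral>\<^sup>+x. ennreal (exp (\<alpha> * x\<^sup>2)) \<partial>gauss1) =
      (\<integral>\<^sup>+x. ennreal (1 / r) * ennreal (normal_density 0 (1 / r) x) \<partial>lborel)"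
    using r(1) by (subst nn_integral_gauss1) (auto simp: ennreal_mult'[symmetric] e)
  also have "\<dots> = ennreal (1 / r)"
    using r(1) by (subst nn_integral_cmult) (auto simp: nn_integral_normal_density)
  finally show ?thesis by (simp add: r_def)
qed

lemma gauss1_square: "(\<integral>\<^sup>+x. ennreal (x\<^sup>2) \<partial>gauss1) = 1"
proof -
  have h: "has_bochner_integral lborel (\<lambda>x. std_normal_density x * x\<^sup>2) 1"
    using std_normal_moment_even[of 1] by (simp add: numeral_2_eq_2)
  have "(\<integral>\<^sup>+x. ennreal (x\<^sup>2) \<partial>gauss1) = (\<integral>\<^sup>+x. ennreal (std_normal_density x * x\<^sup>2) \<partial>lborel)"
    by (subst nn_integral_gauss1) (auto simp: ennreal_mult')
  also have "\<dots> = 1"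
    using h by (subst nn_integral_eq_integral) (auto simp: has_bochner_integral_iff)
  finally show ?thesis .
qed

lemma gauss_prod:
  assumes "finite I" and [measurable]: "\<And>i. i \<in> I \<Longrightarrow> f i \<in> borel_measurable borel"
    and "\<And>i x. i \<in> I \<Longrightarrow> 0 \<le> f i x"
    and "\<And>i. i \<in> I \<Longrightarrow> (\<integral>\<^sup>+x. ennreal (f i x) \<partial>gauss1) = ennreal (c i)" "\<And>i. i \<in> I \<Longrightarrow> 0 \<le> c i"
  shows "(\<integral>\<^sup>+x. ennreal (\<Prod>i\<in>I. f i (x i)) \<partial>gauss I) = ennreal (\<Prod>i\<in>I. c i)"
proof -
  have "(\<integral>\<^sup>+x. ennreal (\<Prod>i\<in>I. f i (x i)) \<partial>gauss I) = (\<integral>\<^sup>+x. (\<Prod>i\<in>I. ennreal (f i (x i))) \<partial>gauss I)"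
    using assms(3) by (simp add: prod_ennreal)
  also have "\<dots> = (\<Prod>i\<in>I. \<integral>\<^sup>+x. ennreal (f i x) \<partial>gauss1)"
    unfolding gauss_def by (rule gauss.product_nn_integral_prod) (use assms in auto)
  also have "\<dots> = (\<Prod>i\<in>I. ennreal (c i))" using assms(4) by simp
  also have "\<dots> = ennreal (\<Prod>i\<in>I. c i)" using assms(5) by (simp add: prod_ennreal)
  finally show ?thesis .
qed

lemma gauss_exp:
  assumes "finite I"
  shows "(\<integral>\<^sup>+x. ennreal (exp (\<Sum>i\<in>I. a i * x i)) \<partial>gauss I) = ennreal (exp ((\<Sum>i\<in>I. (a i)\<^sup>2) / 2))"
  using gauss_prod[OF assms, of "\<lambda>i x. exp (a i * x)" "\<lambda>i. exp ((a i)\<^sup>2 / 2)"] assms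
  by (simp add: gauss1_exp exp_sum sum_divide_distrib)

lemma gauss_exp_squares:
  assumes "finite I" "\<And>i. i \<in> I \<Longrightarrow> \<alpha> i < 1 / 2"
  shows "(\<integral>\<^sup>+x. ennreal (exp (\<Sum>i\<in>I. \<alpha> i * (x i)\<^sup>2)) \<partial>gauss I) = ennreal (\<Prod>i\<in>I. 1 / sqrt (1 - 2 * \<alpha> i))"
proof -
  have "0 \<le> 1 / sqrt (1 - 2 * \<alpha> i)" if "i \<in> I" for i using assms(2)[OF that] by simp
  then show ?thesis
    unfolding exp_sum[OF assms(1)]
    by (intro gauss_prod assms(1) gauss1_exp_square assms(2)) auto
qed

lemma gauss_squares:
  assumes "finite I"
  shows "(\<integral>\<^sup>+x. ennreal (\<Sum>i\<in>I. (x i)\<^sup>2) \<partial>gauss I) = of_nat (card I)"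
proof -
  have "(\<integral>\<^sup>+x. ennreal (\<Sum>i\<in>I. (x i)\<^sup>2) \<partial>gauss I) = (\<integral>\<^sup>+x. (\<Sum>i\<in>I. ennreal ((x i)\<^sup>2)) \<partial>gauss I)"
    by (simp add: sum_ennreal)
  also have "\<dots> = (\<Sum>i\<in>I. \<integral>\<^sup>+x. ennreal ((x i)\<^sup>2) \<partial>gauss I)"
    by (rule nn_integral_sum) measurable
  also have "\<dots> = (\<Sum>i\<in>I. 1)"
  proof (intro sum.cong refl)
    fix i assume i: "i \<in> I"
    have d: "distr (gauss I) gauss1 (\<lambda>x. x i) = gauss1"
      unfolding gauss_def by (rule distr_PiM_component) (auto intro: prob_space_gauss1 i)
    have m: "(\<lambda>x. x i) \<in> measurable (gauss I) gauss1" using i by measurable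
    have "(\<integral>\<^sup>+x. ennreal ((x i)\<^sup>2) \<partial>gauss I) = (\<integral>\<^sup>+y. ennreal (y\<^sup>2) \<partial>distr (gauss I) gauss1 (\<lambda>x. x i))"
      by (subst nn_integral_distr[OF m]) auto
    then show "(\<integral>\<^sup>+x. ennreal ((x i)\<^sup>2) \<partial>gauss I) = 1" by (simp only: d gauss1_square)
  qed
  finally show ?thesis by simp
qed

lemma gauss_cosh:
  assumes "finite I"
  shows "(\<integral>\<^sup>+x. ennreal (cosh (\<Sum>i\<in>I. a i * x i)) \<partial>gauss I) = ennreal (exp ((\<Sum>i\<in>I. (a i)\<^sup>2) / 2))"
proof -
  have [measurable]: "(\<lambda>x. \<Sum>i\<in>I. b i * x i) \<in> borel_measurable (gauss I)" for b
    by measurable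
  have "(\<integral>\<^sup>+x. ennreal (cosh (\<Sum>i\<in>I. a i * x i)) \<partial>gauss I) =
    (\<integral>\<^sup>+x. ennreal (1 / 2) * (ennreal (exp (\<Sum>i\<in>I. a i * x i)) + ennreal (exp (\<Sum>i\<in>I. (- a i) * x i))) \<partial>gauss I)"
    by (intro nn_integral_cong)
       (simp add: cosh_def sum_negf ennreal_plus[symmetric] ennreal_mult'[symmetric] del: ennreal_plus ennreal_half)
  also have "\<dots> = ennreal (1 / 2) * (\<integral>\<^sup>+x. ennreal (exp (\<Sum>i\<in>I. a i * x i)) + ennreal (exp (\<Sum>i\<in>I. (- a i) * x i)) \<partial>gauss I)"
    by (rule nn_integral_cmult) measurable
  also have "\<dots> = ennreal (1 / 2) * ((\<integral>\<^sup>+x. ennreal (exp (\<Sum>i\<in>I. a i * x i)) \<partial>gauss I) + (\<integral>\<^sup>+x. ennreal (exp (\<Sum>i\<in>I. (- a i) * x i)) \<partial>gauss I))"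
    by (subst nn_integral_add) auto
  also have "\<dots> = ennreal (1 / 2) * (ennreal (exp ((\<Sum>i\<in>I. (a i)\<^sup>2) / 2)) + ennreal (exp ((\<Sum>i\<in>I. (a i)\<^sup>2) / 2)))"
    using gauss_exp[OF assms, of a] gauss_exp[OF assms, of "\<lambda>i. - a i"] by simp
  also have "\<dots> = ennreal (exp ((\<Sum>i\<in>I. (a i)\<^sup>2) / 2))"
    by (simp add: ennreal_plus[symmetric] ennreal_mult'[symmetric] del: ennreal_plus ennreal_half)
  finally show ?thesis .
qed

lemma sinh_le_mult_cosh:
  fixes x :: real
  assumes "0 \<le> x"
  shows "sinh x \<le> x * cosh x"
proof -
  have "0 * cosh 0 - sinh 0 \<le> x * cosh x - sinh (x :: real)"
  proof (rule DERIV_nonneg_imp_nondecreasing[OF assms], intro exI conjI)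
    fix t :: real assume "0 \<le> t"
    show "((\<lambda>x. x * cosh x - sinh x) has_real_derivative t * sinh t) (at t)"
      by (auto intro!: derivative_eq_intros)
    show "0 \<le> t * sinh t" using \<open>0 \<le> t\<close> by simp
  qed
  then show ?thesis by simp
qed

lemma sinh_ratio_mono:
  fixes x y :: real
  assumes "0 \<le> x" "x \<le> y"
  shows "y * sinh x \<le> x * sinh y"
proof -
  have "x * sinh x - x * sinh x \<le> x * sinh y - y * sinh x"
  proof (rule DERIV_nonneg_imp_nondecreasing[OF assms(2)], intro exI conjI)
    fix t :: real assume t: "x \<le> t"
    show "((\<lambda>y. x * sinh y - y * sinh x) has_real_derivative x * cosh t - sinh x) (at t)"
      by (auto intro!: derivative_eq_intros)
    have "x * cosh x \<le> x * cosh t"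
      using assms(1) t by (intro mult_left_mono) (auto simp: cosh_real_nonneg_le_iff)
    then show "0 \<le> x * cosh t - sinh x" using sinh_le_mult_cosh[OF assms(1)] by simp
  qed
  then show ?thesis by simp
qed

text \<open>As a function of \<open>u = x\<^sup>2\<close>, \<open>cosh (a * sqrt u)\<close> is convex; this is its tangent at \<open>u = x0\<^sup>2\<close>.\<close>

lemma cosh_square_tangent:
  fixes a x x0 :: real
  assumes "0 \<le> x" "0 < x0" "0 \<le> a"
  defines "K \<equiv> a * sinh (a * x0) / (2 * x0)"
  shows "cosh (a * x0) + K * x\<^sup>2 \<le> cosh (a * x) + K * x0\<^sup>2"
proof -
  let ?D = "\<lambda>t. cosh (a * t) - K * t\<^sup>2"
  let ?D' = "\<lambda>t. a * sinh (a * t) - 2 * K * t"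
  have d: "(?D has_real_derivative ?D' t) (at t)" for t
    by (auto intro!: derivative_eq_intros)
  have D': "?D' t = (a * x0 * sinh (a * t) - a * t * sinh (a * x0)) / x0" for t
    using assms(2) by (simp add: K_def field_simps)
  have "?D x0 \<le> ?D x"
  proof (cases "x0 \<le> x")
    case True
    show ?thesis
    proof (rule DERIV_nonneg_imp_nondecreasing[OF True], intro exI conjI)
      fix t assume t: "x0 \<le> t"
      show "(?D has_real_derivative ?D' t) (at t)" by (rule d)
      have "a * t * sinh (a * x0) \<le> a * x0 * sinh (a * t)"
        using assms t by (intro sinh_ratio_mono) (auto intro: mult_left_mono)
      then show "0 \<le> ?D' t" unfolding D' using assms(2) by simp
    qed
  next
    case False
    then have le: "x \<le> x0" by simp
    show ?thesis
    proof (rule DERIV_nonpos_imp_nonincreasing[OF le], intro exI conjI)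
      fix t assume t: "x \<le> t" "t \<le> x0"
      show "(?D has_real_derivative ?D' t) (at t)" by (rule d)
      have "a * x0 * sinh (a * t) \<le> a * t * sinh (a * x0)"
        using assms t by (intro sinh_ratio_mono) (auto intro: mult_left_mono)
      then show "?D' t \<le> 0" unfolding D' using assms(2) by (simp add: divide_nonpos_pos)
    qed
  qed
  then show ?thesis by simp
qed

lemma measurable_cosh [measurable]: "(cosh :: real \<Rightarrow> real) \<in> borel_measurable borel"
  by (intro borel_measurable_continuous_onI continuous_intros)

text \<open>Jensen's inequality for the convex function \<open>cosh (a * sqrt u)\<close>, as \<open>|g|\<^sup>2\<close> has mean \<open>n\<close>.\<close>

lemma gauss_cosh_norm:
  assumes n: "n \<ge> 1" and a: "0 \<le> a"
  shows "ennreal (cosh (a * sqrt (real n))) \<le> (\<integral>\<^sup>+g. ennreal (cosh (a * sqrt (\<Sum>k<n. (g k)\<^sup>2))) \<partial>gauss {..<n})"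
proof -
  interpret P: prob_space "gauss {..<n}" by (rule prob_space_gauss)
  define K where "K = a * sinh (a * sqrt n) / (2 * sqrt n)"
  have K: "K \<ge> 0" using a by (simp add: K_def)
  have [measurable]: "(\<lambda>g. \<Sum>k<n. (g k)\<^sup>2) \<in> borel_measurable (gauss {..<n})"
    by measurable
  have pw: "cosh (a * sqrt n) + K * (\<Sum>k<n. (g k)\<^sup>2) \<le> cosh (a * sqrt (\<Sum>k<n. (g k)\<^sup>2)) + K * n" for g
    using cosh_square_tangent[of "sqrt (\<Sum>k<n. (g k)\<^sup>2)" "sqrt n" a] n a
    by (simp add: K_def sum_nonneg)
  have "ennreal (cosh (a * sqrt n)) + ennreal K * of_nat n =
      (\<integral>\<^sup>+g. ennreal (cosh (a * sqrt n)) + ennreal K * ennreal (\<Sum>k<n. (g k)\<^sup>2) \<partial>gauss {..<n})"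
    by (subst nn_integral_add) (auto simp: nn_integral_cmult gauss_squares P.emeasure_space_1)
  also have "\<dots> \<le> (\<integral>\<^sup>+g. ennreal (cosh (a * sqrt (\<Sum>k<n. (g k)\<^sup>2))) + ennreal K * of_nat n \<partial>gauss {..<n})"
  proof (rule nn_integral_mono)
    fix g :: "nat \<Rightarrow> real"
    have "ennreal (cosh (a * sqrt n) + K * (\<Sum>k<n. (g k)\<^sup>2)) \<le> ennreal (cosh (a * sqrt (\<Sum>k<n. (g k)\<^sup>2)) + K * real n)"
      by (rule ennreal_leI[OF pw])
    then show "ennreal (cosh (a * sqrt n)) + ennreal K * ennreal (\<Sum>k<n. (g k)\<^sup>2) \<le>
        ennreal (cosh (a * sqrt (\<Sum>k<n. (g k)\<^sup>2))) + ennreal K * of_nat n"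
      using K by (simp add: ennreal_mult' sum_nonneg ennreal_of_nat_eq_real_of_nat less_imp_le cosh_real_pos)
  qed
  also have "\<dots> = (\<integral>\<^sup>+g. ennreal (cosh (a * sqrt (\<Sum>k<n. (g k)\<^sup>2))) \<partial>gauss {..<n}) + ennreal K * of_nat n"
    by (subst nn_integral_add) (auto simp: P.emeasure_space_1)
  finally show ?thesis
    by (subst (asm) (1 2) add.commute) (auto simp: ennreal_add_left_cancel_le ennreal_mult_eq_top_iff)
qed

section \<open>Concentration of the eigenvectors of a GOE matrix\<close>

lemma tendsto_by_subsequences:
  fixes f :: "nat \<Rightarrow> 'a :: metric_space"
  assumes "\<And>r. strict_mono (r :: nat \<Rightarrow> nat) \<Longrightarrow> \<exists>q. strict_mono q \<and> (\<lambda>p. f (r (q p))) \<longlonglongrightarrow> L"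
  shows "f \<longlonglongrightarrow> L"
proof (rule ccontr)
  assume "\<not> f \<longlonglongrightarrow> L"
  then obtain e where e: "e > 0" "\<not> (\<forall>\<^sub>F p in sequentially. dist (f p) L < e)"
    by (auto simp: tendsto_iff)
  then have "infinite {p. \<not> dist (f p) L < e}"
    by (simp add: not_eventually frequently_cofinite[symmetric] cofinite_eq_sequentially)
  then obtain r :: "nat \<Rightarrow> nat" where r: "strict_mono r" "\<And>p. r p \<in> {p. \<not> dist (f p) L < e}"
    using infinite_enumerate by metis
  obtain q where q: "(\<lambda>p. f (r (q p))) \<longlonglongrightarrow> L" using assms[OF r(1)] by blast
  then have "\<forall>\<^sub>F p in sequentially. dist (f (r (q p))) L < e" using e(1) by (auto simp: tendsto_iff)
  then obtain p where "dist (f (r (q p))) L < e" by (auto simp: eventually_sequentially)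
  then show False using r(2)[of "q p"] by simp
qed

lemma tendsto_coordinate:
  fixes X :: "nat \<Rightarrow> 'i :: countable \<Rightarrow> real"
  assumes "X \<longlonglongrightarrow> Y"
  shows "(\<lambda>p. X p q) \<longlonglongrightarrow> Y q"
proof -
  have "continuous_on UNIV (\<lambda>x :: 'i \<Rightarrow> real. x q)" by (rule continuous_on_product_coordinates)
  then have "isCont (\<lambda>x :: 'i \<Rightarrow> real. x q) Y"
    using continuous_on_eq_continuous_at[OF open_UNIV, of "\<lambda>x :: 'i \<Rightarrow> real. x q"] by blast
  then show ?thesis by (rule isCont_tendsto_compose[OF _ assms])
qed

definition simple_spectrum :: "nat \<Rightarrow> (nat \<times> nat \<Rightarrow> real) set" where
  "simple_spectrum n = {X. (\<exists>lam w. eigenbasis n X lam w) \<and> (\<forall>lam w. eigenbasis n X lam w \<longrightarrow> inj_on lam {..<n})}"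

lemma simple_spectrumI:
  assumes E: "eigenbasis n X lam w" and inj: "inj_on lam {..<n}"
  shows "X \<in> simple_spectrum n"
proof -
  have "inj_on lam' {..<n}" if E': "eigenbasis n X lam' w'" for lam' w'
  proof -
    have "lam' i = lam i" if "i \<in> {..<n}" for i
      using simple_eigvals_unique[OF E E' inj] that by simp
    then have "inj_on lam' {..<n} = inj_on lam {..<n}" by (rule inj_on_cong)
    with inj show ?thesis by simp
  qed
  with E show ?thesis unfolding simple_spectrum_def by blast
qed

lemma closed_eigenbasis:
  assumes Q: "\<And>lam w lam' w'. \<lbrakk>\<And>p :: nat. Q (lam p) (w p);
      \<And>i. i < n \<Longrightarrow> (\<lambda>p. lam p i) \<longlonglongrightarrow> lam' i; \<And>i k. i < n \<Longrightarrow> k < n \<Longrightarrow> (\<lambda>p. w p i k) \<longlonglongrightarrow> w' i k\<rbrakk> \<Longrightarrow> Q lam' w'"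
  shows "closed {X. \<exists>lam w. eigenbasis n X lam w \<and> Q lam w}"
  unfolding closed_sequential_limits
proof (intro allI impI, elim conjE)
  fix X Y assume X: "\<forall>p. X p \<in> {X. \<exists>lam w. eigenbasis n X lam w \<and> Q lam w}" and lim: "X \<longlonglongrightarrow> Y"
  obtain lam w where lw: "\<And>p. eigenbasis n (X p) (lam p) (w p)" "\<And>p. Q (lam p) (w p)"
    using X by simp metis
  obtain r lam' w' where *: "strict_mono r" "eigenbasis n Y lam' w'"
    "\<And>i. i < n \<Longrightarrow> (\<lambda>p. lam (r p) i) \<longlonglongrightarrow> lam' i"
    "\<And>i k. i < n \<Longrightarrow> k < n \<Longrightarrow> (\<lambda>p. w (r p) i k) \<longlonglongrightarrow> w' i k"
    using eigenbasis_limit[OF lw(1) tendsto_coordinate[OF lim]] by blast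
  have "Q lam' w'" by (rule Q[OF lw(2) *(3,4)])
  then show "Y \<in> {X. \<exists>lam w. eigenbasis n X lam w \<and> Q lam w}" using *(2) by blast
qed

lemma borel_simple_spectrum [measurable]: "simple_spectrum n \<in> sets borel"
proof -
  let ?E = "{X. \<exists>lam w. eigenbasis n X lam w \<and> True}"
  let ?N = "\<lambda>a b. {X. \<exists>lam w. eigenbasis n X lam w \<and> lam a = lam b}"
  let ?P = "{(a, b). a < n \<and> b < n \<and> a \<noteq> b}"
  have E: "?E \<in> sets borel" by (rule borel_closed, rule closed_eigenbasis) simp
  have N: "closed (?N a b)" if "a < n" "b < n" for a b
  proof (rule closed_eigenbasis)
    fix lam :: "nat \<Rightarrow> nat \<Rightarrow> real" and w :: "nat \<Rightarrow> nat \<Rightarrow> nat \<Rightarrow> real" and lam' w'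
    assume "\<And>p. lam p a = lam p b" "\<And>i. i < n \<Longrightarrow> (\<lambda>p. lam p i) \<longlonglongrightarrow> lam' i"
    then show "lam' a = lam' b" using that by (metis (no_types, lifting) LIMSEQ_unique ext)
  qed
  have "finite ?P" by (rule finite_subset[of _ "{..<n} \<times> {..<n}"]) auto
  then have "(\<Union>p\<in>?P. ?N (fst p) (snd p)) \<in> sets borel"
  proof (rule sets.finite_UN)
    fix p assume "p \<in> ?P"
    then show "?N (fst p) (snd p) \<in> sets borel" by (intro borel_closed N) auto
  qed
  with E have "?E - (\<Union>p\<in>?P. ?N (fst p) (snd p)) \<in> sets borel" by (rule sets.Diff)
  also have "?E - (\<Union>p\<in>{(a, b). a < n \<and> b < n \<and> a \<noteq> b}. ?N (fst p) (snd p)) = simple_spectrum n"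
  proof (intro equalityI subsetI)
    fix X assume X: "X \<in> ?E - (\<Union>p\<in>?P. ?N (fst p) (snd p))"
    have "a = b" if "eigenbasis n X lam w" "a < n" "b < n" "lam a = lam b" for lam w a b
    proof (rule ccontr)
      assume "a \<noteq> b"
      then have "(a, b) \<in> ?P" "X \<in> ?N (fst (a, b)) (snd (a, b))" using that by auto
      then show False using X by blast
    qed
    then show "X \<in> simple_spectrum n" using X unfolding simple_spectrum_def inj_on_def by blast
  next
    fix X assume X: "X \<in> simple_spectrum n"
    have "X \<notin> ?N (fst p) (snd p)" if "p \<in> ?P" for p
      using X that unfolding simple_spectrum_def inj_on_def by auto
    then show "X \<in> ?E - (\<Union>p\<in>?P. ?N (fst p) (snd p))"
      using X unfolding simple_spectrum_def by blast
  qed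
  finally show ?thesis .
qed

text \<open>The choice of signs of the eigenvectors need not be measurable. The projections \<open>eproj\<close> onto the
  eigenspaces do not depend on it and are continuous where the spectrum is simple.\<close>

definition evec :: "nat \<Rightarrow> (nat \<times> nat \<Rightarrow> real) \<Rightarrow> nat \<Rightarrow> nat \<Rightarrow> real" where
  "evec n X = (SOME w. \<exists>lam. eigenbasis n X lam w)"

definition eproj :: "nat \<Rightarrow> nat \<Rightarrow> (nat \<times> nat \<Rightarrow> real) \<Rightarrow> nat \<Rightarrow> nat \<Rightarrow> real" where
  "eproj n i X k l = (if X \<in> simple_spectrum n then evec n X i k * evec n X i l else 0)"

lemma evec: "X \<in> simple_spectrum n \<Longrightarrow> \<exists>lam. eigenbasis n X lam (evec n X) \<and> inj_on lam {..<n}"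
  unfolding evec_def simple_spectrum_def by (smt (verit, best) mem_Collect_eq someI_ex)

lemma evec_orthn: "X \<in> simple_spectrum n \<Longrightarrow> orthonormal n (evec n X)"
  using evec by (auto simp: eigenbasis_def)

lemma eproj_eq:
  assumes X: "X \<in> simple_spectrum n" and E: "eigenbasis n X lam w" and "i < n" "k < n" "l < n"
  shows "eproj n i X k l = w i k * w i l"
proof -
  obtain lam' where l: "eigenbasis n X lam' (evec n X)" "inj_on lam' {..<n}" using evec[OF X] by blast
  obtain c :: real where "c = 1 \<or> c = -1" "\<And>k. k < n \<Longrightarrow> w i k = c * evec n X i k"
    using simple_eigvec_unique[OF l(1) E l(2) assms(3)] by metis
  then show ?thesis using assms by (auto simp: eproj_def)
qed

lemma measurable_eproj [measurable]:
  assumes "i < n" "k < n" "l < n"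
  shows "(\<lambda>X. eproj n i X k l) \<in> borel_measurable borel"
proof -
  have "continuous_on (simple_spectrum n) (\<lambda>X. eproj n i X k l)"
    unfolding continuous_on_sequentially
  proof (intro allI ballI impI, elim conjE, rule tendsto_by_subsequences)
    fix X Y and r :: "nat \<Rightarrow> nat"
    assume Y: "Y \<in> simple_spectrum n" and X: "\<forall>p. X p \<in> simple_spectrum n" and lim: "X \<longlonglongrightarrow> Y" and r: "strict_mono r"
    have "\<forall>p. \<exists>lam. eigenbasis n (X (r p)) lam (evec n (X (r p)))"
      using evec X by blast
    then obtain lam where lam: "\<And>p. eigenbasis n (X (r p)) (lam p) (evec n (X (r p)))"
      using choice[of "\<lambda>p lam. eigenbasis n (X (r p)) lam (evec n (X (r p)))"] by blast
    have "(\<lambda>p. X (r p)) \<longlonglongrightarrow> Y" using LIMSEQ_subseq_LIMSEQ[OF lim r] by (simp add: o_def)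
    then have lim': "(\<lambda>p. X (r p) (k, l)) \<longlonglongrightarrow> Y (k, l)" for k l by (rule tendsto_coordinate)
    obtain q lam' w' where q: "strict_mono q" "eigenbasis n Y lam' w'"
      "\<And>i k. i < n \<Longrightarrow> k < n \<Longrightarrow> (\<lambda>p. evec n (X (r (q p))) i k) \<longlonglongrightarrow> w' i k"
      by (rule eigenbasis_limit[of n "\<lambda>p. X (r p)" lam "\<lambda>p. evec n (X (r p))" Y, OF lam lim'], rule that; assumption)
    have "(\<lambda>p. evec n (X (r (q p))) i k * evec n (X (r (q p))) i l) \<longlonglongrightarrow> w' i k * w' i l"
      by (intro tendsto_mult q(3) assms)
    then have "(\<lambda>p. ((\<lambda>X. eproj n i X k l) \<circ> X) (r (q p))) \<longlonglongrightarrow> eproj n i Y k l"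
      using X eproj_eq[OF Y q(2) assms] by (simp add: eproj_def)
    then show "\<exists>q. strict_mono q \<and> (\<lambda>p. ((\<lambda>X. eproj n i X k l) \<circ> X) (r (q p))) \<longlonglongrightarrow> eproj n i Y k l"
      using q(1) by blast
  qed
  then have "(\<lambda>X. indicator (simple_spectrum n) X *\<^sub>R eproj n i X k l) \<in> borel_measurable borel"
    by (rule borel_measurable_continuous_on_indicator[OF borel_simple_spectrum])
  also have "(\<lambda>X. indicator (simple_spectrum n) X *\<^sub>R eproj n i X k l) = (\<lambda>X. eproj n i X k l)"
    by (auto simp: eproj_def fun_eq_iff indicator_def)
  finally show ?thesis .
qed

lemma sum_rot:
  fixes a b n :: nat
  assumes "a < n" "b < n" "a \<noteq> b" "c\<^sup>2 + s\<^sup>2 = 1"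
  shows "(\<Sum>k<n. rot a b c s x k * rot a b c s y k) = (\<Sum>k<n. x k * y k)"
proof -
  have split: "(\<Sum>k<n. f k) = f a + f b + (\<Sum>k\<in>{..<n} - {a, b}. f k)" for f :: "nat \<Rightarrow> real"
    using assms by (subst sum.subset_diff[of "{a, b}"]) auto
  have "rot a b c s x a * rot a b c s y a + rot a b c s x b * rot a b c s y b =
     (c\<^sup>2 + s\<^sup>2) * (x a * y a + x b * y b)"
    using assms(3) by (simp add: rot_def power2_eq_square algebra_simps)
  moreover have "(\<Sum>k\<in>{..<n} - {a, b}. rot a b c s x k * rot a b c s y k) = (\<Sum>k\<in>{..<n} - {a, b}. x k * y k)"
    by (intro sum.cong) (auto simp: rot_def)
  ultimately show ?thesis using assms(4) by (simp add: split)
qed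

lemma eigenbasis_conj_rot:
  assumes ab: "a < n" "b < n" "a \<noteq> b" "c\<^sup>2 + s\<^sup>2 = 1" and E: "eigenbasis n X lam w"
  shows "eigenbasis n (conj_rot n a b c s X) lam (\<lambda>i. rot a b c s (w i))"
  unfolding eigenbasis_def
proof (intro conjI allI impI)
  show "orthonormal n (\<lambda>i. rot a b c s (w i))"
    using E unfolding orthonormal_def by (simp add: sum_rot[OF ab] eigenbasis_def orthonormal_def)
  show "lam j \<le> lam i" if "i \<le> j" "j < n" for i j using E that by (simp add: eigenbasis_def)
next
  fix i k assume ik: "i < n" "k < n"
  have e: "(\<Sum>l<n. X (k, l) * w i l) = lam i * w i k" if "k < n" for k
    using E that ik by (simp add: eigenbasis_def)
  let ?R = "\<lambda>l. rowrot n a b c s X (k, l)"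
  have "(\<Sum>l<n. conj_rot n a b c s X (k, l) * rot a b c s (w i) l) =
      (\<Sum>l<n. rot a b c s ?R l * rot a b c s (w i) l)"
    using ik ab by (intro sum.cong) (auto simp: conj_rot_def colrot_def rot_def)
  also have "\<dots> = (\<Sum>l<n. ?R l * w i l)" by (rule sum_rot[OF ab])
  also have "\<dots> = rot a b c s (\<lambda>k. \<Sum>l<n. X (k, l) * w i l) k"
  proof -
    consider "k = a" | "k = b" | "k \<noteq> a" "k \<noteq> b" by blast
    then show ?thesis
    proof cases
      case 1
      then show ?thesis using ab
        by (simp add: rot_def rowrot_def sum_distrib_left sum_subtractf[symmetric] algebra_simps)
    next
      case 2
      then show ?thesis using ab
        by (simp add: rot_def rowrot_def sum_distrib_left sum.distrib[symmetric] algebra_simps)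
    next
      case 3
      then show ?thesis by (simp add: rot_def rowrot_def)
    qed
  qed
  also have "\<dots> = rot a b c s (\<lambda>k. lam i * w i k) k"
    using ab(1-3) ik by (simp add: rot_def e)
  also have "\<dots> = lam i * rot a b c s (w i) k"
    by (simp add: rot_def algebra_simps)
  finally show "(\<Sum>l<n. conj_rot n a b c s X (k, l) * rot a b c s (w i) l) = lam i * rot a b c s (w i) k" .
qed

text \<open>For simple spectrum, the squared inner product of \<open>t\<close> with the \<open>i\<close>-th eigenvector.\<close>

definition qform :: "nat \<Rightarrow> nat \<Rightarrow> (nat \<Rightarrow> real) \<Rightarrow> (nat \<times> nat \<Rightarrow> real) \<Rightarrow> real" where
  "qform n i t X = (\<Sum>k<n. \<Sum>l<n. t k * t l * eproj n i X k l)"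

lemma qform_eq:
  assumes "X \<in> simple_spectrum n" "eigenbasis n X lam w" "i < n"
  shows "qform n i t X = (\<Sum>k<n. t k * w i k)\<^sup>2"
  unfolding qform_def power2_eq_square sum_product
  by (intro sum.cong refl) (simp add: eproj_eq[OF assms] mult_ac)

lemma qform_evec:
  assumes "X \<in> simple_spectrum n" "i < n"
  shows "qform n i t X = (\<Sum>k<n. t k * evec n X i k)\<^sup>2"
proof -
  obtain lam where "eigenbasis n X lam (evec n X)" using evec[OF assms(1)] by blast
  from qform_eq[OF assms(1) this assms(2)] show ?thesis .
qed

lemma measurable_qform:
  assumes "i < n" "\<And>k. k < n \<Longrightarrow> (\<lambda>x. t x k) \<in> borel_measurable M" "f \<in> borel_measurable M"
  shows "(\<lambda>x. qform n i (t x) (f x)) \<in> borel_measurable M"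
proof -
  have "(\<lambda>x. eproj n i (f x) k l) \<in> borel_measurable M" if "k < n" "l < n" for k l
    by (rule measurable_compose[OF assms(3) measurable_eproj[OF assms(1) that]])
  then show ?thesis
    unfolding qform_def using assms(2) by (intro borel_measurable_sum borel_measurable_times) auto
qed

text \<open>Rotating \<open>t\<close> and the eigenvectors simultaneously does not change inner products.\<close>

lemma qform_conj_rot:
  assumes "a < n" "b < n" "a \<noteq> b" "c\<^sup>2 + s\<^sup>2 = 1" "X \<in> simple_spectrum n" "i < n"
  shows "qform n i (rot a b c s t) (conj_rot n a b c s X) = qform n i t X"
proof -
  obtain lam where l: "eigenbasis n X lam (evec n X)" "inj_on lam {..<n}" using evec[OF assms(5)] by blast
  note l' = eigenbasis_conj_rot[OF assms(1-4) l(1)]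
  show ?thesis
    unfolding qform_eq[OF simple_spectrumI[OF l' l(2)] l' assms(6)] qform_eq[OF assms(5) l(1) assms(6)]
    by (simp add: sum_rot[OF assms(1-4)])
qed

definition goe_cosh :: "nat \<Rightarrow> nat \<Rightarrow> (nat \<Rightarrow> real) \<Rightarrow> ennreal" where
  "goe_cosh n i t = (\<integral>\<^sup>+X. ennreal (cosh (sqrt (qform n i t X))) \<partial>goe_law n)"

context
  fixes n i :: nat
  assumes i: "i < n" and S: "AE X in goe_law n. X \<in> simple_spectrum n"
begin

lemma goe_cosh_measurable: "(\<lambda>X. ennreal (cosh (sqrt (qform n i t X)))) \<in> borel_measurable (goe_law n)"
proof -
  have "(\<lambda>X. qform n i t X) \<in> borel_measurable (goe_law n)"
    by (rule measurable_qform[OF i, of "\<lambda>_. t" _ "\<lambda>X. X"])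
       (rule borel_measurable_const, rule measurable_ident_sets, rule sets_goe_law)
  moreover have "(\<lambda>x :: real. ennreal (cosh (sqrt x))) \<in> borel_measurable borel" by measurable
  ultimately show ?thesis by (rule measurable_compose)
qed

lemma goe_cosh_rot:
  assumes "a < n" "b < n" "a \<noteq> b" "c\<^sup>2 + s\<^sup>2 = 1"
  shows "goe_cosh n i (rot a b c s t) = goe_cosh n i t"
proof -
  have "goe_cosh n i (rot a b c s t) =
    (\<integral>\<^sup>+X. ennreal (cosh (sqrt (qform n i (rot a b c s t) (conj_rot n a b c s X)))) \<partial>goe_law n)"
    unfolding goe_cosh_def
    by (rule goe_law_conj_rot[OF assms, symmetric])
      (use goe_cosh_measurable[of "rot a b c s t"] in \<open>simp only: measurable_cong_sets[OF sets_goe_law refl]\<close>)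
  also have "\<dots> = goe_cosh n i t"
    unfolding goe_cosh_def
    by (rule nn_integral_cong_AE, rule AE_mp[OF S]) (auto simp: qform_conj_rot[OF assms _ i])
  finally show ?thesis .
qed

text \<open>Rotations in the planes of the coordinates \<open>0\<close> and \<open>m\<close> collect the length of \<open>t\<close> in the
  coordinate \<open>0\<close>, one \<open>m\<close> after the other.\<close>

lemma goe_cosh_reduce:
  assumes "1 \<le> m" "m \<le> n"
  shows "\<exists>r. r\<^sup>2 = (\<Sum>j<m. (t j)\<^sup>2) \<and> goe_cosh n i t = goe_cosh n i (\<lambda>k. if k = 0 then r else if k < m then 0 else t k)"
  using assms
proof (induction m)
  case (Suc m)
  show ?case
  proof (cases "m = 0")
    case True
    have "(\<lambda>k. if k = 0 then t 0 else if k < Suc m then 0 else t k) = t"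
      using True by (auto simp: fun_eq_iff)
    then show ?thesis using True by (intro exI[of _ "t 0"]) auto
  next
    case False
    then have "1 \<le> m" "m \<le> n" using Suc.prems by auto
    from Suc.IH[OF this] obtain r where
      "r\<^sup>2 = (\<Sum>j<m. (t j)\<^sup>2) \<and> goe_cosh n i t = goe_cosh n i (\<lambda>k. if k = 0 then r else if k < m then 0 else t k)"
      by (rule exE)
    then have r: "r\<^sup>2 = (\<Sum>j<m. (t j)\<^sup>2)"
      "goe_cosh n i t = goe_cosh n i (\<lambda>k. if k = 0 then r else if k < m then 0 else t k)"
      by (rule conjunct1, rule conjunct2)
    define R where "R = sqrt (r\<^sup>2 + (t m)\<^sup>2)"
    have R2: "R\<^sup>2 = r\<^sup>2 + (t m)\<^sup>2" by (simp add: R_def)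
    show ?thesis
    proof (cases "R = 0")
      case True
      then have "r\<^sup>2 + (t m)\<^sup>2 = 0" using R2 by simp
      then have "r = 0" "t m = 0" by (simp_all only: sum_power2_eq_zero_iff)
      moreover from this have "(\<lambda>k. if k = 0 then r else if k < m then 0 else t k) =
          (\<lambda>k. if k = 0 then r else if k < Suc m then 0 else t k)"
        by (intro ext) (auto simp: less_Suc_eq)
      moreover have "r\<^sup>2 = (\<Sum>j<Suc m. (t j)\<^sup>2)" using r(1) \<open>t m = 0\<close> by simp
      ultimately show ?thesis using r(2) by (intro exI[of _ r] conjI) (simp_all only:)
    next
      case R: False
      \<comment> \<open>the rotation that maps the coordinates (r, t m) to (R, 0)\<close>
      define c s where "c = r / R" and "s = - t m / R"
      have cs: "c\<^sup>2 + s\<^sup>2 = 1"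
      proof -
        have "c\<^sup>2 + s\<^sup>2 = (r\<^sup>2 + (t m)\<^sup>2) / R\<^sup>2"
          by (simp add: c_def s_def power_divide add_divide_distrib)
        then show ?thesis using R by (simp add: R2[symmetric])
      qed
      have z: "c * r - s * t m = R" "s * r + c * t m = 0"
      proof -
        have "c * r - s * t m = (r\<^sup>2 + (t m)\<^sup>2) / R"
          by (simp add: c_def s_def power2_eq_square add_divide_distrib)
        also have "\<dots> = R * R / R" by (subst R2[symmetric]) (simp add: power2_eq_square)
        finally show "c * r - s * t m = R" using R by simp
        show "s * r + c * t m = 0" by (simp add: c_def s_def)
      qed
      let ?f = "\<lambda>k. if k = 0 then r else if k < m then 0 else t k"
      let ?g = "\<lambda>k. if k = 0 then R else if k < Suc m then 0 else t k"
      have f: "?f 0 = r" "?f m = t m" using False by auto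
      have fg: "rot 0 m c s ?f = ?g"
      proof (rule ext)
        fix k
        have "k = 0 \<or> k = m \<or> k \<noteq> 0 \<and> k < m \<or> m < k" by linarith
        then show "rot 0 m c s ?f k = ?g k"
          unfolding rot_def f z using False by (elim disjE) simp_all
      qed
      have m: "0 < n" "m < n" "0 \<noteq> m" using Suc.prems False by auto
      have "goe_cosh n i t = goe_cosh n i ?f" by (rule r(2))
      also have "\<dots> = goe_cosh n i (rot 0 m c s ?f)" by (rule goe_cosh_rot[OF m cs, symmetric])
      also have "\<dots> = goe_cosh n i ?g" by (simp only: fg)
      finally have "goe_cosh n i t = goe_cosh n i ?g" .
      moreover have "R\<^sup>2 = (\<Sum>j<Suc m. (t j)\<^sup>2)" by (simp add: R2 r(1))
      ultimately show ?thesis by (intro exI[of _ R] conjI)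
    qed
  qed
qed simp

lemma goe_cosh_norm:
  "goe_cosh n i t = (\<integral>\<^sup>+X. ennreal (cosh (sqrt ((\<Sum>j<n. (t j)\<^sup>2) * eproj n i X 0 0))) \<partial>goe_law n)"
proof -
  have "1 \<le> n" using i by simp
  from goe_cosh_reduce[OF this order.refl, of t] obtain r where
    "r\<^sup>2 = (\<Sum>j<n. (t j)\<^sup>2) \<and> goe_cosh n i t = goe_cosh n i (\<lambda>k. if k = 0 then r else if k < n then 0 else t k)"
    by (rule exE)
  then have r: "r\<^sup>2 = (\<Sum>j<n. (t j)\<^sup>2)"
    "goe_cosh n i t = goe_cosh n i (\<lambda>k. if k = 0 then r else if k < n then 0 else t k)"
    by (rule conjunct1, rule conjunct2)
  have "qform n i (\<lambda>k. if k = 0 then r else if k < n then 0 else t k) X = r\<^sup>2 * eproj n i X 0 0" for X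
  proof -
    have "qform n i (\<lambda>k. if k = 0 then r else if k < n then 0 else t k) X =
       (\<Sum>k<n. \<Sum>l<n. if l = 0 then (if k = 0 then r\<^sup>2 * eproj n i X 0 0 else 0) else 0)"
      unfolding qform_def by (intro sum.cong refl) (auto simp: power2_eq_square)
    then show ?thesis using i by simp
  qed
  then show ?thesis by (subst r(2)) (simp only: goe_cosh_def r(1))
qed

lemma goe_gauss_Fubini:
  assumes "f \<in> borel_measurable (gauss {..<n} \<Otimes>\<^sub>M goe_law n)"
  shows "(\<integral>\<^sup>+X. \<integral>\<^sup>+g. f (g, X) \<partial>gauss {..<n} \<partial>goe_law n) = (\<integral>\<^sup>+g. \<integral>\<^sup>+X. f (g, X) \<partial>goe_law n \<partial>gauss {..<n})"
proof -
  interpret G: prob_space "gauss {..<n}" by (rule prob_space_gauss)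
  interpret L: prob_space "goe_law n" by (rule prob_space_goe_law)
  interpret P: pair_sigma_finite "gauss {..<n}" "goe_law n" ..
  show ?thesis by (rule P.Fubini[OF assms])
qed

lemma measurable_cosh_sqrt_qform:
  assumes "\<And>k. k < n \<Longrightarrow> (\<lambda>g. t g k) \<in> borel_measurable (gauss {..<n})"
  shows "(\<lambda>p. ennreal (cosh (sqrt (qform n i (t (fst p)) (snd p))))) \<in> borel_measurable (gauss {..<n} \<Otimes>\<^sub>M goe_law n)"
proof -
  have "(\<lambda>p. qform n i (t (fst p)) (snd p)) \<in> borel_measurable (gauss {..<n} \<Otimes>\<^sub>M goe_law n)"
  proof (rule measurable_qform[OF i])
    show "(\<lambda>p. t (fst p) k) \<in> borel_measurable (gauss {..<n} \<Otimes>\<^sub>M goe_law n)" if "k < n" for k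
      by (rule measurable_compose[OF measurable_fst assms[OF that]])
    show "snd \<in> borel_measurable (gauss {..<n} \<Otimes>\<^sub>M goe_law n)"
      using measurable_snd[of "gauss {..<n}" "goe_law n"]
      by (simp cong: measurable_cong_sets)
  qed
  moreover have "(\<lambda>x :: real. ennreal (cosh (sqrt x))) \<in> borel_measurable borel" by measurable
  ultimately show ?thesis by (rule measurable_compose)
qed

text \<open>Compare \<open>t\<close> with the Gaussian vector \<open>\<rho> * g\<close> whose mean squared length is \<open>|t|\<^sup>2\<close>. As \<open>goe_cosh\<close>
  depends on the length only, Jensen's inequality shows that averaging over \<open>g\<close> does not decrease
  it. After exchanging the integrals, the mean of \<open>cosh <\<rho> * g, z>\<close> over \<open>g\<close> is \<open>exp (\<rho>\<^sup>2 / 2)\<close> for every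
  unit vector \<open>z\<close>.\<close>

lemma goe_cosh_bound: "goe_cosh n i t \<le> ennreal (exp ((\<Sum>j<n. (t j)\<^sup>2) / (2 * n)))"
proof -
  interpret L: prob_space "goe_law n" by (rule prob_space_goe_law)
  define \<rho> where "\<rho> = sqrt ((\<Sum>j<n. (t j)\<^sup>2) / n)"
  have n: "n \<ge> 1" using i by simp
  have r: "\<rho> \<ge> 0" "\<rho>\<^sup>2 * n = (\<Sum>j<n. (t j)\<^sup>2)" using n by (auto simp: \<rho>_def sum_nonneg)
  have e0: "eproj n i X 0 0 \<ge> 0" for X by (simp add: eproj_def)
  have norm_g: "(\<Sum>j<n. (\<rho> * g j)\<^sup>2) = \<rho>\<^sup>2 * (\<Sum>j<n. (g j)\<^sup>2)" for g
    by (simp add: power_mult_distrib sum_distrib_left)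
  have mg: "(\<lambda>g. \<Sum>j<n. (g j)\<^sup>2) \<in> borel_measurable (gauss {..<n})" by measurable
  have me: "(\<lambda>X. eproj n i X 0 0) \<in> borel_measurable (goe_law n)"
    using measurable_eproj[OF i, of 0 0] i by (simp cong: measurable_cong_sets)
  have m1: "(\<lambda>p. ennreal (cosh (\<rho> * sqrt (eproj n i (snd p) 0 0) * sqrt (\<Sum>k<n. (fst p k)\<^sup>2))))
      \<in> borel_measurable (gauss {..<n} \<Otimes>\<^sub>M goe_law n)"
  proof -
    have a: "(\<lambda>p. eproj n i (snd p) 0 0) \<in> borel_measurable (gauss {..<n} \<Otimes>\<^sub>M goe_law n)"
      by (rule measurable_compose[OF measurable_snd me])
    have b: "(\<lambda>p. \<Sum>k<n. (fst p k)\<^sup>2) \<in> borel_measurable (gauss {..<n} \<Otimes>\<^sub>M goe_law n)"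
      by (rule measurable_compose[OF measurable_fst mg])
    show ?thesis using a b by measurable
  qed
  have "goe_cosh n i t = (\<integral>\<^sup>+X. ennreal (cosh (\<rho> * sqrt (eproj n i X 0 0) * sqrt (real n))) \<partial>goe_law n)"
    unfolding goe_cosh_norm r(2)[symmetric] using r(1)
    by (simp add: real_sqrt_mult mult_ac)
  also have "\<dots> \<le> (\<integral>\<^sup>+X. \<integral>\<^sup>+g. ennreal (cosh (\<rho> * sqrt (eproj n i X 0 0) * sqrt (\<Sum>k<n. (g k)\<^sup>2))) \<partial>gauss {..<n} \<partial>goe_law n)"
    using r(1) e0 n by (intro nn_integral_mono gauss_cosh_norm) auto
  also have "\<dots> = (\<integral>\<^sup>+g. \<integral>\<^sup>+X. ennreal (cosh (\<rho> * sqrt (eproj n i X 0 0) * sqrt (\<Sum>k<n. (g k)\<^sup>2))) \<partial>goe_law n \<partial>gauss {..<n})"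
    using goe_gauss_Fubini[OF m1] by simp
  also have "\<dots> = (\<integral>\<^sup>+g. goe_cosh n i (\<lambda>k. \<rho> * g k) \<partial>gauss {..<n})"
    unfolding goe_cosh_norm norm_g using r(1)
    by (simp add: real_sqrt_mult mult_ac)
  also have "\<dots> = (\<integral>\<^sup>+X. \<integral>\<^sup>+g. ennreal (cosh (sqrt (qform n i (\<lambda>k. \<rho> * g k) X))) \<partial>gauss {..<n} \<partial>goe_law n)"
  proof -
    have mm: "(\<lambda>g. \<rho> * g k) \<in> borel_measurable (gauss {..<n})" if "k < n" for k
    proof -
      have "k \<in> {..<n}" using that by simp
      then show ?thesis by measurable
    qed
    show ?thesis
      unfolding goe_cosh_def
      using goe_gauss_Fubini[OF measurable_cosh_sqrt_qform[of "\<lambda>g k. \<rho> * g k", OF mm]] by simp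
  qed
  also have "\<dots> = (\<integral>\<^sup>+X. ennreal (exp (\<rho>\<^sup>2 / 2)) \<partial>goe_law n)"
  proof (rule nn_integral_cong_AE, rule AE_mp[OF S], rule AE_I2, rule impI)
    fix X assume X: "X \<in> simple_spectrum n"
    have "(\<integral>\<^sup>+g. ennreal (cosh (sqrt (qform n i (\<lambda>k. \<rho> * g k) X))) \<partial>gauss {..<n}) =
        (\<integral>\<^sup>+g. ennreal (cosh (\<Sum>k<n. (\<rho> * evec n X i k) * g k)) \<partial>gauss {..<n})"
      by (simp add: qform_evec[OF X i] mult_ac)
    also have "\<dots> = ennreal (exp ((\<Sum>k<n. (\<rho> * evec n X i k)\<^sup>2) / 2))" by (rule gauss_cosh) simp
    also have "(\<Sum>k<n. (\<rho> * evec n X i k)\<^sup>2) = \<rho>\<^sup>2"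
      using orthonormal_norm[OF evec_orthn[OF X] i] by (simp add: power_mult_distrib sum_distrib_left[symmetric])
    finally show "(\<integral>\<^sup>+g. ennreal (cosh (sqrt (qform n i (\<lambda>k. \<rho> * g k) X))) \<partial>gauss {..<n}) = ennreal (exp (\<rho>\<^sup>2 / 2))" .
  qed
  also have "\<dots> = ennreal (exp (\<rho>\<^sup>2 / 2))" by (simp add: L.emeasure_space_1)
  also have "\<rho>\<^sup>2 / 2 = (\<Sum>j<n. (t j)\<^sup>2) / (2 * n)" using n by (simp add: r(2)[symmetric])
  finally show ?thesis .
qed

text \<open>The exponential of \<open>1/2 * \<Sum>j. (a j * y j)\<^sup>2\<close> is the mean of \<open>cosh (\<Sum>j. a j * y j * g j)\<close> over a
  standard Gaussian vector \<open>g\<close>. For fixed \<open>g\<close> the argument is linear in the eigenvector, so that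
  \<open>goe_cosh_bound\<close> applies to \<open>t = \<Sum>j. a j * g j * v j\<close>; what remains is a Gaussian integral.\<close>

lemma goe_mgf:
  fixes \<theta> :: real
  assumes v: "orthonormal n v" and c: "\<And>j. j < n \<Longrightarrow> 0 \<le> c j" "\<And>j. j < n \<Longrightarrow> \<theta> * c j < 1 / 2" and \<theta>: "0 \<le> \<theta>"
  shows "(\<integral>\<^sup>+X. ennreal (exp (\<theta> * n * (\<Sum>j<n. c j * qform n i (v j) X))) \<partial>goe_law n)
    \<le> ennreal (\<Prod>j<n. 1 / sqrt (1 - 2 * (\<theta> * c j)))"
proof -
  define a where "a j = sqrt (2 * \<theta> * n * c j)" for j
  have a2: "(a j)\<^sup>2 = 2 * \<theta> * n * c j" if "j < n" for j
    using c(1)[OF that] \<theta> by (simp add: a_def)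
  \<comment> \<open>linear in g: the vector whose inner product with the eigenvector is the argument of cosh\<close>
  define T where "T g k = (\<Sum>j<n. a j * g j * v j k)" for g :: "nat \<Rightarrow> real" and k
  have mT: "(\<lambda>g. T g k) \<in> borel_measurable (gauss {..<n})" for k
    unfolding T_def by measurable
  have "(\<integral>\<^sup>+X. ennreal (exp (\<theta> * n * (\<Sum>j<n. c j * qform n i (v j) X))) \<partial>goe_law n) =
      (\<integral>\<^sup>+X. \<integral>\<^sup>+g. ennreal (cosh (sqrt (qform n i (T g) X))) \<partial>gauss {..<n} \<partial>goe_law n)"
  proof (rule nn_integral_cong_AE, rule AE_mp[OF S], rule AE_I2, rule impI)
    fix X assume X: "X \<in> simple_spectrum n"
    define y where "y j = (\<Sum>k<n. v j k * evec n X i k)" for j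
    have "(\<Sum>k<n. T g k * evec n X i k) = (\<Sum>j<n. a j * y j * g j)" for g
    proof -
      have "(\<Sum>k<n. T g k * evec n X i k) = (\<Sum>k<n. \<Sum>j<n. a j * g j * v j k * evec n X i k)"
        unfolding T_def sum_distrib_right ..
      also have "\<dots> = (\<Sum>j<n. \<Sum>k<n. a j * g j * v j k * evec n X i k)" by (rule sum.swap)
      also have "\<dots> = (\<Sum>j<n. a j * y j * g j)"
        unfolding y_def by (intro sum.cong refl) (simp add: sum_distrib_left sum_distrib_right mult_ac)
      finally show ?thesis .
    qed
    then have "(\<integral>\<^sup>+g. ennreal (cosh (sqrt (qform n i (T g) X))) \<partial>gauss {..<n}) =
       (\<integral>\<^sup>+g. ennreal (cosh (\<Sum>j<n. (a j * y j) * g j)) \<partial>gauss {..<n})"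
      by (simp add: qform_evec[OF X i])
    also have "\<dots> = ennreal (exp ((\<Sum>j<n. (a j * y j)\<^sup>2) / 2))" by (rule gauss_cosh) simp
    also have "(\<Sum>j<n. (a j * y j)\<^sup>2) / 2 = \<theta> * n * (\<Sum>j<n. c j * qform n i (v j) X)"
      unfolding sum_distrib_left sum_divide_distrib
      by (intro sum.cong refl) (simp add: power_mult_distrib a2 qform_evec[OF X i] y_def)
    finally show "ennreal (exp (\<theta> * n * (\<Sum>j<n. c j * qform n i (v j) X))) =
      (\<integral>\<^sup>+g. ennreal (cosh (sqrt (qform n i (T g) X))) \<partial>gauss {..<n})" ..
  qed
  also have "\<dots> = (\<integral>\<^sup>+g. goe_cosh n i (T g) \<partial>gauss {..<n})"
    unfolding goe_cosh_def
    using goe_gauss_Fubini[OF measurable_cosh_sqrt_qform[of T, OF mT]] by simp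
  also have "\<dots> \<le> (\<integral>\<^sup>+g. ennreal (exp (\<Sum>j<n. (\<theta> * c j) * (g j)\<^sup>2)) \<partial>gauss {..<n})"
  proof (rule nn_integral_mono)
    fix g :: "nat \<Rightarrow> real"
    have "(\<Sum>k<n. (T g k)\<^sup>2) = (\<Sum>j<n. (\<Sum>k<n. T g k * v j k)\<^sup>2)"
      by (rule orthonormal_parseval[OF v, symmetric])
    also have "\<dots> = (\<Sum>j<n. (a j * g j)\<^sup>2)"
    proof (intro sum.cong refl)
      fix j assume j: "j \<in> {..<n}"
      have "(\<Sum>k<n. T g k * v j k) = (\<Sum>k<n. \<Sum>m<n. a m * g m * v m k * v j k)"
        unfolding T_def sum_distrib_right ..
      also have "\<dots> = (\<Sum>m<n. \<Sum>k<n. a m * g m * v m k * v j k)" by (rule sum.swap)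
      also have "\<dots> = (\<Sum>m<n. a m * g m * (\<Sum>k<n. v m k * v j k))"
        by (simp add: sum_distrib_left mult.assoc)
      also have "\<dots> = (\<Sum>m<n. if m = j then a m * g m else 0)"
        using v j by (intro sum.cong refl) (auto simp: orthonormal_def)
      finally have "(\<Sum>k<n. T g k * v j k) = a j * g j" using j by simp
      then show "(\<Sum>k<n. T g k * v j k)\<^sup>2 = (a j * g j)\<^sup>2" by simp
    qed
    finally have "(\<Sum>k<n. (T g k)\<^sup>2) / (2 * n) = (\<Sum>j<n. (a j * g j)\<^sup>2 / (2 * n))"
      by (simp only: sum_divide_distrib)
    also have "\<dots> = (\<Sum>j<n. (\<theta> * c j) * (g j)\<^sup>2)"
      using i by (intro sum.cong refl) (simp add: power_mult_distrib a2)
    finally have e: "(\<Sum>k<n. (T g k)\<^sup>2) / (2 * n) = (\<Sum>j<n. (\<theta> * c j) * (g j)\<^sup>2)" .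
    show "goe_cosh n i (T g) \<le> ennreal (exp (\<Sum>j<n. (\<theta> * c j) * (g j)\<^sup>2))"
      using goe_cosh_bound[of "T g"] by (simp only: e)
  qed
  also have "\<dots> = ennreal (\<Prod>j<n. 1 / sqrt (1 - 2 * (\<theta> * c j)))"
    by (rule gauss_exp_squares) (use c(2) in auto)
  finally show ?thesis .
qed

lemma inverse_sqrt_le_exp:
  fixes x :: real
  assumes "0 \<le> x" "x \<le> 1 / 2"
  shows "1 / sqrt (1 - x) \<le> exp ((x + 2 * x\<^sup>2) / 2)"
proof -
  have "- x - 2 * x\<^sup>2 \<le> ln (1 - x)" by (rule ln_one_minus_pos_lower_bound[OF assms])
  then have "exp (- (x + 2 * x\<^sup>2) / 2) \<le> exp (ln (1 - x) / 2)" by simp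
  also have "\<dots> = sqrt (1 - x)"
    using assms by (simp add: ln_sqrt[symmetric])
  finally have "exp (- (x + 2 * x\<^sup>2) / 2) \<le> sqrt (1 - x)" .
  moreover have "sqrt (1 - x) > 0" using assms by simp
  moreover have "exp ((x + 2 * x\<^sup>2) / 2) * exp (- (x + 2 * x\<^sup>2) / 2) = 1"
    by (simp add: exp_add[symmetric] add_divide_distrib diff_divide_distrib)
  ultimately show ?thesis
    by (simp add: divide_le_eq) (metis mult_left_mono exp_ge_zero)
qed

text \<open>The exponential Markov inequality. The weights \<open>\<beta> j\<close> are shifted by \<open>b\<close> to become nonnegative; the
  squared inner products sum to one, so the shift moves the threshold by \<open>b\<close>. As the \<open>\<beta> j\<close> sum to
  zero, this is compensated by the first-order term in \<open>\<theta>\<close> of the generating function.\<close>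

lemma goe_upper_tail:
  fixes \<theta> \<epsilon> b :: real
  assumes v: "orthonormal n v" and b: "0 < b" "\<And>j. j < n \<Longrightarrow> \<bar>\<beta> j\<bar> \<le> b" and s: "(\<Sum>j<n. \<beta> j) = 0"
    and \<theta>: "0 \<le> \<theta>" "8 * \<theta> * b \<le> 1"
  shows "emeasure (goe_law n) {X \<in> simple_spectrum n. (\<Sum>j<n. \<beta> j * qform n i (v j) X) \<ge> \<epsilon>}
     \<le> ennreal (exp (- (\<theta> * \<epsilon> - 16 * \<theta>\<^sup>2 * b\<^sup>2) * n))"
proof -
  let ?y = "\<lambda>j X. qform n i (v j) X"
  let ?B = "{X \<in> simple_spectrum n. (\<Sum>j<n. \<beta> j * ?y j X) \<ge> \<epsilon>}"
  define c where "c j = \<beta> j + b" for j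
  have c: "0 \<le> c j" "c j \<le> 2 * b" if "j < n" for j using b(2)[OF that] by (auto simp: c_def)
  have \<theta>c: "\<theta> * c j \<le> 1 / 4" if "j < n" for j
    using mult_left_mono[OF c(2)[OF that] \<theta>(1)] \<theta>(2) by simp
  have my: "(\<lambda>X. ?y j X) \<in> borel_measurable (goe_law n)" for j
    by (rule measurable_qform[OF i, of "\<lambda>_. v j" _ "\<lambda>X. X"])
       (rule borel_measurable_const, rule measurable_ident_sets, rule sets_goe_law)
  note [measurable] = my
  have [measurable]: "simple_spectrum n \<in> sets (goe_law n)" by simp
  have Bm: "?B \<in> sets (goe_law n)"
  proof -
    have "?B = simple_spectrum n \<inter> {X \<in> space (goe_law n). (\<Sum>j<n. \<beta> j * ?y j X) \<ge> \<epsilon>}"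
      by (auto simp: goe_law_def)
    also have "\<dots> \<in> sets (goe_law n)" by measurable
    finally show ?thesis .
  qed
  have pw: "indicator ?B X \<le> ennreal (exp (- (\<theta> * n * (b + \<epsilon>)))) * ennreal (exp (\<theta> * n * (\<Sum>j<n. c j * ?y j X)))" for X
  proof (cases "X \<in> ?B")
    case True
    then have X: "X \<in> simple_spectrum n" by simp
    have "(\<Sum>j<n. ?y j X) = (\<Sum>j<n. (\<Sum>k<n. evec n X i k * v j k)\<^sup>2)"
      by (simp add: qform_evec[OF X i] mult.commute)
    also have "\<dots> = 1" using orthonormal_parseval[OF v] orthonormal_norm[OF evec_orthn[OF X] i] by simp
    finally have y1: "(\<Sum>j<n. ?y j X) = 1" .
    have "(\<Sum>j<n. c j * ?y j X) = (\<Sum>j<n. \<beta> j * ?y j X) + b * (\<Sum>j<n. ?y j X)"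
      by (simp add: c_def algebra_simps sum.distrib sum_distrib_left)
    then have "b + \<epsilon> \<le> (\<Sum>j<n. c j * ?y j X)" using True y1 by simp
    then have "\<theta> * n * (b + \<epsilon>) \<le> \<theta> * n * (\<Sum>j<n. c j * ?y j X)"
      using \<theta>(1) by (intro mult_left_mono) auto
    then have "1 \<le> exp (- (\<theta> * n * (b + \<epsilon>))) * exp (\<theta> * n * (\<Sum>j<n. c j * ?y j X))"
      by (simp add: exp_add[symmetric])
    then show ?thesis using True by (simp add: ennreal_mult'[symmetric] ennreal_1[symmetric] del: ennreal_1)
  qed simp
  have "emeasure (goe_law n) ?B = (\<integral>\<^sup>+X. indicator ?B X \<partial>goe_law n)" using Bm by simp
  also have "\<dots> \<le> (\<integral>\<^sup>+X. ennreal (exp (- (\<theta> * n * (b + \<epsilon>)))) * ennreal (exp (\<theta> * n * (\<Sum>j<n. c j * ?y j X))) \<partial>goe_law n)"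
    by (rule nn_integral_mono[OF pw])
  also have "\<dots> = ennreal (exp (- (\<theta> * n * (b + \<epsilon>)))) * (\<integral>\<^sup>+X. ennreal (exp (\<theta> * n * (\<Sum>j<n. c j * ?y j X))) \<partial>goe_law n)"
    by (rule nn_integral_cmult) measurable
  also have "\<dots> \<le> ennreal (exp (- (\<theta> * n * (b + \<epsilon>)))) * ennreal (\<Prod>j<n. 1 / sqrt (1 - 2 * (\<theta> * c j)))"
  proof (rule mult_left_mono[OF goe_mgf[OF v c(1) _ \<theta>(1)]])
    show "\<theta> * c j < 1 / 2" if "j < n" for j using \<theta>c[OF that] by linarith
  qed simp_all
  also have "\<dots> \<le> ennreal (exp (- (\<theta> * n * (b + \<epsilon>)))) * ennreal (exp (\<theta> * n * b + 16 * \<theta>\<^sup>2 * b\<^sup>2 * n))"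
  proof (intro mult_left_mono ennreal_leI)
    have "(\<Prod>j<n. 1 / sqrt (1 - 2 * (\<theta> * c j))) \<le> (\<Prod>j<n. exp (\<theta> * c j + 16 * \<theta>\<^sup>2 * b\<^sup>2))"
    proof (rule prod_mono, intro conjI)
      fix j assume "j \<in> {..<n}"
      then have j: "j < n" by simp
      show "0 \<le> 1 / sqrt (1 - 2 * (\<theta> * c j))" using \<theta>c[OF j] by simp
      have "1 / sqrt (1 - 2 * (\<theta> * c j)) \<le> exp ((2 * (\<theta> * c j) + 2 * (2 * (\<theta> * c j))\<^sup>2) / 2)"
        using \<theta>c[OF j] c(1)[OF j] \<theta>(1) by (intro inverse_sqrt_le_exp) auto
      also have "(\<theta> * c j)\<^sup>2 \<le> (\<theta> * (2 * b))\<^sup>2"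
        using c[OF j] \<theta>(1) by (intro power_mono mult_left_mono) auto
      then have "(2 * (\<theta> * c j) + 2 * (2 * (\<theta> * c j))\<^sup>2) / 2 \<le> \<theta> * c j + 16 * \<theta>\<^sup>2 * b\<^sup>2"
        by (simp add: power_mult_distrib)
      finally show "1 / sqrt (1 - 2 * (\<theta> * c j)) \<le> exp (\<theta> * c j + 16 * \<theta>\<^sup>2 * b\<^sup>2)" by simp
    qed
    also have "\<dots> = exp (\<theta> * n * b + 16 * \<theta>\<^sup>2 * b\<^sup>2 * n)"
    proof -
      have "(\<Sum>j<n. \<theta> * c j + 16 * \<theta>\<^sup>2 * b\<^sup>2) = \<theta> * (\<Sum>j<n. c j) + 16 * \<theta>\<^sup>2 * b\<^sup>2 * n"
        by (simp add: sum.distrib sum_distrib_left)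
      also have "(\<Sum>j<n. c j) = n * b" by (simp add: c_def sum.distrib s)
      finally show ?thesis by (simp add: exp_sum[symmetric] mult.assoc)
    qed
    finally show "(\<Prod>j<n. 1 / sqrt (1 - 2 * (\<theta> * c j))) \<le> exp (\<theta> * n * b + 16 * \<theta>\<^sup>2 * b\<^sup>2 * n)" .
  qed simp
  also have "\<dots> = ennreal (exp (- (\<theta> * \<epsilon> - 16 * \<theta>\<^sup>2 * b\<^sup>2) * n))"
    by (simp add: ennreal_mult'[symmetric] exp_add[symmetric] algebra_simps)
  finally show ?thesis .
qed

end

section \<open>Spectral calculus of symmetric matrices\<close>

lemma ordered_eigenbasis_scaled:
  fixes w :: "nat \<Rightarrow> real vec"
  assumes B: "B \<in> carrier_mat n n" and w: "ordered_eigenbasis B lam w"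
    and X: "\<And>k l. k < n \<Longrightarrow> l < n \<Longrightarrow> X (k, l) = a * B $$ (k, l)" and a: "0 \<le> a"
  shows "eigenbasis n X (\<lambda>i. a * lam i) (\<lambda>i k. w i $ k)"
proof -
  have d: "dim_row B = n" "dim_col B = n" using B by auto
  have wc: "w i \<in> carrier_vec n" if "i < n" for i
    using w that unfolding ordered_eigenbasis_def d by blast
  have ev: "(\<Sum>l<n. B $$ (k, l) * w i $ l) = lam i * w i $ k" if "i < n" "k < n" for i k
  proof -
    have "(B *\<^sub>v w i) $ k = (lam i \<cdot>\<^sub>v w i) $ k"
      using w that unfolding ordered_eigenbasis_def d by simp
    then show ?thesis using that wc[of i] d by (simp add: scalar_prod_def lessThan_atLeast0)
  qed
  show ?thesis
    unfolding eigenbasis_def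
  proof (intro conjI allI impI)
    fix i k assume ik: "i < n" "k < n"
    have "(\<Sum>l<n. X (k, l) * w i $ l) = a * (\<Sum>l<n. B $$ (k, l) * w i $ l)"
      unfolding sum_distrib_left using ik by (intro sum.cong refl) (simp add: X mult.assoc)
    then show "(\<Sum>l<n. X (k, l) * w i $ l) = a * lam i * w i $ k" using ev[OF ik] by simp
  next
    show "orthonormal n (\<lambda>i k. w i $ k)"
      unfolding orthonormal_def
    proof (intro allI impI)
      fix i j assume ij: "i < n" "j < n"
      have "scalar_prod (w i) (w j) = (if i = j then 1 else 0)"
        using w ij unfolding ordered_eigenbasis_def d by blast
      then show "(\<Sum>k<n. w i $ k * w j $ k) = (if i = j then 1 else 0)"
        using wc[OF ij(2)] by (simp add: scalar_prod_def lessThan_atLeast0)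
    qed
  next
    fix i j :: nat assume "i \<le> j" "j < n"
    then have "lam j \<le> lam i" using w unfolding ordered_eigenbasis_def d by blast
    then show "a * lam j \<le> a * lam i" using a by (rule mult_left_mono)
  qed
qed

definition emat :: "nat \<Rightarrow> (nat \<Rightarrow> nat \<Rightarrow> real) \<Rightarrow> real mat" where
  "emat n v = mat n n (\<lambda>(k, i). v i k)"

lemma emat_orth:
  assumes "orthonormal n v"
  shows "emat n v * transpose_mat (emat n v) = 1\<^sub>m n" "transpose_mat (emat n v) * emat n v = 1\<^sub>m n"
proof -
  show "emat n v * transpose_mat (emat n v) = 1\<^sub>m n"
    using orthonormal_complete[OF assms] by (intro eq_matI) (auto simp: emat_def scalar_prod_def lessThan_atLeast0)
  show "transpose_mat (emat n v) * emat n v = 1\<^sub>m n"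
    using assms by (intro eq_matI) (auto simp: emat_def orthonormal_def scalar_prod_def lessThan_atLeast0)
qed

lemma conj_diag_entry:
  fixes Q :: "real mat"
  assumes Q: "Q \<in> carrier_mat n n" and kl: "k < n" "l < n"
  shows "(Q * mat_diag n d * transpose_mat Q) $$ (k, l) = (\<Sum>i<n. d i * Q $$ (k, i) * Q $$ (l, i))"
proof -
  have "(Q * mat_diag n d) $$ (k, i) = Q $$ (k, i) * d i" if "i < n" for i
    using Q kl that by (simp add: mat_diag_mult_right)
  then show ?thesis
    using Q kl by (auto simp: scalar_prod_def lessThan_atLeast0 mat_diag_mult_right mult_ac intro!: sum.cong)
qed

lemma eigenbasis_decomp:
  assumes B: "B \<in> carrier_mat n n" and E: "eigenbasis n (zext n B) mu v"
  shows "B = emat n v * mat_diag n mu * transpose_mat (emat n v)"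
proof (intro eq_matI)
  fix k l assume "k < dim_row (emat n v * mat_diag n mu * transpose_mat (emat n v))"
    "l < dim_col (emat n v * mat_diag n mu * transpose_mat (emat n v))"
  then have kl: "k < n" "l < n" by (auto simp: emat_def)
  have "B $$ (k, l) = (\<Sum>i<n. mu i * v i k * v i l)"
    using eigenbasis_repr[OF E kl] kl by (simp add: zext_def)
  also have "\<dots> = (emat n v * mat_diag n mu * transpose_mat (emat n v)) $$ (k, l)"
    using kl by (subst conj_diag_entry) (auto simp: emat_def)
  finally show "B $$ (k, l) = (emat n v * mat_diag n mu * transpose_mat (emat n v)) $$ (k, l)" .
qed (use B in \<open>auto simp: emat_def\<close>)

text \<open>If two orthogonal matrices diagonalise \<open>B\<close>, with eigenvalues \<open>lam\<close> and \<open>mu\<close>, then the entry \<open>R i j\<close>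
  of the transition matrix vanishes unless \<open>lam i = mu j\<close>. Hence both give the same value of \<open>f (B)\<close>
  and the definite description in \<open>mat_fun\<close> is meaningful.\<close>

lemma mat_fun_eigenbasis:
  assumes B: "B \<in> carrier_mat n n" and E: "eigenbasis n (zext n B) mu v"
  shows "mat_fun f B = emat n v * mat_diag n (\<lambda>i. f (mu i)) * transpose_mat (emat n v)"
proof -
  have d: "dim_row B = n" using B by auto
  have o: "orthonormal n v" using E by (simp add: eigenbasis_def)
  have Vc: "emat n v \<in> carrier_mat n n" by (simp add: emat_def)
  show ?thesis
    unfolding mat_fun_def d
  proof (rule the_equality, goal_cases)
    case 1
    show ?case
      by (intro exI[of _ "emat n v"] exI[of _ mu] conjI Vc emat_orth(1)[OF o] eigenbasis_decomp[OF B E] refl)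
  next
    case (2 C)
    then obtain Q lam where Q: "Q \<in> carrier_mat n n" "Q * transpose_mat Q = 1\<^sub>m n"
      "B = Q * mat_diag n lam * transpose_mat Q" "C = Q * mat_diag n (\<lambda>i. f (lam i)) * transpose_mat Q" by blast
    have Q': "transpose_mat Q * Q = 1\<^sub>m n"
      by (rule mat_mult_left_right_inverse[OF Q(1) _ Q(2)]) (use Q(1) in simp)
    define V where "V = emat n v"
    have V: "V \<in> carrier_mat n n" "V * transpose_mat V = 1\<^sub>m n" "transpose_mat V * V = 1\<^sub>m n"
      using emat_orth[OF o] Vc by (simp_all add: V_def)
    define R where "R i j = (\<Sum>k<n. Q $$ (k, i) * v j k)" for i j
    have qo: "(\<Sum>k<n. Q $$ (k, i) * Q $$ (k, j)) = (if i = j then 1 else 0)" if "i < n" "j < n" for i j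
    proof -
      have "(transpose_mat Q * Q) $$ (i, j) = (1\<^sub>m n :: real mat) $$ (i, j)" by (simp only: Q')
      then show ?thesis using that Q(1) by (auto simp: scalar_prod_def lessThan_atLeast0)
    qed
    have oq: "orthonormal n (\<lambda>i k. Q $$ (k, i))" using qo by (simp add: orthonormal_def)
    have Brep: "zext n B (k, l) = (\<Sum>i<n. lam i * Q $$ (k, i) * Q $$ (l, i))" if "k < n" "l < n" for k l
      using that conj_diag_entry[OF Q(1) that, of lam] by (simp add: zext_def Q(3))
    have BQ: "(\<Sum>k<n. zext n B (l, k) * Q $$ (k, i)) = lam i * Q $$ (l, i)" if "i < n" "l < n" for i l
    proof -
      have "(\<Sum>k<n. zext n B (l, k) * Q $$ (k, i)) = (\<Sum>k<n. \<Sum>m<n. lam m * Q $$ (l, m) * Q $$ (k, m) * Q $$ (k, i))"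
        using that by (simp add: Brep sum_distrib_right)
      also have "\<dots> = (\<Sum>m<n. \<Sum>k<n. lam m * Q $$ (l, m) * Q $$ (k, m) * Q $$ (k, i))" by (rule sum.swap)
      also have "\<dots> = (\<Sum>m<n. lam m * Q $$ (l, m) * (\<Sum>k<n. Q $$ (k, m) * Q $$ (k, i)))"
        by (simp add: sum_distrib_left mult.assoc)
      also have "\<dots> = (\<Sum>m<n. if m = i then lam i * Q $$ (l, i) else 0)"
        using that by (intro sum.cong refl) (simp add: qo)
      also have "\<dots> = lam i * Q $$ (l, i)" using that by simp
      finally show ?thesis .
    qed
    have R: "lam i * R i j = mu j * R i j" if "i < n" "j < n" for i j
    proof -
      have "lam i * R i j = (\<Sum>l<n. (\<Sum>k<n. zext n B (l, k) * Q $$ (k, i)) * v j l)"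
        unfolding R_def sum_distrib_left using that by (intro sum.cong refl) (simp add: BQ)
      also have "\<dots> = (\<Sum>k<n. \<Sum>l<n. zext n B (l, k) * Q $$ (k, i) * v j l)"
        unfolding sum_distrib_right by (rule sum.swap)
      also have "\<dots> = (\<Sum>k<n. Q $$ (k, i) * (\<Sum>l<n. zext n B (k, l) * v j l))"
        unfolding sum_distrib_left by (intro sum.cong refl) (simp add: eigenbasis_sym[OF E])
      also have "\<dots> = (\<Sum>k<n. Q $$ (k, i) * (mu j * v j k))"
        using E that by (intro sum.cong refl) (simp add: eigenbasis_def)
      finally show ?thesis by (simp add: R_def sum_distrib_left mult_ac)
    qed
    have fR: "f (lam i) * R i j = f (mu j) * R i j" if "i < n" "j < n" for i j
      using R[OF that] by auto
    show ?case
      unfolding Q(4)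
    proof (intro eq_matI)
      fix k l assume "k < dim_row (emat n v * mat_diag n (\<lambda>i. f (mu i)) * transpose_mat (emat n v))"
        "l < dim_col (emat n v * mat_diag n (\<lambda>i. f (mu i)) * transpose_mat (emat n v))"
      then have kl: "k < n" "l < n" by (auto simp: emat_def)
      have qk: "Q $$ (k, i) = (\<Sum>j<n. R i j * v j k)" for i
        unfolding R_def by (rule orthonormal_expand[OF o kl(1), of "\<lambda>k. Q $$ (k, i)"])
      have vl: "(\<Sum>i<n. R i j * Q $$ (l, i)) = v j l" for j
        using orthonormal_expand[OF oq kl(2), of "v j"] by (simp add: R_def mult.commute)
      have "(Q * mat_diag n (\<lambda>i. f (lam i)) * transpose_mat Q) $$ (k, l) =
          (\<Sum>i<n. f (lam i) * Q $$ (k, i) * Q $$ (l, i))" by (rule conj_diag_entry[OF Q(1) kl])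
      also have "\<dots> = (\<Sum>i<n. \<Sum>j<n. f (lam i) * R i j * (v j k * Q $$ (l, i)))"
        by (subst qk) (simp add: sum_distrib_left sum_distrib_right mult.assoc)
      also have "\<dots> = (\<Sum>i<n. \<Sum>j<n. f (mu j) * R i j * (v j k * Q $$ (l, i)))"
        by (intro sum.cong refl) (simp add: fR)
      also have "\<dots> = (\<Sum>j<n. f (mu j) * v j k * (\<Sum>i<n. R i j * Q $$ (l, i)))"
        by (subst sum.swap) (simp add: sum_distrib_left mult_ac)
      also have "\<dots> = (emat n v * mat_diag n (\<lambda>i. f (mu i)) * transpose_mat (emat n v)) $$ (k, l)"
        unfolding vl using kl by (subst conj_diag_entry) (auto simp: emat_def)
      finally show "(Q * mat_diag n (\<lambda>i. f (lam i)) * transpose_mat Q) $$ (k, l) =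
          (emat n v * mat_diag n (\<lambda>i. f (mu i)) * transpose_mat (emat n v)) $$ (k, l)" .
    qed (use Q(1) in \<open>auto simp: emat_def\<close>)
  qed
qed

lemma quadratic_form_entries:
  fixes w :: "'a :: comm_ring vec"
  assumes "F \<in> carrier_mat n n" "w \<in> carrier_vec n"
  shows "scalar_prod w (F *\<^sub>v w) = (\<Sum>k<n. w $ k * (\<Sum>l<n. F $$ (k, l) * w $ l))"
  using assms by (auto simp: scalar_prod_def lessThan_atLeast0 intro!: sum.cong)

lemma mat_fun_quadratic:
  fixes w :: "real vec"
  assumes B: "B \<in> carrier_mat n n" and E: "eigenbasis n (zext n B) mu v" and w: "w \<in> carrier_vec n"
  shows "scalar_prod w (mat_fun f B *\<^sub>v w) = (\<Sum>j<n. f (mu j) * (\<Sum>k<n. w $ k * v j k)\<^sup>2)"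
proof -
  let ?F = "emat n v * mat_diag n (\<lambda>i. f (mu i)) * transpose_mat (emat n v)"
  have Fc: "?F \<in> carrier_mat n n" by (intro carrier_matI) (auto simp: emat_def)
  have F: "?F $$ (k, l) = (\<Sum>j<n. f (mu j) * v j k * v j l)" if "k < n" "l < n" for k l
    using that by (subst conj_diag_entry) (auto simp: emat_def)
  have "scalar_prod w (?F *\<^sub>v w) = (\<Sum>k<n. w $ k * (\<Sum>l<n. ?F $$ (k, l) * w $ l))"
    by (rule quadratic_form_entries[OF Fc w])
  also have "\<dots> = (\<Sum>k<n. \<Sum>l<n. \<Sum>j<n. f (mu j) * (w $ k * v j k) * (w $ l * v j l))"
  proof (intro sum.cong refl)
    fix k assume "k \<in> {..<n}"
    then have "w $ k * (\<Sum>l<n. ?F $$ (k, l) * w $ l) = w $ k * (\<Sum>l<n. (\<Sum>j<n. f (mu j) * v j k * v j l) * w $ l)"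
      using F by (intro arg_cong2[where f = "(*)"] sum.cong refl) simp
    also have "\<dots> = (\<Sum>l<n. \<Sum>j<n. f (mu j) * (w $ k * v j k) * (w $ l * v j l))"
      by (simp add: sum_distrib_left sum_distrib_right mult_ac)
    finally show "w $ k * (\<Sum>l<n. ?F $$ (k, l) * w $ l) = (\<Sum>l<n. \<Sum>j<n. f (mu j) * (w $ k * v j k) * (w $ l * v j l))" .
  qed
  also have "\<dots> = (\<Sum>k<n. \<Sum>j<n. \<Sum>l<n. f (mu j) * (w $ k * v j k) * (w $ l * v j l))"
    by (intro sum.cong refl sum.swap)
  also have "\<dots> = (\<Sum>j<n. \<Sum>k<n. \<Sum>l<n. f (mu j) * (w $ k * v j k) * (w $ l * v j l))"
    by (rule sum.swap)
  also have "\<dots> = (\<Sum>j<n. f (mu j) * (\<Sum>k<n. w $ k * v j k)\<^sup>2)"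
    unfolding power2_eq_square sum_product by (simp add: sum_distrib_left mult.assoc)
  finally show ?thesis by (simp only: mat_fun_eigenbasis[OF B E])
qed

lemma proots_eigenbasis:
  assumes B: "B \<in> carrier_mat n n" and E: "eigenbasis n (zext n B) mu v"
  shows "proots (char_poly B) = image_mset mu (mset_set {..<n})"
proof -
  have o: "orthonormal n v" using E by (simp add: eigenbasis_def)
  let ?V = "emat n v" and ?D = "mat_diag n mu"
  have Vc: "?V \<in> carrier_mat n n" by (simp add: emat_def)
  have "similar_mat_wit B ?D ?V (transpose_mat ?V)"
    unfolding similar_mat_wit_def Let_def
    using B Vc emat_orth[OF o] eigenbasis_decomp[OF B E] by auto
  then have "similar_mat B ?D" unfolding similar_mat_def by blast
  then have "char_poly B = char_poly ?D" by (rule char_poly_similar)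
  also have "\<dots> = (\<Prod>a\<leftarrow>diag_mat ?D. [:- a, 1:])"
    by (rule char_poly_upper_triangular[of _ n]) (auto simp: upper_triangular_def mat_diag_def)
  also have "diag_mat ?D = map mu [0..<n]" by (auto simp: diag_mat_def mat_diag_def)
  also have "(\<Prod>a\<leftarrow>map mu [0..<n]. [:- a, 1:]) = (\<Prod>i<n. [:- mu i, 1:])"
    using prod.distinct_set_conv_list[of "[0..<n]" "\<lambda>i. [:- mu i, 1:]"]
    by (simp add: o_def lessThan_atLeast0)
  finally have "proots (char_poly B) = (\<Sum>i<n. proots [:- mu i, 1:])"
    by (simp only:) (rule proots_prod, simp)
  also have "\<dots> = (\<Sum>i<n. {#mu i#})" by simp
  also have "\<dots> = image_mset mu (mset_set {..<n})"
    by (induction n) (simp_all add: lessThan_Suc)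
  finally show ?thesis .
qed

lemma eigenbasis_eigenvalue:
  assumes B: "B \<in> carrier_mat n n" and E: "eigenbasis n (zext n B) mu v" and j: "j < n"
  shows "eigenvalue B (mu j)"
proof -
  have "mu j \<in># proots (char_poly B)" unfolding proots_eigenbasis[OF B E] using j by auto
  moreover have "char_poly B \<noteq> 0" using degree_monic_char_poly[OF B] by auto
  ultimately have "poly (char_poly B) (mu j) = 0" by simp
  then show ?thesis using eigenvalue_root_char_poly[OF B] by simp
qed

lemma integral_esd:
  assumes B: "B \<in> carrier_mat n n" and E: "eigenbasis n (zext n B) mu v" and n: "n \<ge> 1" and f: "f \<in> borel_measurable borel"
  shows "(LINT x|esd B. f x) = (\<Sum>j<n. f (mu j)) / n"
proof -
  let ?M = "image_mset mu (mset_set {..<n})"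
  have I: "{..<n} \<noteq> {}" "finite {..<n}" using n by (auto simp: lessThan_empty_iff)
  have ne: "?M \<noteq> {#}" using I by (simp add: mset_set_empty_iff)
  have "(LINT x|esd B. f x) = measure_pmf.expectation (pmf_of_multiset ?M) f"
    unfolding esd_def proots_eigenbasis[OF B E] using f by (subst integral_distr) auto
  also have "pmf_of_multiset ?M = map_pmf mu (pmf_of_set {..<n})"
    by (rule map_pmf_of_set[OF I(2,1), symmetric])
  also have "measure_pmf.expectation (map_pmf mu (pmf_of_set {..<n})) f = (\<Sum>j<n. f (mu j)) / n"
    by (subst integral_map_pmf, subst integral_pmf_of_set[OF I]) simp
  finally show ?thesis .
qed

lemma real_distribution_esd: "real_distribution (esd B)"
  unfolding esd_def real_distribution_def real_distribution_axioms_def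
  by (auto intro!: prob_space.prob_space_distr prob_space_measure_pmf)

section \<open>Weak and strong noise limits of the perturbed eigenbases\<close>

lemma perturbed_entry:
  assumes "A \<in> carrier_mat n n" "Z \<in> carrier_mat n n" "k < n" "l < n"
  shows "perturbed \<sigma> n A Z $$ (k, l) = A $$ (k, l) + \<sigma> / sqrt n * Z $$ (k, l)"
  using assms by (simp add: perturbed_def)

lemma perturbed_carrier:
  assumes "A \<in> carrier_mat n n" "Z \<in> carrier_mat n n"
  shows "perturbed \<sigma> n A Z \<in> carrier_mat n n"
  using assms by (simp add: perturbed_def)

text \<open>Letting the noise tend to zero gives an eigenbasis of \<open>A\<close> as a limit of the given ones.\<close>

lemma unperturbed_eigenbasis:
  fixes w :: "real \<Rightarrow> nat \<Rightarrow> real vec"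
  assumes A: "A \<in> carrier_mat n n" and Z: "Z \<in> carrier_mat n n"
    and w: "\<And>\<sigma>. 0 < \<sigma> \<Longrightarrow> ordered_eigenbasis (perturbed \<sigma> n A Z) (lam \<sigma>) (w \<sigma>)"
  shows "\<exists>mu v. eigenbasis n (zext n A) mu v"
proof -
  define s where "s p = 1 / real (Suc p)" for p
  have s: "0 < s p" for p by (simp add: s_def)
  have E: "eigenbasis n (zext n (perturbed (s p) n A Z)) (\<lambda>i. 1 * lam (s p) i) (\<lambda>i k. w (s p) i $ k)" for p
    by (rule ordered_eigenbasis_scaled[OF perturbed_carrier[OF A Z] w[OF s]]) (auto simp: zext_def)
  have X: "(\<lambda>p. zext n (perturbed (s p) n A Z) (k, l)) \<longlonglongrightarrow> zext n A (k, l)" if kl: "k < n" "l < n" for k l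
  proof -
    have "s \<longlonglongrightarrow> 0" unfolding s_def by real_asymp
    then have "(\<lambda>p. A $$ (k, l) + s p / sqrt n * Z $$ (k, l)) \<longlonglongrightarrow> A $$ (k, l) + 0 / sqrt n * Z $$ (k, l)"
      using kl by (intro tendsto_intros) auto
    then show ?thesis using kl by (simp add: zext_def perturbed_entry[OF A Z])
  qed
  show ?thesis by (rule eigenbasis_limit[OF E X]) (assumption | intro exI)+
qed

text \<open>Scaling by \<open>sqrt n / \<sigma>\<close> keeps the eigenvectors and brings the matrix to a form which converges to
  the noise as \<open>\<sigma>\<close> grows.\<close>

lemma rescaled_eigenbasis:
  fixes w :: "nat \<Rightarrow> real vec"
  assumes A: "A \<in> carrier_mat n n" and Z: "Z \<in> carrier_mat n n"
    and w: "ordered_eigenbasis (perturbed \<sigma> n A Z) lam w" and \<sigma>: "0 < \<sigma>"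
  shows "eigenbasis n (\<lambda>p. sqrt n / \<sigma> * zext n A p + zext n Z p) (\<lambda>i. sqrt n / \<sigma> * lam i) (\<lambda>i k. w i $ k)"
proof (rule ordered_eigenbasis_scaled[OF perturbed_carrier[OF A Z] w])
  fix k l assume kl: "k < n" "l < n"
  then have "0 < sqrt (real n)" by simp
  then show "sqrt n / \<sigma> * zext n A (k, l) + zext n Z (k, l) = sqrt n / \<sigma> * perturbed \<sigma> n A Z $$ (k, l)"
    using kl \<sigma> by (simp add: perturbed_entry[OF A Z] zext_def distrib_left)
qed (use \<sigma> in simp)

lemma rescaled_tendsto:
  assumes s: "filterlim s at_top sequentially"
  shows "(\<lambda>p. sqrt n / s p * a + z) \<longlonglongrightarrow> (z :: real)"
proof -
  have "(\<lambda>p. sqrt n / s p) \<longlonglongrightarrow> 0"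
    by (rule real_tendsto_divide_at_top[OF tendsto_const s])
  then have "(\<lambda>p. sqrt n / s p * a + z) \<longlonglongrightarrow> 0 * a + z"
    by (intro tendsto_add tendsto_mult tendsto_const)
  then show ?thesis by simp
qed

lemma noise_eigenbasis:
  fixes w :: "real \<Rightarrow> nat \<Rightarrow> real vec"
  assumes A: "A \<in> carrier_mat n n" and Z: "Z \<in> carrier_mat n n"
    and w: "\<And>\<sigma>. 0 < \<sigma> \<Longrightarrow> ordered_eigenbasis (perturbed \<sigma> n A Z) (lam \<sigma>) (w \<sigma>)"
  shows "\<exists>mu v. eigenbasis n (zext n Z) mu v"
proof -
  define s where "s p = real (Suc p)" for p
  have s: "0 < s p" for p by (simp add: s_def)
  have fl: "filterlim s at_top sequentially" unfolding s_def by real_asymp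
  have E: "eigenbasis n (\<lambda>q. sqrt n / s p * zext n A q + zext n Z q) (\<lambda>i. sqrt n / s p * lam (s p) i) (\<lambda>i k. w (s p) i $ k)" for p
    by (rule rescaled_eigenbasis[OF A Z w[OF s] s])
  show ?thesis by (rule eigenbasis_limit[of n "\<lambda>p q. sqrt n / s p * zext n A q + zext n Z q", OF E rescaled_tendsto[OF fl]])
      (assumption | intro exI)+
qed

text \<open>Limits of the eigenvectors along subsequences are eigenvectors of \<open>Z\<close> with the same index, hence
  equal to \<open>z i\<close> up to a sign, which the square removes.\<close>

lemma strong_noise_overlap:
  fixes w :: "real \<Rightarrow> nat \<Rightarrow> real vec"
  assumes A: "A \<in> carrier_mat n n" and Z: "Z \<in> carrier_mat n n"
    and w: "\<And>\<sigma>. 0 < \<sigma> \<Longrightarrow> ordered_eigenbasis (perturbed \<sigma> n A Z) (lam \<sigma>) (w \<sigma>)"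
    and z: "eigenbasis n (zext n Z) zl z" "inj_on zl {..<n}" and i: "i < n"
  shows "((\<lambda>\<sigma>. (\<Sum>k<n. w \<sigma> i $ k * t k)\<^sup>2) \<longlongrightarrow> (\<Sum>k<n. z i k * t k)\<^sup>2) at_top"
proof (rule tendsto_at_topI_sequentially)
  fix s0 :: "nat \<Rightarrow> real" assume s0: "filterlim s0 at_top sequentially"
  \<comment> \<open>eigenbases are given for positive noise levels only\<close>
  define s where "s p = max 1 (s0 p)" for p
  have s: "0 < s p" for p by (simp add: s_def)
  have eq: "\<forall>\<^sub>F p in sequentially. s p = s0 p"
    using s0[unfolded filterlim_at_top, rule_format, of 1] by eventually_elim (simp add: s_def)
  have fl: "filterlim s at_top sequentially"
    by (rule filterlim_at_top_mono[OF s0]) (simp add: s_def)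
  let ?f = "\<lambda>\<sigma>. (\<Sum>k<n. w \<sigma> i $ k * t k)\<^sup>2"
  have "(\<lambda>p. ?f (s p)) \<longlonglongrightarrow> (\<Sum>k<n. z i k * t k)\<^sup>2"
  proof (rule tendsto_by_subsequences)
    fix r :: "nat \<Rightarrow> nat" assume r: "strict_mono r"
    have flr: "filterlim (\<lambda>p. s (r p)) at_top sequentially"
      by (rule filterlim_compose[OF fl filterlim_subseq[OF r]])
    have E: "eigenbasis n (\<lambda>q. sqrt n / s (r p) * zext n A q + zext n Z q) (\<lambda>i. sqrt n / s (r p) * lam (s (r p)) i) (\<lambda>i k. w (s (r p)) i $ k)" for p
      by (rule rescaled_eigenbasis[OF A Z w[OF s] s])
    obtain q lam' w' where q: "strict_mono q" "eigenbasis n (zext n Z) lam' w'"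
      "\<And>i. i < n \<Longrightarrow> (\<lambda>p. sqrt n / s (r (q p)) * lam (s (r (q p))) i) \<longlonglongrightarrow> lam' i"
      "\<And>i k. i < n \<Longrightarrow> k < n \<Longrightarrow> (\<lambda>p. w (s (r (q p))) i $ k) \<longlonglongrightarrow> w' i k"
      using eigenbasis_limit[of n "\<lambda>p q. sqrt n / s (r p) * zext n A q + zext n Z q", OF E rescaled_tendsto[OF flr]] by blast
    obtain c where c: "c = 1 \<or> c = - 1" "\<And>k. k < n \<Longrightarrow> w' i k = c * z i k"
      using simple_eigvec_unique[OF z(1) q(2) z(2) i] by blast
    have "(\<lambda>p. ?f (s (r (q p)))) \<longlonglongrightarrow> (\<Sum>k<n. w' i k * t k)\<^sup>2"
      by (intro tendsto_power tendsto_sum tendsto_mult tendsto_const q(4) i) simp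
    moreover have "(\<Sum>k<n. w' i k * t k) = c * (\<Sum>k<n. z i k * t k)"
      unfolding sum_distrib_left using c(2) by (intro sum.cong refl) simp
    then have "(\<Sum>k<n. w' i k * t k)\<^sup>2 = (\<Sum>k<n. z i k * t k)\<^sup>2"
      using c(1) by auto
    ultimately have "(\<lambda>p. ?f (s (r (q p)))) \<longlonglongrightarrow> (\<Sum>k<n. z i k * t k)\<^sup>2" by (simp only:)
    with q(1) show "\<exists>q. strict_mono q \<and> (\<lambda>p. ?f (s (r (q p)))) \<longlonglongrightarrow> (\<Sum>k<n. z i k * t k)\<^sup>2" by blast
  qed
  then show "(\<lambda>p. ?f (s0 p)) \<longlonglongrightarrow> (\<Sum>k<n. z i k * t k)\<^sup>2"
    by (rule Lim_transform_eventually) (use eq in eventually_elim, simp)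
qed

lemma tendsto_Max:
  fixes f :: "'i \<Rightarrow> 'a \<Rightarrow> real"
  assumes "finite S" "S \<noteq> {}" "\<And>i. i \<in> S \<Longrightarrow> (f i \<longlongrightarrow> l i) F"
  shows "((\<lambda>x. MAX i\<in>S. f i x) \<longlongrightarrow> (MAX i\<in>S. l i)) F"
  using assms by (induction S rule: finite_ne_induct) (auto intro: tendsto_max)

section \<open>Deviation of the overlaps from equidistribution\<close>

text \<open>The value of the quadratic form of \<open>g (Y) - tr (g (Y)) / n\<close> at \<open>w i\<close>, if \<open>(mu, v)\<close> is an eigenbasis of
  \<open>Y\<close>.\<close>

definition overlap_deviation :: "nat \<Rightarrow> (real \<Rightarrow> real) \<Rightarrow> nat \<Rightarrow> (nat \<Rightarrow> nat \<Rightarrow> real) \<Rightarrow> (nat \<Rightarrow> real) \<Rightarrow> (nat \<Rightarrow> nat \<Rightarrow> real) \<Rightarrow> real" where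
  "overlap_deviation n g i w mu v =
     (\<Sum>j<n. (g (mu j) - (\<Sum>j<n. g (mu j)) / n) * (\<Sum>k<n. v j k * w i k)\<^sup>2)"

text \<open>Quantifying over all eigenbases avoids any measurable choice of them: the set is closed, by
  compactness of the set of eigenbases.\<close>

definition deviant :: "nat \<Rightarrow> (real \<Rightarrow> real) \<Rightarrow> nat \<Rightarrow> real \<Rightarrow> ((nat \<times> nat \<Rightarrow> real) \<times> (nat \<times> nat \<Rightarrow> real)) set" where
  "deviant n g i \<epsilon> = {(X, Y). \<exists>lam w mu v. eigenbasis n X lam w \<and> eigenbasis n Y mu v \<and> \<epsilon> \<le> \<bar>overlap_deviation n g i w mu v\<bar>}"

lemma closed_deviant:
  assumes g: "\<And>t. isCont g t" and i: "i < n"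
  shows "closed (deviant n g i \<epsilon>)"
  unfolding closed_sequential_limits
proof (intro allI impI, elim conjE)
  fix P :: "nat \<Rightarrow> (nat \<times> nat \<Rightarrow> real) \<times> (nat \<times> nat \<Rightarrow> real)" and Q
  assume P: "\<forall>p. P p \<in> deviant n g i \<epsilon>" and lim: "P \<longlonglongrightarrow> Q"
  have "\<forall>p. \<exists>lam w mu v. eigenbasis n (fst (P p)) lam w \<and> eigenbasis n (snd (P p)) mu v \<and> \<epsilon> \<le> \<bar>overlap_deviation n g i w mu v\<bar>"
    using P by (auto simp: deviant_def split_beta)
  then obtain lam w mu v where E: "\<And>p. eigenbasis n (fst (P p)) (lam p) (w p)" "\<And>p. eigenbasis n (snd (P p)) (mu p) (v p)"
    and dev: "\<And>p. \<epsilon> \<le> \<bar>overlap_deviation n g i (w p) (mu p) (v p)\<bar>" by metis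
  obtain r lam' w' where r: "strict_mono r" "eigenbasis n (fst Q) lam' w'"
    "\<And>i. i < n \<Longrightarrow> (\<lambda>p. lam (r p) i) \<longlonglongrightarrow> lam' i"
    "\<And>i k. i < n \<Longrightarrow> k < n \<Longrightarrow> (\<lambda>p. w (r p) i k) \<longlonglongrightarrow> w' i k"
    using eigenbasis_limit[OF E(1) tendsto_coordinate[OF tendsto_fst[OF lim]]] by blast
  have limr: "(\<lambda>p. snd (P (r p))) \<longlonglongrightarrow> snd Q"
    using LIMSEQ_subseq_LIMSEQ[OF tendsto_snd[OF lim] r(1)] by (simp add: comp_def)
  obtain q mu' v' where q: "strict_mono q" "eigenbasis n (snd Q) mu' v'"
    "\<And>i. i < n \<Longrightarrow> (\<lambda>p. mu (r (q p)) i) \<longlonglongrightarrow> mu' i"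
    "\<And>i k. i < n \<Longrightarrow> k < n \<Longrightarrow> (\<lambda>p. v (r (q p)) i k) \<longlonglongrightarrow> v' i k"
    using eigenbasis_limit[of n "\<lambda>p. snd (P (r p))", OF E(2) tendsto_coordinate[OF limr]] by blast
  have w: "(\<lambda>p. w (r (q p)) i k) \<longlonglongrightarrow> w' i k" if "k < n" for k
    using LIMSEQ_subseq_LIMSEQ[OF r(4)[OF i that] q(1)] by (simp add: comp_def)
  have gmu: "(\<lambda>p. g (mu (r (q p)) j)) \<longlonglongrightarrow> g (mu' j)" if "j < n" for j
    by (rule isCont_tendsto_compose[OF g q(3)[OF that]])
  have "(\<lambda>p. overlap_deviation n g i (w (r (q p))) (mu (r (q p))) (v (r (q p)))) \<longlonglongrightarrow> overlap_deviation n g i w' mu' v'"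
    unfolding overlap_deviation_def
    using i by (intro tendsto_sum tendsto_mult tendsto_diff tendsto_divide tendsto_power tendsto_const gmu q(4) w) auto
  then have "(\<lambda>p. \<bar>overlap_deviation n g i (w (r (q p))) (mu (r (q p))) (v (r (q p)))\<bar>) \<longlonglongrightarrow> \<bar>overlap_deviation n g i w' mu' v'\<bar>"
    by (rule tendsto_rabs)
  then have "\<epsilon> \<le> \<bar>overlap_deviation n g i w' mu' v'\<bar>"
    by (rule LIMSEQ_le_const) (use dev in blast)
  then show "Q \<in> deviant n g i \<epsilon>"
    using r(2) q(2) unfolding deviant_def split_beta by blast
qed

lemma sum_eigval_trace:
  assumes "eigenbasis n Y mu v"
  shows "(\<Sum>j<n. g (mu j)) = (\<Sum>k<n. \<Sum>j<n. g (mu j) * v j k * v j k)"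
proof -
  have o: "orthonormal n v" using assms by (simp add: eigenbasis_def)
  have "(\<Sum>k<n. \<Sum>j<n. g (mu j) * v j k * v j k) = (\<Sum>j<n. g (mu j) * (\<Sum>k<n. (v j k)\<^sup>2))"
    by (subst sum.swap) (simp add: sum_distrib_left power2_eq_square mult.assoc)
  also have "\<dots> = (\<Sum>j<n. g (mu j))" by (intro sum.cong refl) (simp add: orthonormal_norm[OF o])
  finally show ?thesis by simp
qed

lemma sum_eigval_unique:
  fixes g :: "real \<Rightarrow> real"
  assumes "eigenbasis n Y mu v" "eigenbasis n Y mu' v'"
  shows "(\<Sum>j<n. g (mu j)) = (\<Sum>j<n. g (mu' j))"
proof -
  have "(\<Sum>k<n. \<Sum>j<n. g (mu j) * v j k * v j k) = (\<Sum>k<n. \<Sum>j<n. g (mu' j) * v' j k * v' j k)"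
    by (rule sum.cong[OF refl], rule eigenbasis_fun_unique[OF assms]) auto
  then show ?thesis
    by (simp only: sum_eigval_trace[OF assms(1), of g] sum_eigval_trace[OF assms(2), of g])
qed

lemma quadratic_form_eigenbasis:
  fixes v :: "nat \<Rightarrow> nat \<Rightarrow> real"
  shows "(\<Sum>j<n. f j * (\<Sum>k<n. v j k * x k)\<^sup>2) = (\<Sum>k<n. \<Sum>l<n. (\<Sum>j<n. f j * v j k * v j l) * (x k * x l))"
proof -
  have "(\<Sum>j<n. f j * (\<Sum>k<n. v j k * x k)\<^sup>2) = (\<Sum>j<n. \<Sum>k<n. \<Sum>l<n. f j * v j k * v j l * (x k * x l))"
    unfolding power2_eq_square sum_product by (simp add: sum_distrib_left mult_ac)
  also have "\<dots> = (\<Sum>k<n. \<Sum>j<n. \<Sum>l<n. f j * v j k * v j l * (x k * x l))" by (rule sum.swap)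
  also have "\<dots> = (\<Sum>k<n. \<Sum>l<n. \<Sum>j<n. f j * v j k * v j l * (x k * x l))" by (intro sum.cong refl sum.swap)
  finally show ?thesis by (simp only: sum_distrib_right)
qed

lemma overlap_deviation_unique:
  assumes "eigenbasis n Y mu v" "eigenbasis n Y mu' v'"
  shows "overlap_deviation n g i w mu v = overlap_deviation n g i w mu' v'"
  unfolding overlap_deviation_def quadratic_form_eigenbasis sum_eigval_unique[OF assms, of g]
  by (rule sum.cong[OF refl], rule sum.cong[OF refl], rule arg_cong2[where f = "(*)"],
      rule eigenbasis_fun_unique[OF assms, of _ _ "\<lambda>t. g t - (\<Sum>j<n. g (mu' j)) / n"]) auto

text \<open>For fixed \<open>Y\<close> the deviation is a linear combination of squared inner products with an
  orthonormal basis, with weights that sum to zero, so \<open>goe_upper_tail\<close> bounds both tails. The first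
  bound in \<open>\<theta>\<close> is the one required there, and the second one makes the exponent negative.\<close>

lemma deviant_slice:
  fixes \<epsilon> c :: real
  assumes i: "i < n" and S: "AE X in goe_law n. X \<in> simple_spectrum n" and g: "\<And>t. \<bar>g t\<bar> \<le> c" and \<epsilon>: "0 < \<epsilon>"
    and b_def: "b = 2 * c + 1" and \<theta>_def: "\<theta> = min (1 / (8 * b)) (\<epsilon> / (32 * b\<^sup>2))"
  shows "emeasure (goe_law n) {X. (X, Y) \<in> deviant n g i \<epsilon>} \<le> ennreal (2 * exp (- (\<theta> * \<epsilon> - 16 * \<theta>\<^sup>2 * b\<^sup>2) * n))"
proof (cases "\<exists>mu v. eigenbasis n Y mu v")
  case False
  then have "{X. (X, Y) \<in> deviant n g i \<epsilon>} = {}" by (auto simp: deviant_def)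
  then show ?thesis by (simp only: emeasure_empty zero_le)
next
  case True
  then obtain mu v where E: "eigenbasis n Y mu v" by blast
  have c0: "0 \<le> c" using g[of 0] by linarith
  have b0: "0 < b" using c0 by (simp add: b_def)
  have \<theta>0: "0 \<le> \<theta>" using b0 \<epsilon> by (simp add: \<theta>_def)
  have "\<theta> \<le> 1 / (8 * b)" by (simp add: \<theta>_def)
  then have \<theta>b: "8 * \<theta> * b \<le> 1" using b0 by (simp add: pos_le_divide_eq mult_ac)
  have o: "orthonormal n v" using E by (simp add: eigenbasis_def)
  have n: "0 < real n" using i by simp
  define avg where "avg = (\<Sum>j<n. g (mu j)) / n"
  define \<beta> where "\<beta> j = g (mu j) - avg" for j
  have "\<bar>\<Sum>j<n. g (mu j)\<bar> \<le> (\<Sum>j<n. c)" by (rule order_trans[OF sum_abs sum_mono]) (rule g)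
  then have "\<bar>avg\<bar> \<le> c" using n by (simp add: avg_def abs_div pos_divide_le_eq mult.commute)
  then have \<beta>b: "\<bar>\<beta> j\<bar> \<le> b" "\<bar>- \<beta> j\<bar> \<le> b" for j using g[of "mu j"] unfolding \<beta>_def b_def by linarith+
  have \<beta>s: "(\<Sum>j<n. \<beta> j) = 0" "(\<Sum>j<n. - \<beta> j) = 0" using n by (simp_all add: \<beta>_def sum_subtractf sum_negf avg_def)
  let ?q = "\<lambda>j X. qform n i (v j) X"
  let ?B1 = "{X \<in> simple_spectrum n. (\<Sum>j<n. \<beta> j * ?q j X) \<ge> \<epsilon>}" and ?B2 = "{X \<in> simple_spectrum n. (\<Sum>j<n. - \<beta> j * ?q j X) \<ge> \<epsilon>}"
  have mq [measurable]: "(\<lambda>X. ?q j X) \<in> borel_measurable borel" for j by (rule measurable_qform[OF i]) auto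
  have B: "?B1 \<in> sets (goe_law n)" "?B2 \<in> sets (goe_law n)" by (simp_all only: sets_goe_law, measurable)
  have "emeasure (goe_law n) {X. (X, Y) \<in> deviant n g i \<epsilon>} \<le> emeasure (goe_law n) (?B1 \<union> ?B2)"
  proof (rule emeasure_mono_AE)
    show "AE X in goe_law n. X \<in> {X. (X, Y) \<in> deviant n g i \<epsilon>} \<longrightarrow> X \<in> ?B1 \<union> ?B2"
      using S
    proof (rule AE_mp, intro AE_I2 impI)
      fix X assume X: "X \<in> simple_spectrum n" and "X \<in> {X. (X, Y) \<in> deviant n g i \<epsilon>}"
      then obtain lam w mu' v' where EX: "eigenbasis n X lam w" and E': "eigenbasis n Y mu' v'"
        and d: "\<epsilon> \<le> \<bar>overlap_deviation n g i w mu' v'\<bar>" by (auto simp: deviant_def)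
      have "overlap_deviation n g i w mu' v' = overlap_deviation n g i w mu v"
        by (rule overlap_deviation_unique[OF E' E])
      also have "\<dots> = (\<Sum>j<n. \<beta> j * ?q j X)"
        unfolding overlap_deviation_def \<beta>_def avg_def by (simp only: qform_eq[OF X EX i])
      finally have "\<epsilon> \<le> \<bar>\<Sum>j<n. \<beta> j * ?q j X\<bar>" using d by simp
      then have "\<epsilon> \<le> (\<Sum>j<n. \<beta> j * ?q j X) \<or> \<epsilon> \<le> - (\<Sum>j<n. \<beta> j * ?q j X)" by linarith
      moreover have "- (\<Sum>j<n. \<beta> j * ?q j X) = (\<Sum>j<n. - \<beta> j * ?q j X)"
        by (simp only: sum_negf[symmetric] mult_minus_left)
      ultimately show "X \<in> ?B1 \<union> ?B2" using X by auto
    qed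
  qed (use B in \<open>rule sets.Un\<close>)
  also have "\<dots> \<le> emeasure (goe_law n) ?B1 + emeasure (goe_law n) ?B2" by (rule emeasure_subadditive[OF B])
  also have "\<dots> \<le> ennreal (exp (- (\<theta> * \<epsilon> - 16 * \<theta>\<^sup>2 * b\<^sup>2) * n)) + ennreal (exp (- (\<theta> * \<epsilon> - 16 * \<theta>\<^sup>2 * b\<^sup>2) * n))"
    by (intro add_mono goe_upper_tail[OF i S o b0 \<beta>b(1) \<beta>s(1) \<theta>0 \<theta>b] goe_upper_tail[OF i S o b0 \<beta>b(2) \<beta>s(2) \<theta>0 \<theta>b])
  also have "\<dots> = ennreal (2 * exp (- (\<theta> * \<epsilon> - 16 * \<theta>\<^sup>2 * b\<^sup>2) * n))"
    by (simp only: ennreal_plus[OF exp_ge_zero exp_ge_zero, symmetric] mult_2)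
  finally show ?thesis .
qed

section \<open>Independence and the Borel--Cantelli argument\<close>

definition zfill :: "nat \<Rightarrow> (nat \<times> nat \<Rightarrow> real) \<Rightarrow> nat \<times> nat \<Rightarrow> real" where
  "zfill n e = (\<lambda>(k, l). if k < n \<and> l < n then e (k, l) else 0)"

lemma measurable_zfill: "zfill n \<in> borel_measurable (Pi\<^sub>M ({..<n} \<times> {..<n}) (\<lambda>_. borel))"
proof (rule measurable_coordinatewise_then_product)
  fix p :: "nat \<times> nat"
  show "(\<lambda>e. zfill n e p) \<in> borel_measurable (Pi\<^sub>M ({..<n} \<times> {..<n}) (\<lambda>_. borel))"
  proof (cases "p \<in> {..<n} \<times> {..<n}")
    case True
    then have "(\<lambda>e. e p) \<in> borel_measurable (Pi\<^sub>M ({..<n} \<times> {..<n}) (\<lambda>_. borel :: real measure))"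
      by (rule measurable_component_singleton)
    then show ?thesis using True by (auto simp: zfill_def)
  next
    case False
    then have "(\<lambda>e. zfill n e p) = (\<lambda>_. 0)" by (auto simp: zfill_def split: prod.split)
    then show ?thesis by simp
  qed
qed

lemma zfill_entries: "zfill n (entries n A \<omega>) = zext n (A \<omega>)"
  by (auto simp: zfill_def zext_def entries_def)

context prob_space
begin

text \<open>By independence the joint law is a product, and the slices can be estimated separately.\<close>

lemma goe_deviation_prob:
  assumes n: "n \<ge> 1" and goe: "is_GOE M n Z" and ind: "indep_mat M n Z A"
    and D: "D \<in> sets borel" and slice: "\<And>Y. emeasure (goe_law n) {X. (X, Y) \<in> D} \<le> ennreal \<delta>"
  shows "{\<omega> \<in> space M. (zext n (Z \<omega>), zext n (A \<omega>)) \<in> D} \<in> events"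
    and "emeasure M {\<omega> \<in> space M. (zext n (Z \<omega>), zext n (A \<omega>)) \<in> D} \<le> ennreal \<delta>"
proof -
  let ?X = "\<lambda>\<omega>. zext n (Z \<omega>)" and ?Y = "\<lambda>\<omega>. zext n (A \<omega>)"
  have "indep_var borel (zfill n \<circ> entries n Z) borel (zfill n \<circ> entries n A)"
    by (rule indep_var_compose[OF ind[unfolded indep_mat_def] measurable_zfill measurable_zfill])
  then have iv: "indep_var borel ?X borel ?Y" by (simp only: comp_def zfill_entries)
  then have m: "?X \<in> borel_measurable M" "?Y \<in> borel_measurable M"
    and joint: "distr M borel ?X \<Otimes>\<^sub>M distr M borel ?Y = distr M (borel \<Otimes>\<^sub>M borel) (\<lambda>\<omega>. (?X \<omega>, ?Y \<omega>))"
    unfolding indep_var_distribution_eq by blast+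
  have D2: "D \<in> sets (borel \<Otimes>\<^sub>M borel)" using D by (simp only: borel_prod)
  have mp: "(\<lambda>\<omega>. (?X \<omega>, ?Y \<omega>)) \<in> measurable M (borel \<Otimes>\<^sub>M borel)" using m by (rule measurable_Pair)
  have eq: "{\<omega> \<in> space M. (?X \<omega>, ?Y \<omega>) \<in> D} = (\<lambda>\<omega>. (?X \<omega>, ?Y \<omega>)) -` D \<inter> space M" by blast
  show "{\<omega> \<in> space M. (?X \<omega>, ?Y \<omega>) \<in> D} \<in> events" unfolding eq by (rule measurable_sets[OF mp D2])
  interpret Y: prob_space "distr M borel ?Y" by (rule prob_space_distr[OF m(2)])
  interpret X: prob_space "goe_law n" by (rule prob_space_goe_law)
  interpret XY: pair_sigma_finite "goe_law n" "distr M borel ?Y" ..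
  have DS: "D \<in> sets (goe_law n \<Otimes>\<^sub>M distr M borel ?Y)" using D2 by (simp cong: sets_pair_measure_cong)
  have "emeasure M {\<omega> \<in> space M. (?X \<omega>, ?Y \<omega>) \<in> D} = emeasure (distr M (borel \<Otimes>\<^sub>M borel) (\<lambda>\<omega>. (?X \<omega>, ?Y \<omega>))) D"
    unfolding eq by (rule emeasure_distr[OF mp D2, symmetric])
  also have "\<dots> = emeasure (goe_law n \<Otimes>\<^sub>M distr M borel ?Y) D"
    by (simp only: joint[symmetric] is_GOE_law(2)[OF prob_space_axioms n goe])
  also have "\<dots> = (\<integral>\<^sup>+y. emeasure (goe_law n) ((\<lambda>x. (x, y)) -` D) \<partial>distr M borel ?Y)"
    by (rule XY.emeasure_pair_measure_alt2[OF DS])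
  also have "\<dots> \<le> (\<integral>\<^sup>+y. ennreal \<delta> \<partial>distr M borel ?Y)"
    using slice by (intro nn_integral_mono) (simp add: vimage_def)
  also have "\<dots> = ennreal \<delta>" using Y.emeasure_space_1 by simp
  finally show "emeasure M {\<omega> \<in> space M. (?X \<omega>, ?Y \<omega>) \<in> D} \<le> ennreal \<delta>" .
qed

end

context prob_space
begin

text \<open>The \<open>n\<close> events for a fixed dimension have total probability at most
  \<open>2 * n * exp (- \<kappa> * n)\<close>, which is summable.\<close>

lemma goe_deviation_AE:
  fixes Z A :: "nat \<Rightarrow> 'a \<Rightarrow> real mat"
  assumes goe: "\<And>n. n \<ge> 1 \<Longrightarrow> is_GOE M n (Z n)" and ind: "\<And>n. n \<ge> 1 \<Longrightarrow> indep_mat M n (Z n) (A n)"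
    and S: "\<And>n. n \<ge> 1 \<Longrightarrow> AE X in goe_law n. X \<in> simple_spectrum n"
    and g: "\<And>t. isCont g t" "\<And>t. \<bar>g t\<bar> \<le> c" and \<epsilon>: "0 < \<epsilon>"
  shows "AE \<omega> in M. \<forall>\<^sub>F n in sequentially. \<forall>i<n. (zext n (Z n \<omega>), zext n (A n \<omega>)) \<notin> deviant n g i \<epsilon>"
proof -
  define b where "b = 2 * c + 1"
  define \<theta> where "\<theta> = min (1 / (8 * b)) (\<epsilon> / (32 * b\<^sup>2))"
  define \<kappa> where "\<kappa> = \<theta> * \<epsilon> - 16 * \<theta>\<^sup>2 * b\<^sup>2"
  have c0: "0 \<le> c" using g(2)[of 0] by linarith
  have b0: "0 < b" using c0 by (simp add: b_def)
  have \<theta>0: "0 < \<theta>" using b0 \<epsilon> by (simp add: \<theta>_def)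
  have "\<theta> \<le> \<epsilon> / (32 * b\<^sup>2)" by (simp add: \<theta>_def)
  then have "\<theta> * (32 * b\<^sup>2) \<le> \<epsilon>" using b0 by (simp add: pos_le_divide_eq)
  then have "\<theta> * (\<theta> * (32 * b\<^sup>2)) \<le> \<theta> * \<epsilon>" using \<theta>0 by (intro mult_left_mono) auto
  moreover have "0 < \<theta>\<^sup>2 * b\<^sup>2" using \<theta>0 b0 by simp
  ultimately have \<kappa>0: "0 < \<kappa>" unfolding \<kappa>_def power2_eq_square by (simp add: mult_ac)
  let ?D = "\<lambda>n i. {\<omega> \<in> space M. (zext n (Z n \<omega>), zext n (A n \<omega>)) \<in> deviant n g i \<epsilon>}"
  let ?E = "\<lambda>n. \<Union>i<n. ?D n i"
  have D: "?D n i \<in> events" "measure M (?D n i) \<le> 2 * exp (- \<kappa> * n)" if i: "i < n" for n i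
  proof -
    have n: "n \<ge> 1" using i by simp
    have B: "deviant n g i \<epsilon> \<in> sets borel" by (rule borel_closed[OF closed_deviant[OF g(1) i]])
    note sl = deviant_slice[OF i S[OF n] g(2) \<epsilon> b_def \<theta>_def, folded \<kappa>_def]
    note D = goe_deviation_prob[OF n goe[OF n] ind[OF n] B sl]
    show "?D n i \<in> events" by (rule D(1))
    show "measure M (?D n i) \<le> 2 * exp (- \<kappa> * n)"
      using D(2) by (simp add: emeasure_eq_measure)
  qed
  have E: "?E n \<in> events" for n using D(1) by (intro sets.finite_UN) auto
  have Eb: "measure M (?E n) \<le> 2 * (real (Suc n) * exp (- \<kappa>) ^ n)" for n
  proof -
    have "measure M (?E n) \<le> (\<Sum>i<n. measure M (?D n i))"
      by (rule finite_measure_subadditive_finite) (use D(1) in auto)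
    also have "\<dots> \<le> (\<Sum>i<n. 2 * exp (- \<kappa> * n))" by (intro sum_mono D(2)) simp
    also have "\<dots> = 2 * (real n * exp (- \<kappa>) ^ n)" by (simp add: exp_of_nat2_mult[symmetric])
    also have "\<dots> \<le> 2 * (real (Suc n) * exp (- \<kappa>) ^ n)" by (intro mult_left_mono mult_right_mono) auto
    finally show ?thesis .
  qed
  have sm: "summable (\<lambda>n. 2 * (real (Suc n) * exp (- \<kappa>) ^ n))"
    using geometric_deriv_sums[of "exp (- \<kappa>)"] \<kappa>0 by (intro summable_mult) (auto simp: sums_iff)
  have "summable (\<lambda>n. measure M (?E n))"
    by (rule summable_comparison_test'[OF sm, of 0]) (simp only: real_norm_def abs_of_nonneg[OF measure_nonneg] Eb)
  then have "AE \<omega> in M. \<forall>\<^sub>F n in sequentially. \<omega> \<in> space M - ?E n"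
    by (intro borel_cantelli_AE1 E) (simp_all add: emeasure_eq_measure)
  then show ?thesis
  proof (rule AE_mp, intro AE_I2 impI)
    fix \<omega> assume "\<omega> \<in> space M" "\<forall>\<^sub>F n in sequentially. \<omega> \<in> space M - ?E n"
    from this(2) show "\<forall>\<^sub>F n in sequentially. \<forall>i<n. (zext n (Z n \<omega>), zext n (A n \<omega>)) \<notin> deviant n g i \<epsilon>"
      by eventually_elim auto
  qed
qed

text \<open>The existence of an eigenbasis passes from the values of \<open>Z\<close> to almost every matrix under
  \<open>goe_law\<close>, as this is the law of \<open>Z\<close>.\<close>

lemma goe_simple_AE:
  assumes n: "n \<ge> 1" and goe: "is_GOE M n Z"
    and ex: "\<And>\<omega>. \<omega> \<in> space M \<Longrightarrow> \<exists>zl z. eigenbasis n (zext n (Z \<omega>)) zl z"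
  shows "AE \<omega> in M. zext n (Z \<omega>) \<in> simple_spectrum n" "AE X in goe_law n. X \<in> simple_spectrum n"
proof -
  note G = is_GOE_law[OF prob_space_axioms n goe]
  let ?P = "\<lambda>X. \<forall>lam w. eigenbasis n X lam w \<longrightarrow> inj_on lam {..<n}"
  have "AE X in distr M borel (\<lambda>\<omega>. zext n (Z \<omega>)). ?P X" unfolding G(2) by (rule goe_simple[OF n])
  then have "AE \<omega> in M. ?P (zext n (Z \<omega>))" by (rule AE_distrD[OF G(1)])
  then show a: "AE \<omega> in M. zext n (Z \<omega>) \<in> simple_spectrum n"
    by (rule AE_mp) (use ex in \<open>auto simp: simple_spectrum_def\<close>)
  have "AE X in distr M borel (\<lambda>\<omega>. zext n (Z \<omega>)). X \<in> simple_spectrum n"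
    by (subst AE_distr_iff[OF G(1)]) (use a in auto)
  then show "AE X in goe_law n. X \<in> simple_spectrum n" unfolding G(2) .
qed

end

section \<open>Equidistribution of the spectrum\<close>

text \<open>The function \<open>h\<close> is only controlled near \<open>{h1..h2}\<close>; composing it with \<open>clamp\<close> gives a bounded
  continuous function on the line that agrees with it on this interval.\<close>

definition clamp :: "real \<Rightarrow> real \<Rightarrow> real \<Rightarrow> real" where
  "clamp h1 h2 t = max h1 (min h2 t)"

lemma isCont_clamp: "isCont (clamp h1 h2) t"
  unfolding clamp_def[abs_def] by (intro continuous_intros)

lemma clamp_mem: "h1 \<le> h2 \<Longrightarrow> clamp h1 h2 t \<in> {h1..h2}"
  by (auto simp: clamp_def)

lemma clamp_id: "t \<in> {h1..h2} \<Longrightarrow> clamp h1 h2 t = t"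
  by (auto simp: clamp_def)

lemma esd_average_tendsto:
  fixes f :: "real \<Rightarrow> real" and B :: "nat \<Rightarrow> real mat"
  assumes W: "weak_conv_m (\<lambda>n. esd (B n)) H" and H: "real_distribution H"
    and B: "\<And>n. n \<ge> 1 \<Longrightarrow> B n \<in> carrier_mat n n"
    and E: "\<And>n. n \<ge> 1 \<Longrightarrow> eigenbasis n (zext n (B n)) (mu n) (v n)"
    and f: "\<And>t. isCont f t" "\<And>t. \<bar>f t\<bar> \<le> c"
  shows "(\<lambda>n. (\<Sum>j<n. f (mu n j)) / n) \<longlonglongrightarrow> (LINT t|H. f t)"
proof -
  have m: "f \<in> borel_measurable borel"
    by (rule borel_measurable_continuous_onI) (use f(1) in \<open>simp add: continuous_on_eq_continuous_within continuous_at_imp_continuous_at_within\<close>)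
  have "(\<lambda>n. LINT t|esd (B n). f t) \<longlonglongrightarrow> (LINT t|H. f t)"
    by (rule weak_conv_imp_integral_bdd_continuous_conv[OF real_distribution_esd H W f(1)]) (use f(2) in simp)
  then show ?thesis
  proof (rule Lim_transform_eventually)
    show "\<forall>\<^sub>F n in sequentially. (LINT t|esd (B n). f t) = (\<Sum>j<n. f (mu n j)) / n"
      using eventually_ge_at_top[of 1] by eventually_elim (rule integral_esd[OF B E _ m])
  qed
qed

text \<open>The bounded continuous function \<open>min 1 \<bar>t - clamp h1 h2 t\<bar>\<close> vanishes exactly on the interval. Its
  averages over the eigenvalues are eventually zero, so its integral against the limit law is.\<close>

lemma limit_law_concentrated:
  fixes B :: "nat \<Rightarrow> real mat"
  assumes W: "weak_conv_m (\<lambda>n. esd (B n)) H" and H: "real_distribution H"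
    and B: "\<And>n. n \<ge> 1 \<Longrightarrow> B n \<in> carrier_mat n n"
    and E: "\<And>n. n \<ge> 1 \<Longrightarrow> \<exists>mu v. eigenbasis n (zext n (B n)) mu v"
    and eigs: "\<forall>\<^sub>F n in sequentially. \<forall>x. eigenvalue (B n) x \<longrightarrow> x \<in> {h1..h2}"
  shows "h1 \<le> h2" "AE t in H. t \<in> {h1..h2}"
proof -
  interpret real_distribution H by (rule H)
  obtain mu v where E: "\<And>n. n \<ge> 1 \<Longrightarrow> eigenbasis n (zext n (B n)) (mu n) (v n)" using E by metis
  have mem: "\<forall>\<^sub>F n in sequentially. n \<ge> 1 \<and> (\<forall>j<n. mu n j \<in> {h1..h2})"
    using eigs eventually_ge_at_top[of 1]
  proof eventually_elim
    case (elim n)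
    then show ?case using eigenbasis_eigenvalue[OF B E] by blast
  qed
  from eventually_happens'[OF sequentially_bot this] obtain n where "n \<ge> 1" "\<forall>j<n. mu n j \<in> {h1..h2}" by blast
  then have "mu n 0 \<in> {h1..h2}" by simp
  then show h12: "h1 \<le> h2" by simp
  define f where "f t = min 1 \<bar>t - clamp h1 h2 t\<bar>" for t
  have fc: "isCont f t" for t unfolding f_def[abs_def] by (intro continuous_intros isCont_clamp)
  have fb: "\<bar>f t\<bar> \<le> 1" for t by (auto simp: f_def)
  have mf: "f \<in> borel_measurable borel" unfolding f_def[abs_def] clamp_def[abs_def] by measurable
  have "(\<lambda>n. (\<Sum>j<n. f (mu n j)) / n) \<longlonglongrightarrow> (LINT t|H. f t)"
    by (rule esd_average_tendsto[OF W H B E fc fb])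
  moreover have "(\<lambda>n. (\<Sum>j<n. f (mu n j)) / n) \<longlonglongrightarrow> 0"
  proof (rule tendsto_eventually)
    show "\<forall>\<^sub>F n in sequentially. (\<Sum>j<n. f (mu n j)) / n = 0"
      using mem by eventually_elim (simp add: f_def clamp_id)
  qed
  ultimately have "(LINT t|H. f t) = 0" by (rule LIMSEQ_unique)
  moreover have "integrable H f" by (rule integrable_const_bound[of _ 1]) (use fb mf in auto)
  moreover have "AE t in H. 0 \<le> f t" by (simp add: f_def)
  ultimately have "AE t in H. f t = 0" using integral_nonneg_eq_0_iff_AE by blast
  then show "AE t in H. t \<in> {h1..h2}"
  proof (rule AE_mp, intro AE_I2 impI)
    fix t assume "f t = 0"
    then have "t = clamp h1 h2 t" by (auto simp: f_def min_def split: if_splits)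
    then show "t \<in> {h1..h2}" using clamp_mem[OF h12, of t] by simp
  qed
qed

section \<open>The oracle quantities\<close>

text \<open>The inner limit is the maximum \<open>L n\<close> of the distances of \<open>D n i = \<Sum>j. g (mu j) * <z i, v j>\<^sup>2\<close> from
  the integral. Each \<open>D n i\<close> differs from the average of the \<open>g (mu j)\<close> by an \<open>overlap_deviation\<close>.\<close>

lemma (in prob_space) oracle_strong_noise:
  fixes A Z :: "nat \<Rightarrow> 'a \<Rightarrow> real mat" and w :: "nat \<Rightarrow> real \<Rightarrow> 'a \<Rightarrow> nat \<Rightarrow> real vec"
  assumes A: "\<And>n. n \<ge> 1 \<Longrightarrow> random_sym_mat M n (A n)"
    and Z: "\<And>n. n \<ge> 1 \<Longrightarrow> random_sym_mat M n (Z n)"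
    and indep: "\<And>n. n \<ge> 1 \<Longrightarrow> indep_mat M n (Z n) (A n)"
    and goe: "\<And>n. n \<ge> 1 \<Longrightarrow> is_GOE M n (Z n)"
    and H: "real_distribution H"
    and esd: "AE \<omega> in M. weak_conv_m (\<lambda>n. esd (A n \<omega>)) H"
    and eigs: "AE \<omega> in M. \<forall>\<^sub>F n in sequentially. \<forall>x. eigenvalue (A n \<omega>) x \<longrightarrow> x \<in> {h1..h2}"
    and basis: "\<And>n \<sigma> \<omega>. n \<ge> 1 \<Longrightarrow> \<sigma> > 0 \<Longrightarrow> \<omega> \<in> space M \<Longrightarrow>
      ordered_eigenbasis (perturbed \<sigma> n (A n \<omega>) (Z n \<omega>)) (lam n \<sigma> \<omega>) (w n \<sigma> \<omega>)"
    and g: "\<And>t. isCont g t" "\<And>t. \<bar>g t\<bar> \<le> c" and hg: "\<And>t. t \<in> {h1..h2} \<Longrightarrow> h t = g t"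
  shows "AE \<omega> in M. \<exists>L :: nat \<Rightarrow> real.
          (\<forall>\<^sub>F n in sequentially.
             ((\<lambda>\<sigma>. MAX i\<in>{..<n}.
                 \<bar>scalar_prod (w n \<sigma> \<omega> i) (mat_fun h (A n \<omega>) *\<^sub>v w n \<sigma> \<omega> i) - (LINT t|H. g t)\<bar>)
              \<longlongrightarrow> L n) at_top) \<and>
          L \<longlonglongrightarrow> 0"
proof -
  have Ac: "A n \<omega> \<in> carrier_mat n n" and Zc: "Z n \<omega> \<in> carrier_mat n n" if "n \<ge> 1" "\<omega> \<in> space M" for n \<omega>
    using A[OF that(1)] Z[OF that(1)] that(2) by (auto simp: random_sym_mat_def sym_mat_def)
  have exA: "\<exists>mu v. eigenbasis n (zext n (A n \<omega>)) mu v" if "n \<ge> 1" "\<omega> \<in> space M" for n \<omega>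
    by (rule unperturbed_eigenbasis[OF Ac[OF that] Zc[OF that] basis[OF that(1) _ that(2)]])
  have exZ: "\<exists>mu v. eigenbasis n (zext n (Z n \<omega>)) mu v" if "n \<ge> 1" "\<omega> \<in> space M" for n \<omega>
    by (rule noise_eigenbasis[OF Ac[OF that] Zc[OF that] basis[OF that(1) _ that(2)]])
  have "AE \<omega> in M. n \<ge> 1 \<longrightarrow> zext n (Z n \<omega>) \<in> simple_spectrum n" for n
  proof (cases "n \<ge> 1")
    case True
    have "AE \<omega> in M. zext n (Z n \<omega>) \<in> simple_spectrum n"
      by (rule goe_simple_AE(1)[OF True goe[OF True] exZ[OF True]])
    then show ?thesis by (rule AE_mp) (rule AE_I2, simp)
  qed simp
  then have simple: "AE \<omega> in M. \<forall>n. n \<ge> 1 \<longrightarrow> zext n (Z n \<omega>) \<in> simple_spectrum n"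
    unfolding AE_all_countable by (rule allI)
  have S: "AE X in goe_law n. X \<in> simple_spectrum n" if "n \<ge> 1" for n
    by (rule goe_simple_AE(2)[OF that goe[OF that] exZ[OF that]])
  have dev: "AE \<omega> in M. \<forall>m. \<forall>\<^sub>F n in sequentially. \<forall>i<n.
      (zext n (Z n \<omega>), zext n (A n \<omega>)) \<notin> deviant n g i (1 / real (Suc m))"
    unfolding AE_all_countable by (intro allI goe_deviation_AE[OF goe indep S g]) simp_all
  define I where "I = (LINT t|H. g t)"
  show ?thesis
    unfolding I_def[symmetric] using esd eigs dev simple AE_space
  proof eventually_elim
    case (elim \<omega>)
    note W = elim(1) and eigs = elim(2) and dev = elim(3) and simple = elim(4) and sp = elim(5)
    obtain mu v where E: "\<And>n. n \<ge> 1 \<Longrightarrow> eigenbasis n (zext n (A n \<omega>)) (mu n) (v n)"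
      using exA[OF _ sp] by metis
    define z where "z n = evec n (zext n (Z n \<omega>))" for n
    have zE: "\<exists>zl. eigenbasis n (zext n (Z n \<omega>)) zl (z n) \<and> inj_on zl {..<n}" if "n \<ge> 1" for n
      unfolding z_def using evec simple that by blast
    define D where "D n i = (\<Sum>j<n. g (mu n j) * (\<Sum>k<n. z n i k * v n j k)\<^sup>2)" for n i
    define L where "L n = (MAX i\<in>{..<n}. \<bar>D n i - I\<bar>)" for n
    define avg where "avg n = (\<Sum>j<n. g (mu n j)) / n" for n
    have mem: "\<forall>\<^sub>F n in sequentially. n \<ge> 1 \<and> (\<forall>j<n. mu n j \<in> {h1..h2})"
      using eigs eventually_ge_at_top[of 1]
    proof eventually_elim
      case (elim n)
      then show ?case using eigenbasis_eigenvalue[OF Ac[OF _ sp] E] by blast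
    qed
    have "\<forall>\<^sub>F n in sequentially.
             ((\<lambda>\<sigma>. MAX i\<in>{..<n}.
                 \<bar>scalar_prod (w n \<sigma> \<omega> i) (mat_fun h (A n \<omega>) *\<^sub>v w n \<sigma> \<omega> i) - I\<bar>)
              \<longlongrightarrow> L n) at_top"
      using mem
    proof eventually_elim
      case (elim n)
      then have n: "n \<ge> 1" and mu: "\<And>j. j < n \<Longrightarrow> mu n j \<in> {h1..h2}" by auto
      obtain zl where zl: "eigenbasis n (zext n (Z n \<omega>)) zl (z n)" "inj_on zl {..<n}" using zE[OF n] by blast
      have B: "ordered_eigenbasis (perturbed \<sigma> n (A n \<omega>) (Z n \<omega>)) (lam n \<sigma> \<omega>) (w n \<sigma> \<omega>)" if "0 < \<sigma>" for \<sigma>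
        by (rule basis[OF n that sp])
      have "((\<lambda>\<sigma>. scalar_prod (w n \<sigma> \<omega> i) (mat_fun h (A n \<omega>) *\<^sub>v w n \<sigma> \<omega> i)) \<longlongrightarrow> D n i) at_top" if i: "i < n" for i
      proof (rule Lim_transform_eventually)
        show "((\<lambda>\<sigma>. \<Sum>j<n. g (mu n j) * (\<Sum>k<n. w n \<sigma> \<omega> i $ k * v n j k)\<^sup>2) \<longlongrightarrow> D n i) at_top"
          unfolding D_def
          by (intro tendsto_sum tendsto_mult tendsto_const strong_noise_overlap[OF Ac[OF n sp] Zc[OF n sp] B zl i])
        show "\<forall>\<^sub>F \<sigma> in at_top. (\<Sum>j<n. g (mu n j) * (\<Sum>k<n. w n \<sigma> \<omega> i $ k * v n j k)\<^sup>2)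
            = scalar_prod (w n \<sigma> \<omega> i) (mat_fun h (A n \<omega>) *\<^sub>v w n \<sigma> \<omega> i)"
          using eventually_gt_at_top[of 0]
        proof eventually_elim
          case (elim \<sigma>)
          have "dim_row (perturbed \<sigma> n (A n \<omega>) (Z n \<omega>)) = n"
            using perturbed_carrier[OF Ac[OF n sp] Zc[OF n sp]] by blast
          then have wc: "w n \<sigma> \<omega> i \<in> carrier_vec n" using B[OF elim] i unfolding ordered_eigenbasis_def by metis
          show ?case unfolding mat_fun_quadratic[OF Ac[OF n sp] E[OF n] wc]
            by (rule sum.cong[OF refl]) (use hg mu in simp)
        qed
      qed
      then show ?case unfolding L_def
        using n by (intro tendsto_Max tendsto_rabs tendsto_diff tendsto_const) (auto simp: lessThan_empty_iff)
    qed
    moreover have "L \<longlonglongrightarrow> 0"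
    proof (rule tendstoI)
      fix \<epsilon> :: real assume \<epsilon>: "0 < \<epsilon>"
      then obtain m where m: "1 / real (Suc m) < \<epsilon> / 2" using nat_approx_posE[of "\<epsilon> / 2"] by (metis half_gt_zero)
      have "avg \<longlonglongrightarrow> I" unfolding avg_def[abs_def] I_def
        by (rule esd_average_tendsto[OF W H Ac[OF _ sp] E g])
      then have "\<forall>\<^sub>F n in sequentially. dist (avg n) I < \<epsilon> / 2" using \<epsilon> by (intro tendstoD) auto
      then show "\<forall>\<^sub>F n in sequentially. dist (L n) 0 < \<epsilon>"
        using dev[rule_format, of m] eventually_ge_at_top[of 1]
      proof eventually_elim
        case (elim n)
        obtain zl where zl: "eigenbasis n (zext n (Z n \<omega>)) zl (z n)" using zE[OF elim(3)] by blast
        have lt: "\<bar>D n i - I\<bar> < \<epsilon>" if i: "i < n" for i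
        proof -
          have vo: "orthonormal n (v n)" and zo: "orthonormal n (z n)" using E[OF elim(3)] zl by (auto simp: eigenbasis_def)
          \<comment> \<open>Parseval's identity\<close>
          have one: "(\<Sum>j<n. (\<Sum>k<n. z n i k * v n j k)\<^sup>2) = 1"
            using orthonormal_parseval[OF vo, of "z n i"] orthonormal_norm[OF zo i] by simp
          have "overlap_deviation n g i (z n) (mu n) (v n) = (\<Sum>j<n. (g (mu n j) - avg n) * (\<Sum>k<n. z n i k * v n j k)\<^sup>2)"
            by (simp only: overlap_deviation_def avg_def mult.commute[of "v n _ _"])
          also have "\<dots> = D n i - avg n * (\<Sum>j<n. (\<Sum>k<n. z n i k * v n j k)\<^sup>2)"
            by (simp only: D_def left_diff_distrib sum_subtractf sum_distrib_left)
          finally have dv: "overlap_deviation n g i (z n) (mu n) (v n) = D n i - avg n" unfolding one by simp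
          have "\<not> 1 / real (Suc m) \<le> \<bar>overlap_deviation n g i (z n) (mu n) (v n)\<bar>"
            using elim(2) i zl E[OF elim(3)] unfolding deviant_def by blast
          then show ?thesis using m elim(1) unfolding dv dist_real_def by linarith
        qed
        have ne: "(\<lambda>i. \<bar>D n i - I\<bar>) ` {..<n} \<noteq> {}" "finite ((\<lambda>i. \<bar>D n i - I\<bar>) ` {..<n})"
          using elim(3) by (auto simp: lessThan_empty_iff)
        have "L n < \<epsilon>" unfolding L_def using Max_less_iff[OF ne(2,1)] lt by auto
        moreover have "0 \<le> L n" unfolding L_def using Max_in[OF ne(2,1)] by auto
        ultimately show ?case by (simp add: dist_real_def)
      qed
    qed
    ultimately show ?case by blast
  qed
qed

section \<open>The free algebra and the free difference quotient\<close>

definition ncmono :: "bool list \<Rightarrow> ncpoly" where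
  "ncmono w = Poly_Mapping.single (NCWord w) 1"

lemma ncmono_Nil [simp]: "ncmono [] = 1"
  by (simp add: ncmono_def zero_ncword_def[symmetric])

lemma ncmono_append: "ncmono (u @ v) = ncmono u * ncmono v"
  by (simp add: ncmono_def mult_single plus_ncword_def)

lemma ncmono_Cons: "ncmono (b # w) = ncvar b * ncmono w"
  using ncmono_append[of "[b]" w] by (simp add: ncmono_def ncvar_def)

lemma ncvar_power: "ncvar b ^ k = ncmono (replicate k b)"
  by (induction k) (simp_all add: ncmono_Cons)

lemma ncconst_mult_single: "ncconst c * Poly_Mapping.single w a = Poly_Mapping.single w (c * a)"
  by (simp add: ncconst_def mult_single)

lemma ncconst_0 [simp]: "ncconst 0 = 0" by (simp add: ncconst_def)
lemma ncconst_1 [simp]: "ncconst 1 = 1" by (simp add: ncconst_def)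

lemma ncconst_add: "ncconst (a + b) = ncconst a + ncconst b"
  by (simp add: ncconst_def single_add)

lemma ncconst_mult: "ncconst (a * b) = ncconst a * ncconst b"
  by (simp add: ncconst_def mult_single)

lemma ncpoly_expand: "Q = (\<Sum>w\<in>Poly_Mapping.keys Q. ncconst (Poly_Mapping.lookup Q w) * ncmono (letters w))"
proof (rule poly_mapping_eqI)
  fix k
  have "Poly_Mapping.lookup (\<Sum>w\<in>Poly_Mapping.keys Q. ncconst (Poly_Mapping.lookup Q w) * ncmono (letters w)) k =
     (\<Sum>w\<in>Poly_Mapping.keys Q. if w = k then Poly_Mapping.lookup Q w else 0)"
    unfolding lookup_sum ncmono_def ncconst_mult_single
    by (intro sum.cong refl) (auto simp: lookup_single when_def)
  also have "\<dots> = Poly_Mapping.lookup Q k" by (auto simp: in_keys_iff)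
  finally show "Poly_Mapping.lookup Q k = Poly_Mapping.lookup (\<Sum>w\<in>Poly_Mapping.keys Q. ncconst (Poly_Mapping.lookup Q w) * ncmono (letters w)) k" ..
qed

lemma ncpoly_induct [case_names add scale word]:
  assumes "\<And>p q. P p \<Longrightarrow> P q \<Longrightarrow> P (p + q)" "\<And>c p. P p \<Longrightarrow> P (ncconst c * p)" "\<And>w. P (ncmono w)"
  shows "P Q"
proof -
  have 0: "P 0" using assms(2)[of "ncmono []" 0] assms(3)[of "[]"] by simp
  have *: "P (\<Sum>w\<in>A. ncconst (f w) * ncmono (letters w))" for A f
  proof (induction A rule: infinite_finite_induct)
    case (insert x A)
    show ?case
      unfolding sum.insert[OF insert.hyps] by (rule assms(1)[OF assms(2)[OF assms(3)] insert.IH])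
  qed (simp_all add: 0)
  show ?thesis
    by (rule subst[OF ncpoly_expand[of Q, symmetric], of P]) (rule *)
qed

lemma ncconst_commute: "ncconst c * Q = Q * ncconst c"
proof (induction Q rule: ncpoly_induct)
  case (scale d p)
  have "ncconst c * (ncconst d * p) = ncconst (c * d) * p" by (simp only: ncconst_mult mult.assoc)
  also have "\<dots> = ncconst d * (ncconst c * p)"
    by (simp only: mult.commute[of c d] ncconst_mult mult.assoc)
  also have "\<dots> = ncconst d * p * ncconst c" by (simp only: scale mult.assoc)
  finally show ?case .
next
  case (word w)
  then show ?case by (simp add: ncconst_def ncmono_def mult_single)
qed (simp add: algebra_simps)

lemma ncconst_left_commute: "P * (ncconst c * Q) = ncconst c * (P * Q)"
proof -
  have "P * (ncconst c * Q) = (P * ncconst c) * Q" by (rule mult.assoc[symmetric])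
  also have "P * ncconst c = ncconst c * P" by (rule ncconst_commute[symmetric])
  finally show ?thesis by (simp only: mult.assoc)
qed

text \<open>Linear functionals on the free algebra; two of them agree if they agree on words.\<close>

definition lin :: "(ncpoly \<Rightarrow> real) \<Rightarrow> bool" where
  "lin F \<longleftrightarrow> (\<forall>p q. F (p + q) = F p + F q) \<and> (\<forall>c p. F (ncconst c * p) = c * F p)"

lemma lin_add: "lin F \<Longrightarrow> F (p + q) = F p + F q" and lin_scale: "lin F \<Longrightarrow> F (ncconst c * p) = c * F p"
  by (simp_all add: lin_def)

lemma lin_0: "lin F \<Longrightarrow> F 0 = 0"
  using lin_scale[of F 0 0] by simp

lemma lin_sum: "lin F \<Longrightarrow> F (\<Sum>i\<in>A. f i) = (\<Sum>i\<in>A. F (f i))"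
  by (induction A rule: infinite_finite_induct) (simp_all add: lin_0 lin_add)

lemma lin_eqI:
  assumes "lin F" "lin G" "\<And>w. F (ncmono w) = G (ncmono w)"
  shows "F Q = G Q"
  by (induction Q rule: ncpoly_induct) (simp_all add: assms lin_add lin_scale)

lemma lin_left: "lin F \<Longrightarrow> lin (\<lambda>Z. F (P * Z))"
  unfolding lin_def by (simp add: distrib_left ncconst_left_commute)

lemma lin_right: "lin F \<Longrightarrow> lin (\<lambda>Z. F (Z * P))"
  unfolding lin_def by (simp add: distrib_right mult.assoc)

lemma lin_plus: "lin F \<Longrightarrow> lin G \<Longrightarrow> lin (\<lambda>Z. F Z + G Z)"
  unfolding lin_def by (simp add: algebra_simps)

lemma lin_cmult: "lin F \<Longrightarrow> lin (\<lambda>Z. a * F Z)"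
  unfolding lin_def by (simp add: algebra_simps)

lemma lin_zero: "lin (\<lambda>Z. 0)"
  unfolding lin_def by simp

text \<open>The sum of \<open>F (ncmono u) * G (ncmono v)\<close> over all decompositions \<open>u @ [True] @ v\<close> of the word, that
  is, over all occurrences of the second variable.\<close>

fun split_word :: "(ncpoly \<Rightarrow> real) \<Rightarrow> (ncpoly \<Rightarrow> real) \<Rightarrow> bool list \<Rightarrow> real" where
  "split_word F G [] = 0"
| "split_word F G (b # w) = (if b then F 1 * G (ncmono w) else 0) + split_word (\<lambda>Z. F (ncvar b * Z)) G w"

text \<open>The linear extension of \<open>split_word\<close>: the functional \<open>F \<otimes> G\<close> applied to the free difference
  quotient of \<open>Q\<close> with respect to the second variable.\<close>

definition split_at :: "(ncpoly \<Rightarrow> real) \<Rightarrow> (ncpoly \<Rightarrow> real) \<Rightarrow> ncpoly \<Rightarrow> real" where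
  "split_at F G Q = (\<Sum>w\<in>Poly_Mapping.keys Q. Poly_Mapping.lookup Q w * split_word F G (letters w))"

lemma split_at_mono [simp]: "split_at F G (ncmono w) = split_word F G w"
  by (simp add: split_at_def ncmono_def)

lemma lin_split_at: "lin (split_at F G)"
  unfolding lin_def
proof (intro conjI allI)
  show "split_at F G (p + q) = split_at F G p + split_at F G q" for p q
    unfolding split_at_def by (rule setsum_keys_plus_distrib) (simp_all add: algebra_simps)
  fix c p
  have l: "Poly_Mapping.lookup (ncconst c * p) w = c * Poly_Mapping.lookup p w" for w
  proof -
    have "ncconst c * p = Poly_Mapping.map ((*) c) p"
      by (simp add: mult_map_scale_conv_mult ncconst_def)
    then show ?thesis by (simp add: map.rep_eq when_def)
  qed
  have "split_at F G (ncconst c * p) = (\<Sum>w\<in>Poly_Mapping.keys p. Poly_Mapping.lookup (ncconst c * p) w * split_word F G (letters w))"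
    unfolding split_at_def by (rule sum.mono_neutral_left) (auto simp: in_keys_iff l)
  then show "split_at F G (ncconst c * p) = c * split_at F G p"
    by (simp add: l split_at_def sum_distrib_left mult.assoc)
qed

lemma split_word_add: "split_word (\<lambda>Z. F Z + F' Z) G w = split_word F G w + split_word F' G w"
  by (induction w arbitrary: F F') (simp_all add: algebra_simps)

lemma split_word_scale: "split_word (\<lambda>Z. c * F Z) G w = c * split_word F G w"
  by (induction w arbitrary: F) (simp_all add: algebra_simps)

lemma split_word_lin_right:
  assumes "\<And>Z. lin (\<lambda>Q. G Q Z)"
  shows "lin (\<lambda>Q. split_word F (G Q) w)"
proof (induction w arbitrary: F)
  case (Cons b w)
  then show ?case
    by (cases b) (auto intro!: lin_plus lin_cmult assms simp: lin_zero)
qed (simp add: lin_zero)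

lemma split_word_append:
  "split_word F G (u @ v) = split_word F (\<lambda>Z. G (Z * ncmono v)) u + split_word (\<lambda>Z. F (ncmono u * Z)) G v"
  by (induction u arbitrary: F) (simp_all add: ncmono_append ncmono_Cons mult.assoc)

text \<open>The Leibniz rule for the free difference quotient.\<close>

lemma split_at_mult:
  assumes F: "lin F" and G: "lin G"
  shows "split_at F G (P * Q) = split_at F (\<lambda>Z. G (Z * Q)) P + split_at (\<lambda>Z. F (P * Z)) G Q"
proof -
  have words: "split_at F G (ncmono u * Q) = split_at F (\<lambda>Z. G (Z * Q)) (ncmono u) + split_at (\<lambda>Z. F (ncmono u * Z)) G Q" for u
  proof (rule lin_eqI[where Q = Q])
    show "lin (\<lambda>Q. split_at F G (ncmono u * Q))" by (rule lin_left[OF lin_split_at])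
    have "lin (\<lambda>Q. split_word F (\<lambda>Z. G (Z * Q)) u)"
      by (rule split_word_lin_right[OF lin_left[OF G]])
    then show "lin (\<lambda>Q. split_at F (\<lambda>Z. G (Z * Q)) (ncmono u) + split_at (\<lambda>Z. F (ncmono u * Z)) G Q)"
      by (simp only: split_at_mono) (rule lin_plus[OF _ lin_split_at])
  qed (simp add: ncmono_append[symmetric] split_word_append)
  show ?thesis
  proof (rule lin_eqI[where Q = P])
    show "lin (\<lambda>P. split_at F G (P * Q))" by (rule lin_right[OF lin_split_at])
    have "lin (\<lambda>P. split_at (\<lambda>Z. F (P * Z)) G Q)"
      unfolding lin_def split_at_def
      by (simp add: distrib_right mult.assoc lin_add[OF F] lin_scale[OF F] split_word_add split_word_scale
          sum.distrib algebra_simps sum_distrib_left)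
    then show "lin (\<lambda>P. split_at F (\<lambda>Z. G (Z * Q)) P + split_at (\<lambda>Z. F (P * Z)) G Q)"
      by (rule lin_plus[OF lin_split_at])
  qed (rule words)
qed

lemma split_word_replicate_False: "split_word F G (replicate k False) = 0"
  by (induction k arbitrary: F) simp_all

lemma split_word_replicate_True:
  "split_word F G (replicate k True) = (\<Sum>i<k. F (ncvar True ^ i) * G (ncvar True ^ (k - 1 - i)))"
proof (induction k arbitrary: F)
  case (Suc k)
  have "(\<Sum>i<Suc k. F (ncvar True ^ i) * G (ncvar True ^ (Suc k - 1 - i))) =
     F 1 * G (ncvar True ^ k) + (\<Sum>i<k. F (ncvar True ^ Suc i) * G (ncvar True ^ (k - 1 - i)))"
    by (subst sum.lessThan_Suc_shift) simp
  then show ?case using Suc[of "\<lambda>Z. F (ncvar True * Z)"] by (simp add: ncvar_power)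
qed simp

lemma nc_eval_bound:
  assumes "degree p \<le> N"
  shows "nc_eval p X = (\<Sum>i\<le>N. ncconst (coeff p i) * X ^ i)"
  unfolding nc_eval_def
  by (rule sum.mono_neutral_left) (use assms in \<open>auto simp: coeff_eq_0\<close>)

lemma nc_eval_pCons: "nc_eval (pCons a p) X = ncconst a + X * nc_eval p X"
proof -
  have "nc_eval (pCons a p) X = (\<Sum>i\<le>Suc (degree p). ncconst (coeff (pCons a p) i) * X ^ i)"
    by (rule nc_eval_bound) (rule degree_pCons_le)
  also have "\<dots> = ncconst a + (\<Sum>i\<le>degree p. ncconst (coeff p i) * (X * X ^ i))"
    by (subst sum.atMost_Suc_shift) simp
  also have "(\<Sum>i\<le>degree p. ncconst (coeff p i) * (X * X ^ i)) = X * nc_eval p X"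
    unfolding nc_eval_def sum_distrib_left
    by (intro sum.cong refl) (rule ncconst_left_commute[symmetric])
  finally show ?thesis .
qed

lemma nc_eval_0 [simp]: "nc_eval 0 X = 0" by (simp add: nc_eval_def)

lemma nc_eval_const: "nc_eval [:a:] X = ncconst a" by (simp add: nc_eval_pCons)

lemma nc_eval_add: "nc_eval (p + q) X = nc_eval p X + nc_eval q X"
proof -
  let ?N = "max (degree p) (degree q)"
  have "nc_eval (p + q) X = (\<Sum>i\<le>?N. ncconst (coeff (p + q) i) * X ^ i)"
    by (rule nc_eval_bound) (rule degree_add_le_max)
  then show ?thesis
    using nc_eval_bound[of p ?N X] nc_eval_bound[of q ?N X]
    by (simp add: ncconst_add distrib_right sum.distrib)
qed

lemma nc_eval_monom: "nc_eval (monom 1 k) X = X ^ k"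
  by (induction k) (simp_all add: monom_0 monom_Suc nc_eval_pCons nc_eval_const)

section \<open>Free pairs with a semicircular variable\<close>

text \<open>The lists to which freeness applies, in a form suited to induction.\<close>

fun alternating_centred :: "(ncpoly \<Rightarrow> real) \<Rightarrow> (bool \<times> real poly) list \<Rightarrow> bool" where
  "alternating_centred \<phi> [] \<longleftrightarrow> True"
| "alternating_centred \<phi> (x # ps) \<longleftrightarrow> \<phi> (nc_eval (snd x) (ncvar (fst x))) = 0 \<and> (ps = [] \<or> fst (hd ps) \<noteq> fst x) \<and> alternating_centred \<phi> ps"

definition word_eval :: "(bool \<times> real poly) list \<Rightarrow> ncpoly" where
  "word_eval ps = prod_list (map (\<lambda>(b, p). nc_eval p (ncvar b)) ps)"

lemma word_eval_Nil [simp]: "word_eval [] = 1" and word_eval_Cons: "word_eval ((b, p) # ps) = nc_eval p (ncvar b) * word_eval ps"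
  and word_eval_append: "word_eval (ps @ qs) = word_eval ps * word_eval qs"
  by (simp_all add: word_eval_def)

lemma alternating_centred_nth:
  "alternating_centred \<phi> ps \<Longrightarrow> Suc k < length ps \<Longrightarrow> fst (ps ! k) \<noteq> fst (ps ! Suc k)"
proof (induction ps arbitrary: k)
  case (Cons x ps)
  then show ?case by (cases k; cases ps) auto
qed simp

lemma alternating_centred_set: "alternating_centred \<phi> ps \<Longrightarrow> x \<in> set ps \<Longrightarrow> \<phi> (nc_eval (snd x) (ncvar (fst x))) = 0"
  by (induction ps) auto

lemma alternating_centred_append:
  "alternating_centred \<phi> (ps @ [x]) \<longleftrightarrow> alternating_centred \<phi> ps \<and> (ps = [] \<or> fst (last ps) \<noteq> fst x) \<and> \<phi> (nc_eval (snd x) (ncvar (fst x))) = 0"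
proof (induction ps)
  case (Cons y ps)
  then show ?case by (cases ps) auto
qed auto

context
  fixes \<phi> :: "ncpoly \<Rightarrow> real" and s :: real
  assumes uni: "unital_functional \<phi>" and free: "free_vars \<phi>"
begin

lemma lin_phi: "lin \<phi>" using uni by (simp add: unital_functional_def lin_def)

lemma phi_1 [simp]: "\<phi> 1 = 1" using uni by (simp add: unital_functional_def)

lemma phi_const [simp]: "\<phi> (ncconst c) = c"
  using lin_scale[OF lin_phi, of c 1] by simp

lemma alternating_centred_zero:
  assumes "alternating_centred \<phi> ps" "ps \<noteq> []"
  shows "\<phi> (word_eval ps) = 0"
  using free assms alternating_centred_nth[OF assms(1)] alternating_centred_set[OF assms(1)]
  unfolding free_vars_def word_eval_def by (auto simp: case_prod_beta)

definition centre :: "bool \<Rightarrow> real poly \<Rightarrow> real poly" where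
  "centre b q = q + [:- \<phi> (nc_eval q (ncvar b)):]"

lemma nc_eval_centre: "nc_eval q (ncvar b) = nc_eval (centre b q) (ncvar b) + ncconst (\<phi> (nc_eval q (ncvar b)))"
  by (simp add: centre_def nc_eval_add nc_eval_const ncconst_add[symmetric] add.assoc)

lemma phi_centre: "\<phi> (nc_eval (centre b q) (ncvar b)) = 0"
  by (simp add: centre_def nc_eval_add nc_eval_const lin_add[OF lin_phi])

lemma phi_factor_left:
  assumes "alternating_centred \<phi> ps" "ps = [] \<or> fst (hd ps) \<noteq> b"
  shows "\<phi> (nc_eval q (ncvar b) * word_eval ps) = \<phi> (nc_eval q (ncvar b)) * \<phi> (word_eval ps)"
proof -
  have "alternating_centred \<phi> ((b, centre b q) # ps)" using assms phi_centre by auto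
  then have "\<phi> (nc_eval (centre b q) (ncvar b) * word_eval ps) = 0"
    using alternating_centred_zero[of "(b, centre b q) # ps"] by (simp add: word_eval_Cons)
  then show ?thesis
    by (subst nc_eval_centre) (simp add: distrib_right lin_add[OF lin_phi] lin_scale[OF lin_phi])
qed

text \<open>Centring \<open>c (S)\<close> leaves an alternating product to the right of \<open>p (X)\<close>, which freeness annihilates
  also after multiplication by \<open>p (X)\<close>.\<close>

lemma phi_factor_middle:
  assumes "alternating_centred \<phi> ps" "ps = [] \<or> fst (hd ps) \<noteq> True"
  shows "\<phi> (nc_eval p (ncvar False) * (nc_eval c (ncvar True) * word_eval ps)) =
    \<phi> (nc_eval c (ncvar True)) * \<phi> (nc_eval p (ncvar False) * word_eval ps)"
proof -
  have a: "alternating_centred \<phi> ((True, centre True c) # ps)" using assms phi_centre by auto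
  then have "\<phi> (nc_eval p (ncvar False) * word_eval ((True, centre True c) # ps)) = 0"
    by (subst phi_factor_left) (simp_all add: alternating_centred_zero)
  then have z: "\<phi> (nc_eval p (ncvar False) * (nc_eval (centre True c) (ncvar True) * word_eval ps)) = 0"
    by (simp add: word_eval_Cons)
  have "\<phi> (nc_eval p (ncvar False) * (ncconst d * word_eval ps)) = d * \<phi> (nc_eval p (ncvar False) * word_eval ps)" for d
    by (rule lin_scale[OF lin_left[OF lin_phi]])
  then show ?thesis
    by (subst nc_eval_centre) (simp add: distrib_right distrib_left lin_add[OF lin_phi] z)
qed

lemma split_at_nc_eval:
  assumes "lin G"
  shows "split_at F G (nc_eval q (ncvar b)) =
    (if b then (\<Sum>k\<le>degree q. coeff q k * (\<Sum>i<k. F (ncvar True ^ i) * G (ncvar True ^ (k - 1 - i)))) else 0)"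
  unfolding nc_eval_def lin_sum[OF lin_split_at] lin_scale[OF lin_split_at] ncvar_power split_at_mono
  by (cases b) (simp_all add: split_word_replicate_False split_word_replicate_True ncvar_power)

text \<open>Splitting at a letter of a later factor leaves to its left an alternating centred product
  followed by a power of the second variable. This power is a centred element plus a constant, which
  gives two alternating centred products, and \<open>\<phi>\<close> vanishes on both.\<close>

lemma split_at_vanish:
  assumes "alternating_centred \<phi> (us @ rs)" "us \<noteq> []" "lin G"
  shows "split_at (\<lambda>Z. \<phi> (word_eval us * Z)) G (word_eval rs) = 0"
  using assms
proof (induction rs arbitrary: us G)
  case Nil
  then show ?case using split_at_mono[of _ G "[]"] by simp
next
  case (Cons r rs)
  obtain b q where r: "r = (b, q)" by (cases r)
  have a: "alternating_centred \<phi> us \<and> (us = [] \<or> fst (last us) \<noteq> b)"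
  proof -
    have "alternating_centred \<phi> ((us @ [r]) @ rs') \<Longrightarrow> alternating_centred \<phi> (us @ [r])" for rs'
    proof (induction rs' rule: rev_induct)
      case (snoc x xs)
      then show ?case using alternating_centred_append[of \<phi> "(us @ [r]) @ xs" x] by simp
    qed simp
    then show ?thesis using Cons.prems(1) alternating_centred_append[of \<phi> us r] r by simp
  qed
  have v: "\<phi> (word_eval us * ncvar b ^ i) = 0" for i
  proof -
    let ?q = "monom 1 i"
    have "alternating_centred \<phi> (us @ [(b, centre b ?q)])" using a by (simp add: alternating_centred_append phi_centre)
    then have "\<phi> (word_eval us * nc_eval (centre b ?q) (ncvar b)) = 0"
      using alternating_centred_zero[of "us @ [(b, centre b ?q)]"] by (simp add: word_eval_append word_eval_Cons)
    moreover have "\<phi> (word_eval us * ncconst d) = 0" for d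
      using a Cons.prems(2) by (simp add: ncconst_commute[symmetric] lin_scale[OF lin_phi] alternating_centred_zero)
    ultimately have "\<phi> (word_eval us * nc_eval ?q (ncvar b)) = 0"
      by (subst nc_eval_centre) (simp add: distrib_left lin_add[OF lin_phi])
    then show ?thesis by (simp add: nc_eval_monom)
  qed
  have "split_at (\<lambda>Z. \<phi> (word_eval us * Z)) G (word_eval (r # rs)) =
     split_at (\<lambda>Z. \<phi> (word_eval us * Z)) (\<lambda>Z. G (Z * word_eval rs)) (nc_eval q (ncvar b)) +
     split_at (\<lambda>Z. \<phi> (word_eval us * (nc_eval q (ncvar b) * Z))) G (word_eval rs)"
    unfolding r word_eval_Cons by (rule split_at_mult[OF lin_left[OF lin_phi] Cons.prems(3)])
  also have "split_at (\<lambda>Z. \<phi> (word_eval us * Z)) (\<lambda>Z. G (Z * word_eval rs)) (nc_eval q (ncvar b)) = 0"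
    unfolding split_at_nc_eval[OF lin_right[OF Cons.prems(3)]] using v by (cases b) simp_all
  also have "split_at (\<lambda>Z. \<phi> (word_eval us * (nc_eval q (ncvar b) * Z))) G (word_eval rs) = 0"
    using Cons.IH[of "us @ [r]" G] Cons.prems r by (simp add: word_eval_append word_eval_Cons mult.assoc)
  finally show ?case by simp
qed

inductive alt_span :: "ncpoly \<Rightarrow> bool" where
  base: "alternating_centred \<phi> ps \<Longrightarrow> alt_span (word_eval ps)"
| plus: "alt_span p \<Longrightarrow> alt_span q \<Longrightarrow> alt_span (p + q)"
| scale: "alt_span p \<Longrightarrow> alt_span (ncconst c * p)"

lemma alt_span_eval_mult:
  assumes "alternating_centred \<phi> ps" "ps = [] \<or> fst (hd ps) \<noteq> b"
  shows "alt_span (nc_eval q (ncvar b) * word_eval ps)"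
proof -
  have "alternating_centred \<phi> ((b, centre b q) # ps)" using assms phi_centre by auto
  then have "alt_span (nc_eval (centre b q) (ncvar b) * word_eval ps)"
    using alt_span.base[of "(b, centre b q) # ps"] by (simp add: word_eval_Cons)
  moreover have "alt_span (ncconst d * word_eval ps)" for d using assms by (intro alt_span.scale alt_span.base)
  ultimately show ?thesis
    by (subst nc_eval_centre) (simp add: distrib_right alt_span.plus)
qed

lemma alt_span_ncvar_mult: "alt_span Q \<Longrightarrow> alt_span (ncvar b * Q)"
proof (induction rule: alt_span.induct)
  case (base ps)
  show ?case
  proof (cases "ps = [] \<or> fst (hd ps) \<noteq> b")
    case True
    have "nc_eval (monom 1 1) (ncvar b) = ncvar b" unfolding nc_eval_monom by simp
    with alt_span_eval_mult[OF base True, of "monom 1 1"] show ?thesis by simp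
  next
    case False
    then obtain q rs where ps: "ps = (b, q) # rs" by (cases ps) auto
    have "alt_span (nc_eval (pCons 0 q) (ncvar b) * word_eval rs)"
      by (rule alt_span_eval_mult) (use base ps in auto)
    then show ?thesis by (simp add: ps word_eval_Cons nc_eval_pCons mult.assoc)
  qed
next
  case (plus p q)
  then show ?case by (simp add: distrib_left alt_span.plus)
next
  case (scale p c)
  have "ncvar b * (ncconst c * p) = ncconst c * (ncvar b * p)" by (rule ncconst_left_commute)
  with scale show ?case by (simp add: alt_span.scale)
qed

text \<open>Multiplication by a variable either merges with the first factor or adds a new one, and centring
  the modified factor produces one further alternating product. So every word is in the span.\<close>

lemma alt_span_all: "alt_span Q"
proof (induction Q rule: ncpoly_induct)
  case (word w)
  show ?case
  proof (induction w)
    case Nil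
    then show ?case using alt_span.base[of "[]"] by simp
  next
    case (Cons b w)
    then show ?case by (simp add: ncmono_Cons alt_span_ncvar_mult)
  qed
qed (auto intro: alt_span.intros)

text \<open>The semicircle law, with \<open>p (X)\<close> a spectator on the left. Both sides are linear in \<open>Q\<close>, so it is
  enough to treat alternating centred products. On those which begin with a factor \<open>q (S)\<close> both sides
  reduce to the one-variable identity \<open>sc\<close> for the moments of \<open>S\<close>; on the others both sides vanish.\<close>

lemma schwinger_dyson:
  assumes sc: "\<And>k. \<phi> (ncvar True ^ Suc k) = s * (\<Sum>i<k. \<phi> (ncvar True ^ i) * \<phi> (ncvar True ^ (k - 1 - i)))"
  shows "\<phi> (nc_eval p (ncvar False) * (ncvar True * Q)) = s * split_at \<phi> (\<lambda>Z. \<phi> (nc_eval p (ncvar False) * Z)) Q"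
proof -
  let ?X = "nc_eval p (ncvar False)"
  let ?L = "\<lambda>Q. \<phi> (?X * (ncvar True * Q))" and ?R = "\<lambda>Q. s * split_at \<phi> (\<lambda>Z. \<phi> (?X * Z)) Q"
  have linL: "lin ?L" using lin_left[OF lin_left[OF lin_phi, of ?X], of "ncvar True"] by simp
  have linR: "lin ?R" by (rule lin_cmult[OF lin_split_at])
  have linG: "lin (\<lambda>Z. \<phi> (?X * Z))" by (rule lin_left[OF lin_phi])
  have phiS: "\<phi> (ncvar True) = 0" using sc[of 0] by simp
  have S1: "nc_eval (monom 1 1) (ncvar True) = ncvar True" unfolding nc_eval_monom by simp
  have base: "?L (word_eval ps) = ?R (word_eval ps)" if ps: "alternating_centred \<phi> ps" for ps
  proof (cases "ps = [] \<or> fst (hd ps) \<noteq> True")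
    case True
    have "?L (word_eval ps) = 0"
      using phi_factor_middle[OF ps True, of p "monom 1 1"] by (simp only: S1 phiS mult_zero_left)
    moreover have "split_at \<phi> (\<lambda>Z. \<phi> (?X * Z)) (word_eval ps) = 0"
    proof (cases ps)
      case Nil
      then show ?thesis using split_at_mono[of _ _ "[]"] by simp
    next
      case (Cons x rs)
      then obtain q where x: "ps = (False, q) # rs" using True by (cases x) auto
      have "split_at \<phi> (\<lambda>Z. \<phi> (?X * Z)) (word_eval ps) =
        split_at \<phi> (\<lambda>Z. \<phi> (?X * (Z * word_eval rs))) (nc_eval q (ncvar False)) +
        split_at (\<lambda>Z. \<phi> (nc_eval q (ncvar False) * Z)) (\<lambda>Z. \<phi> (?X * Z)) (word_eval rs)"
        unfolding x word_eval_Cons by (rule split_at_mult[OF lin_phi linG])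
      also have "split_at \<phi> (\<lambda>Z. \<phi> (?X * (Z * word_eval rs))) (nc_eval q (ncvar False)) = 0"
        by (subst split_at_nc_eval[OF lin_right[OF linG]]) simp
      also have "split_at (\<lambda>Z. \<phi> (nc_eval q (ncvar False) * Z)) (\<lambda>Z. \<phi> (?X * Z)) (word_eval rs) = 0"
        using split_at_vanish[of "[(False, q)]" rs, OF _ _ linG] ps x by (simp add: word_eval_Cons)
      finally show ?thesis by simp
    qed
    ultimately show ?thesis by simp
  next
    case False
    then obtain q rs where x: "ps = (True, q) # rs" by (cases ps) auto
    have rs: "alternating_centred \<phi> rs" "rs = [] \<or> fst (hd rs) \<noteq> True" using ps x by auto
    have "?L (word_eval ps) = \<phi> (?X * (nc_eval (pCons 0 q) (ncvar True) * word_eval rs))"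
      by (simp add: x word_eval_Cons nc_eval_pCons mult.assoc)
    also have "\<dots> = \<phi> (nc_eval (pCons 0 q) (ncvar True)) * \<phi> (?X * word_eval rs)"
      by (rule phi_factor_middle[OF rs])
    also have "\<phi> (nc_eval (pCons 0 q) (ncvar True)) = (\<Sum>k\<le>degree q. coeff q k * \<phi> (ncvar True ^ Suc k))"
    proof -
      have "nc_eval (pCons 0 q) (ncvar True) = ncvar True * nc_eval q (ncvar True)"
        by (simp add: nc_eval_pCons)
      also have "\<dots> = (\<Sum>k\<le>degree q. ncconst (coeff q k) * ncvar True ^ Suc k)"
        unfolding nc_eval_def sum_distrib_left by (simp add: ncconst_left_commute)
      finally have "nc_eval (pCons 0 q) (ncvar True) = (\<Sum>k\<le>degree q. ncconst (coeff q k) * ncvar True ^ Suc k)" .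
      then show ?thesis by (simp only: lin_sum[OF lin_phi] lin_scale[OF lin_phi])
    qed
    finally have L: "?L (word_eval ps) = (\<Sum>k\<le>degree q. coeff q k * \<phi> (ncvar True ^ Suc k)) * \<phi> (?X * word_eval rs)" .
    have G: "\<phi> (?X * (ncvar True ^ j * word_eval rs)) = \<phi> (ncvar True ^ j) * \<phi> (?X * word_eval rs)" for j
      using phi_factor_middle[OF rs, of p "monom 1 j"] by (simp add: nc_eval_monom)
    have "split_at \<phi> (\<lambda>Z. \<phi> (?X * Z)) (word_eval ps) =
        split_at \<phi> (\<lambda>Z. \<phi> (?X * (Z * word_eval rs))) (nc_eval q (ncvar True)) +
        split_at (\<lambda>Z. \<phi> (nc_eval q (ncvar True) * Z)) (\<lambda>Z. \<phi> (?X * Z)) (word_eval rs)"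
      unfolding x word_eval_Cons by (rule split_at_mult[OF lin_phi linG])
    also have "split_at (\<lambda>Z. \<phi> (nc_eval q (ncvar True) * Z)) (\<lambda>Z. \<phi> (?X * Z)) (word_eval rs) = 0"
      using split_at_vanish[of "[(True, q)]" rs, OF _ _ linG] ps x by (simp add: word_eval_Cons)
    also have "split_at \<phi> (\<lambda>Z. \<phi> (?X * (Z * word_eval rs))) (nc_eval q (ncvar True)) =
      (\<Sum>k\<le>degree q. coeff q k * (\<Sum>i<k. \<phi> (ncvar True ^ i) * \<phi> (ncvar True ^ (k - 1 - i)))) * \<phi> (?X * word_eval rs)"
      by (subst split_at_nc_eval[OF lin_right[OF linG]]) (simp add: G sum_distrib_right mult.assoc)
    finally have "?R (word_eval ps) = (\<Sum>k\<le>degree q. coeff q k * (s * (\<Sum>i<k. \<phi> (ncvar True ^ i) * \<phi> (ncvar True ^ (k - 1 - i))))) * \<phi> (?X * word_eval rs)"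
      by (simp add: sum_distrib_left sum_distrib_right mult_ac)
    then show ?thesis unfolding L sc by (rule sym)
  qed
  have "?L Q = ?R Q" using alt_span_all[of Q]
  proof (induction rule: alt_span.induct)
    case (plus p q)
    then show ?case by (simp only: lin_add[OF linL] lin_add[OF linR])
  next
    case (scale p c)
    then show ?case by (simp only: lin_scale[OF linL] lin_scale[OF linR])
  qed (rule base)
  then show ?thesis .
qed

lemma split_at_sum_power:
  assumes "lin F" "lin G"
  shows "split_at F G ((ncvar False + ncvar True) ^ k) =
    (\<Sum>i<k. F ((ncvar False + ncvar True) ^ i) * G ((ncvar False + ncvar True) ^ (k - 1 - i)))"
  using assms
proof (induction k arbitrary: F)
  case 0
  then show ?case using split_at_mono[of F G "[]"] by simp
next
  case (Suc k)
  let ?a = "ncvar False + ncvar True"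
  have 1: "split_at F G' ?a = F 1 * G' 1" for G'
  proof -
    have "split_at F G' ?a = split_at F G' (ncmono [False]) + split_at F G' (ncmono [True])"
      by (simp add: lin_add[OF lin_split_at] ncmono_Cons del: split_at_mono)
    then show ?thesis by simp
  qed
  have "split_at F G (?a * ?a ^ k) = split_at F (\<lambda>Z. G (Z * ?a ^ k)) ?a + split_at (\<lambda>Z. F (?a * Z)) G (?a ^ k)"
    by (rule split_at_mult[OF Suc.prems])
  also have "\<dots> = F 1 * G (?a ^ k) + (\<Sum>i<k. F (?a * ?a ^ i) * G (?a ^ (k - 1 - i)))"
    unfolding 1 Suc.IH[OF lin_left[OF Suc.prems(1)] Suc.prems(2)] by simp
  also have "\<dots> = (\<Sum>i<Suc k. F (?a ^ i) * G (?a ^ (Suc k - 1 - i)))"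
    by (subst sum.lessThan_Suc_shift) simp
  finally show ?case by simp
qed

text \<open>Write one factor \<open>a\<close> as \<open>X + S\<close> and apply the Schwinger-Dyson equation to \<open>S\<close>.\<close>

lemma mixed_moment_recursion:
  assumes sc: "\<And>k. \<phi> (ncvar True ^ Suc k) = s * (\<Sum>i<k. \<phi> (ncvar True ^ i) * \<phi> (ncvar True ^ (k - 1 - i)))"
  defines "a \<equiv> ncvar False + ncvar True"
  shows "\<phi> (ncvar False ^ K * a ^ Suc k) = \<phi> (ncvar False ^ Suc K * a ^ k) +
     s * (\<Sum>i<k. \<phi> (a ^ i) * \<phi> (ncvar False ^ K * a ^ (k - 1 - i)))"
proof -
  have "ncvar False ^ K * a ^ Suc k = ncvar False ^ K * ((ncvar False + ncvar True) * a ^ k)"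
    by (simp add: a_def)
  also have "\<dots> = ncvar False ^ Suc K * a ^ k + ncvar False ^ K * (ncvar True * a ^ k)"
    by (simp only: distrib_left distrib_right power_Suc2 mult.assoc)
  finally have "\<phi> (ncvar False ^ K * a ^ Suc k) = \<phi> (ncvar False ^ Suc K * a ^ k) + \<phi> (ncvar False ^ K * (ncvar True * a ^ k))"
    by (simp only: lin_add[OF lin_phi])
  also have "\<phi> (ncvar False ^ K * (ncvar True * a ^ k)) =
     s * split_at \<phi> (\<lambda>Z. \<phi> (ncvar False ^ K * Z)) (a ^ k)"
    using schwinger_dyson[OF sc, of "monom 1 K" "a ^ k"] by (simp add: nc_eval_monom)
  finally show ?thesis
    unfolding a_def using split_at_sum_power[OF lin_phi lin_left[OF lin_phi]] by simp
qed

end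

section \<open>Moments of the semicircle law\<close>

lemma sum_weight_symmetric:
  fixes x :: "nat \<Rightarrow> real"
  shows "(\<Sum>i\<le>N. real i * (x i * x (N - i))) = real N / 2 * (\<Sum>i\<le>N. x i * x (N - i))"
proof -
  have "(\<Sum>i\<le>N. real i * (x i * x (N - i))) = (\<Sum>i\<le>N. real (N - i) * (x (N - i) * x (N - (N - i))))"
    by (rule sum.reindex_bij_witness[of _ "\<lambda>i. N - i" "\<lambda>i. N - i"]) auto
  also have "\<dots> = (\<Sum>i\<le>N. (real N - real i) * (x i * x (N - i)))"
    by (intro sum.cong refl) (auto simp: of_nat_diff)
  also have "\<dots> = real N * (\<Sum>i\<le>N. x i * x (N - i)) - (\<Sum>i\<le>N. real i * (x i * x (N - i)))"
    by (simp add: left_diff_distrib sum_subtractf sum_distrib_left)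
  finally show ?thesis by simp
qed

text \<open>By induction: reflecting the summation index turns the weight \<open>i\<close> in the convolution into \<open>N / 2\<close>,
  which makes the two-term recursion applicable inside the convolution.\<close>

lemma catalan_convolution:
  fixes m :: "nat \<Rightarrow> real"
  assumes m: "m 0 = 1" "m 1 = 0" "\<And>k. (real k + 4) * m (k + 2) = 4 * s * (real k + 1) * m k"
  shows "m (k + 2) = s * (\<Sum>i\<le>k. m i * m (k - i))"
proof (induction k rule: less_induct)
  case (less k)
  show ?case
  proof (cases "k < 2")
    case True
    then consider "k = 0" | "k = 1" by linarith
    then show ?thesis
    proof cases
      case 1
      then show ?thesis using m(3)[of 0] m(1) by simp
    next
      case 2
      then show ?thesis using m(3)[of 1] m(1,2) by simp
    qed
  next
    case False
    then obtain N where k: "k = N + 2" by (metis add.commute le_Suc_ex not_less)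
    let ?S = "\<lambda>N. \<Sum>i\<le>N. m i * m (N - i)"
    have IH: "m (N + 2) = s * ?S N" using less k by simp
    have "(\<Sum>i\<le>N + 2. (real i + 2) * (m i * m (N + 2 - i))) = (real (N + 2) / 2 + 2) * ?S (N + 2)"
      by (simp add: distrib_right sum.distrib sum_weight_symmetric sum_distrib_left)
    moreover have "(\<Sum>i\<le>N + 2. (real i + 2) * (m i * m (N + 2 - i))) =
        2 * m (N + 2) + (\<Sum>i\<le>N. (real i + 4) * m (i + 2) * m (N - i))"
      using m(1,2) by (simp add: sum.atMost_Suc_shift numeral_2_eq_2 algebra_simps del: sum.atMost_Suc)
    moreover have "(\<Sum>i\<le>N. (real i + 4) * m (i + 2) * m (N - i)) = 4 * s * (\<Sum>i\<le>N. (real i + 1) * (m i * m (N - i)))"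
      unfolding m(3) by (simp add: sum_distrib_left algebra_simps)
    moreover have "(\<Sum>i\<le>N. (real i + 1) * (m i * m (N - i))) = (real N / 2 + 1) * ?S N"
      by (simp add: distrib_right sum.distrib sum_weight_symmetric sum_distrib_left)
    ultimately have "(real (N + 2) / 2 + 2) * ?S (N + 2) = 2 * m (N + 2) + 4 * (real N / 2 + 1) * (s * ?S N)"
      by (simp add: mult_ac)
    also have "\<dots> = (2 * real N + 6) * m (N + 2)" unfolding IH[symmetric] by (simp add: algebra_simps)
    finally have S: "(real N + 6) * ?S (N + 2) = 4 * (real N + 3) * m (N + 2)"
      by (simp add: field_simps)
    have "(real N + 6) * m (k + 2) = s * (4 * (real N + 3) * m (N + 2))"
      using m(3)[of k] k by (simp add: algebra_simps)
    also have "\<dots> = (real N + 6) * (s * ?S k)" unfolding S[symmetric] k by (simp add: algebra_simps)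
    finally show ?thesis by simp
  qed
qed

lemma semicircle_moments_integral:
  assumes s: "s > 0"
  defines "r \<equiv> 2 * sqrt s"
  shows "(LINT x|semicircle s. x ^ k) = integral {-r..r} (\<lambda>x. x ^ k * sqrt (4 * s - x\<^sup>2)) / (2 * pi * s)"
proof -
  let ?f = "\<lambda>x :: real. x ^ k * sqrt (4 * s - x\<^sup>2)"
  have r2: "r\<^sup>2 = 4 * s" "r > 0" using s by (auto simp: r_def power_mult_distrib)
  have sq: "x\<^sup>2 \<le> 4 * s \<longleftrightarrow> x \<in> {-r..r}" for x
    using abs_le_square_iff[of x r] r2 by auto
  have "(LINT x|semicircle s. x ^ k) = (LINT x|lborel. (sqrt (max 0 (4 * s - x\<^sup>2)) / (2 * pi * s)) *\<^sub>R x ^ k)"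
    unfolding semicircle_def using s by (subst integral_density) auto
  also have "\<dots> = (LINT x|lborel. indicator {-r..r} x *\<^sub>R ?f x / (2 * pi * s))"
  proof (rule Bochner_Integration.integral_cong[OF refl])
    fix x :: real
    show "(sqrt (max 0 (4 * s - x\<^sup>2)) / (2 * pi * s)) *\<^sub>R x ^ k = indicator {-r..r} x *\<^sub>R ?f x / (2 * pi * s)"
      using sq[of x] by (cases "x\<^sup>2 \<le> 4 * s") (auto simp: max_def)
  qed
  also have "\<dots> = (LINT x:{-r..r}|lborel. ?f x) / (2 * pi * s)"
    unfolding set_lebesgue_integral_def by (rule integral_divide_zero)
  also have "(LINT x:{-r..r}|lborel. ?f x) = integral {-r..r} ?f"
  proof (rule set_borel_integral_eq_integral(2))
    show "set_integrable lborel {-r..r} ?f"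
      unfolding set_integrable_def
      by (rule borel_integrable_compact) (auto intro!: continuous_intros)
  qed
  finally show ?thesis .
qed

text \<open>Integrate the derivative of \<open>x ^ k * (4 * s - x\<^sup>2) powr (3 / 2)\<close>, which vanishes at both end
  points.\<close>

lemma semicircle_moment_step:
  assumes s: "s > 0"
  defines "r \<equiv> 2 * sqrt s"
  defines "J \<equiv> \<lambda>k. integral {-r..r} (\<lambda>x. x ^ k * sqrt (4 * s - x\<^sup>2))"
  shows "J 1 = 0" "(real k + 4) * J (k + 2) = 4 * s * (real k + 1) * J k"
proof -
  have r2: "r\<^sup>2 = 4 * s" "r > 0" using s by (auto simp: r_def power_mult_distrib)
  let ?u = "\<lambda>x :: real. 4 * s - x\<^sup>2"
  have upos: "?u x > 0" if "x \<in> {-r<..<r}" for x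
  proof -
    have "\<bar>x\<bar>\<^sup>2 < r\<^sup>2" using that by (intro power_strict_mono) auto
    then show ?thesis using r2 by simp
  qed
  have J: "((\<lambda>x. x ^ k * sqrt (?u x)) has_integral J k) {-r..r}" for k
    unfolding J_def
    by (intro integrable_integral integrable_continuous_real) (auto intro!: continuous_intros)
  have ftc: "((\<lambda>x. real k * x ^ (k - 1) * (?u x * sqrt (?u x)) - 3 * (x ^ (k + 1) * sqrt (?u x))) has_integral 0) {-r..r}" for k
  proof -
    let ?F = "\<lambda>x. x ^ k * (?u x * sqrt (?u x))"
    have "((\<lambda>x. real k * x ^ (k - 1) * (?u x * sqrt (?u x)) - 3 * (x ^ (k + 1) * sqrt (?u x))) has_integral (?F r - ?F (-r))) {-r..r}"
    proof (rule fundamental_theorem_of_calculus_interior)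
      fix x assume x: "x \<in> {-r<..<r}"
      note u = upos[OF x]
      have du: "((\<lambda>x. ?u x) has_real_derivative (- (2 * x))) (at x)"
        by (auto intro!: derivative_eq_intros)
      have sd: "((\<lambda>x. sqrt (?u x)) has_real_derivative (- x / sqrt (?u x))) (at x)"
        by (rule DERIV_cong[OF DERIV_chain2[OF DERIV_real_sqrt[OF u] du]]) (simp add: inverse_eq_divide)
      have dd: "((\<lambda>x. ?u x * sqrt (?u x)) has_real_derivative (- 2 * x * sqrt (?u x) + ?u x * (- x / sqrt (?u x)))) (at x)"
        by (rule DERIV_cong[OF DERIV_mult[OF du sd]]) simp
      have eq: "- 2 * x * sqrt (?u x) + ?u x * (- x / sqrt (?u x)) = - 3 * x * sqrt (?u x)"
        using u real_div_sqrt[of "?u x"] by (simp add: field_simps)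
      have d: "((\<lambda>x. ?u x * sqrt (?u x)) has_real_derivative - 3 * x * sqrt (?u x)) (at x)"
        by (rule DERIV_cong[OF dd eq])
      have "(?F has_real_derivative real k * x ^ (k - 1) * (?u x * sqrt (?u x)) - 3 * (x ^ (k + 1) * sqrt (?u x))) (at x)"
        by (rule derivative_eq_intros d refl)+ (simp add: algebra_simps)
      then show "(?F has_vector_derivative real k * x ^ (k - 1) * (?u x * sqrt (?u x)) - 3 * (x ^ (k + 1) * sqrt (?u x))) (at x)"
        by (simp add: has_real_derivative_iff_has_vector_derivative)
    qed (use r2 in \<open>auto intro!: continuous_intros\<close>)
    moreover have "?F r - ?F (-r) = 0" using r2 by simp
    ultimately show ?thesis by (simp only:)
  qed
  have h1: "((\<lambda>x. - 3 * (x ^ 1 * sqrt (?u x))) has_integral - 3 * J 1) {-r..r}"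
    by (rule has_integral_mult_right[OF J])
  have e1: "(\<lambda>x. real 0 * x ^ (0 - 1) * (?u x * sqrt (?u x)) - 3 * (x ^ (0 + 1) * sqrt (?u x))) =
      (\<lambda>x. - 3 * (x ^ 1 * sqrt (?u x)))"
    by (intro ext) simp
  have "- 3 * J 1 = 0" by (rule has_integral_unique[OF h1 ftc[of 0, unfolded e1]])
  then show "J 1 = 0" by simp
  have h2: "((\<lambda>x. (real k + 1) * (4 * s * (x ^ k * sqrt (?u x)) - x ^ (k + 2) * sqrt (?u x)) - 3 * (x ^ (k + 2) * sqrt (?u x)))
     has_integral (real k + 1) * (4 * s * J k - J (k + 2)) - 3 * J (k + 2)) {-r..r}"
    by (intro has_integral_diff has_integral_mult_right J)
  have e2: "(\<lambda>x. real (k + 1) * x ^ (k + 1 - 1) * (?u x * sqrt (?u x)) - 3 * (x ^ (k + 1 + 1) * sqrt (?u x))) =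
     (\<lambda>x. (real k + 1) * (4 * s * (x ^ k * sqrt (?u x)) - x ^ (k + 2) * sqrt (?u x)) - 3 * (x ^ (k + 2) * sqrt (?u x)))"
    by (intro ext) (simp add: algebra_simps power2_eq_square)
  have "(real k + 1) * (4 * s * J k - J (k + 2)) - 3 * J (k + 2) = 0"
    by (rule has_integral_unique[OF h2 ftc[of "k + 1", unfolded e2]])
  then show "(real k + 4) * J (k + 2) = 4 * s * (real k + 1) * J k" by (simp add: algebra_simps)
qed

lemma semicircle_moments:
  assumes s: "s > 0" and c: "compactly_supported_law (semicircle s)"
  defines "m \<equiv> \<lambda>k. LINT x|semicircle s. x ^ k"
  shows "m (Suc k) = s * (\<Sum>i<k. m i * m (k - 1 - i))"
proof -
  interpret real_distribution "semicircle s" using c by (simp add: compactly_supported_law_def)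
  have 0: "m 0 = 1" unfolding m_def using prob_space by simp
  have 1: "m 1 = 0" "\<And>k. (real k + 4) * m (k + 2) = 4 * s * (real k + 1) * m k"
    using semicircle_moment_step[OF s] s unfolding m_def semicircle_moments_integral[OF s]
    by (simp_all add: field_simps)
  show ?thesis
  proof (cases k)
    case 0
    then show ?thesis using 1(1) by simp
  next
    case (Suc j)
    then show ?thesis using catalan_convolution[OF 0 1, of j] by (simp add: lessThan_Suc_atMost)
  qed
qed

section \<open>Resolvent expansions of bounded laws\<close>

text \<open>Otherwise \<open>norm (d K)\<close> would grow like \<open>norm w ^ K\<close>.\<close>

lemma geometric_recursion_zero:
  fixes d :: "nat \<Rightarrow> complex"
  assumes rec: "\<And>K. w * d K = d (Suc K)" and bound: "\<And>K. norm (d K) \<le> c * A ^ K" and A: "0 \<le> A" "A < norm w"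
  shows "d 0 = 0"
proof (rule ccontr)
  assume "d 0 \<noteq> 0"
  have "w ^ K * d 0 = d K" for K
    by (induction K) (simp_all add: rec[symmetric] mult.assoc)
  then have "norm w ^ K * norm (d 0) \<le> c * A ^ K" for K
    using bound[of K] by (metis norm_mult norm_power)
  moreover have "norm w > 0" using A by linarith
  ultimately have le: "norm (d 0) \<le> c * (A / norm w) ^ K" for K
    by (simp add: power_divide pos_le_divide_eq mult.commute)
  have "(\<lambda>K. c * (A / norm w) ^ K) \<longlonglongrightarrow> c * 0"
  proof (intro tendsto_mult tendsto_const LIMSEQ_power_zero)
    have "norm w > 0" using A by linarith
    then show "norm (A / norm w) < 1" using A by (simp add: divide_less_eq)
  qed
  then have "norm (d 0) \<le> c * 0" by (rule LIMSEQ_le_const) (use le in auto)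
  then show False using \<open>d 0 \<noteq> 0\<close> by simp
qed

locale bounded_law = real_distribution H for H :: "real measure" +
  fixes A :: real
  assumes A_pos: "A > 0" and supp: "AE t in H. \<bar>t\<bar> \<le> A"
begin

lemma
  fixes f :: "real \<Rightarrow> 'b :: {banach, second_countable_topology}"
  assumes f: "f \<in> borel_measurable borel" and b: "\<And>t. \<bar>t\<bar> \<le> A \<Longrightarrow> norm (f t) \<le> c"
  shows integrable_bounded: "integrable H f" and norm_integral_bounded: "norm (LINT t|H. f t) \<le> c"
proof -
  have ae: "AE t in H. norm (f t) \<le> c" using supp b by (auto elim: AE_mp)
  show i: "integrable H f"
    by (rule integrable_const_bound[OF ae]) (use f in simp)
  have "norm (LINT t|H. f t) \<le> (LINT t|H. norm (f t))" by (rule integral_norm_bound)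
  also have "\<dots> \<le> (LINT t|H. c)" by (rule integral_mono_AE[OF integrable_norm[OF i] _ ae]) simp
  also have "\<dots> = c" using prob_space by simp
  finally show "norm (LINT t|H. f t) \<le> c" .
qed

lemma moment_bound: "\<bar>LINT t|H. t ^ k\<bar> \<le> A ^ k"
  using norm_integral_bounded[of "\<lambda>t. t ^ k" "A ^ k"] by (simp add: power_abs power_mono)

definition resolvent_moment :: "nat \<Rightarrow> complex \<Rightarrow> complex" where
  "resolvent_moment K w = (LINT t|H. of_real t ^ K / (w - of_real t))"

lemma resolvent_moment_integrand:
  assumes w: "A < norm w" and t: "\<bar>t\<bar> \<le> A"
  shows "w - complex_of_real t \<noteq> 0"
    "norm (complex_of_real t ^ K / (w - complex_of_real t)) \<le> A ^ K / (norm w - A)"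
proof -
  have 1: "norm w - A \<le> norm (w - complex_of_real t)"
    using norm_triangle_ineq2[of w "complex_of_real t"] t by simp
  then show "w - complex_of_real t \<noteq> 0" using w by auto
  have "norm (of_real t ^ K :: complex) \<le> A ^ K" using t by (simp add: norm_power power_mono)
  then show "norm (complex_of_real t ^ K / (w - complex_of_real t)) \<le> A ^ K / (norm w - A)"
    using 1 w A_pos unfolding norm_divide by (intro frac_le) auto
qed

lemma resolvent_moment_bound: "A < norm w \<Longrightarrow> norm (resolvent_moment K w) \<le> A ^ K / (norm w - A)"
  unfolding resolvent_moment_def by (rule norm_integral_bounded) (auto intro: resolvent_moment_integrand(2))

lemma resolvent_moment_rec:
  assumes w: "A < norm w"
  shows "w * resolvent_moment K w = of_real (LINT t|H. t ^ K) + resolvent_moment (Suc K) w"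
proof -
  have i: "integrable H (\<lambda>t. of_real t ^ K / (w - of_real t))" for K
    by (rule integrable_bounded) (auto intro: resolvent_moment_integrand(2)[OF w])
  have i2: "integrable H (\<lambda>t. t ^ K)"
    by (rule integrable_bounded[of _ "A ^ K"]) (auto simp: power_abs power_mono)
  have i3: "integrable H (\<lambda>t. complex_of_real (t ^ K))" using i2 by (rule integrable_of_real)
  have i4: "(LINT t|H. complex_of_real (t ^ K)) = of_real (LINT t|H. t ^ K)"
    by (rule integral_complex_of_real)
  have "w * resolvent_moment K w = (LINT t|H. w * (of_real t ^ K / (w - of_real t)))"
    unfolding resolvent_moment_def by (rule integral_mult_right_zero[symmetric])
  also have "\<dots> = (LINT t|H. of_real (t ^ K) + of_real t ^ Suc K / (w - of_real t))"
  proof (rule integral_cong_AE)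
    show "AE t in H. w * (of_real t ^ K / (w - of_real t)) = of_real (t ^ K) + of_real t ^ Suc K / (w - of_real t)"
    proof (rule AE_mp[OF supp], rule AE_I2, rule impI)
      fix t assume "\<bar>t\<bar> \<le> A"
      then have "w - of_real t \<noteq> 0" by (rule resolvent_moment_integrand(1)[OF w])
      then show "w * (of_real t ^ K / (w - of_real t)) = of_real (t ^ K) + of_real t ^ Suc K / (w - of_real t)"
        by (simp add: field_simps)
    qed
  qed (use i i3 in \<open>auto dest: borel_measurable_integrable\<close>)
  also have "\<dots> = of_real (LINT t|H. t ^ K) + resolvent_moment (Suc K) w"
    unfolding resolvent_moment_def Bochner_Integration.integral_add[OF i3 i] i4 ..
  finally show ?thesis .
qed

lemma stieltjes_resolvent_moment: "stieltjes H z = - resolvent_moment 0 z"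
proof -
  have "stieltjes H z = (LINT t|H. - (1 / (z - of_real t)))"
    unfolding stieltjes_def by (intro Bochner_Integration.integral_cong refl) (metis minus_diff_eq divide_minus_right)
  then show ?thesis unfolding resolvent_moment_def by simp
qed

lemma moment_series:
  assumes z: "A < norm z"
  shows "(\<lambda>k. of_real (LINT t|H. t ^ k) * inverse z ^ Suc k) sums resolvent_moment 0 z"
proof -
  have z0: "z \<noteq> 0" using z A_pos by auto
  have part: "(\<Sum>k<N. of_real (LINT t|H. t ^ k) * inverse z ^ Suc k) = resolvent_moment 0 z - inverse z ^ N * resolvent_moment N z" for N
  proof (induction N)
    case (Suc N)
    have "resolvent_moment N z = inverse z * (of_real (LINT t|H. t ^ N) + resolvent_moment (Suc N) z)"
      using resolvent_moment_rec[OF z, of N] z0 by (simp add: field_simps)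
    then show ?case using Suc by (simp add: algebra_simps)
  qed simp
  have "(\<lambda>N. inverse z ^ N * resolvent_moment N z) \<longlonglongrightarrow> 0"
  proof (rule Lim_null_comparison)
    have "norm (inverse z ^ N * resolvent_moment N z) \<le> inverse (norm z) ^ N * (A ^ N / (norm z - A))" for N
      unfolding norm_mult norm_power norm_inverse by (intro mult_left_mono resolvent_moment_bound[OF z]) simp
    then show "\<forall>\<^sub>F N in sequentially. norm (inverse z ^ N * resolvent_moment N z) \<le> (A / norm z) ^ N / (norm z - A)"
      by (intro always_eventually allI) (simp add: power_divide field_simps)
    have "(\<lambda>N. (A / norm z) ^ N / (norm z - A)) \<longlonglongrightarrow> 0 / (norm z - A)"
    proof (intro tendsto_divide tendsto_const LIMSEQ_power_zero)
      have "norm z > 0" using z A_pos by linarith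
      then show "norm (A / norm z) < 1" using z A_pos by (simp add: divide_less_eq)
    qed (use z in simp)
    then show "(\<lambda>N. (A / norm z) ^ N / (norm z - A)) \<longlonglongrightarrow> 0" by simp
  qed
  then have "(\<lambda>N. resolvent_moment 0 z - inverse z ^ N * resolvent_moment N z) \<longlonglongrightarrow> resolvent_moment 0 z - 0"
    by (intro tendsto_diff tendsto_const)
  then show ?thesis unfolding sums_def part by simp
qed

end

lemma geometric_mixed_sum:
  fixes B C :: real
  assumes "0 \<le> B" "B + 1 \<le> C"
  shows "(\<Sum>i<k. B ^ i * C ^ (k - 1 - i)) \<le> C ^ k"
proof -
  have "(\<Sum>i<k. B ^ i * C ^ (k - 1 - i)) \<ge> 0" using assms by (intro sum_nonneg) auto
  then have "(\<Sum>i<k. B ^ i * C ^ (k - 1 - i)) \<le> (C - B) * (\<Sum>i<k. B ^ i * C ^ (k - 1 - i))"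
    using assms by (simp add: mult_le_cancel_right1)
  also have "\<dots> = C ^ k - B ^ k"
    using power_diff_sumr2[of B k C] by (simp add: algebra_simps)
  also have "\<dots> \<le> C ^ k" using assms by simp
  finally show ?thesis .
qed

text \<open>A crude geometric bound, which makes the generating functions of the mixed moments converge near
  infinity.\<close>

lemma mixed_moment_bound:
  fixes D :: "nat \<Rightarrow> nat \<Rightarrow> real"
  assumes rec: "\<And>K k. D K (Suc k) = D (Suc K) k + s * (\<Sum>i<k. m i * D K (k - 1 - i))"
    and D0: "\<And>K. \<bar>D K 0\<bar> \<le> A ^ K" and m: "\<And>k. \<bar>m k\<bar> \<le> B ^ k"
    and pos: "0 < A" "0 < B" "0 < s" and C: "A + B + s + 1 \<le> C"
  shows "\<bar>D K k\<bar> \<le> A ^ K * C ^ k"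
proof (induction k arbitrary: K rule: less_induct)
  case (less k)
  show ?case
  proof (cases k)
    case 0
    then show ?thesis using D0 by simp
  next
    case (Suc j)
    have C0: "C \<ge> 0" using C pos by simp
    have "\<bar>m i * D K (j - 1 - i)\<bar> \<le> B ^ i * (A ^ K * C ^ (j - 1 - i))" if "i < j" for i
      unfolding abs_mult using less[of "j - 1 - i" K] m[of i] Suc that pos by (intro mult_mono) auto
    then have "\<bar>\<Sum>i<j. m i * D K (j - 1 - i)\<bar> \<le> (\<Sum>i<j. B ^ i * (A ^ K * C ^ (j - 1 - i)))"
      by (intro order.trans[OF sum_abs] sum_mono) auto
    also have "\<dots> = A ^ K * (\<Sum>i<j. B ^ i * C ^ (j - 1 - i))"
      by (simp add: sum_distrib_left mult_ac)
    also have "\<dots> \<le> A ^ K * C ^ j"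
      using pos C by (intro mult_left_mono geometric_mixed_sum) auto
    finally have 1: "\<bar>\<Sum>i<j. m i * D K (j - 1 - i)\<bar> \<le> A ^ K * C ^ j" .
    have "\<bar>D K (Suc j)\<bar> \<le> \<bar>D (Suc K) j\<bar> + s * \<bar>\<Sum>i<j. m i * D K (j - 1 - i)\<bar>"
      unfolding rec using pos by (intro order.trans[OF abs_triangle_ineq]) (simp add: abs_mult)
    also have "\<dots> \<le> A ^ Suc K * C ^ j + s * (A ^ K * C ^ j)"
      using less[of j "Suc K"] Suc 1 pos by (intro add_mono mult_left_mono) auto
    also have "\<dots> = (A + s) * (A ^ K * C ^ j)" by (simp add: algebra_simps)
    also have "\<dots> \<le> C * (A ^ K * C ^ j)" using C C0 pos by (intro mult_right_mono) auto
    finally show ?thesis by (simp add: Suc mult_ac)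
  qed
qed

text \<open>Let \<open>M K = \<Sum>k. D K k / z ^ (k + 1)\<close> and \<open>g = M 0 = - m z\<close>. The recursion for \<open>D\<close> becomes
  \<open>(z - s * g) * M K = \<integral> t ^ K dH + M (K + 1)\<close>. The resolvent moments \<open>\<integral> t ^ K / (om - t) dH\<close> at
  \<open>om = z - s * g\<close> satisfy the same recursion. The difference is multiplied by \<open>om\<close> in each step but
  is bounded by a multiple of \<open>A ^ K\<close>, with \<open>A < norm om\<close>, so it vanishes; \<open>K = 0\<close> is the claim.\<close>

lemma subordination_large:
  fixes D :: "nat \<Rightarrow> nat \<Rightarrow> real"
  assumes H: "bounded_law H A" and mu: "bounded_law \<mu> B"
    and rec: "\<And>K k. D K (Suc k) = D (Suc K) k + s * (\<Sum>i<k. D 0 i * D K (k - 1 - i))"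
    and DH: "\<And>K. D K 0 = (LINT t|H. t ^ K)" and Dmu: "\<And>k. D 0 k = (LINT x|\<mu>. x ^ k)"
    and s: "0 < s" and z: "A + B + 2 * s + 1 < norm z"
  shows "stieltjes \<mu> z = (LINT t|H. 1 / (of_real t - z - of_real s * stieltjes \<mu> z))"
proof -
  interpret H: bounded_law H A by fact
  interpret mu: bounded_law \<mu> B by fact
  define C where "C = A + B + s + 1"
  have zC: "C + s < norm z" using z by (simp add: C_def)
  have pos: "0 < A" "0 < B" by (rule H.A_pos, rule mu.A_pos)
  have C0: "C > 0" using pos s by (simp add: C_def)
  have zB: "B + 1 < norm z" "C < norm z" using zC pos s by (auto simp: C_def)
  have z0: "z \<noteq> 0" using zB pos by auto
  define w where "w = inverse z"
  have w: "norm w * C < 1" "norm w > 0"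
  proof -
    have nw: "norm w = 1 / norm z" by (simp add: w_def norm_inverse inverse_eq_divide norm_divide)
    have "norm z > 0" using z0 by simp
    then show "norm w * C < 1" "norm w > 0" unfolding nw using zB by (simp_all add: divide_less_eq)
  qed
  have Db: "\<bar>D K k\<bar> \<le> A ^ K * C ^ k" for K k
  proof (rule mixed_moment_bound[where D = D and m = "D 0" and s = s and B = B])
    show "D K (Suc k) = D (Suc K) k + s * (\<Sum>i<k. D 0 i * D K (k - 1 - i))" for K k by (rule rec)
    show "\<bar>D K 0\<bar> \<le> A ^ K" for K unfolding DH by (rule H.moment_bound)
    show "\<bar>D 0 k\<bar> \<le> B ^ k" for k unfolding Dmu by (rule mu.moment_bound)
  qed (use pos s in \<open>simp_all add: C_def\<close>)
  define a where "a K k = of_real (D K k) * w ^ Suc k" for K k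
  have an: "norm (a K k) \<le> A ^ K * norm w * (norm w * C) ^ k" for K k
  proof -
    have "norm (a K k) = \<bar>D K k\<bar> * norm w ^ Suc k" by (simp add: a_def norm_mult norm_power)
    also have "\<dots> \<le> A ^ K * C ^ k * norm w ^ Suc k" by (intro mult_right_mono Db) simp
    finally show ?thesis by (simp add: power_mult_distrib mult_ac)
  qed
  have gs: "(\<lambda>k. A ^ K * norm w * (norm w * C) ^ k) sums (A ^ K * norm w * (1 / (1 - norm w * C)))" for K
    using w C0 by (intro sums_mult geometric_sums) auto
  have an_sum: "summable (\<lambda>k. norm (a K k))" for K
    by (rule summable_comparison_test'[OF sums_summable[OF gs[of K]], of 0]) (use an in simp)
  have a_sum: "summable (a K)" for K using an_sum by (rule summable_norm_cancel)
  define M where "M K = suminf (a K)" for K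
  have Mb: "norm (M K) \<le> (norm w / (1 - norm w * C)) * A ^ K" for K
  proof -
    have "norm (M K) \<le> suminf (\<lambda>k. norm (a K k))" unfolding M_def by (rule summable_norm[OF an_sum])
    also have "\<dots> \<le> suminf (\<lambda>k. A ^ K * norm w * (norm w * C) ^ k)"
      by (rule suminf_le[OF an an_sum sums_summable[OF gs]])
    finally show ?thesis using sums_unique[OF gs[of K]] by (simp add: mult_ac)
  qed
  define g where "g = M 0"
  have g: "g = mu.resolvent_moment 0 z"
    using mu.moment_series[of z] zB pos unfolding g_def M_def a_def[abs_def] Dmu w_def
    by (intro sums_unique[symmetric]) auto
  have gb: "norm g \<le> 1"
  proof -
    have "norm g \<le> B ^ 0 / (norm z - B)" unfolding g by (rule mu.resolvent_moment_bound) (use zB in simp)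
    also have "\<dots> \<le> 1" using zB by (simp add: divide_le_eq)
    finally show ?thesis .
  qed
  define om where "om = z - of_real s * g"
  have omA: "A < norm om"
  proof -
    have "norm (of_real s * g) \<le> s" using gb s by (simp add: norm_mult mult_le_cancel_left1)
    then have "norm z - s \<le> norm om"
      using norm_triangle_ineq2[of z "of_real s * g"] by (simp add: om_def)
    then show ?thesis using zC pos s by (simp add: C_def)
  qed
  have Mrec: "om * M K = of_real (LINT t|H. t ^ K) + M (Suc K)" for K
  proof -
    have "(\<lambda>j. \<Sum>i\<le>j. a 0 i * a K (j - i)) sums (g * M K)"
      unfolding g_def M_def by (rule Cauchy_product_sums[OF an_sum an_sum])
    then have c1: "(\<lambda>j. of_real s * (w * (\<Sum>i\<le>j. a 0 i * a K (j - i)))) sums (of_real s * (w * (g * M K)))"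
      by (intro sums_mult)
    define c where "c k = of_real s * of_real (\<Sum>i<k. D 0 i * D K (k - 1 - i)) * w ^ (k + 2)" for k
    have cS: "c (Suc j) = of_real s * (w * (\<Sum>i\<le>j. a 0 i * a K (j - i)))" for j
    proof -
      have "of_real (\<Sum>i<Suc j. D 0 i * D K (Suc j - 1 - i)) * w ^ (j + 2) = (\<Sum>i\<le>j. a 0 i * a K (j - i))"
        unfolding of_real_sum sum_distrib_right lessThan_Suc_atMost
      proof (intro sum.cong refl)
        fix i assume "i \<in> {..j}"
        then have pw: "w ^ Suc i * w ^ Suc (j - i) = w ^ (j + 2)" by (simp add: power_add[symmetric] del: power_Suc)
        have "a 0 i * a K (j - i) = of_real (D 0 i * D K (j - i)) * (w ^ Suc i * w ^ Suc (j - i))"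
          by (simp add: a_def mult_ac)
        then show "of_real (D 0 i * D K (Suc j - 1 - i)) * w ^ (j + 2) = a 0 i * a K (j - i)"
          unfolding pw by simp
      qed
      then show ?thesis unfolding c_def by (simp add: mult_ac)
    qed
    have "(\<lambda>j. c (Suc j)) sums (of_real s * (w * (g * M K)))" using c1 by (simp only: cS)
    then have "c sums (of_real s * (w * (g * M K)) + c 0)" by (simp only: sums_Suc_iff)
    moreover have "c 0 = 0" by (simp add: c_def)
    ultimately have "c sums (of_real s * (w * (g * M K)))" by simp
    moreover have "(\<lambda>k. w * a (Suc K) k) sums (w * M (Suc K))"
      unfolding M_def by (intro sums_mult summable_sums a_sum)
    ultimately have "(\<lambda>k. w * a (Suc K) k + c k) sums (w * M (Suc K) + of_real s * (w * (g * M K)))"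
      by (rule sums_add[rotated])
    moreover have "w * a (Suc K) k + c k = a K (Suc k)" for k
      unfolding a_def c_def rec[of K k] by (simp add: algebra_simps)
    moreover have "(\<lambda>k. a K (Suc k)) sums (M K - a K 0)"
      using sums_Suc_iff[of "a K" "M K - a K 0"] summable_sums[OF a_sum[of K]] by (simp add: M_def)
    ultimately have "w * M (Suc K) + of_real s * (w * (g * M K)) = M K - a K 0"
      using sums_unique2 by simp
    then have "w * M (Suc K) + of_real s * (w * (g * M K)) = M K - of_real (D K 0) * w"
      by (simp add: a_def)
    then have "z * (w * M (Suc K) + of_real s * (w * (g * M K))) = z * (M K - of_real (D K 0) * w)"
      by simp
    moreover have "z * w = 1" using z0 by (simp add: w_def)
    ultimately have "M (Suc K) + of_real s * (g * M K) = z * M K - of_real (D K 0)"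
      by (simp add: algebra_simps) (metis mult.commute mult.left_commute mult.right_neutral)
    then show ?thesis by (simp add: om_def DH algebra_simps)
  qed
  have "M 0 - H.resolvent_moment 0 om = 0"
  proof (rule geometric_recursion_zero[of om "\<lambda>K. M K - H.resolvent_moment K om"])
    show "om * (M K - H.resolvent_moment K om) = M (Suc K) - H.resolvent_moment (Suc K) om" for K
      using Mrec[of K] H.resolvent_moment_rec[OF omA, of K] by (simp add: algebra_simps)
    show "norm (M K - H.resolvent_moment K om) \<le> (norm w / (1 - norm w * C) + 1 / (norm om - A)) * A ^ K" for K
      using norm_triangle_ineq4[of "M K" "H.resolvent_moment K om"] Mb[of K] H.resolvent_moment_bound[OF omA, of K]
      by (simp add: algebra_simps)
  qed (use omA pos in auto)
  then have "g = H.resolvent_moment 0 om" by (simp add: g_def)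
  moreover have st: "stieltjes \<mu> z = - g" by (simp add: g mu.stieltjes_resolvent_moment)
  ultimately have "stieltjes \<mu> z = (LINT t|H. - (1 / (om - of_real t)))" by (simp add: H.resolvent_moment_def)
  also have "\<dots> = (LINT t|H. 1 / (of_real t - z - of_real s * stieltjes \<mu> z))"
  proof (intro Bochner_Integration.integral_cong refl)
    fix t :: real
    have "of_real t - z - of_real s * stieltjes \<mu> z = - (om - of_real t)"
      unfolding st om_def by simp
    then show "- (1 / (om - of_real t)) = 1 / (of_real t - z - of_real s * stieltjes \<mu> z)"
      by (metis divide_minus_right)
  qed
  finally show ?thesis .
qed

section \<open>Cauchy transforms and the rescaled subordination equation\<close>

declare of_real_mult [simp del]

context bounded_law
begin

text \<open>The scale \<open>\<tau>\<close> is the inverse of the noise level; for \<open>\<tau> = 1\<close> and \<open>f = 1\<close> this is the Stieltjes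
  transform.\<close>

definition cauchy_int :: "real \<Rightarrow> (real \<Rightarrow> real) \<Rightarrow> complex \<Rightarrow> complex" where
  "cauchy_int \<tau> f q = (LINT t|H. of_real (f t) / (of_real (\<tau> * t) - q))"

lemma denom_Im: "\<bar>Im q\<bar> \<le> norm (of_real u - q)"
  using abs_Im_le_cmod[of "of_real u - q"] by simp

lemma denom_nz: "0 < Im q \<Longrightarrow> of_real u - q \<noteq> 0"
  using denom_Im[of q u] by auto

lemma cauchy_int_integrand_bound:
  assumes "\<bar>y\<bar> \<le> c" "0 < Im q"
  shows "norm (of_real y / (of_real u - q)) \<le> c / Im q"
  using assms denom_Im[of q u] unfolding norm_divide by (intro frac_le) auto

context
  fixes f :: "real \<Rightarrow> real" and c :: real
  assumes f [measurable]: "f \<in> borel_measurable borel" and c: "\<And>t. \<bar>f t\<bar> \<le> c"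
begin

lemma c_nonneg: "0 \<le> c" using c[of 0] by linarith

lemma cauchy_int_integrable: "0 < Im q \<Longrightarrow> integrable H (\<lambda>t. of_real (f t) / (of_real (\<tau> * t) - q))"
  by (rule integrable_bounded[where c = "c / Im q"]) (auto intro: cauchy_int_integrand_bound c)

lemma cauchy_int_bound_product:
  assumes "0 < Im q" "0 < Im p"
  shows "norm (of_real (f t) / ((of_real (\<tau> * t) - q) * (of_real (\<tau> * t) - p))) \<le> c / (Im q * Im p)"
  using assms c[of t] denom_Im[of q "\<tau> * t"] denom_Im[of p "\<tau> * t"]
  unfolding norm_divide norm_mult by (intro frac_le mult_mono) auto

lemma cauchy_int_diff:
  assumes q: "0 < Im q" and p: "0 < Im p"
  shows "cauchy_int \<tau> f q - cauchy_int \<tau> f p = (q - p) * (LINT t|H. of_real (f t) / ((of_real (\<tau> * t) - q) * (of_real (\<tau> * t) - p)))"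
proof -
  have "cauchy_int \<tau> f q - cauchy_int \<tau> f p = (LINT t|H. of_real (f t) / (of_real (\<tau> * t) - q) - of_real (f t) / (of_real (\<tau> * t) - p))"
    unfolding cauchy_int_def by (rule Bochner_Integration.integral_diff[symmetric]) (intro cauchy_int_integrable q p)+
  also have "\<dots> = (LINT t|H. (q - p) * (of_real (f t) / ((of_real (\<tau> * t) - q) * (of_real (\<tau> * t) - p))))"
  proof (intro Bochner_Integration.integral_cong refl)
    fix t
    show "of_real (f t) / (of_real (\<tau> * t) - q) - of_real (f t) / (of_real (\<tau> * t) - p) =
        (q - p) * (of_real (f t) / ((of_real (\<tau> * t) - q) * (of_real (\<tau> * t) - p)))"
      using denom_nz[OF q, of "\<tau> * t"] denom_nz[OF p, of "\<tau> * t"]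
      by (simp add: divide_simps) (simp add: algebra_simps)
  qed
  also have "\<dots> = (q - p) * (LINT t|H. of_real (f t) / ((of_real (\<tau> * t) - q) * (of_real (\<tau> * t) - p)))"
    by (rule integral_mult_right_zero)
  finally show ?thesis .
qed

lemma cauchy_int_has_derivative:
  assumes q: "0 < Im q"
  shows "(cauchy_int \<tau> f has_field_derivative (LINT t|H. of_real (f t) / (of_real (\<tau> * t) - q)\<^sup>2)) (at q)"
proof -
  let ?I = "LINT t|H. of_real (f t) / (of_real (\<tau> * t) - q)\<^sup>2"
  let ?K = "\<lambda>p. LINT t|H. of_real (f t) / ((of_real (\<tau> * t) - p) * (of_real (\<tau> * t) - q))"
  have d: "norm (?K p - ?I) \<le> norm (p - q) * (2 * c / (Im q) ^ 3)" if p: "Im q / 2 < Im p" for p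
  proof -
    have p0: "0 < Im p" using p q by simp
    have i1: "integrable H (\<lambda>t. of_real (f t) / ((of_real (\<tau> * t) - p) * (of_real (\<tau> * t) - q)))"
      by (rule integrable_bounded[where c = "c / (Im p * Im q)"]) (auto intro: cauchy_int_bound_product p0 q)
    have i2: "integrable H (\<lambda>t. of_real (f t) / (of_real (\<tau> * t) - q)\<^sup>2)"
    proof (rule integrable_bounded[where c = "c / (Im q * Im q)"])
      show "norm (of_real (f t) / (of_real (\<tau> * t) - q)\<^sup>2) \<le> c / (Im q * Im q)" for t
        unfolding power2_eq_square by (rule cauchy_int_bound_product[OF q q])
    qed simp
    have "?K p - ?I = (LINT t|H. of_real (f t) / ((of_real (\<tau> * t) - p) * (of_real (\<tau> * t) - q)) - of_real (f t) / (of_real (\<tau> * t) - q)\<^sup>2)"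
      by (rule Bochner_Integration.integral_diff[symmetric, OF i1 i2])
    also have "norm \<dots> \<le> norm (p - q) * (2 * c / (Im q) ^ 3)"
    proof (rule norm_integral_bounded)
      fix t
      have "of_real (f t) / ((of_real (\<tau> * t) - p) * (of_real (\<tau> * t) - q)) - of_real (f t) / (of_real (\<tau> * t) - q)\<^sup>2
        = (p - q) * (of_real (f t) / ((of_real (\<tau> * t) - p) * (of_real (\<tau> * t) - q)) / (of_real (\<tau> * t) - q))"
        using denom_nz[OF q, of "\<tau> * t"] denom_nz[OF p0, of "\<tau> * t"]
        by (simp add: divide_simps power2_eq_square) (simp add: algebra_simps)
      also have "norm \<dots> \<le> norm (p - q) * (c / (Im p * Im q) / Im q)"
        unfolding norm_mult norm_divide[of _ "of_real (\<tau> * t) - q"]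
        using denom_Im[of q "\<tau> * t"] q c_nonneg p0
        by (intro mult_left_mono frac_le cauchy_int_bound_product p0) auto
      also have "\<dots> \<le> norm (p - q) * (2 * c / (Im q) ^ 3)"
      proof (intro mult_left_mono)
        have "c / (Im p * Im q) \<le> c / (Im q / 2 * Im q)"
          using p q c_nonneg p0 by (intro divide_left_mono mult_right_mono) auto
        then have "c / (Im p * Im q) / Im q \<le> c / (Im q / 2 * Im q) / Im q"
          using q by (intro divide_right_mono) auto
        also have "\<dots> = 2 * c / (Im q) ^ 3" by (simp add: power3_eq_cube)
        finally show "c / (Im p * Im q) / Im q \<le> 2 * c / (Im q) ^ 3" .
      qed simp
      finally show "norm (of_real (f t) / ((of_real (\<tau> * t) - p) * (of_real (\<tau> * t) - q)) - of_real (f t) / (of_real (\<tau> * t) - q)\<^sup>2) \<le> norm (p - q) * (2 * c / (Im q) ^ 3)" .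
    qed simp
    finally show ?thesis .
  qed
  have near: "\<forall>\<^sub>F p in at q. Im q / 2 < Im p"
  proof -
    have "(Im \<longlongrightarrow> Im q) (at q)" by (intro tendsto_intros)
    then show ?thesis by (rule order_tendstoD(1)) (use q in simp)
  qed
  have "((\<lambda>p. ?K p - ?I) \<longlongrightarrow> 0) (at q)"
  proof (rule Lim_null_comparison)
    show "\<forall>\<^sub>F p in at q. norm (?K p - ?I) \<le> norm (p - q) * (2 * c / (Im q) ^ 3)"
      using near by eventually_elim (rule d)
    have "((\<lambda>p. norm (p - q) * (2 * c / (Im q) ^ 3)) \<longlongrightarrow> norm (q - q) * (2 * c / (Im q) ^ 3)) (at q)"
      by (intro tendsto_intros)
    then show "((\<lambda>p. norm (p - q) * (2 * c / (Im q) ^ 3)) \<longlongrightarrow> 0) (at q)" by simp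
  qed
  then have "(?K \<longlongrightarrow> ?I) (at q)" by (simp only: Lim_null[symmetric])
  moreover have "\<forall>\<^sub>F p in at q. ?K p = (cauchy_int \<tau> f p - cauchy_int \<tau> f q) / (p - q)"
    using near eventually_neq_at_within[of q q]
  proof eventually_elim
    case (elim p)
    then have "0 < Im p" using q by simp
    from cauchy_int_diff[OF this q] show ?case using elim by simp
  qed
  ultimately have "((\<lambda>p. (cauchy_int \<tau> f p - cauchy_int \<tau> f q) / (p - q)) \<longlongrightarrow> ?I) (at q)"
    by (rule Lim_transform_eventually)
  then show ?thesis by (simp only: has_field_derivative_iff)
qed

lemma cauchy_int_holomorphic: "cauchy_int \<tau> f holomorphic_on {q. 0 < Im q}"
  unfolding holomorphic_on_def field_differentiable_def
  using cauchy_int_has_derivative has_field_derivative_at_within by blast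

end

lemma stieltjes_cauchy_int: "stieltjes H z = cauchy_int 1 (\<lambda>_. 1) z"
  by (simp add: stieltjes_def cauchy_int_def)

definition inv_square_int :: "real \<Rightarrow> complex \<Rightarrow> real" where
  "inv_square_int \<tau> q = (LINT t|H. 1 / (norm (of_real (\<tau> * t) - q))\<^sup>2)"

lemma Im_cauchy_int: "0 < Im q \<Longrightarrow> Im (cauchy_int \<tau> (\<lambda>_. 1) q) = Im q * inv_square_int \<tau> q"
proof -
  assume q: "0 < Im q"
  have i: "integrable H (\<lambda>t. of_real 1 / (of_real (\<tau> * t) - q))"
    by (rule cauchy_int_integrable[of _ 1]) (use q in auto)
  have "Im (cauchy_int \<tau> (\<lambda>_. 1) q) = (LINT t|H. Im (of_real 1 / (of_real (\<tau> * t) - q)))"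
    unfolding cauchy_int_def by (rule integral_Im[symmetric, OF i])
  also have "\<dots> = (LINT t|H. Im q * (1 / (norm (of_real (\<tau> * t) - q))\<^sup>2))"
    by (intro Bochner_Integration.integral_cong refl) (simp add: Im_divide cmod_power2)
  also have "\<dots> = Im q * inv_square_int \<tau> q" unfolding inv_square_int_def by (rule integral_mult_right_zero)
  finally show ?thesis .
qed

lemma inv_square_int_lower:
  assumes q: "0 < Im q" and \<tau>: "0 \<le> \<tau>"
  shows "1 / (norm q + \<tau> * A)\<^sup>2 \<le> inv_square_int \<tau> q"
proof -
  have i: "integrable H (\<lambda>t. 1 / (norm (of_real (\<tau> * t) - q))\<^sup>2)"
  proof (rule integrable_bounded[where c = "1 / (Im q)\<^sup>2"])
    fix t
    have "(Im q)\<^sup>2 \<le> (norm (of_real (\<tau> * t) - q))\<^sup>2"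
      using denom_Im[of q "\<tau> * t"] q by (intro power_mono) auto
    then show "norm (1 / (norm (of_real (\<tau> * t) - q))\<^sup>2) \<le> 1 / (Im q)\<^sup>2"
      using q by (simp add: frac_le)
  qed simp
  have "1 / (norm q + \<tau> * A)\<^sup>2 = (LINT t|H. 1 / (norm q + \<tau> * A)\<^sup>2)" using prob_space by simp
  also have "\<dots> \<le> inv_square_int \<tau> q"
    unfolding inv_square_int_def
  proof (rule integral_mono_AE[OF _ i])
    show "AE t in H. 1 / (norm q + \<tau> * A)\<^sup>2 \<le> 1 / (norm (of_real (\<tau> * t) - q))\<^sup>2"
    proof (rule AE_mp[OF supp], rule AE_I2, rule impI)
      fix t assume t: "\<bar>t\<bar> \<le> A"
      have "norm (of_real (\<tau> * t) - q) \<le> norm (of_real (\<tau> * t) :: complex) + norm q" by (rule norm_triangle_ineq4)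
      also have "norm (of_real (\<tau> * t) :: complex) \<le> \<tau> * A"
        unfolding norm_of_real abs_mult using t \<tau> by (intro mult_mono) auto
      finally have "norm (of_real (\<tau> * t) - q) \<le> norm q + \<tau> * A" by simp
      moreover have "0 < norm (of_real (\<tau> * t) - q)" using denom_nz[OF q, of "\<tau> * t"] by simp
      moreover from calculation have "0 < norm q + \<tau> * A" by linarith
      ultimately show "1 / (norm q + \<tau> * A)\<^sup>2 \<le> 1 / (norm (of_real (\<tau> * t) - q))\<^sup>2"
        by (intro divide_left_mono power_mono mult_pos_pos zero_less_power) auto
    qed
  qed simp
  finally show ?thesis .
qed

lemma inv_square_int_pos:
  assumes q: "0 < Im q" and \<tau>: "0 \<le> \<tau>"
  shows "0 < inv_square_int \<tau> q"
proof -
  have "norm q > 0" using q by auto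
  then have "0 < norm q + \<tau> * A" using \<tau> A_pos by (intro add_pos_nonneg) auto
  then have "0 < 1 / (norm q + \<tau> * A)\<^sup>2" by simp
  then show ?thesis using inv_square_int_lower[OF q \<tau>] by linarith
qed

lemma const_one: "(\<lambda>_ :: real. 1 :: real) \<in> borel_measurable borel" "\<And>t :: real. \<bar>1 :: real\<bar> \<le> 1"
  by simp_all

lemma integral_constant: "(LINT t|H. c :: complex) = c"
  using prob_space by simp

text \<open>The subordination equation in the variables \<open>y = z / \<sigma>\<close> and \<open>q = (z + \<sigma>\<^sup>2 * m z) / \<sigma>\<close>, with
  \<open>\<tau> = 1 / \<sigma>\<close>.\<close>

definition sol :: "real \<Rightarrow> complex \<Rightarrow> complex \<Rightarrow> bool" where
  "sol \<tau> y q \<longleftrightarrow> 0 < Im y \<and> 0 < Im q \<and> q - y = cauchy_int \<tau> (\<lambda>_. 1) q"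

text \<open>The imaginary part of the equation is \<open>Im y = Im q * (1 - inv_square_int \<tau> q)\<close>. This is the a priori
  bound which keeps \<open>q\<close> away from zero.\<close>

lemma sol_inv_square_int_less_1:
  assumes "sol \<tau> y q"
  shows "inv_square_int \<tau> q < 1"
proof -
  have q: "0 < Im q" and y: "0 < Im y" using assms by (auto simp: sol_def)
  have "Im (q - y) = Im q * inv_square_int \<tau> q" using assms Im_cauchy_int[OF q, of \<tau>] by (simp only: sol_def)
  then have "Im y = Im q * (1 - inv_square_int \<tau> q)" by (simp add: right_diff_distrib)
  then have "0 < Im q * (1 - inv_square_int \<tau> q)" using y by (simp only:)
  then have "0 < 1 - inv_square_int \<tau> q" using q by (rule zero_less_mult_pos)
  then show ?thesis by simp
qed

lemma sol_norm_lower: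
  assumes "sol \<tau> y q" "0 \<le> \<tau>"
  shows "1 - \<tau> * A < norm q"
proof -
  have q: "0 < Im q" using assms by (simp add: sol_def)
  have n: "0 < norm q + \<tau> * A" using q assms(2) A_pos by (intro add_pos_nonneg) auto
  have "1 / (norm q + \<tau> * A)\<^sup>2 < 1" using inv_square_int_lower[OF q assms(2)] sol_inv_square_int_less_1[OF assms(1)] by linarith
  then have "1 < (norm q + \<tau> * A)\<^sup>2" using n by (simp add: divide_less_eq)
  then have "1 < norm q + \<tau> * A" using n power_le_one[of "norm q + \<tau> * A" 2] by linarith
  then show ?thesis by simp
qed

lemma sol_estimates:
  assumes s: "sol \<tau> y q" and \<tau>: "0 \<le> \<tau>" "\<tau> * A \<le> 1 / 8"
  shows "norm q \<le> norm y + 4 / 3" "norm (cauchy_int \<tau> (\<lambda>_. 1) q + 1 / q) \<le> 2 * (\<tau> * A)"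
proof -
  have q: "0 < Im q" and eq: "q - y = cauchy_int \<tau> (\<lambda>_. 1) q" using s by (auto simp: sol_def)
  have q0: "q \<noteq> 0" using q by auto
  have nq: "7 / 8 \<le> norm q" using sol_norm_lower[OF s \<tau>(1)] \<tau>(2) by linarith
  have d: "3 / 4 \<le> norm (of_real (\<tau> * t) - q)" and tt: "norm (of_real (\<tau> * t) :: complex) \<le> \<tau> * A" if "\<bar>t\<bar> \<le> A" for t
  proof -
    show tA: "norm (of_real (\<tau> * t) :: complex) \<le> \<tau> * A"
      unfolding norm_of_real abs_mult using that \<tau> by (intro mult_mono) auto
    have "norm q - norm (of_real (\<tau> * t) :: complex) \<le> norm (of_real (\<tau> * t) - q)"
      using norm_triangle_ineq2[of q "of_real (\<tau> * t)"] by (simp add: norm_minus_commute)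
    then show "3 / 4 \<le> norm (of_real (\<tau> * t) - q)" using nq tA \<tau>(2) by linarith
  qed
  have "norm (cauchy_int \<tau> (\<lambda>_. 1) q) \<le> 4 / 3"
    unfolding cauchy_int_def
  proof (rule norm_integral_bounded)
    fix t assume "\<bar>t\<bar> \<le> A"
    from d[OF this] have "1 / norm (of_real (\<tau> * t) - q) \<le> 1 / (3 / 4)" by (intro divide_left_mono mult_pos_pos) auto
    then show "norm (of_real 1 / (of_real (\<tau> * t) - q)) \<le> 4 / 3" by (simp add: norm_divide)
  qed simp
  then have "norm (q - y) \<le> 4 / 3" by (simp only: eq)
  moreover have "norm q \<le> norm y + norm (q - y)" using norm_triangle_ineq[of y "q - y"] by simp
  ultimately show "norm q \<le> norm y + 4 / 3" by linarith
  have i: "integrable H (\<lambda>t. of_real 1 / (of_real (\<tau> * t) - q))" by (rule cauchy_int_integrable[OF const_one q])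
  have i': "integrable H (\<lambda>t. 1 / q)" by simp
  have "cauchy_int \<tau> (\<lambda>_. 1) q + 1 / q = (LINT t|H. of_real 1 / (of_real (\<tau> * t) - q) + 1 / q)"
    unfolding cauchy_int_def Bochner_Integration.integral_add[OF i i'] by (simp only: integral_constant)
  also have "norm \<dots> \<le> 2 * (\<tau> * A)"
  proof (rule norm_integral_bounded)
    fix t assume t: "\<bar>t\<bar> \<le> A"
    have "of_real 1 / (of_real (\<tau> * t) - q) + 1 / q = of_real (\<tau> * t) / ((of_real (\<tau> * t) - q) * q)"
      using denom_nz[OF q, of "\<tau> * t"] q0 by (simp add: divide_simps)
    also have "norm \<dots> \<le> (\<tau> * A) / (3 / 4 * (7 / 8))"
      unfolding norm_divide norm_mult[of _ q]
      using d[OF t] tt[OF t] nq \<tau>(1) A_pos by (intro frac_le mult_mono) auto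
    also have "\<dots> \<le> 2 * (\<tau> * A)" using \<tau>(1) A_pos by simp
    finally show "norm (of_real 1 / (of_real (\<tau> * t) - q) + 1 / q) \<le> 2 * (\<tau> * A)" .
  qed simp
  finally show "norm (cauchy_int \<tau> (\<lambda>_. 1) q + 1 / q) \<le> 2 * (\<tau> * A)" .
qed

context
  fixes x b :: real and q0 :: complex
  assumes x: "\<bar>x\<bar> < 2" and b_def: "b = sqrt (1 - x\<^sup>2 / 4)" and q0_def: "q0 = Complex (x / 2) b"
begin

lemma b: "0 < b" "b \<le> 1" "b\<^sup>2 = 1 - x\<^sup>2 / 4"
proof -
  have "\<bar>x\<bar>\<^sup>2 < 2\<^sup>2" using x by (intro power_strict_mono) auto
  then have "0 < 1 - x\<^sup>2 / 4" by simp
  then show "0 < b" "b\<^sup>2 = 1 - x\<^sup>2 / 4" by (simp_all add: b_def)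
  show "b \<le> 1" by (simp add: b_def)
qed

lemma q0_cnj: "q0 * cnj q0 = 1" "q0 + cnj q0 = of_real x" "norm q0 = 1" "1 / q0 = cnj q0" "Im q0 = b"
proof -
  show 1: "q0 * cnj q0 = 1" "q0 + cnj q0 = of_real x" "Im q0 = b"
    using b(3) by (auto simp: q0_def complex_eq_iff power2_eq_square field_simps)
  have "(norm q0)\<^sup>2 = 1" using b(3) by (simp add: q0_def cmod_power2 power_divide)
  then have "sqrt ((norm q0)\<^sup>2) = sqrt 1" by (simp only:)
  then show "norm q0 = 1" by simp
  then have "q0 \<noteq> 0" by auto
  then show "1 / q0 = cnj q0" using 1(1) by (metis nonzero_eq_divide_eq mult.commute)
qed

text \<open>Up to a small error \<open>r\<close>, \<open>q\<close> is a root of \<open>q\<^sup>2 - x * q + 1 = (q - q0) * (q - cnj q0)\<close>, and it is at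
  distance at least \<open>b\<close> from the root in the lower half-plane.\<close>

lemma sol_close:
  assumes s: "sol \<tau> y q" and \<tau>: "0 \<le> \<tau>" "\<tau> * A \<le> 1 / 8" and y: "norm (y - of_real x) \<le> 1"
  shows "norm (q - q0) * b \<le> 5 * (norm (y - of_real x) + 2 * (\<tau> * A))"
proof -
  define r where "r = cauchy_int \<tau> (\<lambda>_. 1) q + 1 / q"
  have q: "0 < Im q" and eq: "q - y = r - 1 / q" using s by (auto simp: sol_def r_def)
  have qn: "q \<noteq> 0" using q by auto
  have "(q - q0) * (q - cnj q0) = q * q - (q0 + cnj q0) * q + q0 * cnj q0" by (simp add: algebra_simps)
  also have "\<dots> = q * (q - y) + 1 + (y - of_real x) * q" unfolding q0_cnj(1,2) by (simp add: algebra_simps)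
  also have "\<dots> = (y - of_real x + r) * q" unfolding eq using qn by (simp add: algebra_simps)
  finally have "norm (q - q0) * norm (q - cnj q0) = norm (y - of_real x + r) * norm q"
    by (simp only: norm_mult[symmetric])
  moreover have "b \<le> norm (q - cnj q0)"
    using abs_Im_le_cmod[of "q - cnj q0"] q q0_cnj(5) b(1) by simp
  moreover have "norm (y - of_real x + r) * norm q \<le> (norm (y - of_real x) + 2 * (\<tau> * A)) * 5"
  proof (intro mult_mono)
    show "norm (y - of_real x + r) \<le> norm (y - of_real x) + 2 * (\<tau> * A)"
      using norm_triangle_ineq[of "y - of_real x" r] sol_estimates(2)[OF s \<tau>] by (simp add: r_def)
    have "norm y \<le> norm (y - of_real x) + \<bar>x\<bar>"
      using norm_triangle_ineq[of "y - of_real x" "of_real x"] by simp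
    then show "norm q \<le> 5" using sol_estimates(1)[OF s \<tau>] y x by linarith
  qed (use \<tau> A_pos in auto)
  ultimately show ?thesis
    using mult_left_mono[of b "norm (q - cnj q0)" "norm (q - q0)"] by simp
qed

lemma near_q0:
  assumes d: "norm (q - q0) \<le> \<delta>" and e: "\<delta> + \<tau> * A \<le> b ^ 3 / 6" and \<tau>: "0 \<le> \<tau>"
  shows "b / 2 \<le> Im q"
    and "\<bar>t\<bar> \<le> A \<Longrightarrow> norm (1 / (of_real (\<tau> * t) - q) + 1 / q0) \<le> 2 * (\<delta> + \<tau> * A) / b"
proof -
  have "b ^ 3 \<le> b" using b power_decreasing[of 1 3 b] by simp
  then have "\<delta> \<le> b / 2" using e \<tau> A_pos b(1) mult_nonneg_nonneg[of \<tau> A] by linarith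
  moreover have "\<bar>Im q - b\<bar> \<le> \<delta>" using abs_Im_le_cmod[of "q - q0"] d q0_cnj(5) by simp
  ultimately show im: "b / 2 \<le> Im q" by linarith
  assume t: "\<bar>t\<bar> \<le> A"
  have q: "0 < Im q" using im b(1) by linarith
  have q0n: "q0 \<noteq> 0" using q0_cnj(3) by auto
  have tt: "norm (of_real (\<tau> * t) :: complex) \<le> \<tau> * A"
    unfolding norm_of_real abs_mult using t \<tau> by (intro mult_mono) auto
  have "1 / (of_real (\<tau> * t) - q) + 1 / q0 = (of_real (\<tau> * t) - (q - q0)) / ((of_real (\<tau> * t) - q) * q0)"
    using denom_nz[OF q, of "\<tau> * t"] q0n by (simp add: divide_simps)
  also have "norm \<dots> \<le> (\<delta> + \<tau> * A) / (b / 2 * 1)"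
    unfolding norm_divide norm_mult
  proof (intro frac_le mult_mono)
    show "norm (of_real (\<tau> * t) - (q - q0)) \<le> \<delta> + \<tau> * A"
      using norm_triangle_ineq4[of "of_real (\<tau> * t)" "q - q0"] tt d by linarith
    show "b / 2 \<le> norm (of_real (\<tau> * t) - q)" using denom_Im[of q "\<tau> * t"] im by linarith
    have "0 \<le> \<delta>" using d norm_ge_zero order_trans by blast
    then show "0 \<le> \<delta> + \<tau> * A" using \<tau> A_pos by simp
  qed (use q0_cnj(3) b(1) in auto)
  finally show "norm (1 / (of_real (\<tau> * t) - q) + 1 / q0) \<le> 2 * (\<delta> + \<tau> * A) / b" by (simp add: field_simps)
qed

text \<open>Subtracting the two equations gives \<open>(q1 - q2) * (1 - I) = y1 - y2\<close> with \<open>I\<close> close to \<open>1 / q0\<^sup>2\<close>, and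
  \<open>norm (1 - 1 / q0\<^sup>2) = norm (q0 - cnj q0) = 2 * b\<close>.\<close>

lemma sol_stable:
  assumes s: "sol \<tau> y1 q1" "sol \<tau> y2 q2" and \<tau>: "0 \<le> \<tau>"
    and d: "norm (q1 - q0) \<le> \<delta>" "norm (q2 - q0) \<le> \<delta>" and e: "\<delta> + \<tau> * A \<le> b ^ 3 / 6"
  shows "norm (q1 - q2) * b \<le> norm (y1 - y2)"
proof -
  have q: "0 < Im q1" "0 < Im q2" and eq: "q1 - y1 = cauchy_int \<tau> (\<lambda>_. 1) q1" "q2 - y2 = cauchy_int \<tau> (\<lambda>_. 1) q2"
    using s by (auto simp: sol_def)
  define I where "I = (LINT t|H. of_real 1 / ((of_real (\<tau> * t) - q1) * (of_real (\<tau> * t) - q2)))"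
  have "(q1 - q2) - (y1 - y2) = (q1 - q2) * I"
    using cauchy_int_diff[OF const_one q, of \<tau>] by (simp add: eq[symmetric] I_def algebra_simps)
  then have prod: "(q1 - q2) * (1 - I) = y1 - y2" by (simp add: algebra_simps)
  define \<epsilon> where "\<epsilon> = 2 * (\<delta> + \<tau> * A) / b"
  have \<epsilon>0: "0 \<le> \<epsilon>"
  proof -
    have "0 \<le> \<delta>" using order_trans[OF norm_ge_zero d(1)] .
    moreover have "0 \<le> \<tau> * A" using \<tau> A_pos by simp
    ultimately show ?thesis
      using b(1) unfolding \<epsilon>_def by (intro divide_nonneg_pos mult_nonneg_nonneg[OF _ add_nonneg_nonneg]) simp_all
  qed
  have "\<epsilon> * (2 / b) + \<epsilon> \<le> \<epsilon> * (3 / b)"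
  proof -
    have "1 \<le> 1 / b" using b by simp
    then have "\<epsilon> * 1 \<le> \<epsilon> * (1 / b)" using \<epsilon>0 by (rule mult_left_mono)
    then have "\<epsilon> * (2 / b) + \<epsilon> * 1 \<le> \<epsilon> * (2 / b) + \<epsilon> * (1 / b)" by (rule add_left_mono)
    also have "\<dots> = \<epsilon> * (3 / b)"
      by (simp only: distrib_left[symmetric] add_divide_distrib[symmetric]) simp
    finally show ?thesis by (simp only: mult_1_right)
  qed
  also have "\<dots> = 6 * (\<delta> + \<tau> * A) / b\<^sup>2" by (simp add: \<epsilon>_def power2_eq_square)
  also have "\<dots> \<le> b ^ 3 / b\<^sup>2" using e by (intro divide_right_mono) (auto simp: algebra_simps)
  also have "\<dots> = b" using b(1) by (simp add: power2_eq_square power3_eq_cube)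
  finally have \<epsilon>b: "\<epsilon> * (2 / b) + \<epsilon> \<le> b" .
  have i: "integrable H (\<lambda>t. of_real 1 / ((of_real (\<tau> * t) - q1) * (of_real (\<tau> * t) - q2)))"
    by (rule integrable_bounded[where c = "1 / (Im q1 * Im q2)"]) (auto intro: cauchy_int_bound_product[OF const_one q, simplified])
  have i': "integrable H (\<lambda>t. (1 / q0)\<^sup>2)" by simp
  have "I - (1 / q0)\<^sup>2 = (LINT t|H. of_real 1 / ((of_real (\<tau> * t) - q1) * (of_real (\<tau> * t) - q2)) - (1 / q0)\<^sup>2)"
    unfolding I_def Bochner_Integration.integral_diff[OF i i'] by (simp only: integral_constant)
  also have "norm \<dots> \<le> b"
  proof (rule norm_integral_bounded)
    fix t assume t: "\<bar>t\<bar> \<le> A"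
    define u where "u = 1 / (of_real (\<tau> * t) - q1)"
    define v where "v = 1 / (of_real (\<tau> * t) - q2)"
    have u: "norm (u + 1 / q0) \<le> \<epsilon>" and v: "norm (v + 1 / q0) \<le> \<epsilon>"
      using near_q0(2)[OF d(1) e \<tau> t] near_q0(2)[OF d(2) e \<tau> t] by (simp_all add: u_def v_def \<epsilon>_def)
    have "b / 2 \<le> norm (of_real (\<tau> * t) - q2)" using denom_Im[of q2 "\<tau> * t"] near_q0(1)[OF d(2) e \<tau>] by linarith
    then have "1 / norm (of_real (\<tau> * t) - q2) \<le> 1 / (b / 2)" using b(1) by (intro frac_le) auto
    then have vb: "norm v \<le> 2 / b" by (simp add: v_def norm_divide)
    have "of_real 1 / ((of_real (\<tau> * t) - q1) * (of_real (\<tau> * t) - q2)) - (1 / q0)\<^sup>2 = u * v - (1 / q0)\<^sup>2"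
      by (simp add: u_def v_def)
    also have "\<dots> = (u + 1 / q0) * v - (1 / q0) * (v + 1 / q0)" by (simp only: algebra_simps power2_eq_square)
    also have "norm \<dots> \<le> norm (u + 1 / q0) * norm v + norm (1 / q0) * norm (v + 1 / q0)"
      unfolding norm_mult[symmetric] by (rule norm_triangle_ineq4)
    also have "\<dots> \<le> \<epsilon> * (2 / b) + 1 * \<epsilon>"
      using u v vb \<epsilon>0 q0_cnj(3) by (intro add_mono mult_mono) (auto simp: norm_divide)
    finally show "norm (of_real 1 / ((of_real (\<tau> * t) - q1) * (of_real (\<tau> * t) - q2)) - (1 / q0)\<^sup>2) \<le> b"
      using \<epsilon>b by linarith
  qed simp
  finally have I: "norm (I - (1 / q0)\<^sup>2) \<le> b" .
  have "1 - (1 / q0)\<^sup>2 = cnj q0 * (q0 - cnj q0)"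
    unfolding q0_cnj(4) power2_eq_square right_diff_distrib using q0_cnj(1) by (simp add: mult.commute)
  moreover have "q0 - cnj q0 = Complex 0 (2 * b)" by (simp add: q0_def complex_eq_iff)
  ultimately have "norm (1 - (1 / q0)\<^sup>2) = norm (cnj q0) * norm (Complex 0 (2 * b))"
    by (simp only: norm_mult)
  also have "norm (Complex 0 (2 * b)) = 2 * b" using b(1) by (simp add: cmod_def real_sqrt_mult)
  finally have "norm (1 - (1 / q0)\<^sup>2) = 2 * b" by (simp add: q0_cnj(3))
  then have "2 * b \<le> norm (1 - I) + norm (I - (1 / q0)\<^sup>2)"
    using norm_triangle_ineq[of "1 - I" "I - (1 / q0)\<^sup>2"] by simp
  then have "b \<le> norm (1 - I)" using I by linarith
  then have "norm (q1 - q2) * b \<le> norm (q1 - q2) * norm (1 - I)" by (intro mult_left_mono) auto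
  also have "\<dots> = norm (y1 - y2)" by (simp only: norm_mult[symmetric] prod)
  finally show ?thesis .
qed

end

end

lemma lipschitz_limit_at_right_0:
  fixes f :: "real \<Rightarrow> complex"
  assumes \<rho>: "0 < \<rho>" and L: "\<And>u v. u \<in> {0<..<\<rho>} \<Longrightarrow> v \<in> {0<..<\<rho>} \<Longrightarrow> norm (f u - f v) \<le> L * \<bar>u - v\<bar>"
  shows "\<exists>l. (f \<longlongrightarrow> l) (at_right 0)"
proof -
  define a where "a n = \<rho> / (real n + 2)" for n
  have a: "a n \<in> {0<..<\<rho>}" for n using \<rho> by (auto simp: a_def pos_divide_less_eq)
  have a0: "a \<longlonglongrightarrow> 0" unfolding a_def by real_asymp
  have Lp: "0 \<le> L * \<bar>a 0 - a 1\<bar>" using L[OF a a, of 0 1] norm_ge_zero order_trans by blast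
  have "a 0 \<noteq> a 1" using \<rho> by (simp add: a_def)
  then have L0: "0 \<le> L" using Lp by (simp add: zero_le_mult_iff)
  have "Cauchy (\<lambda>n. f (a n))"
  proof (rule metric_CauchyI)
    fix e :: real assume e: "0 < e"
    have "Cauchy a" using a0 by (rule LIMSEQ_imp_Cauchy)
    moreover have "0 < e / (L + 1)" using e L0 by simp
    ultimately have "\<exists>N. \<forall>m\<ge>N. \<forall>n\<ge>N. dist (a m) (a n) < e / (L + 1)" by (rule metric_CauchyD)
    then obtain N where N: "\<And>m n. N \<le> m \<Longrightarrow> N \<le> n \<Longrightarrow> dist (a m) (a n) < e / (L + 1)" by blast
    have "dist (f (a m)) (f (a n)) < e" if "N \<le> m" "N \<le> n" for m n
    proof -
      have "dist (f (a m)) (f (a n)) \<le> L * dist (a m) (a n)" using L[OF a a] by (simp add: dist_norm)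
      also have "\<dots> \<le> (L + 1) * dist (a m) (a n)" by (intro mult_right_mono) auto
      also have "\<dots> < (L + 1) * (e / (L + 1))" using N[OF that] L0 by (intro mult_strict_left_mono) auto
      finally show ?thesis using L0 by simp
    qed
    then show "\<exists>N. \<forall>m\<ge>N. \<forall>n\<ge>N. dist (f (a m)) (f (a n)) < e" by blast
  qed
  then obtain l where l: "(\<lambda>n. f (a n)) \<longlonglongrightarrow> l" using Cauchy_convergent convergent_def by blast
  have bound: "norm (f u - l) \<le> L * u" if u: "u \<in> {0<..<\<rho>}" for u
  proof (rule LIMSEQ_le)
    show "(\<lambda>n. norm (f u - f (a n))) \<longlonglongrightarrow> norm (f u - l)" by (intro tendsto_intros l)
    have "(\<lambda>n. L * \<bar>u - a n\<bar>) \<longlonglongrightarrow> L * \<bar>u - 0\<bar>" by (intro tendsto_intros a0)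
    then show "(\<lambda>n. L * \<bar>u - a n\<bar>) \<longlonglongrightarrow> L * u" using u by simp
    show "\<exists>N. \<forall>n\<ge>N. norm (f u - f (a n)) \<le> L * \<bar>u - a n\<bar>" using L[OF u a] by blast
  qed
  have "((\<lambda>u. f u - l) \<longlongrightarrow> 0) (at_right 0)"
  proof (rule Lim_null_comparison)
    show "\<forall>\<^sub>F u in at_right 0. norm (f u - l) \<le> L * u"
      using bound \<rho> by (auto simp: eventually_at_right_field)
    have "((\<lambda>u. L * u) \<longlongrightarrow> L * 0) (at_right 0)" by (intro tendsto_intros)
    then show "((\<lambda>u. L * u) \<longlongrightarrow> 0) (at_right 0)" by simp
  qed
  then show ?thesis by (auto simp: Lim_null[symmetric])
qed

declare of_real_mult [simp]

section \<open>Subordination in the upper half-plane\<close>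

context bounded_law
begin

lemma Im_stieltjes_pos:
  assumes "0 < Im z"
  shows "0 < Im (stieltjes H z)"
  unfolding stieltjes_cauchy_int Im_cauchy_int[OF assms] using inv_square_int_pos[OF assms, of 1] assms by simp

lemma stieltjes_holomorphic: "stieltjes H holomorphic_on {z. 0 < Im z}"
  using cauchy_int_holomorphic[OF const_one, of 1] unfolding stieltjes_cauchy_int[abs_def] .

end

lemma connected_upper_half_plane: "connected {z. 0 < Im z}"
  by (intro convex_connected convex_halfspace_Im_gt)

lemma compactly_supported_bounded_law:
  assumes "compactly_supported_law \<mu>"
  obtains A where "bounded_law \<mu> A"
proof -
  obtain a b where ab: "real_distribution \<mu>" "measure \<mu> {a..b} = 1"
    using assms by (auto simp: compactly_supported_law_def)
  interpret real_distribution \<mu> by (rule ab(1))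
  have "AE t in \<mu>. t \<in> {a..b}" using prob_eq_1[of "{a..b}"] ab(2) by simp
  then have "AE t in \<mu>. \<bar>t\<bar> \<le> \<bar>a\<bar> + \<bar>b\<bar> + 1" by (rule AE_mp) (rule AE_I2, auto)
  then have "bounded_law \<mu> (\<bar>a\<bar> + \<bar>b\<bar> + 1)" by unfold_locales auto
  then show ?thesis by (rule that)
qed

lemma free_convolution_large:
  assumes free: "is_free_add_conv H (semicircle s) \<mu>" and s: "0 < s"
    and H: "bounded_law H A" and mu: "bounded_law \<mu> B" and z: "A + B + 2 * s + 1 < norm z"
  shows "stieltjes \<mu> z = (LINT t|H. 1 / (of_real t - z - of_real s * stieltjes \<mu> z))"
proof -
  obtain \<phi> where \<phi>: "unital_functional \<phi>" "free_vars \<phi>" "has_law \<phi> (ncvar False) H"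
    "has_law \<phi> (ncvar True) (semicircle s)" "has_law \<phi> (ncvar False + ncvar True) \<mu>"
    using free unfolding is_free_add_conv_def by blast
  have cs: "compactly_supported_law (semicircle s)" using free by (simp add: is_free_add_conv_def)
  let ?a = "ncvar False + ncvar True"
  define D where "D K k = \<phi> (ncvar False ^ K * ?a ^ k)" for K k
  have sc: "\<phi> (ncvar True ^ Suc k) = s * (\<Sum>i<k. \<phi> (ncvar True ^ i) * \<phi> (ncvar True ^ (k - 1 - i)))" for k
  proof -
    have l: "\<phi> (ncvar True ^ k) = (LINT x|semicircle s. x ^ k)" for k
      using \<phi>(4) unfolding has_law_def by blast
    show ?thesis unfolding l by (rule semicircle_moments[OF s cs])
  qed
  have rec: "D K (Suc k) = D (Suc K) k + s * (\<Sum>i<k. D 0 i * D K (k - 1 - i))" for K k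
    using mixed_moment_recursion[OF \<phi>(1,2) sc, of K k] by (simp only: D_def power_0 mult_1_left)
  have DH: "D K 0 = (LINT t|H. t ^ K)" for K
    using \<phi>(3) by (simp add: D_def has_law_def)
  have Dm: "D 0 k = (LINT t|\<mu>. t ^ k)" for k
    using \<phi>(5) by (simp add: D_def has_law_def)
  show ?thesis by (rule subordination_large[OF H mu rec DH Dm s z])
qed

text \<open>Both sides are holomorphic in the upper half-plane, as \<open>z + s * m z\<close> maps it into itself, and they
  agree near infinity.\<close>

lemma subordination:
  assumes free: "is_free_add_conv H (semicircle s) \<mu>" and s: "0 < s"
    and H: "bounded_law H A" and z: "0 < Im z"
  shows "stieltjes \<mu> z = (LINT t|H. 1 / (of_real t - (z + of_real s * stieltjes \<mu> z)))"
proof -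
  interpret H: bounded_law H A by (rule H)
  obtain B where mu: "bounded_law \<mu> B"
    using compactly_supported_bounded_law free by (auto simp: is_free_add_conv_def)
  interpret mu: bounded_law \<mu> B by (rule mu)
  let ?S = "{z. 0 < Im z}"
  define R where "R = A + B + 2 * s + 1"
  let ?U = "{z. 0 < Im z} \<inter> - cball 0 R"
  let ?w = "\<lambda>z. z + of_real s * stieltjes \<mu> z"
  have wS: "?w ` ?S \<subseteq> ?S"
    using mu.Im_stieltjes_pos s by (auto intro!: add_pos_pos)
  have hw: "?w holomorphic_on ?S"
    by (intro holomorphic_on_add holomorphic_on_mult holomorphic_on_const holomorphic_on_ident mu.stieltjes_holomorphic)
  have hJ: "(H.cauchy_int 1 (\<lambda>_. 1) \<circ> ?w) holomorphic_on ?S"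
    by (rule holomorphic_on_compose_gen[OF hw H.cauchy_int_holomorphic[OF H.const_one] wS])
  have o: "open ?U" "open ?S" by (intro open_Int open_halfspace_Im_gt open_Compl closed_cball)+
  have "\<i> * of_real (\<bar>R\<bar> + 1) \<in> ?U" by (simp add: norm_mult) linarith
  then have ne: "?U \<noteq> {}" by blast
  have eq: "stieltjes \<mu> y = (H.cauchy_int 1 (\<lambda>_. 1) \<circ> ?w) y" if "y \<in> ?U" for y
  proof -
    have "A + B + 2 * s + 1 < norm y" using that by (simp add: R_def)
    from free_convolution_large[OF free s H mu this] show ?thesis
      by (simp add: H.cauchy_int_def diff_diff_eq)
  qed
  have sub: "?U \<subseteq> ?S" and zS: "z \<in> ?S" using z by auto
  have "stieltjes \<mu> z = (H.cauchy_int 1 (\<lambda>_. 1) \<circ> ?w) z"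
    by (rule analytic_continuation_open[OF o ne connected_upper_half_plane sub mu.stieltjes_holomorphic hJ eq zS])
  then show ?thesis by (simp add: H.cauchy_int_def)
qed

text \<open>By \<open>sol_close\<close> the solution stays near \<open>q0\<close> above \<open>x\<close>; by \<open>sol_stable\<close> it is then Lipschitz
  continuous in \<open>\<eta>\<close> and has a limit.\<close>

lemma boundary_solution:
  assumes H: "bounded_law H A" and \<tau>: "0 \<le> \<tau>" and x: "\<bar>x\<bar> < 2"
    and b_def: "b = sqrt (1 - x\<^sup>2 / 4)" and q0_def: "q0 = Complex (x / 2) b"
    and small: "\<tau> * A \<le> b ^ 4 / 100"
    and sol: "\<And>y. 0 < Im y \<Longrightarrow> bounded_law.sol H \<tau> y (Q y)"
  shows "\<exists>l. ((\<lambda>\<eta>. Q (Complex x \<eta>)) \<longlongrightarrow> l) (at_right 0) \<and> norm (l - q0) * b \<le> 10 * (\<tau> * A) \<and> b / 2 \<le> Im l"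
proof -
  interpret H: bounded_law H A by (rule H)
  note b = H.b[OF x b_def q0_def]
  \<comment> \<open>small enough that delta + tau * A is at most b ^ 3 / 6, as stability requires\<close>
  define \<rho> where "\<rho> = b ^ 4 / 120"
  have b4: "b ^ 4 \<le> 1" "0 < b ^ 4" using b by (auto intro: power_le_one)
  have \<rho>: "0 < \<rho>" "\<rho> \<le> 1" using b4 by (auto simp: \<rho>_def)
  have \<tau>8: "\<tau> * A \<le> 1 / 8" using small b4 by linarith
  define \<delta> where "\<delta> = 5 * (\<rho> + 2 * (\<tau> * A)) / b"
  have close: "norm (Q (Complex x \<eta>) - q0) * b \<le> 5 * (\<eta> + 2 * (\<tau> * A))" if "\<eta> \<in> {0<..<\<rho>}" for \<eta>
  proof -
    have n: "Complex x \<eta> - of_real x = Complex 0 \<eta>" by (simp add: complex_eq_iff)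
    have "norm (Complex x \<eta> - of_real x) = \<eta>" unfolding n using that by (simp add: cmod_def)
    then show ?thesis
      using H.sol_close[OF x b_def q0_def sol \<tau> \<tau>8, of "Complex x \<eta>"] that \<rho> by simp
  qed
  have d: "norm (Q (Complex x \<eta>) - q0) \<le> \<delta>" if "\<eta> \<in> {0<..<\<rho>}" for \<eta>
  proof -
    have "norm (Q (Complex x \<eta>) - q0) * b \<le> 5 * (\<rho> + 2 * (\<tau> * A))" using close[OF that] that by simp
    then show ?thesis unfolding \<delta>_def using b(1) by (simp add: pos_le_divide_eq)
  qed
  have e: "\<delta> + \<tau> * A \<le> b ^ 3 / 6"
  proof -
    have "\<tau> * A \<le> (\<tau> * A) / b" using b \<tau> H.A_pos by (simp add: pos_le_divide_eq mult_left_le)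
    then have "\<delta> + \<tau> * A \<le> \<delta> + (\<tau> * A) / b" by simp
    also have "\<dots> = (5 * (\<rho> + 2 * (\<tau> * A)) + \<tau> * A) / b" by (simp only: \<delta>_def add_divide_distrib)
    also have "5 * (\<rho> + 2 * (\<tau> * A)) + \<tau> * A = 5 * \<rho> + 11 * (\<tau> * A)" by simp
    also have "(5 * \<rho> + 11 * (\<tau> * A)) / b \<le> (5 * (b ^ 4 / 120) + 11 * (b ^ 4 / 100)) / b"
      using small b(1) unfolding \<rho>_def by (intro divide_right_mono add_mono mult_left_mono) auto
    also have "\<dots> = (5 / 120 + 11 / 100) * b ^ 3" using b(1) by (simp add: power_eq_if field_simps)
    also have "\<dots> \<le> b ^ 3 / 6" using b(1) by simp
    finally show ?thesis .
  qed
  have lip: "norm (Q (Complex x u) - Q (Complex x v)) \<le> (1 / b) * \<bar>u - v\<bar>" if uv: "u \<in> {0<..<\<rho>}" "v \<in> {0<..<\<rho>}" for u v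
  proof -
    have "norm (Q (Complex x u) - Q (Complex x v)) * b \<le> norm (Complex x u - Complex x v)"
      by (rule H.sol_stable[OF x b_def q0_def sol sol \<tau> d d e]) (use uv in auto)
    also have "\<dots> = \<bar>u - v\<bar>" by (simp add: cmod_def)
    finally show ?thesis using b(1) by (simp add: pos_le_divide_eq)
  qed
  obtain l where l: "((\<lambda>\<eta>. Q (Complex x \<eta>)) \<longlongrightarrow> l) (at_right 0)"
    using lipschitz_limit_at_right_0[OF \<rho>(1) lip] by blast
  have ev: "\<forall>\<^sub>F \<eta> in at_right 0. \<eta> \<in> {0<..<\<rho>}"
    using \<rho>(1) by (auto simp: eventually_at_right_field)
  have "norm (l - q0) * b \<le> 5 * (0 + 2 * (\<tau> * A))"
  proof (rule tendsto_le[OF trivial_limit_at_right_real])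
    show "((\<lambda>\<eta>. 5 * (\<eta> + 2 * (\<tau> * A))) \<longlongrightarrow> 5 * (0 + 2 * (\<tau> * A))) (at_right 0)" by (intro tendsto_intros)
    show "((\<lambda>\<eta>. norm (Q (Complex x \<eta>) - q0) * b) \<longlongrightarrow> norm (l - q0) * b) (at_right 0)" by (intro tendsto_intros l)
    show "\<forall>\<^sub>F \<eta> in at_right 0. norm (Q (Complex x \<eta>) - q0) * b \<le> 5 * (\<eta> + 2 * (\<tau> * A))"
      using ev by eventually_elim (rule close)
  qed
  moreover have "b / 2 \<le> Im l"
  proof (rule tendsto_lowerbound[OF tendsto_Im[OF l]])
    show "\<forall>\<^sub>F \<eta> in at_right 0. b / 2 \<le> Im (Q (Complex x \<eta>))"
      using ev by eventually_elim (rule H.near_q0(1)[OF x b_def q0_def d e \<tau>])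
  qed simp
  ultimately show ?thesis using l by auto
qed

section \<open>The optimal shrinkage function for strong noise\<close>

text \<open>At distance \<open>\<delta>\<close> from the support the imaginary part of the Stieltjes transform is at most
  \<open>\<eta> / \<delta>\<^sup>2\<close>.\<close>

lemma (in bounded_law) support_of_boundary_density:
  assumes l: "((\<lambda>\<eta>. stieltjes H (Complex x \<eta>)) \<longlongrightarrow> l) (at_right 0)" and pos: "0 < Im l"
  shows "x \<in> measure_support H"
  unfolding measure_support_def
proof (intro CollectI allI impI, rule ccontr)
  fix V assume V: "open V" "x \<in> V" and "\<not> 0 < emeasure H V"
  then have "emeasure H V = 0" by simp
  moreover have "V \<in> sets H" using V(1) by simp
  ultimately have "AE t in H. t \<notin> V" using AE_iff_measurable[of V H "\<lambda>t. t \<notin> V"] sets.sets_into_space[of V H] by auto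
  moreover obtain \<delta> where \<delta>: "0 < \<delta>" "ball x \<delta> \<subseteq> V" using V openE by blast
  ultimately have far: "AE t in H. \<delta> \<le> \<bar>t - x\<bar>"
    by (elim AE_mp) (rule AE_I2, force simp: dist_real_def subset_eq)
  have bound: "Im (stieltjes H (Complex x \<eta>)) \<le> \<eta> * (1 / \<delta>\<^sup>2)" if \<eta>: "0 < \<eta>" for \<eta>
  proof -
    have \<eta>': "0 < Im (Complex x \<eta>)" using \<eta> by simp
    have "inv_square_int 1 (Complex x \<eta>) \<le> 1 / \<delta>\<^sup>2"
      unfolding inv_square_int_def
    proof (rule integral_le_const)
      show "integrable H (\<lambda>t. 1 / (norm (of_real (1 * t) - Complex x \<eta>))\<^sup>2)"
      proof (rule integrable_bounded[where c = "1 / \<eta>\<^sup>2"])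
        fix t :: real
        have "\<eta>\<^sup>2 \<le> (norm (of_real (1 * t) - Complex x \<eta>))\<^sup>2"
          using denom_Im[of "Complex x \<eta>" "1 * t"] \<eta> by (intro power_mono) auto
        then show "norm (1 / (norm (of_real (1 * t) - Complex x \<eta>))\<^sup>2) \<le> 1 / \<eta>\<^sup>2"
          using \<eta> by (simp add: frac_le)
      qed simp
      show "AE t in H. 1 / (norm (of_real (1 * t) - Complex x \<eta>))\<^sup>2 \<le> 1 / \<delta>\<^sup>2"
        using far
      proof (rule AE_mp, intro AE_I2 impI)
        fix t assume t: "\<delta> \<le> \<bar>t - x\<bar>"
        have "\<bar>t - x\<bar> \<le> norm (of_real (1 * t) - Complex x \<eta>)"
          using abs_Re_le_cmod[of "of_real (1 * t) - Complex x \<eta>"] by simp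
        then have "\<delta>\<^sup>2 \<le> (norm (of_real (1 * t) - Complex x \<eta>))\<^sup>2" using t \<delta>(1) by (intro power_mono) auto
        then show "1 / (norm (of_real (1 * t) - Complex x \<eta>))\<^sup>2 \<le> 1 / \<delta>\<^sup>2"
          using \<delta>(1) by (intro frac_le) auto
      qed
    qed
    then show ?thesis unfolding stieltjes_cauchy_int Im_cauchy_int[OF \<eta>'] using \<eta> by (simp only: complex.sel mult_left_mono)
  qed
  have "Im l \<le> 0 * (1 / \<delta>\<^sup>2)"
  proof (rule tendsto_le[OF trivial_limit_at_right_real])
    show "((\<lambda>\<eta>. \<eta> * (1 / \<delta>\<^sup>2)) \<longlongrightarrow> 0 * (1 / \<delta>\<^sup>2)) (at_right 0)" by (intro tendsto_intros)
    show "((\<lambda>\<eta>. Im (stieltjes H (Complex x \<eta>))) \<longlongrightarrow> Im l) (at_right 0)" by (intro tendsto_Im l)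
    show "\<forall>\<^sub>F \<eta> in at_right 0. Im (stieltjes H (Complex x \<eta>)) \<le> \<eta> * (1 / \<delta>\<^sup>2)"
      using bound by (auto simp: eventually_at_right_field intro!: exI[of _ 1])
  qed
  then show False using pos by simp
qed

lemma rescaled_subordination:
  assumes free: "is_free_add_conv H (semicircle (\<sigma>\<^sup>2)) \<mu>" and \<sigma>: "0 < \<sigma>" and H: "bounded_law H A" and y: "0 < Im y"
  shows "bounded_law.sol H (1 / \<sigma>) y (y + of_real \<sigma> * stieltjes \<mu> (of_real \<sigma> * y))"
proof -
  interpret H: bounded_law H A by (rule H)
  obtain B where mu: "bounded_law \<mu> B"
    using compactly_supported_bounded_law free by (auto simp: is_free_add_conv_def)
  interpret mu: bounded_law \<mu> B by (rule mu)
  let ?m = "stieltjes \<mu> (of_real \<sigma> * y)"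
  let ?q = "y + of_real \<sigma> * ?m"
  have z: "0 < Im (of_real \<sigma> * y)" using \<sigma> y by simp
  have s2: "0 < \<sigma>\<^sup>2" using \<sigma> by simp
  have d: "of_real t - (of_real \<sigma> * y + of_real (\<sigma>\<^sup>2) * ?m) = of_real \<sigma> * (of_real (1 / \<sigma> * t) - ?q)" for t
    using \<sigma> by (simp add: algebra_simps power2_eq_square)
  have "of_real \<sigma> * ?m = of_real \<sigma> * (LINT t|H. 1 / (of_real \<sigma> * (of_real (1 / \<sigma> * t) - ?q)))"
    by (subst subordination[OF free s2 H z]) (simp only: d)
  also have "\<dots> = (LINT t|H. of_real \<sigma> * (1 / (of_real \<sigma> * (of_real (1 / \<sigma> * t) - ?q))))"
    by (rule integral_mult_right_zero[symmetric])
  also have "\<dots> = H.cauchy_int (1 / \<sigma>) (\<lambda>_. 1) ?q"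
    unfolding H.cauchy_int_def using \<sigma> by (intro Bochner_Integration.integral_cong refl) simp
  finally have "?q - y = H.cauchy_int (1 / \<sigma>) (\<lambda>_. 1) ?q" by simp
  moreover have "0 < Im ?q" using mu.Im_stieltjes_pos[OF z] \<sigma> y by (simp add: add_pos_pos)
  ultimately show ?thesis using y by (simp add: H.sol_def)
qed

lemma weighted_stieltjes_cauchy_int:
  assumes \<sigma>: "0 < \<sigma>" and H: "bounded_law H A"
    and ht [measurable]: "ht \<in> borel_measurable borel" and hm: "(\<lambda>t. indicat_real U t * h t) \<in> borel_measurable borel"
    and hU: "AE t in H. indicat_real U t * h t = ht t"
  shows "weighted_stieltjes h U H \<sigma> \<mu> (of_real \<sigma> * y)
    = of_real (1 / \<sigma>) * bounded_law.cauchy_int H (1 / \<sigma>) ht (y + of_real \<sigma> * stieltjes \<mu> (of_real \<sigma> * y))"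
proof -
  interpret H: bounded_law H A by (rule H)
  note hm [measurable]
  let ?m = "stieltjes \<mu> (of_real \<sigma> * y)"
  let ?q = "y + of_real \<sigma> * ?m"
  have d: "of_real t - of_real \<sigma> * y - of_real (\<sigma>\<^sup>2) * ?m = of_real \<sigma> * (of_real (1 / \<sigma> * t) - ?q)" for t
    using \<sigma> by (simp add: algebra_simps power2_eq_square)
  have "weighted_stieltjes h U H \<sigma> \<mu> (of_real \<sigma> * y)
      = (LINT t|H. of_real (indicat_real U t * h t) / (of_real \<sigma> * (of_real (1 / \<sigma> * t) - ?q)))"
    unfolding weighted_stieltjes_def set_lebesgue_integral_def d
    by (intro Bochner_Integration.integral_cong refl) (simp add: indicator_def)
  also have "\<dots> = (LINT t|H. of_real (ht t) / (of_real \<sigma> * (of_real (1 / \<sigma> * t) - ?q)))"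
  proof (rule integral_cong_AE)
    show "AE t in H. of_real (indicat_real U t * h t) / (of_real \<sigma> * (of_real (1 / \<sigma> * t) - ?q))
        = of_real (ht t) / (of_real \<sigma> * (of_real (1 / \<sigma> * t) - ?q))"
      using hU by (rule AE_mp) (intro AE_I2 impI, simp only:)
  qed measurable
  also have "\<dots> = (LINT t|H. of_real (1 / \<sigma>) * (of_real (ht t) / (of_real (1 / \<sigma> * t) - ?q)))"
    using \<sigma> by (intro Bochner_Integration.integral_cong refl) simp
  also have "\<dots> = of_real (1 / \<sigma>) * H.cauchy_int (1 / \<sigma>) ht ?q"
    unfolding H.cauchy_int_def by (rule integral_mult_right_zero)
  finally show ?thesis .
qed

lemma boundary_value_eq:
  assumes "((\<lambda>\<eta>. f (Complex x \<eta>)) \<longlongrightarrow> l) (at_right 0)"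
  shows "boundary_value f x = l" "has_boundary_value f x"
  using assms tendsto_Lim[OF trivial_limit_at_right_real assms]
  by (auto simp: boundary_value_def has_boundary_value_def)

text \<open>Once the boundary value \<open>Q\<close> of the rescaled solution exists, both boundary values in the
  shrinkage function are explicit in \<open>Q\<close>, and the common factor \<open>1 / \<sigma>\<close> cancels.\<close>

lemma shrinkage_at_large_noise:
  assumes free: "is_free_add_conv H (semicircle (\<sigma>\<^sup>2)) \<mu>" and \<sigma>: "0 < \<sigma>" and H: "bounded_law H A"
    and ht: "ht \<in> borel_measurable borel" "\<And>t. \<bar>ht t\<bar> \<le> c"
    and hm: "(\<lambda>t. indicat_real U t * h t) \<in> borel_measurable borel"
    and hU: "AE t in H. indicat_real U t * h t = ht t"
    and x: "\<bar>x\<bar> < 2"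
    and b_def: "b = sqrt (1 - x\<^sup>2 / 4)" and q0_def: "q0 = Complex (x / 2) b"
    and small: "1 / \<sigma> * A \<le> b ^ 4 / 100"
  shows "\<exists>Q. norm (Q - q0) * b \<le> 10 * (1 / \<sigma> * A) \<and> b / 2 \<le> Im Q \<and>
     \<sigma> * x \<in> opt_shrinkage_dom h U H \<sigma> \<mu> \<and>
     opt_shrinkage h U H \<sigma> \<mu> (\<sigma> * x) = Im (bounded_law.cauchy_int H (1 / \<sigma>) ht Q) / Im Q"
proof -
  interpret H: bounded_law H A by (rule H)
  obtain B where mu: "bounded_law \<mu> B"
    using compactly_supported_bounded_law free by (auto simp: is_free_add_conv_def)
  interpret mu: bounded_law \<mu> B by (rule mu)
  note b = H.b[OF x b_def q0_def]
  define qf where "qf y = y + of_real \<sigma> * stieltjes \<mu> (of_real \<sigma> * y)" for y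
  have sol: "H.sol (1 / \<sigma>) y (qf y)" if "0 < Im y" for y
    unfolding qf_def by (rule rescaled_subordination[OF free \<sigma> H that])
  have \<tau>: "0 \<le> 1 / \<sigma>" using \<sigma> by simp
  obtain Q where Q0: "((\<lambda>\<eta>. qf (Complex x \<eta>)) \<longlongrightarrow> Q) (at_right 0)"
    and Q: "norm (Q - q0) * b \<le> 10 * (1 / \<sigma> * A)" "b / 2 \<le> Im Q"
    using boundary_solution[OF H \<tau> x b_def q0_def small sol] by blast
  have ImQ: "0 < Im Q" using Q(2) b(1) by linarith
  have "((\<lambda>\<eta>. \<eta> / \<sigma>) \<longlongrightarrow> 0 / \<sigma>) (at_right 0)" using \<sigma> by (intro tendsto_intros) simp
  then have fl0: "((\<lambda>\<eta>. \<eta> / \<sigma>) \<longlongrightarrow> 0) (at_right 0)" by simp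
  have fl: "filterlim (\<lambda>\<eta>. \<eta> / \<sigma>) (at_right 0) (at_right 0)"
  proof (rule filterlim_at_withinI)
    show "((\<lambda>\<eta>. \<eta> / \<sigma>) \<longlongrightarrow> 0) (at_right 0)" by (rule fl0)
    show "\<forall>\<^sub>F \<eta> in at_right 0. \<eta> / \<sigma> \<in> {0<..} - {0}"
      using \<sigma> by (auto simp: eventually_at_right_field intro!: exI[of _ 1])
  qed
  have Ql: "((\<lambda>\<eta>. qf (Complex x (\<eta> / \<sigma>))) \<longlongrightarrow> Q) (at_right 0)"
    by (rule filterlim_compose[OF Q0 fl])
  have z: "Complex (\<sigma> * x) \<eta> = of_real \<sigma> * Complex x (\<eta> / \<sigma>)" for \<eta>
    using \<sigma> by (simp add: complex_eq_iff)
  have "stieltjes \<mu> (Complex (\<sigma> * x) \<eta>) = (qf (Complex x (\<eta> / \<sigma>)) - Complex x (\<eta> / \<sigma>)) / of_real \<sigma>" for \<eta>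
    using \<sigma> by (simp add: z qf_def)
  moreover have "((\<lambda>\<eta>. (qf (Complex x (\<eta> / \<sigma>)) - Complex x (\<eta> / \<sigma>)) / of_real \<sigma>) \<longlongrightarrow> (Q - Complex x 0) / of_real \<sigma>) (at_right 0)"
  proof -
    have "((\<lambda>\<eta>. Complex x (\<eta> / \<sigma>)) \<longlongrightarrow> Complex x 0) (at_right 0)"
      by (rule tendsto_Complex[OF tendsto_const fl0])
    then show ?thesis using \<sigma> by (intro tendsto_divide tendsto_diff Ql tendsto_const) auto
  qed
  ultimately have m: "((\<lambda>\<eta>. stieltjes \<mu> (Complex (\<sigma> * x) \<eta>)) \<longlongrightarrow> (Q - Complex x 0) / of_real \<sigma>) (at_right 0)"
    by (simp only:)
  have Im_m: "Im ((Q - Complex x 0) / of_real \<sigma>) = Im Q / \<sigma>" by (simp add: Im_divide_of_real)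
  have "((\<lambda>\<eta>. H.cauchy_int (1 / \<sigma>) ht (qf (Complex x (\<eta> / \<sigma>)))) \<longlongrightarrow> H.cauchy_int (1 / \<sigma>) ht Q) (at_right 0)"
  proof -
    have o: "open {q. 0 < Im q}" by (rule open_halfspace_Im_gt)
    have "continuous_on {q. 0 < Im q} (H.cauchy_int (1 / \<sigma>) ht)"
      by (rule holomorphic_on_imp_continuous_on[OF H.cauchy_int_holomorphic[OF ht]])
    then have "isCont (H.cauchy_int (1 / \<sigma>) ht) Q"
      using ImQ continuous_on_eq_continuous_at[OF o] by blast
    then show ?thesis using Ql by (rule isCont_tendsto_compose)
  qed
  then have "((\<lambda>\<eta>. of_real (1 / \<sigma>) * H.cauchy_int (1 / \<sigma>) ht (qf (Complex x (\<eta> / \<sigma>)))) \<longlongrightarrow> of_real (1 / \<sigma>) * H.cauchy_int (1 / \<sigma>) ht Q) (at_right 0)"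
    by (rule tendsto_mult_left)
  then have wm: "((\<lambda>\<eta>. weighted_stieltjes h U H \<sigma> \<mu> (Complex (\<sigma> * x) \<eta>)) \<longlongrightarrow> of_real (1 / \<sigma>) * H.cauchy_int (1 / \<sigma>) ht Q) (at_right 0)"
    unfolding z weighted_stieltjes_cauchy_int[OF \<sigma> H ht(1) hm hU] qf_def .
  note bv = boundary_value_eq[OF m] boundary_value_eq[OF wm]
  have v: "v_fun \<mu> (\<sigma> * x) = Im Q / \<sigma>" unfolding v_fun_def bv(1) by (rule Im_m)
  have vh: "vh_fun h U H \<sigma> \<mu> (\<sigma> * x) = Im (H.cauchy_int (1 / \<sigma>) ht Q) / \<sigma>"
    unfolding vh_fun_def bv(3) by simp
  have "\<sigma> * x \<in> measure_support \<mu>"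
    by (rule mu.support_of_boundary_density[OF m]) (use ImQ \<sigma> Im_m in simp)
  then have "\<sigma> * x \<in> opt_shrinkage_dom h U H \<sigma> \<mu>"
    using bv(2,4) v ImQ \<sigma> by (simp add: opt_shrinkage_dom_def)
  moreover have "opt_shrinkage h U H \<sigma> \<mu> (\<sigma> * x) = Im (H.cauchy_int (1 / \<sigma>) ht Q) / Im Q"
    unfolding opt_shrinkage_def v vh using \<sigma> by simp
  ultimately show ?thesis using Q by blast
qed

text \<open>Near \<open>q0\<close> and for small \<open>\<tau>\<close> the kernel \<open>1 / (\<tau> * t - Q)\<close> is uniformly close to \<open>- 1 / q0\<close>.\<close>

lemma (in bounded_law) cauchy_int_near_q0:
  assumes ht: "ht \<in> borel_measurable borel" "\<And>t. \<bar>ht t\<bar> \<le> c" and \<tau>: "0 \<le> \<tau>"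
    and x: "\<bar>x\<bar> < 2" and b_def: "b = sqrt (1 - x\<^sup>2 / 4)" and q0_def: "q0 = Complex (x / 2) b"
    and d: "norm (Q - q0) \<le> \<delta>" and e: "\<delta> + \<tau> * A \<le> b ^ 3 / 6"
  shows "norm (cauchy_int \<tau> ht Q + of_real (LINT t|H. ht t) / q0) \<le> c * (2 * (\<delta> + \<tau> * A) / b)"
proof -
  have c0: "0 \<le> c" using ht(2)[of 0] by linarith
  have ImQ: "0 < Im Q" using near_q0(1)[OF x b_def q0_def d e \<tau>] b[OF x b_def q0_def] by linarith
  have m [measurable]: "ht \<in> borel_measurable borel" by (rule ht(1))
  have iht: "integrable H (\<lambda>t. of_real (ht t) / q0)"
  proof (rule integrable_bounded[where c = "c / norm q0"])
    show "(\<lambda>t. complex_of_real (ht t) / q0) \<in> borel_measurable borel" by measurable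
    show "norm (complex_of_real (ht t) / q0) \<le> c / norm q0" for t
      using ht(2)[of t] by (simp add: norm_divide divide_right_mono)
  qed
  have "of_real (LINT t|H. ht t) / q0 = (LINT t|H. of_real (ht t) / q0)" by simp
  then have "cauchy_int \<tau> ht Q + of_real (LINT t|H. ht t) / q0 = (LINT t|H. of_real (ht t) / (of_real (\<tau> * t) - Q) + of_real (ht t) / q0)"
    unfolding cauchy_int_def by (simp only: Bochner_Integration.integral_add[OF cauchy_int_integrable[OF ht ImQ] iht])
  also have "norm \<dots> \<le> c * (2 * (\<delta> + \<tau> * A) / b)"
  proof (rule norm_integral_bounded)
    show "(\<lambda>t. of_real (ht t) / (of_real (\<tau> * t) - Q) + of_real (ht t) / q0) \<in> borel_measurable borel" by measurable
    fix t assume t: "\<bar>t\<bar> \<le> A"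
    have "of_real (ht t) / (of_real (\<tau> * t) - Q) + of_real (ht t) / q0
       = of_real (ht t) * (1 / (of_real (\<tau> * t) - Q) + 1 / q0)"
      by (simp only: distrib_left times_divide_eq_right mult_1_right)
    then have "norm (of_real (ht t) / (of_real (\<tau> * t) - Q) + of_real (ht t) / q0)
       = \<bar>ht t\<bar> * norm (1 / (of_real (\<tau> * t) - Q) + 1 / q0)"
      by (simp only: norm_mult norm_of_real)
    also have "\<dots> \<le> c * (2 * (\<delta> + \<tau> * A) / b)"
      using ht(2)[of t] c0 near_q0(2)[OF x b_def q0_def d e \<tau> t] by (intro mult_mono) auto
    finally show "norm (of_real (ht t) / (of_real (\<tau> * t) - Q) + of_real (ht t) / q0) \<le> c * (2 * (\<delta> + \<tau> * A) / b)" .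
  qed
  finally show ?thesis .
qed

text \<open>Since \<open>Q\<close> tends to \<open>q0\<close>, the quotient tends to \<open>I * Im (- 1 / q0) / Im q0 = I\<close>, because
  \<open>1 / q0 = cnj q0\<close>.\<close>

theorem shrinkage_strong_noise:
  fixes muhat :: "real \<Rightarrow> real measure"
  assumes free: "\<And>\<sigma>. 0 < \<sigma> \<Longrightarrow> is_free_add_conv H (semicircle (\<sigma>\<^sup>2)) (muhat \<sigma>)" and H: "bounded_law H A"
    and ht: "ht \<in> borel_measurable borel" "\<And>t. \<bar>ht t\<bar> \<le> c"
    and hm: "(\<lambda>t. indicat_real U t * h t) \<in> borel_measurable borel"
    and hU: "AE t in H. indicat_real U t * h t = ht t"
    and x: "\<bar>x\<bar> < 2"
  shows "\<forall>\<^sub>F \<sigma> in at_top. \<sigma> * x \<in> opt_shrinkage_dom h U H \<sigma> (muhat \<sigma>)"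
    and "((\<lambda>\<sigma>. opt_shrinkage h U H \<sigma> (muhat \<sigma>) (\<sigma> * x)) \<longlongrightarrow> (LINT t|H. ht t)) at_top"
proof -
  interpret H: bounded_law H A by (rule H)
  define b where "b = sqrt (1 - x\<^sup>2 / 4)"
  define q0 where "q0 = Complex (x / 2) b"
  note b = H.b[OF x b_def q0_def]
  define I where "I = (LINT t|H. ht t)"
  define G where "G \<sigma> Q \<longleftrightarrow> norm (Q - q0) * b \<le> 10 * (1 / \<sigma> * A) \<and> b / 2 \<le> Im Q \<and>
     \<sigma> * x \<in> opt_shrinkage_dom h U H \<sigma> (muhat \<sigma>) \<and>
     opt_shrinkage h U H \<sigma> (muhat \<sigma>) (\<sigma> * x) = Im (H.cauchy_int (1 / \<sigma>) ht Q) / Im Q" for \<sigma> Q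
  have t0: "((\<lambda>\<sigma>. 1 / \<sigma> * A) \<longlongrightarrow> 0) at_top" by real_asymp
  have b4: "0 < b ^ 4 / 100" using b(1) by simp
  have large: "\<forall>\<^sub>F \<sigma> in at_top. 0 < \<sigma> \<and> 1 / \<sigma> * A < b ^ 4 / 100"
    using eventually_gt_at_top[of 0] order_tendstoD(2)[OF t0 b4] by (rule eventually_conj)
  have ex: "\<forall>\<^sub>F \<sigma> in at_top. \<exists>Q. G \<sigma> Q"
    using large
  proof eventually_elim
    case (elim \<sigma>)
    show ?case unfolding G_def
      by (rule shrinkage_at_large_noise[OF free _ H ht hm hU x b_def q0_def]) (use elim in auto)
  qed
  then show "\<forall>\<^sub>F \<sigma> in at_top. \<sigma> * x \<in> opt_shrinkage_dom h U H \<sigma> (muhat \<sigma>)"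
    by eventually_elim (auto simp: G_def)
  define Q where "Q \<sigma> = (SOME Q. G \<sigma> Q)" for \<sigma>
  have GQ: "\<forall>\<^sub>F \<sigma> in at_top. G \<sigma> (Q \<sigma>)"
    using ex by eventually_elim (auto simp: Q_def intro: someI_ex)
  have near: "\<forall>\<^sub>F \<sigma> in at_top. norm (Q \<sigma> - q0) \<le> 10 * (1 / \<sigma> * A) / b"
    using GQ by eventually_elim (simp only: G_def pos_le_divide_eq[OF b(1)])
  have d0: "((\<lambda>\<sigma>. 10 * (1 / \<sigma> * A) / b) \<longlongrightarrow> 0) at_top"
    using tendsto_divide[OF tendsto_mult[OF tendsto_const[of 10] t0] tendsto_const[of b]] b(1) by simp
  have "((\<lambda>\<sigma>. Q \<sigma> - q0) \<longlongrightarrow> 0) at_top" by (rule Lim_null_comparison[OF near d0])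
  then have Ql: "(Q \<longlongrightarrow> q0) at_top" by (simp add: Lim_null[symmetric])
  have e0: "((\<lambda>\<sigma>. 10 * (1 / \<sigma> * A) / b + 1 / \<sigma> * A) \<longlongrightarrow> 0 + 0) at_top" by (rule tendsto_add[OF d0 t0])
  have "0 + 0 < b ^ 3 / 6" using b(1) by simp
  then have e: "\<forall>\<^sub>F \<sigma> in at_top. 10 * (1 / \<sigma> * A) / b + 1 / \<sigma> * A < b ^ 3 / 6"
    by (rule order_tendstoD(2)[OF e0])
  have nearJ: "\<forall>\<^sub>F \<sigma> in at_top. norm (H.cauchy_int (1 / \<sigma>) ht (Q \<sigma>) + of_real I / q0)
      \<le> c * (2 * (10 * (1 / \<sigma> * A) / b + 1 / \<sigma> * A) / b)"
    using near e eventually_gt_at_top[of 0] unfolding I_def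
    by eventually_elim (rule H.cauchy_int_near_q0[OF ht _ x b_def q0_def], auto)
  have "((\<lambda>\<sigma>. c * (2 * (10 * (1 / \<sigma> * A) / b + 1 / \<sigma> * A) / b)) \<longlongrightarrow> c * (2 * (0 + 0) / b)) at_top"
    by (rule tendsto_mult[OF tendsto_const tendsto_divide[OF tendsto_mult[OF tendsto_const e0] tendsto_const]]) (use b(1) in simp)
  then have "((\<lambda>\<sigma>. c * (2 * (10 * (1 / \<sigma> * A) / b + 1 / \<sigma> * A) / b)) \<longlongrightarrow> 0) at_top" by simp
  then have "((\<lambda>\<sigma>. H.cauchy_int (1 / \<sigma>) ht (Q \<sigma>) + of_real I / q0) \<longlongrightarrow> 0) at_top"
    by (rule Lim_null_comparison[OF nearJ])
  then have Jl: "((\<lambda>\<sigma>. H.cauchy_int (1 / \<sigma>) ht (Q \<sigma>)) \<longlongrightarrow> - (of_real I / q0)) at_top"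
    using Lim_null[of "\<lambda>\<sigma>. H.cauchy_int (1 / \<sigma>) ht (Q \<sigma>)" "- (of_real I / q0)" at_top] by simp
  have q0b: "Im q0 = b" by (rule H.q0_cnj(5)[OF x b_def q0_def])
  have "of_real I / q0 = of_real I * cnj q0"
    using H.q0_cnj(4)[OF x b_def q0_def] by (metis mult.right_neutral times_divide_eq_right)
  then have im: "Im (- (of_real I / q0)) = I * b" using q0b by simp
  have "((\<lambda>\<sigma>. Im (H.cauchy_int (1 / \<sigma>) ht (Q \<sigma>)) / Im (Q \<sigma>)) \<longlongrightarrow> Im (- (of_real I / q0)) / Im q0) at_top"
    by (intro tendsto_divide tendsto_Im Jl Ql) (use q0b b(1) in simp)
  moreover have "Im (- (of_real I / q0)) / Im q0 = I" unfolding im q0b using b(1) by simp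
  ultimately have "((\<lambda>\<sigma>. Im (H.cauchy_int (1 / \<sigma>) ht (Q \<sigma>)) / Im (Q \<sigma>)) \<longlongrightarrow> I) at_top" by (simp only:)
  then show "((\<lambda>\<sigma>. opt_shrinkage h U H \<sigma> (muhat \<sigma>) (\<sigma> * x)) \<longlongrightarrow> (LINT t|H. ht t)) at_top"
    unfolding I_def[symmetric]
  proof (rule Lim_transform_eventually)
    show "\<forall>\<^sub>F \<sigma> in at_top. Im (H.cauchy_int (1 / \<sigma>) ht (Q \<sigma>)) / Im (Q \<sigma>) = opt_shrinkage h U H \<sigma> (muhat \<sigma>) (\<sigma> * x)"
      using GQ by eventually_elim (simp add: G_def)
  qed
qed

theorem proposition5p1:
  fixes M :: "'w measure"
    and A Z :: "nat \<Rightarrow> 'w \<Rightarrow> real mat"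
    and H :: "real measure"
    and muhat :: "real \<Rightarrow> real measure"
    and lam :: "nat \<Rightarrow> real \<Rightarrow> 'w \<Rightarrow> nat \<Rightarrow> real"
    and w :: "nat \<Rightarrow> real \<Rightarrow> 'w \<Rightarrow> nat \<Rightarrow> real vec"
    and h :: "real \<Rightarrow> real"
    and U :: "real set"
    and h1 h2 :: real
  assumes prob: "prob_space M"
    and A: "\<And>n. n \<ge> 1 \<Longrightarrow> random_sym_mat M n (A n)"
    and Z: "\<And>n. n \<ge> 1 \<Longrightarrow> random_sym_mat M n (Z n)"
    and indep: "\<And>n. n \<ge> 1 \<Longrightarrow> indep_mat M n (Z n) (A n)"
    and H: "compactly_supported_law H"
    and esd: "AE \<omega> in M. weak_conv_m (\<lambda>n. esd (A n \<omega>)) H"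
    and eigs: "AE \<omega> in M. \<forall>\<^sub>F n in sequentially. \<forall>x. eigenvalue (A n \<omega>) x \<longrightarrow> x \<in> {h1..h2}"
    and basis: "\<And>n \<sigma> \<omega>. n \<ge> 1 \<Longrightarrow> \<sigma> > 0 \<Longrightarrow> \<omega> \<in> space M \<Longrightarrow>
      ordered_eigenbasis (perturbed \<sigma> n (A n \<omega>) (Z n \<omega>)) (lam n \<sigma> \<omega>) (w n \<sigma> \<omega>)"
    and muhat: "\<And>\<sigma>. \<sigma> > 0 \<Longrightarrow> is_free_add_conv H (semicircle (\<sigma>\<^sup>2)) (muhat \<sigma>)"
    and U: "open U" "{h1..h2} \<subseteq> U"
    and h: "continuous_on U h"
  shows
    "((\<forall>n\<ge>1. is_GOE M n (Z n)) \<longrightarrow>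
       (AE \<omega> in M. \<exists>L :: nat \<Rightarrow> real.
          (\<forall>\<^sub>F n in sequentially.
             ((\<lambda>\<sigma>. MAX i\<in>{..<n}.
                 \<bar>scalar_prod (w n \<sigma> \<omega> i) (mat_fun h (A n \<omega>) *\<^sub>v w n \<sigma> \<omega> i) - (LINT t:U|H. h t)\<bar>)
              \<longlongrightarrow> L n) at_top) \<and>
          L \<longlonglongrightarrow> 0)) \<and>
     (\<forall>x. \<bar>x\<bar> < 2 \<longrightarrow>
        (\<forall>\<^sub>F \<sigma> in at_top. \<sigma> * x \<in> opt_shrinkage_dom h U H \<sigma> (muhat \<sigma>)) \<and>
        ((\<lambda>\<sigma>. opt_shrinkage h U H \<sigma> (muhat \<sigma>) (\<sigma> * x)) \<longlongrightarrow> (LINT t:U|H. h t)) at_top)"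
proof -
  interpret prob_space M by (rule prob)
  have Hr: "real_distribution H" using H by (simp add: compactly_supported_law_def)
  interpret H: real_distribution H by (rule Hr)
  have Ac: "A n \<omega> \<in> carrier_mat n n" and Zc: "Z n \<omega> \<in> carrier_mat n n" if "n \<ge> 1" "\<omega> \<in> space M" for n \<omega>
    using A[OF that(1)] Z[OF that(1)] that(2) by (auto simp: random_sym_mat_def sym_mat_def)
  have "AE \<omega> in M. h1 \<le> h2 \<and> (AE t in H. t \<in> {h1..h2})"
    using esd eigs AE_space
  proof eventually_elim
    case (elim \<omega>)
    have ex: "\<exists>mu v. eigenbasis n (zext n (A n \<omega>)) mu v" if "n \<ge> 1" for n
      by (rule unperturbed_eigenbasis[OF Ac[OF that elim(3)] Zc[OF that elim(3)] basis[OF that _ elim(3)]])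
    note conc = limit_law_concentrated[OF elim(1) Hr Ac[OF _ elim(3)] ex elim(2)]
    show ?case by (intro conjI conc)
  qed
  then have h12: "h1 \<le> h2" and HI: "AE t in H. t \<in> {h1..h2}" by simp_all
  define g where "g t = h (clamp h1 h2 t)" for t
  have hc: "continuous_on {h1..h2} h" using h U(2) by (rule continuous_on_subset)
  have "continuous_on UNIV g"
    unfolding g_def[abs_def]
    by (rule continuous_on_compose2[OF hc])
      (use clamp_mem[OF h12] isCont_clamp in \<open>auto simp: continuous_on_eq_continuous_at\<close>)
  then have gc: "isCont g t" for t by (simp add: continuous_on_eq_continuous_at)
  have "bounded (h ` {h1..h2})" by (intro compact_imp_bounded compact_continuous_image hc) simp
  then obtain c where "\<And>t. t \<in> {h1..h2} \<Longrightarrow> \<bar>h t\<bar> \<le> c" unfolding bounded_real by blast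
  then have gb: "\<bar>g t\<bar> \<le> c" for t unfolding g_def using clamp_mem[OF h12] by blast
  have hg: "h t = g t" if "t \<in> {h1..h2}" for t using that by (simp add: g_def clamp_id)
  have gm [measurable]: "g \<in> borel_measurable borel" by (rule borel_measurable_continuous_onI) fact
  have hm [measurable]: "(\<lambda>t. indicat_real U t * h t) \<in> borel_measurable borel"
    using borel_measurable_continuous_on_indicator[OF _ h] U(1) by simp
  have hU: "AE t in H. indicat_real U t * h t = g t"
    using HI by (rule AE_mp) (intro AE_I2 impI, use U(2) hg in \<open>auto simp: indicator_def\<close>)
  have int: "(LINT t:U|H. h t) = (LINT t|H. g t)"
    unfolding set_lebesgue_integral_def real_scaleR_def by (rule integral_cong_AE) (use hU in simp_all)
  obtain a where bl: "bounded_law H a" using compactly_supported_bounded_law[OF H] by blast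
  have "AE \<omega> in M. \<exists>L :: nat \<Rightarrow> real.
          (\<forall>\<^sub>F n in sequentially.
             ((\<lambda>\<sigma>. MAX i\<in>{..<n}.
                 \<bar>scalar_prod (w n \<sigma> \<omega> i) (mat_fun h (A n \<omega>) *\<^sub>v w n \<sigma> \<omega> i) - (LINT t|H. g t)\<bar>)
              \<longlongrightarrow> L n) at_top) \<and>
          L \<longlonglongrightarrow> 0" if goe: "\<forall>n\<ge>1. is_GOE M n (Z n)"
    by (rule oracle_strong_noise[OF A Z indep goe[rule_format] Hr esd eigs basis gc gb hg])
  moreover note shrinkage_strong_noise[OF muhat bl gm gb hm hU]
  ultimately show ?thesis unfolding int by blast
qed

end
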